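(* (Gauss–Bonnet theorem.) Let $h=h^*\in C^\infty(\mathbb{T}^2_\theta)$ and let $g=(g_{ij})_{1\le i,j\le2}$ be any functional metric on the noncommutative two torus $\mathbb{T}^2_\theta$. Then the total scalar curvature of $(\mathbb{T}^2_\theta,g)$ vanishes, $\varphi(R)=0$; hence it is independent of the metric.
   Context: Noncommutative two torus: for a real antisymmetric $2\times2$ matrix $\theta$, $C(\mathbb{T}^2_\theta)$ is the universal $C^*$-algebra generated by unitaries $U_1,U_2$ with $U_kU_j=e^{2\pi i\theta_{jk}}U_jU_k$; $C^\infty(\mathbb{T}^2_\theta)$ consists of the sums $\sum_{n\in\mathbb{Z}^2}a_nU_1^{n_1}U_2^{n_2}$ with rapidly decaying coefficients; $\delta_1,\delta_2$ are the derivations with $\delta_j(U_k)=\delta_{jk}U_k$; $\varphi(\sum a_nU^n)=a_0$ is the tracial state. Functional metric: smooth functions $g_{ij}:\mathbb{R}\to\mathbb{R}$ with $(g_{ij}(t))$ symmetric positive definite for $t$ in a neighbourhood of $\mathrm{spec}(h)$; $|g|(t)=\det(g_{ij}(t))$, $(g^{ij}(t))=(g_{ij}(t))^{-1}$. Its Laplacian on functions is (up to antiunitary equivalence), with Einstein summation, $$\triangle_{0,g}(a)=|g|^{-\frac14}(h)\,\delta_k\Big(|g|^{\frac12}(h)\,g^{jk}(h)\,\delta_j\big(|g|^{-\frac14}(h)\,a\big)\Big),\quad a\in C^\infty(\mathbb{T}^2_\theta).$$ Second density and scalar curvature: write $P=\triangle_{0,g}=\sum_{|\alpha|\le2}p_\alpha\delta^\alpha$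 (coefficients acting by left multiplication), $p_m(\xi)=\sum_{|\alpha|=m}p_\alpha\xi^\alpha$, and for $\lambda\in\mathbb{C}\setminus[0,\infty)$ put (with $\partial_i=\partial/\partial\xi_i$) $b_0=(p_2-\lambda)^{-1}$, $b_1=-b_0p_1b_0-\sum_i\partial_i(b_0)\delta_i(p_2)b_0$, $b_2=-b_0p_0b_0-b_1p_1b_0-\sum_i\partial_i(b_0)\delta_i(p_1)b_0-\sum_i\partial_i(b_1)\delta_i(p_2)b_0-\frac12\sum_{i,j}\partial_i\partial_j(b_0)\delta_i\delta_j(p_2)b_0$, $$b_2(P)=\frac1{(2\pi)^2}\int_{\mathbb{R}^2}\frac{-1}{2\pi i}\int_\gamma e^{-\lambda}b_2(\xi,\lambda)\,d\lambda\,d\xi,$$ $\gamma$ being a contour going counterclockwise around $[0,\infty)$ (from $+\infty$ above the real axis, around $0$, to $+\infty$ below). The scalar curvature density is $R=4\pi\,b_2(\triangle_{0,g})\in C^\infty(\mathbb{T}^2_\theta)$ and the total scalar curvature is $\varphi(R)$. *)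

theory Defs
  imports "HOL-Analysis.Analysis" "HOL-Computational_Algebra.Polynomial"
begin

class cstar_algebra = real_normed_algebra_1 + banach +
  fixes scaleC :: "complex \<Rightarrow> 'a \<Rightarrow> 'a" (infixr "*\<^sub>C" 75)
    and adj :: "'a \<Rightarrow> 'a"
  assumes scaleC_add_right: "z *\<^sub>C (x + y) = z *\<^sub>C x + z *\<^sub>C y"
    and scaleC_add_left: "(z + w) *\<^sub>C x = z *\<^sub>C x + w *\<^sub>C x"
    and scaleC_scaleC: "z *\<^sub>C (w *\<^sub>C x) = (z * w) *\<^sub>C x"
    and scaleC_of_real: "complex_of_real r *\<^sub>C x = r *\<^sub>R x"
    and mult_scaleC_left: "(z *\<^sub>C x) * y = z *\<^sub>C (x * y)"
    and mult_scaleC_right: "x * (z *\<^sub>C y) = z *\<^sub>C (x * y)"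
    and norm_scaleC: "norm (z *\<^sub>C x) = cmod z * norm x"
    and adj_adj: "adj (adj x) = x"
    and adj_add: "adj (x + y) = adj x + adj y"
    and adj_scaleC: "adj (z *\<^sub>C x) = cnj z *\<^sub>C adj x"
    and adj_mult: "adj (x * y) = adj y * adj x"
    and norm_adj_mult: "norm (adj x * x) = (norm x)\<^sup>2"

definition alg_invertible :: "'a::cstar_algebra \<Rightarrow> bool" where
  "alg_invertible x \<longleftrightarrow> (\<exists>y. x * y = 1 \<and> y * x = 1)"

definition alg_inv :: "'a::cstar_algebra \<Rightarrow> 'a" where
  "alg_inv x = (THE y. x * y = 1 \<and> y * x = 1)"

definition alg_spectrum :: "'a::cstar_algebra \<Rightarrow> complex set" where
  "alg_spectrum x = {z. \<not> alg_invertible (x - z *\<^sub>C 1)}"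

definition poly_at :: "real poly \<Rightarrow> 'a::cstar_algebra \<Rightarrow> 'a" where
  "poly_at p x = (\<Sum>i\<le>degree p. coeff p i *\<^sub>R x ^ i)"

text \<open>Continuous functional calculus: for self-adjoint \<open>x\<close> and \<open>f\<close> continuous on the spectrum,
  \<open>f(x)\<close> is the norm limit of \<open>p(x)\<close> as polynomials \<open>p\<close> tend to \<open>f\<close> uniformly on the spectrum.\<close>

definition cfc :: "(real \<Rightarrow> real) \<Rightarrow> 'a::cstar_algebra \<Rightarrow> 'a" where
  "cfc f x = (THE y. \<forall>\<epsilon>>0. \<exists>p. (\<forall>t. complex_of_real t \<in> alg_spectrum x \<longrightarrow> \<bar>poly p t - f t\<bar> < \<epsilon>)
                               \<and> norm (poly_at p x - y) < \<epsilon>)"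

definition upow :: "'a::cstar_algebra \<Rightarrow> int \<Rightarrow> 'a" where
  "upow u k = (if 0 \<le> k then u ^ nat k else adj u ^ nat (- k))"

definition nct_monom :: "(2 \<Rightarrow> 'a::cstar_algebra) \<Rightarrow> int^2 \<Rightarrow> 'a" where
  "nct_monom U n = upow (U 1) (n$1) * upow (U 2) (n$2)"

text \<open>The *-algebra presented by unitaries \<open>U\<^sub>1, U\<^sub>2\<close> with
  \<open>U\<^sub>2 U\<^sub>1 = exp(2\<pi>i \<theta>\<^sub>1\<^sub>2) U\<^sub>1 U\<^sub>2\<close> has the linear basis \<open>U\<^sub>1\<^sup>m U\<^sub>2\<^sup>n\<close>. Its elements are encoded by their
  finitely supported coefficient families; \<open>tw_mult\<close> and \<open>tw_adj\<close> are its product and involution.\<close>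

definition tw_mult :: "real^2^2 \<Rightarrow> (int^2 \<Rightarrow> complex) \<Rightarrow> (int^2 \<Rightarrow> complex) \<Rightarrow> int^2 \<Rightarrow> complex" where
  "tw_mult \<theta> c d n = (\<Sum>m | c m \<noteq> 0. c m * d (n - m)
      * cis (2 * pi * \<theta>$1$2 * of_int (m$2) * of_int ((n - m)$1)))"

definition tw_adj :: "real^2^2 \<Rightarrow> (int^2 \<Rightarrow> complex) \<Rightarrow> int^2 \<Rightarrow> complex" where
  "tw_adj \<theta> c n = cnj (c (- n)) * cis (2 * pi * \<theta>$1$2 * of_int (n$1) * of_int (n$2))"

definition tw_cstar_seminorm :: "real^2^2 \<Rightarrow> ((int^2 \<Rightarrow> complex) \<Rightarrow> real) \<Rightarrow> bool" where
  "tw_cstar_seminorm \<theta> N \<longleftrightarrow>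
     (\<forall>c d z. finite {n. c n \<noteq> 0} \<longrightarrow> finite {n. d n \<noteq> 0} \<longrightarrow>
        N (\<lambda>n. c n + d n) \<le> N c + N d \<and>
        N (\<lambda>n. z * c n) = cmod z * N c \<and>
        N (tw_mult \<theta> c d) \<le> N c * N d \<and>
        N (tw_mult \<theta> (tw_adj \<theta> c) c) = (N c)\<^sup>2)"

text \<open>\<open>nct \<theta> U\<close>: the ambient algebra is the universal C*-algebra generated by unitaries
  \<open>U\<^sub>1, U\<^sub>2\<close> with \<open>U\<^sub>k U\<^sub>j = exp(2\<pi>i \<theta>\<^sub>j\<^sub>k) U\<^sub>j U\<^sub>k\<close>. A homomorphism from the *-algebra presented by these
  relations to any C*-algebra pulls the norm back to a C*-seminorm, and every C*-seminorm arises
  this way; so universality says that the norm dominates every C*-seminorm.\<close>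

definition nct :: "real^2^2 \<Rightarrow> (2 \<Rightarrow> 'a::cstar_algebra) \<Rightarrow> bool" where
  "nct \<theta> U \<longleftrightarrow>
     (\<forall>k. adj (U k) * U k = 1 \<and> U k * adj (U k) = 1) \<and>
     (\<forall>j k. U k * U j = cis (2 * pi * \<theta>$j$k) *\<^sub>C (U j * U k)) \<and>
     (\<forall>S. closed S \<and> range U \<subseteq> S \<and> 1 \<in> S \<and>
          (\<forall>x\<in>S. \<forall>y\<in>S. x + y \<in> S \<and> x * y \<in> S) \<and> (\<forall>x\<in>S. adj x \<in> S \<and> (\<forall>z. z *\<^sub>C x \<in> S))
          \<longrightarrow> S = UNIV) \<and>
     (\<forall>N c. tw_cstar_seminorm \<theta> N \<and> finite {n. c n \<noteq> 0}
          \<longrightarrow> N c \<le> norm (\<Sum>n | c n \<noteq> 0. c n *\<^sub>C nct_monom U n))"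

definition rapid_decay :: "(int^2 \<Rightarrow> complex) \<Rightarrow> bool" where
  "rapid_decay c \<longleftrightarrow> (\<forall>k::nat. bounded (range (\<lambda>n. (1 + \<bar>of_int (n$1)\<bar> + \<bar>of_int (n$2)\<bar>) ^ k * cmod (c n) :: real)))"

definition nct_series :: "(2 \<Rightarrow> 'a::cstar_algebra) \<Rightarrow> (int^2 \<Rightarrow> complex) \<Rightarrow> 'a \<Rightarrow> bool" where
  "nct_series U c a \<longleftrightarrow> rapid_decay c \<and> ((\<lambda>n. c n *\<^sub>C nct_monom U n) has_sum a) UNIV"

definition nct_smooth :: "(2 \<Rightarrow> 'a::cstar_algebra) \<Rightarrow> 'a set" where
  "nct_smooth U = {a. \<exists>c. nct_series U c a}"

text \<open>The continuous derivation of the smooth algebra with \<open>\<delta>\<^sub>j(U\<^sub>k) = \<delta>\<^sub>j\<^sub>k U\<^sub>k\<close>: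
  \<open>\<delta>\<^sub>j(\<Sum> a\<^sub>n U\<^sub>1\<^bsup>n\<^sub>1\<^esup> U\<^sub>2\<^bsup>n\<^sub>2\<^esup>) = \<Sum> n\<^sub>j a\<^sub>n U\<^sub>1\<^bsup>n\<^sub>1\<^esup> U\<^sub>2\<^bsup>n\<^sub>2\<^esup>\<close>. Unspecified outside the smooth algebra.\<close>

definition nct_deriv :: "(2 \<Rightarrow> 'a::cstar_algebra) \<Rightarrow> 2 \<Rightarrow> 'a \<Rightarrow> 'a" where
  "nct_deriv U j a = (THE b. \<exists>c. nct_series U c a \<and> nct_series U (\<lambda>n. of_int (n$j) * c n) b)"

definition nct_trace :: "(2 \<Rightarrow> 'a::cstar_algebra) \<Rightarrow> 'a \<Rightarrow> complex" where
  "nct_trace U = (THE f. bounded_linear f \<and> (\<forall>z a. f (z *\<^sub>C a) = z * f a) \<and>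
                         (\<forall>c a. nct_series U c a \<longrightarrow> f a = c 0))"

definition smooth_real :: "(real \<Rightarrow> real) \<Rightarrow> bool" where
  "smooth_real f \<longleftrightarrow> (\<forall>k. (deriv ^^ k) f differentiable_on UNIV)"

definition functional_metric :: "'a::cstar_algebra \<Rightarrow> (real \<Rightarrow> real^2^2) \<Rightarrow> bool" where
  "functional_metric h g \<longleftrightarrow>
     (\<forall>i j. smooth_real (\<lambda>t. g t $ i $ j)) \<and>
     (\<exists>W. open W \<and> {t. complex_of_real t \<in> alg_spectrum h} \<subseteq> W \<and>
          (\<forall>t\<in>W. transpose (g t) = g t \<and> (\<forall>v. v \<noteq> 0 \<longrightarrow> v \<bullet> (g t *v v) > 0)))"

definition metric_laplacian ::
    "(2 \<Rightarrow> 'a::cstar_algebra) \<Rightarrow> 'a \<Rightarrow> (real \<Rightarrow> real^2^2) \<Rightarrow> 'a \<Rightarrow> 'a" where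
  "metric_laplacian U h g a =
     (\<Sum>j\<in>UNIV. \<Sum>k\<in>UNIV.
        cfc (\<lambda>t. det (g t) powr (-1/4)) h *
        nct_deriv U k
          (cfc (\<lambda>t. det (g t) powr (1/2)) h * cfc (\<lambda>t. matrix_inv (g t) $ j $ k) h *
           nct_deriv U j (cfc (\<lambda>t. det (g t) powr (-1/4)) h * a)))"

definition nct_mderiv :: "(2 \<Rightarrow> 'a::cstar_algebra) \<Rightarrow> nat^2 \<Rightarrow> 'a \<Rightarrow> 'a" where
  "nct_mderiv U \<alpha> a = (nct_deriv U 1 ^^ (\<alpha>$1)) ((nct_deriv U 2 ^^ (\<alpha>$2)) a)"

definition has_coeffs :: "(2 \<Rightarrow> 'a::cstar_algebra) \<Rightarrow> ('a \<Rightarrow> 'a) \<Rightarrow> (nat^2 \<Rightarrow> 'a) \<Rightarrow> bool" where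
  "has_coeffs U P p \<longleftrightarrow>
     (\<forall>\<alpha>. p \<alpha> \<in> nct_smooth U) \<and> (\<forall>\<alpha>. \<alpha>$1 + \<alpha>$2 > 2 \<longrightarrow> p \<alpha> = 0) \<and>
     (\<forall>a\<in>nct_smooth U. P a = (\<Sum>\<alpha> | \<alpha>$1 + \<alpha>$2 \<le> 2. p \<alpha> * nct_mderiv U \<alpha> a))"

definition op_coeffs :: "(2 \<Rightarrow> 'a::cstar_algebra) \<Rightarrow> ('a \<Rightarrow> 'a) \<Rightarrow> nat^2 \<Rightarrow> 'a" where
  "op_coeffs U P = (THE p. has_coeffs U P p)"

definition symb :: "(nat^2 \<Rightarrow> 'a::cstar_algebra) \<Rightarrow> nat \<Rightarrow> real^2 \<Rightarrow> 'a" where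
  "symb p m \<xi> = (\<Sum>\<alpha> | \<alpha>$1 + \<alpha>$2 = m. ((\<xi>$1) ^ (\<alpha>$1) * (\<xi>$2) ^ (\<alpha>$2)) *\<^sub>R p \<alpha>)"

definition partial :: "2 \<Rightarrow> (real^2 \<Rightarrow> 'a::cstar_algebra) \<Rightarrow> real^2 \<Rightarrow> 'a" where
  "partial i F \<xi> = vector_derivative (\<lambda>t. F (\<xi> + t *\<^sub>R axis i 1)) (at 0)"

text \<open>\<open>res0\<close>, \<open>res1\<close>, \<open>res2\<close> are the terms \<open>b\<^sub>0, b\<^sub>1, b\<^sub>2\<close>, of order \<open>-2, -3, -4\<close> in \<open>\<xi>\<close>, of the symbol of the
  parametrix of \<open>P - l\<close>.\<close>

definition res0 :: "(nat^2 \<Rightarrow> 'a::cstar_algebra) \<Rightarrow> complex \<Rightarrow> real^2 \<Rightarrow> 'a" where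
  "res0 p l \<xi> = alg_inv (symb p 2 \<xi> - l *\<^sub>C 1)"

definition res1 ::
    "(2 \<Rightarrow> 'a::cstar_algebra) \<Rightarrow> (nat^2 \<Rightarrow> 'a) \<Rightarrow> complex \<Rightarrow> real^2 \<Rightarrow> 'a" where
  "res1 U p l \<xi> =
     - (res0 p l \<xi> * symb p 1 \<xi> * res0 p l \<xi>)
     - (\<Sum>i\<in>UNIV. partial i (res0 p l) \<xi> * nct_deriv U i (symb p 2 \<xi>) * res0 p l \<xi>)"

definition res2 ::
    "(2 \<Rightarrow> 'a::cstar_algebra) \<Rightarrow> (nat^2 \<Rightarrow> 'a) \<Rightarrow> complex \<Rightarrow> real^2 \<Rightarrow> 'a" where
  "res2 U p l \<xi> =
     - (res0 p l \<xi> * symb p 0 \<xi> * res0 p l \<xi>)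
     - res1 U p l \<xi> * symb p 1 \<xi> * res0 p l \<xi>
     - (\<Sum>i\<in>UNIV. partial i (res0 p l) \<xi> * nct_deriv U i (symb p 1 \<xi>) * res0 p l \<xi>)
     - (\<Sum>i\<in>UNIV. partial i (res1 U p l) \<xi> * nct_deriv U i (symb p 2 \<xi>) * res0 p l \<xi>)
     - (1/2) *\<^sub>R (\<Sum>i\<in>UNIV. \<Sum>j\<in>UNIV.
         partial i (partial j (res0 p l)) \<xi>
         * nct_deriv U i (nct_deriv U j (symb p 2 \<xi>)) * res0 p l \<xi>)"

text \<open>A contour around \<open>[0,\<infinity>)\<close> is a piecewise \<open>C\<^sup>1\<close> curve in the complement of \<open>[0,\<infinity>)\<close> whose ends are
  straight rays with real part tending to \<open>+\<infinity>\<close>, incoming above and outgoing below the real axis. Since the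
  complement of \<open>[0,\<infinity>)\<close> is simply connected, such a curve passes around \<open>0\<close> counterclockwise.\<close>

definition heat_contour :: "(real \<Rightarrow> complex) \<Rightarrow> bool" where
  "heat_contour \<gamma> \<longleftrightarrow>
     \<gamma> piecewise_C1_differentiable_on UNIV \<and>
     (\<forall>t. \<gamma> t \<notin> complex_of_real ` {0..}) \<and>
     (\<exists>T z w z' w'. Re w > 0 \<and> Re w' > 0 \<and>
        (\<forall>t\<le>-T. \<gamma> t = z + of_real (-t) * w \<and> Im (\<gamma> t) > 0) \<and>
        (\<forall>t\<ge>T. \<gamma> t = z' + of_real t * w' \<and> Im (\<gamma> t) < 0))"

definition second_density ::
    "(2 \<Rightarrow> 'a::cstar_algebra) \<Rightarrow> (real \<Rightarrow> complex) \<Rightarrow> ('a \<Rightarrow> 'a) \<Rightarrow> 'a" where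
  "second_density U \<gamma> P = (1 / (2 * pi)\<^sup>2) *\<^sub>R
     integral UNIV (\<lambda>\<xi>::real^2.
       (-1 / (2 * of_real pi * \<i>)) *\<^sub>C
       integral UNIV (\<lambda>t::real.
         (exp (- \<gamma> t) * vector_derivative \<gamma> (at t)) *\<^sub>C res2 U (op_coeffs U P) (\<gamma> t) \<xi>))"

definition scalar_curvature ::
    "(2 \<Rightarrow> 'a::cstar_algebra) \<Rightarrow> (real \<Rightarrow> complex) \<Rightarrow> 'a \<Rightarrow> (real \<Rightarrow> real^2^2) \<Rightarrow> 'a" where
  "scalar_curvature U \<gamma> h g = (4 * pi) *\<^sub>R second_density U \<gamma> (metric_laplacian U h g)"

definition total_scalar_curvature ::
    "(2 \<Rightarrow> 'a::cstar_algebra) \<Rightarrow> (real \<Rightarrow> complex) \<Rightarrow> 'a \<Rightarrow> (real \<Rightarrow> real^2^2) \<Rightarrow> complex" where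
  "total_scalar_curvature U \<gamma> h g = nct_trace U (scalar_curvature U \<gamma> h g)"

end

theory Submission
  imports Defs "HOL-Complex_Analysis.Complex_Analysis" "HOL-Computational_Algebra.Fundamental_Theorem_Algebra"
begin

text \<open>In dimension two \<open>|g|\<^bsup>1/2\<^esup>g\<^sup>-\<^sup>1\<close> has determinant one, so the Laplacian factors as \<open>A B\<close> with first order
  operators \<open>A = w(\<delta>\<^sub>1 + \<delta>\<^sub>2 \<tau>\<^sup>*)\<close> and \<open>B = u(\<delta>\<^sub>1 + \<tau>\<delta>\<^sub>2)w\<close>, where \<open>\<tau>(h)\<close> has negative imaginary part. Deform
  \<open>w\<close>, \<open>u\<close>, \<open>\<tau>\<close> linearly to \<open>1\<close>, \<open>1\<close>, \<open>-\<i>\<close>, where the symbol has constant coefficients and \<open>b\<^sub>2 = 0\<close>. In the algebra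
  of symbols modulo terms of lower order, the trace of a commutator is a divergence in \<open>\<xi>\<close>, so the variation of
  \<open>\<integral> \<phi>(b\<^sub>2) d\<xi>\<close> is \<open>-\<integral> \<partial>\<^sub>\<lambda> \<phi>(F\<^sub>2) d\<xi>\<close> with \<open>F = A' B b + B' b A\<close>. By homogeneity this integral is a multiple of
  \<open>\<integral> \<phi>(F\<^sub>2)(x, 1, \<lambda> = 0) dx\<close>. At \<open>\<lambda> = 0\<close> the function \<open>F\<close> is the sum of the logarithmic derivatives of \<open>A\<close> and \<open>B\<close>,
  which extend holomorphically to opposite half planes of \<open>x\<close> and decay quadratically, so Cauchy's theorem makes
  the integral vanish for every \<open>\<lambda>\<close>.\<close>


subsection \<open>Invertible elements of C*-algebras\<close>

text \<open>The derivatives of h do not commute with h, so b_2 is a sum of words in resolvents and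
  differentiated coefficients without a manageable closed form. Hence b_2 of the given metric is
  never evaluated; only identities under the trace are used. Write G = |g|^(1/2) g^(-1). As det G =
  1, its quadratic form is u |x + tau y|^2 with u = G_11 and tau = (G_12 - i) / G_11. The conditions
  w > 0, u > 0, Im tau < 0 are convex, so a linear path to the flat values stays elliptic. The
  factorisation matters at lambda = 0. The leading symbol of the Laplacian has zeros in both half
  planes of x, which forbids closing a contour; but B b is then the inverse of A, b A is the inverse
  of B, and each factor has zeros on one side only. Dimension two enters once more through degrees:
  F_2 has degree -2 and its lambda derivative degree -4, so on every line through the origin the
  integrand, weighted by the area factor, is an exact derivative. Since the plane integral vanishes
  for each lambda separately, the contour raises only questions of integrability.\<close>

interpretation scaleC: bounded_bilinear "scaleC :: complex \<Rightarrow> 'a::cstar_algebra \<Rightarrow> 'a"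
proof
  fix a a' :: complex and b b' :: 'a and r :: real
  show "(a + a') *\<^sub>C b = a *\<^sub>C b + a' *\<^sub>C b" by (rule scaleC_add_left)
  show "a *\<^sub>C (b + b') = a *\<^sub>C b + a *\<^sub>C b'" by (rule scaleC_add_right)
  show "(r *\<^sub>R a) *\<^sub>C b = r *\<^sub>R (a *\<^sub>C b)"
    unfolding scaleR_conv_of_real[of r a] by (simp only: scaleC_scaleC[symmetric] scaleC_of_real)
  show "a *\<^sub>C (r *\<^sub>R b) = r *\<^sub>R (a *\<^sub>C b)"
    by (simp add: scaleC_scaleC mult.commute flip: scaleC_of_real)
  show "\<exists>K. \<forall>a (b::'a). norm (a *\<^sub>C b) \<le> norm a * norm b * K"
    by (rule exI[of _ 1]) (simp add: norm_scaleC)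
qed

lemma scaleC_one [simp]: "1 *\<^sub>C x = (x::'a::cstar_algebra)"
  using scaleC_of_real[of 1 x] by simp

lemma scaleC_real_simps [simp]:
  "complex_of_real r *\<^sub>C x = r *\<^sub>R (x::'a::cstar_algebra)"
  by (rule scaleC_of_real)

lemma alg_inv_eqI:
  fixes x :: "'a::cstar_algebra"
  assumes "x * y = 1" "y * x = 1"
  shows "alg_inv x = y"
  unfolding alg_inv_def
proof (rule the_equality)
  fix z assume "x * z = 1 \<and> z * x = 1"
  then show "z = y" using assms by (metis mult.assoc mult_1_left mult_1_right)
qed (use assms in auto)

lemma alg_inv_mult [simp]:
  fixes x :: "'a::cstar_algebra"
  assumes "alg_invertible x"
  shows "x * alg_inv x = 1" "alg_inv x * x = 1"
  using assms alg_inv_eqI unfolding alg_invertible_def by metis+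

lemma alg_inv_mult_assoc:
  fixes x :: "'a::cstar_algebra"
  assumes "alg_invertible x"
  shows "x * (alg_inv x * y) = y" "alg_inv x * (x * y) = y"
  using assms by (simp_all flip: mult.assoc)

lemma alg_invertibleI: "x * y = 1 \<Longrightarrow> y * x = 1 \<Longrightarrow> alg_invertible (x::'a::cstar_algebra)"
  unfolding alg_invertible_def by blast

lemma alg_inv_alg_inv: "alg_invertible x \<Longrightarrow> alg_inv (alg_inv x) = x"
  by (rule alg_inv_eqI) auto

lemma alg_invertible_mult:
  assumes "alg_invertible x" "alg_invertible y"
  shows "alg_invertible (x * y)" "alg_inv (x * y) = alg_inv y * alg_inv x"
proof -
  have "x * y * (alg_inv y * alg_inv x) = 1" "alg_inv y * alg_inv x * (x * y) = 1"
    using assms by (simp_all add: mult.assoc alg_inv_mult_assoc)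
  then show "alg_invertible (x * y)" "alg_inv (x * y) = alg_inv y * alg_inv x"
    by (auto intro: alg_invertibleI alg_inv_eqI)
qed

lemma alg_invertible_scaleC:
  assumes "alg_invertible x" "c \<noteq> 0"
  shows "alg_invertible (c *\<^sub>C x)" "alg_inv (c *\<^sub>C x) = inverse c *\<^sub>C alg_inv x"
proof -
  have "(c *\<^sub>C x) * (inverse c *\<^sub>C alg_inv x) = 1" "(inverse c *\<^sub>C alg_inv x) * (c *\<^sub>C x) = 1"
    using assms by (simp_all add: mult_scaleC_left mult_scaleC_right scaleC_scaleC)
  then show "alg_invertible (c *\<^sub>C x)" "alg_inv (c *\<^sub>C x) = inverse c *\<^sub>C alg_inv x"
    by (auto intro: alg_invertibleI alg_inv_eqI)
qed

lemma alg_invertible_one [simp]: "alg_invertible 1" "alg_inv 1 = 1"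
  by (auto intro: alg_invertibleI[of _ 1] alg_inv_eqI)

lemma neumann_invertible:
  fixes x :: "'a::cstar_algebra"
  assumes "norm x < 1"
  shows "alg_invertible (1 - x)" "(\<lambda>n. x ^ n) sums alg_inv (1 - x)"
proof -
  have s: "summable (\<lambda>n. x ^ n)" by (rule complete_algebra_summable_geometric[OF assms])
  let ?S = "\<Sum>n. x ^ n"
  have e: "?S = 1 + (\<Sum>n. x ^ Suc n)" using suminf_split_head[OF s] by simp
  have "x * ?S = (\<Sum>n. x ^ Suc n)" "?S * x = (\<Sum>n. x ^ Suc n)"
    using suminf_mult[OF s, of x] suminf_mult2[OF s, of x] by (simp_all add: power_commutes)
  then have i: "(1 - x) * ?S = 1" "?S * (1 - x) = 1"
    using e by (simp_all add: algebra_simps)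
  then show "alg_invertible (1 - x)" by (rule alg_invertibleI)
  have "alg_inv (1 - x) = ?S" by (rule alg_inv_eqI[OF i])
  then show "(\<lambda>n. x ^ n) sums alg_inv (1 - x)" using s by (simp add: summable_sums)
qed

text \<open>With v the inverse of y, v - 1 = v (1 - y) gives n \<le> (1 + n) e for n = norm (v - 1);
  solving for n yields the bound.\<close>

lemma alg_inv_near_one:
  fixes y :: "'a::cstar_algebra"
  assumes "norm (y - 1) \<le> e" "e < 1"
  shows "alg_invertible y" "norm (alg_inv y - 1) \<le> e / (1 - e)"
proof -
  have "norm (1 - y) < 1" using assms by (metis norm_minus_commute order_le_less_trans)
  from neumann_invertible(1)[OF this] show i: "alg_invertible y" by simp
  let ?v = "alg_inv y"
  have "?v - 1 = ?v * (1 - y)" using i by (simp add: algebra_simps)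
  then have "norm (?v - 1) \<le> norm ?v * norm (1 - y)" by (metis norm_mult_ineq)
  also have "\<dots> \<le> norm ?v * e" using assms(1) by (simp add: mult_left_mono norm_minus_commute)
  also have "\<dots> \<le> (1 + norm (?v - 1)) * e"
    using assms norm_triangle_ineq[of "?v - 1" 1] norm_ge_zero[of "y - 1"]
    by (intro mult_right_mono) (auto simp del: norm_ge_zero)
  finally show "norm (?v - 1) \<le> e / (1 - e)"
    using assms(2) by (simp add: field_simps)
qed

text \<open>Multiplying x by the inverse of x0 moves the question to a neighbourhood of 1.\<close>

lemma alg_inv_perturb:
  fixes x x0 :: "'a::cstar_algebra"
  assumes "alg_invertible x0" "norm (x - x0) * norm (alg_inv x0) \<le> e" "e < 1"
  shows "alg_invertible x" "norm (alg_inv x - alg_inv x0) \<le> e / (1 - e) * norm (alg_inv x0)"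
proof -
  let ?z = "alg_inv x0 * x"
  have zz: "?z - 1 = alg_inv x0 * (x - x0)" using assms(1) by (simp add: algebra_simps)
  have "norm (?z - 1) \<le> e"
    using norm_mult_ineq[of "alg_inv x0" "x - x0"] assms(2) unfolding zz by (simp add: mult.commute)
  note n = alg_inv_near_one[OF this assms(3)]
  have x: "x = x0 * ?z" using assms(1) by (simp add: alg_inv_mult_assoc)
  show "alg_invertible x" using alg_invertible_mult(1)[OF assms(1) n(1)] x by simp
  have "alg_inv x = alg_inv ?z * alg_inv x0"
    using alg_invertible_mult(2)[OF assms(1) n(1)] x by simp
  then have "alg_inv x - alg_inv x0 = (alg_inv ?z - 1) * alg_inv x0" by (simp add: algebra_simps)
  then show "norm (alg_inv x - alg_inv x0) \<le> e / (1 - e) * norm (alg_inv x0)"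
    using order_trans[OF norm_mult_ineq mult_right_mono[OF n(2) norm_ge_zero]] by simp
qed

lemma tendsto_alg_inv:
  fixes f :: "'b \<Rightarrow> 'a::cstar_algebra"
  assumes "(f \<longlongrightarrow> l) F" "alg_invertible l"
  shows "eventually (\<lambda>t. alg_invertible (f t)) F" "((\<lambda>t. alg_inv (f t)) \<longlongrightarrow> alg_inv l) F"
proof -
  let ?n = "norm (alg_inv l)"
  define e where "e t = norm (f t - l) * ?n" for t
  have "((\<lambda>t. norm (f t - l)) \<longlongrightarrow> 0) F" using assms(1) by (simp add: LIM_zero tendsto_norm_zero)
  then have e0: "(e \<longlongrightarrow> 0) F" unfolding e_def by (rule tendsto_mult_left_zero)
  then have e1: "eventually (\<lambda>t. e t < 1) F" by (rule order_tendstoD) simp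
  then show "eventually (\<lambda>t. alg_invertible (f t)) F"
    by eventually_elim (rule alg_inv_perturb(1)[OF assms(2)], auto simp: e_def)
  have "((\<lambda>t. e t / (1 - e t) * ?n) \<longlongrightarrow> 0 / (1 - 0) * ?n) F" by (intro tendsto_intros e0) auto
  then have b: "((\<lambda>t. e t / (1 - e t) * ?n) \<longlongrightarrow> 0) F" by simp
  have "((\<lambda>t. alg_inv (f t) - alg_inv l) \<longlongrightarrow> 0) F"
    by (rule Lim_null_comparison[OF _ b])
       (use e1 in eventually_elim, rule alg_inv_perturb(2)[OF assms(2)], auto simp: e_def)
  then show "((\<lambda>t. alg_inv (f t)) \<longlongrightarrow> alg_inv l) F" by (rule LIM_zero_cancel)
qed

lemma continuous_on_alg_inv [continuous_intros]:
  assumes "continuous_on S f" "\<And>t. t \<in> S \<Longrightarrow> alg_invertible (f t)"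
  shows "continuous_on S (\<lambda>t. alg_inv (f t))"
  using assms unfolding continuous_on_def by (blast intro: tendsto_alg_inv(2))

subsection \<open>Self-adjoint elements and their spectrum\<close>

text \<open>The C*-identity and submultiplicativity give one inequality for every element; applied
  to the adjoint it gives the other.\<close>

lemma norm_adj [simp]: "norm (adj x) = norm (x::'a::cstar_algebra)"
proof -
  have *: "norm x \<le> norm (adj x)" for x :: 'a
  proof (cases "x = 0")
    case False
    have "norm x * norm x \<le> norm (adj x) * norm x"
      using norm_mult_ineq[of "adj x" x] by (simp add: norm_adj_mult power2_eq_square)
    then show ?thesis using False by simp
  qed simp
  show ?thesis using *[of x] *[of "adj x"] by (simp add: adj_adj)
qed

lemma bounded_linear_adj: "bounded_linear (adj :: 'a::cstar_algebra \<Rightarrow> 'a)"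
proof (rule bounded_linear_intro[where K=1])
  fix r and x :: 'a
  show "adj (r *\<^sub>R x) = r *\<^sub>R adj x" using adj_scaleC[of "complex_of_real r" x] by simp
qed (auto simp: adj_add)

lemma adj_scaleR: "adj (r *\<^sub>R x) = r *\<^sub>R adj (x::'a::cstar_algebra)"
  using adj_scaleC[of "complex_of_real r" x] by simp

lemma adj_one [simp]: "adj 1 = (1::'a::cstar_algebra)"
  by (metis adj_adj adj_mult mult_1_left mult_1_right)

lemma adj_power: "adj (x ^ n) = adj x ^ n"
  by (induction n) (auto simp: adj_mult power_commutes)

lemma selfadj_norm_power2:
  fixes a :: "'a::cstar_algebra"
  assumes "adj a = a"
  shows "norm (a ^ (2 ^ k)) = norm a ^ (2 ^ k)"
proof (induction k)
  case (Suc k)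
  have "norm (a ^ (2 ^ Suc k)) = norm (adj (a ^ (2 ^ k)) * a ^ (2 ^ k))"
    using assms by (simp add: adj_power power_add mult_2)
  also have "\<dots> = norm a ^ (2 ^ Suc k)" by (simp add: norm_adj_mult Suc mult.commute flip: power_mult)
  finally show ?case .
qed simp

lemma in_spectrum_norm_le:
  assumes "z \<in> alg_spectrum a"
  shows "cmod z \<le> norm a"
proof (rule ccontr)
  assume "\<not> cmod z \<le> norm a"
  then have z: "norm a < cmod z" "z \<noteq> 0" by auto
  then have "norm ((inverse z) *\<^sub>C a) < 1" by (simp add: norm_scaleC norm_inverse norm_divide field_simps)
  then have "alg_invertible (1 - (inverse z) *\<^sub>C a)" by (rule neumann_invertible)
  then have "alg_invertible ((-z) *\<^sub>C (1 - (inverse z) *\<^sub>C a))" using z by (intro alg_invertible_scaleC) auto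
  moreover have "(-z) *\<^sub>C (1 - (inverse z) *\<^sub>C a) = a - z *\<^sub>C 1"
    using z by (simp add: scaleC.diff_right scaleC_scaleC scaleC.minus_left)
  ultimately show False using assms by (simp add: alg_spectrum_def)
qed

lemma spectrum_shift: "z \<in> alg_spectrum a \<longleftrightarrow> z + w \<in> alg_spectrum (a + w *\<^sub>C 1)"
  by (simp add: alg_spectrum_def scaleC.add_left)

text \<open>Arens' shift: adding i n changes |z|^2 by 2 n Im z + n^2, whereas the square of the norm
  of a + i n exceeds that of a by at most n^2. The choice of n makes n Im z equal to the square of
  norm a plus 1, which is too large.\<close>

lemma selfadj_spectrum_real:
  assumes "adj a = a" "z \<in> alg_spectrum a"
  shows "Im z = 0"
proof (rule ccontr)
  assume y: "Im z \<noteq> 0"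
  define n where "n = (norm a ^ 2 + 1) / Im z"
  have "z + \<i> * of_real n \<in> alg_spectrum (a + (\<i> * of_real n) *\<^sub>C 1)" using assms(2) spectrum_shift by blast
  then have "cmod (z + \<i> * of_real n) ^ 2 \<le> norm (a + (\<i> * of_real n) *\<^sub>C 1) ^ 2"
    by (intro power_mono in_spectrum_norm_le) auto
  also have "\<dots> = norm (adj (a + (\<i> * of_real n) *\<^sub>C 1) * (a + (\<i> * of_real n) *\<^sub>C 1))"
    by (simp add: norm_adj_mult)
  also have "adj (a + (\<i> * of_real n) *\<^sub>C 1) * (a + (\<i> * of_real n) *\<^sub>C 1) = a * a + (n * n) *\<^sub>R 1"
    using assms(1) scaleC_of_real[of "n*n" "1::'a"]
    by (simp add: adj_add adj_scaleC distrib_left distrib_right mult_scaleC_left mult_scaleC_right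
        scaleC_scaleC scaleC.minus_left scaleC.add_right scaleC.diff_right algebra_simps
        del: scaleC_real_simps)
  also have "norm (a * a + (n * n) *\<^sub>R 1) \<le> norm a ^ 2 + n ^ 2"
    by (rule norm_triangle_le) (simp add: norm_mult_ineq add_mono power2_eq_square)
  finally have "(Re z)^2 + (Im z + n)^2 \<le> norm a ^ 2 + n ^ 2" by (simp add: cmod_power2)
  then have "2 * (Im z * n) \<le> norm a ^ 2" using zero_le_power2[of "Re z"] zero_le_power2[of "Im z"]
    unfolding power2_sum by linarith
  moreover have "Im z * n = norm a ^ 2 + 1" using y by (simp add: n_def)
  ultimately show False using zero_le_power2[of "norm a"] by linarith
qed

text \<open>Rickart's argument with roots of unity of order \<open>2\<^sup>k\<close>: if \<open>1 - w b\<close> were invertible on the whole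
  unit circle, then uniform continuity would force \<open>b\<close> to have small powers.\<close>

lemma square_resolvent_split:
  fixes y :: "'a::cstar_algebra"
  assumes "alg_invertible (1 - v *\<^sub>C y)" "alg_invertible (1 - (-v) *\<^sub>C y)"
  shows "alg_invertible (1 - v\<^sup>2 *\<^sub>C y\<^sup>2)"
    "alg_inv (1 - v\<^sup>2 *\<^sub>C y\<^sup>2) = (1/2) *\<^sub>R (alg_inv (1 - v *\<^sub>C y) + alg_inv (1 - (-v) *\<^sub>C y))"
proof -
  let ?p = "1 - v *\<^sub>C y" and ?m = "1 - (-v) *\<^sub>C y"
  have e: "1 - v\<^sup>2 *\<^sub>C y\<^sup>2 = ?p * ?m" "1 - v\<^sup>2 *\<^sub>C y\<^sup>2 = ?m * ?p"
    by (simp_all add: algebra_simps mult_scaleC_left mult_scaleC_right scaleC_scaleC scaleC.minus_left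
        scaleC.diff_right scaleC.add_right power2_eq_square)
  show "alg_invertible (1 - v\<^sup>2 *\<^sub>C y\<^sup>2)" using e(1) alg_invertible_mult(1)[OF assms] by simp
  have s: "?p + ?m = 2 *\<^sub>R 1" by (simp add: scaleC.minus_left scaleR_2)
  show "alg_inv (1 - v\<^sup>2 *\<^sub>C y\<^sup>2) = (1/2) *\<^sub>R (alg_inv ?p + alg_inv ?m)"
  proof (rule alg_inv_eqI)
    have "(1 - v\<^sup>2 *\<^sub>C y\<^sup>2) * (alg_inv ?p + alg_inv ?m) = ?m * ?p * alg_inv ?p + ?p * ?m * alg_inv ?m"
      using e by (simp add: distrib_left)
    also have "\<dots> = 2 *\<^sub>R 1" using assms s by (simp add: mult.assoc add.commute)
    finally show "(1 - v\<^sup>2 *\<^sub>C y\<^sup>2) * ((1/2) *\<^sub>R (alg_inv ?p + alg_inv ?m)) = 1" by simp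
    have "(alg_inv ?p + alg_inv ?m) * (1 - v\<^sup>2 *\<^sub>C y\<^sup>2) = alg_inv ?p * (?p * ?m) + alg_inv ?m * (?m * ?p)"
      using e by (simp add: distrib_right)
    also have "\<dots> = 2 *\<^sub>R 1" using assms s by (simp add: alg_inv_mult_assoc add.commute)
    finally show "((1/2) *\<^sub>R (alg_inv ?p + alg_inv ?m)) * (1 - v\<^sup>2 *\<^sub>C y\<^sup>2) = 1" by simp
  qed
qed

lemma selfadj_norm_one_spectrum:
  fixes b :: "'a::cstar_algebra"
  assumes sa: "adj b = b" and nb: "norm b = 1"
  shows "\<exists>w. cmod w = 1 \<and> \<not> alg_invertible (1 - w *\<^sub>C b)"
proof (rule ccontr)
  assume "\<not> ?thesis"
  then have c: "alg_invertible (1 - w *\<^sub>C b)" if "cmod w = 1" for w using that by blast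
  have i: "alg_invertible (1 - w *\<^sub>C b)" if "w \<in> cball 0 1" for w
  proof (cases "cmod w = 1")
    case False
    then have "norm (w *\<^sub>C b) < 1" using that nb by (simp add: norm_scaleC)
    then show ?thesis by (rule neumann_invertible)
  qed (rule c)
  have "continuous_on (cball 0 1) (\<lambda>w. alg_inv (1 - w *\<^sub>C b))"
    by (intro continuous_intros i scaleC.continuous_on)
  then have "uniformly_continuous_on (cball 0 1) (\<lambda>w. alg_inv (1 - w *\<^sub>C b))"
    by (rule compact_uniformly_continuous) simp
  then obtain d where d: "d > 0" "\<And>w w'. w \<in> cball 0 1 \<Longrightarrow> w' \<in> cball 0 1 \<Longrightarrow> dist w' w < d \<Longrightarrow>
      dist (alg_inv (1 - w' *\<^sub>C b)) (alg_inv (1 - w *\<^sub>C b)) < 1/8"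
    unfolding uniformly_continuous_on_def by (metis zero_less_divide_1_iff zero_less_numeral)
  \<comment> \<open>Shrinking by r keeps w r within the modulus of uniform continuity of w, so the
    resolvents of \<open>r *\<^sub>R b\<close> and b differ by at most 1/8 on the circle, while the
    powers of \<open>r *\<^sub>R b\<close> tend to 0.\<close>
  define r where "r = max (1/2) (1 - d/2)"
  have r: "0 < r" "r < 1" "1 - r < d" using d(1) by (auto simp: r_def max_def)
  have small: "norm (r *\<^sub>R b) < 1" using r nb by simp
  have sm: "norm (w *\<^sub>C (r *\<^sub>R b) ^ (2^k)) < 1" if "cmod w = 1" for w k
  proof -
    have "norm (w *\<^sub>C (r *\<^sub>R b) ^ (2^k)) \<le> norm (r *\<^sub>R b) ^ (2^k)"
      using norm_power_ineq[of "r *\<^sub>R b" "2^k"] that by (simp add: norm_scaleC)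
    also have "\<dots> < 1" using small by (simp add: power_less_one_iff)
    finally show ?thesis .
  qed
  \<comment> \<open>By \<open>square_resolvent_split\<close> the resolvent of a square at w is the
    mean of the resolvents at v and -v with v^2 = w. Averaging does not enlarge the distance 1/8, so
    it survives every doubling of the exponent.\<close>
  have ind: "cmod w = 1 \<Longrightarrow> alg_invertible (1 - w *\<^sub>C b ^ (2^k)) \<and>
      norm (alg_inv (1 - w *\<^sub>C (r *\<^sub>R b) ^ (2^k)) - alg_inv (1 - w *\<^sub>C b ^ (2^k))) \<le> 1/8" for k w
  proof (induction k arbitrary: w)
    case 0
    have "of_real r * w - w = of_real (r - 1) * w" by (simp add: algebra_simps)
    then have "dist (of_real r * w) w = \<bar>r - 1\<bar>"
      using 0 by (simp only: dist_norm norm_mult norm_of_real) simp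
    then have "dist (of_real r * w) w < d" using r by linarith
    then have "dist (alg_inv (1 - (of_real r * w) *\<^sub>C b)) (alg_inv (1 - w *\<^sub>C b)) < 1/8"
      using 0 r by (intro d(2)) (auto simp: norm_mult)
    moreover have "(of_real r * w) *\<^sub>C b = w *\<^sub>C (r *\<^sub>R b)"
      by (metis mult.commute scaleC_of_real scaleC_scaleC)
    ultimately show ?case using c[OF 0] by (simp add: dist_norm)
  next
    case (Suc k)
    define v where "v = csqrt w"
    have v: "v\<^sup>2 = w" "cmod v = 1" "cmod (-v) = 1"
      using Suc.prems by (simp_all add: v_def norm_csqrt)
    note I1 = Suc.IH[OF v(2)] and I2 = Suc.IH[OF v(3)]
    let ?x = "(r *\<^sub>R b) ^ (2^k)" and ?y = "b ^ (2^k)"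
    have sq: "z ^ (2 ^ Suc k) = (z ^ (2^k))\<^sup>2" for z :: 'a
      by (simp only: power_Suc2[of "2::nat" k] power_mult)
    note X = square_resolvent_split[OF neumann_invertible(1)[OF sm[OF v(2)]] neumann_invertible(1)[OF sm[OF v(3)]]]
    note Y = square_resolvent_split[OF conjunct1[OF I1] conjunct1[OF I2]]
    have "norm ((1/2) *\<^sub>R (alg_inv (1 - v *\<^sub>C ?x) + alg_inv (1 - (-v) *\<^sub>C ?x))
         - (1/2) *\<^sub>R (alg_inv (1 - v *\<^sub>C ?y) + alg_inv (1 - (-v) *\<^sub>C ?y)))
       = norm ((1/2) *\<^sub>R ((alg_inv (1 - v *\<^sub>C ?x) - alg_inv (1 - v *\<^sub>C ?y)) + (alg_inv (1 - (-v) *\<^sub>C ?x) - alg_inv (1 - (-v) *\<^sub>C ?y))))"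
      by (simp add: algebra_simps)
    also have "\<dots> \<le> 1/2 * (1/8 + 1/8)"
      unfolding norm_scaleR using I1 I2 by (intro mult_mono norm_triangle_le add_mono) auto
    finally show ?case using X Y v unfolding sq by simp
  qed
  have "(\<lambda>k. r ^ k) \<longlonglongrightarrow> 0" using r by (intro LIMSEQ_realpow_zero) auto
  then have "\<forall>\<^sub>F k in sequentially. r ^ k < 1/9" by (rule order_tendstoD) simp
  then obtain k where k: "r ^ k < 1/9" by (auto simp: eventually_sequentially)
  have "r ^ (2^k) \<le> r ^ k" using r by (intro power_decreasing) auto
  then have k2: "r ^ (2^k) < 1/9" using k by linarith
  let ?n = "2^k :: nat"
  \<comment> \<open>The constants follow e / (1 - e): 1/9 gives 1/8, twice 1/8 is 1/4, and 1/4 gives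
    1/3, which contradicts the norm 1 of the power of b.\<close>
  have "norm ((r *\<^sub>R b) ^ ?n) \<le> 1/9"
    using selfadj_norm_power2[OF sa, of k] nb r k2 by simp
  then have "norm ((1 - (r *\<^sub>R b) ^ ?n) - 1) \<le> 1/9" by simp
  from alg_inv_near_one(2)[OF this] have "norm (alg_inv (1 - (r *\<^sub>R b) ^ ?n) - 1) \<le> 1/8" by simp
  moreover have "norm (alg_inv (1 - (r *\<^sub>R b) ^ ?n) - alg_inv (1 - b ^ ?n)) \<le> 1/8"
    and iv: "alg_invertible (1 - b ^ ?n)" using ind[of 1 k] by auto
  ultimately have "norm (alg_inv (1 - b ^ ?n) - 1) \<le> 1/4"
    using norm_triangle_ineq4[of "alg_inv (1 - (r *\<^sub>R b) ^ ?n) - 1" "alg_inv (1 - (r *\<^sub>R b) ^ ?n) - alg_inv (1 - b ^ ?n)"]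
    by simp
  from alg_inv_near_one(2)[OF this] have "norm (1 - b ^ ?n - 1) \<le> 1/3"
    by (simp add: alg_inv_alg_inv iv)
  then show False using selfadj_norm_power2[OF sa, of k] nb by simp
qed

text \<open>After normalising a to norm 1, a point w of the unit circle at which 1 - w a fails to be
  invertible yields the spectral value norm a / w, which is real because a is self-adjoint.\<close>

lemma selfadj_spectral_radius:
  fixes a :: "'a::cstar_algebra"
  assumes "adj a = a"
  shows "\<exists>t. complex_of_real t \<in> alg_spectrum a \<and> \<bar>t\<bar> = norm a"
proof (cases "a = 0")
  case True
  then have "\<not> alg_invertible (a - 0)" by (auto simp: alg_invertible_def)
  then show ?thesis using True by (intro exI[of _ 0]) (auto simp: alg_spectrum_def scaleC.zero_left)
next
  case False
  let ?n = "norm a"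
  have "adj ((1/?n) *\<^sub>R a) = (1/?n) *\<^sub>R a" using assms by (simp add: adj_scaleR)
  from selfadj_norm_one_spectrum[OF this] False obtain w where
    w: "cmod w = 1" "\<not> alg_invertible (1 - w *\<^sub>C ((1/?n) *\<^sub>R a))" by auto
  let ?z = "of_real ?n / w"
  have wz: "w \<noteq> 0" using w by auto
  have "1 - w *\<^sub>C ((1/?n) *\<^sub>R a) = (- (w / of_real ?n)) *\<^sub>C (a - ?z *\<^sub>C 1)"
    using False wz scaleC_of_real[of "1/?n" a]
    by (simp add: scaleC.diff_right scaleC_scaleC scaleC.minus_left flip: scaleC_of_real)
  then have "?z \<in> alg_spectrum a" using w(2) False wz
    by (auto simp: alg_spectrum_def dest: alg_invertible_scaleC(1)[of _ "- (w / of_real ?n)"])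
  moreover then have "?z = of_real (Re ?z)"
    using selfadj_spectrum_real[OF assms, of ?z] by (simp add: complex_eq_iff)
  moreover have "cmod ?z = ?n" using w by (simp add: norm_divide)
  ultimately show ?thesis by (intro exI[of _ "Re ?z"]) (metis norm_of_real)
qed

subsection \<open>The continuous functional calculus\<close>

definition cpoly :: "complex poly \<Rightarrow> 'a::cstar_algebra \<Rightarrow> 'a" where
  "cpoly p x = (\<Sum>i\<le>degree p. coeff p i *\<^sub>C x ^ i)"

lemma cpoly_altdef: "degree p \<le> n \<Longrightarrow> cpoly p x = (\<Sum>i\<le>n. coeff p i *\<^sub>C x ^ i)"
  unfolding cpoly_def
  by (rule sum.mono_neutral_left) (auto simp: coeff_eq_0 scaleC.zero_left)

lemma cpoly_0 [simp]: "cpoly 0 x = 0"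
  by (simp add: cpoly_def scaleC.zero_left)

lemma cpoly_pCons [simp]: "cpoly (pCons a q) x = a *\<^sub>C 1 + x * cpoly q x"
proof -
  have "cpoly (pCons a q) x = (\<Sum>i\<le>Suc (degree q). coeff (pCons a q) i *\<^sub>C x ^ i)"
    by (rule cpoly_altdef) (simp add: degree_pCons_le)
  also have "\<dots> = a *\<^sub>C 1 + (\<Sum>i\<le>degree q. coeff q i *\<^sub>C x ^ Suc i)"
    by (subst sum.atMost_Suc_shift) simp
  also have "(\<Sum>i\<le>degree q. coeff q i *\<^sub>C x ^ Suc i) = x * cpoly q x"
    by (simp add: cpoly_def sum_distrib_left mult_scaleC_right)
  finally show ?thesis .
qed

lemma cpoly_add [simp]: "cpoly (p + q) x = cpoly p x + cpoly q x"
proof (induction p arbitrary: q)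
  case (pCons a p)
  obtain b r where "q = pCons b r" by (metis pCons_cases)
  then show ?case by (simp add: pCons scaleC.add_left distrib_left)
qed simp

lemma cpoly_smult [simp]: "cpoly (smult c p) x = c *\<^sub>C cpoly p x"
  by (induction p) (simp_all add: scaleC.zero_right scaleC.add_right scaleC_scaleC mult_scaleC_right)

lemma cpoly_mult [simp]: "cpoly (p * q) x = cpoly p x * cpoly q x"
proof (induction p)
  case (pCons a p)
  then show ?case by (simp add: scaleC.zero_left distrib_right mult_scaleC_left mult.assoc)
qed simp

text \<open>Over the complex numbers p splits, so p(x) is a nonzero constant times factors x - r
  with r outside the spectrum.\<close>

lemma cpoly_invertible:
  assumes "p \<noteq> 0" "\<And>r. poly p r = 0 \<Longrightarrow> r \<notin> alg_spectrum x"
  shows "alg_invertible (cpoly p x)"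
  using assms
proof (induction "degree p" arbitrary: p)
  case 0
  then obtain c where c: "p = [:c:]" by (metis degree_eq_zeroE)
  with 0 have "c \<noteq> 0" by auto
  then show ?case using c alg_invertible_scaleC(1)[of "1::'a" c] by simp
next
  case (Suc n)
  from Suc.hyps(2) obtain r where r: "poly p r = 0" using alg_closed_imp_poly_has_root[of p] by auto
  then obtain q where q: "p = [:-r, 1:] * q" by (metis dvdE poly_eq_0_iff_dvd)
  have q0: "q \<noteq> 0" using q Suc.prems(1) by auto
  then have "degree p = Suc (degree q)" unfolding q by (subst degree_mult_eq) auto
  note q0 = q0 this
  have "alg_invertible (cpoly q x)"
    by (rule Suc.hyps(1)) (use Suc q0 q in auto)
  moreover have "alg_invertible (cpoly [:-r, 1:] x)"
    using Suc.prems(2)[OF r] by (simp add: alg_spectrum_def scaleC.minus_left)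
  ultimately show ?case unfolding q cpoly_mult by (intro alg_invertible_mult)
qed

lemma poly_at_cpoly: "poly_at p x = cpoly (map_poly of_real p) x"
  by (simp add: poly_at_def cpoly_def coeff_map_poly degree_map_poly)

lemma map_poly_of_real_add: "map_poly of_real (p + q) = map_poly complex_of_real p + map_poly of_real q"
  by (rule poly_eqI) (simp add: coeff_map_poly)

lemma map_poly_of_real_mult: "map_poly of_real (p * q) = map_poly complex_of_real p * map_poly of_real q"
  by (rule poly_eqI) (simp add: coeff_map_poly coeff_mult)

lemma poly_at_add [simp]: "poly_at (p + q) x = poly_at p x + poly_at q x"
  by (simp add: poly_at_cpoly map_poly_of_real_add)

lemma poly_at_mult [simp]: "poly_at (p * q) x = poly_at p x * poly_at q x"
  by (simp add: poly_at_cpoly map_poly_of_real_mult)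

lemma poly_at_pCons [simp]: "poly_at (pCons a q) x = a *\<^sub>R 1 + x * poly_at q x"
  by (simp add: poly_at_cpoly map_poly_pCons)

lemma poly_at_0 [simp]: "poly_at 0 x = 0"
  by (simp add: poly_at_cpoly)

lemma poly_at_diff [simp]: "poly_at (p - q) x = poly_at p x - poly_at q x"
  using poly_at_add[of "p - q" q x] by (simp del: poly_at_add)

lemma adj_poly_at:
  assumes "adj x = x" shows "adj (poly_at p x) = poly_at p x"
proof (induction p)
  case (pCons a p)
  have "x * poly_at p x = poly_at p x * x"
    using poly_at_mult[of "[:0,1:]" p x] poly_at_mult[of p "[:0,1:]" x]
    by (simp add: mult.commute del: poly_at_mult)
  then show ?case using pCons assms by (simp add: adj_add adj_mult adj_scaleR)
qed (use adj_scaleR[of 0 "0::'a"] in simp)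

definition real_spec :: "'a::cstar_algebra \<Rightarrow> real set" where
  "real_spec x = {t. complex_of_real t \<in> alg_spectrum x}"

lemma real_spec_nonempty: "adj x = x \<Longrightarrow> real_spec x \<noteq> {}"
  using selfadj_spectral_radius[of x] by (auto simp: real_spec_def)

lemma poly_map_poly_of_real: "poly (map_poly complex_of_real p) (of_real t) = of_real (poly p t)"
  by (induction p) (simp_all add: map_poly_pCons)

text \<open>The norm of the self-adjoint element p(x) is |z| for one of its spectral values z. As
  p(x) - z is not invertible, p - z has a root in the spectrum of x. A constant p has no such root
  and needs the spectrum to be nonempty instead.\<close>

lemma poly_at_norm_attained:
  assumes "adj x = x"
  shows "\<exists>t\<in>real_spec x. norm (poly_at p x) = \<bar>poly p t\<bar>"
proof -
  from selfadj_spectral_radius[OF adj_poly_at[OF assms], of p] obtain z where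
    z: "complex_of_real z \<in> alg_spectrum (poly_at p x)" "\<bar>z\<bar> = norm (poly_at p x)" by auto
  let ?P = "map_poly complex_of_real (p - [:z:])"
  have "cpoly ?P x = poly_at p x - of_real z *\<^sub>C 1"
    by (simp flip: poly_at_cpoly)
  then have ni: "\<not> alg_invertible (cpoly ?P x)" using z(1) by (simp add: alg_spectrum_def)
  show ?thesis
  proof (cases "p = [:z:]")
    case True
    obtain t where "t \<in> real_spec x" using real_spec_nonempty[OF assms] by auto
    then show ?thesis using True z(2) by (intro bexI[of _ t]) auto
  next
    case False
    then have "?P \<noteq> 0" by (subst map_poly_eq_0_iff) auto
    with cpoly_invertible[of ?P x] ni obtain r where r: "poly ?P r = 0" "r \<in> alg_spectrum x" by blast
    then have rr: "r = of_real (Re r)" using selfadj_spectrum_real[OF assms] by (simp add: complex_eq_iff)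
    then have "poly ?P (of_real (Re r)) = 0" using r(1) by simp
    then have "poly (p - [:z:]) (Re r) = 0" by (simp only: poly_map_poly_of_real of_real_eq_0_iff)
    then have "poly p (Re r) = z" by simp
    then show ?thesis using z(2) r rr by (intro bexI[of _ "Re r"]) (auto simp: real_spec_def)
  qed
qed

lemma poly_at_norm_le:
  assumes "adj x = x" "\<And>t. t \<in> real_spec x \<Longrightarrow> \<bar>poly p t\<bar> \<le> B"
  shows "norm (poly_at p x) \<le> B"
  using poly_at_norm_attained[OF assms(1), of p] assms(2) by force

lemma real_spec_bound: "t \<in> real_spec x \<Longrightarrow> \<bar>t\<bar> \<le> norm x"
  unfolding real_spec_def using in_spectrum_norm_le[of "of_real t" x] by simp

lemma closed_alg_spectrum: "closed (alg_spectrum x)"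
proof -
  have "open (- alg_spectrum x)"
    unfolding open_dist
  proof clarify
    fix z assume "z \<notin> alg_spectrum x"
    then have i: "alg_invertible (x - z *\<^sub>C 1)" by (simp add: alg_spectrum_def)
    have "((\<lambda>w. x - w *\<^sub>C 1) \<longlongrightarrow> x - z *\<^sub>C 1) (at z)"
      by (intro tendsto_intros scaleC.tendsto)
    from tendsto_alg_inv(1)[OF this i] obtain d where
      d: "d > 0" "\<And>w. w \<noteq> z \<Longrightarrow> dist w z < d \<Longrightarrow> alg_invertible (x - w *\<^sub>C 1)"
      unfolding eventually_at by auto
    show "\<exists>e>0. \<forall>y. dist y z < e \<longrightarrow> y \<in> - alg_spectrum x"
    proof (intro exI[of _ d] conjI allI impI)
      fix y assume "dist y z < d"
      then show "y \<in> - alg_spectrum x" using d(2)[of y] i by (cases "y = z") (auto simp: alg_spectrum_def)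
    qed (rule d)
  qed
  then show ?thesis by (simp add: closed_def)
qed

lemma compact_real_spec: "compact (real_spec x)"
proof -
  have "bounded (real_spec x)" unfolding bounded_iff using real_spec_bound by auto
  moreover have "closed (real_spec x)" unfolding real_spec_def
    using continuous_closed_vimage[OF closed_alg_spectrum[of x], of complex_of_real]
    by (simp add: vimage_def)
  ultimately show ?thesis by (simp add: compact_eq_bounded_closed)
qed

lemma poly_approx:
  fixes f :: "real \<Rightarrow> real"
  assumes "compact S" "continuous_on S f" "e > 0"
  shows "\<exists>p. \<forall>t\<in>S. \<bar>poly p t - f t\<bar> < e"
proof -
  obtain g where g: "real_polynomial_function g" "\<And>t. t \<in> S \<Longrightarrow> \<bar>f t - g t\<bar> < e"
    using Stone_Weierstrass_real_polynomial_function[OF assms] by blast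
  then obtain a n where gn: "g = (\<lambda>x. \<Sum>i\<le>n. a i * x^i)" by (auto simp: real_polynomial_function_iff_sum)
  let ?p = "\<Sum>i\<le>n. monom (a i) i"
  have "poly ?p t = g t" for t by (simp add: gn poly_sum poly_monom)
  then show ?thesis using g(2) by (intro exI[of _ ?p]) (simp add: abs_minus_commute)
qed

text \<open>The predicate under the definite description in \<open>cfc\<close>, so that existence
  and uniqueness can be treated apart.\<close>

definition cfc_rel :: "'a::cstar_algebra \<Rightarrow> (real \<Rightarrow> real) \<Rightarrow> 'a \<Rightarrow> bool" where
  "cfc_rel x f y \<longleftrightarrow> (\<forall>\<epsilon>>0. \<exists>p. (\<forall>t\<in>real_spec x. \<bar>poly p t - f t\<bar> < \<epsilon>) \<and> norm (poly_at p x - y) < \<epsilon>)"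

lemma cfc_eq_The: "cfc f x = (THE y. cfc_rel x f y)"
  by (simp add: cfc_def cfc_rel_def real_spec_def)

text \<open>Polynomials are isometric for the supremum on the spectrum, and the estimate passes to
  limits. With f = g and B = 0 this is the uniqueness that \<open>cfc\<close> requires.\<close>

lemma cfc_rel_near:
  assumes x: "adj x = x" and f: "cfc_rel x f y" and g: "cfc_rel x g z"
    and B: "\<And>t. t \<in> real_spec x \<Longrightarrow> \<bar>f t - g t\<bar> \<le> B"
  shows "norm (y - z) \<le> B"
proof (rule field_le_epsilon)
  fix e :: real assume "e > 0"
  then have e: "e / 4 > 0" by simp
  from f e obtain p where p: "\<And>t. t \<in> real_spec x \<Longrightarrow> \<bar>poly p t - f t\<bar> < e/4" "norm (poly_at p x - y) < e/4"
    unfolding cfc_rel_def by blast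
  from g e obtain q where q: "\<And>t. t \<in> real_spec x \<Longrightarrow> \<bar>poly q t - g t\<bar> < e/4" "norm (poly_at q x - z) < e/4"
    unfolding cfc_rel_def by blast
  have "norm (poly_at (p - q) x) \<le> B + e/2"
  proof (rule poly_at_norm_le[OF x])
    fix t assume "t \<in> real_spec x"
    from p(1)[OF this] q(1)[OF this] B[OF this] have "\<bar>poly p t - poly q t\<bar> \<le> B + e/2" by linarith
    then show "\<bar>poly (p - q) t\<bar> \<le> B + e/2" by simp
  qed
  moreover have "norm (y - z) \<le> norm (poly_at p x - y) + norm (poly_at q x - z) + norm (poly_at p x - poly_at q x)"
    by norm
  ultimately show "norm (y - z) \<le> B + e" using p(2) q(2) by simp
qed

lemma cfc_rel_ex:
  assumes x: "adj x = x" and f: "continuous_on (real_spec x) f"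
  shows "\<exists>y. cfc_rel x f y"
proof -
  have "\<forall>n. \<exists>p. \<forall>t\<in>real_spec x. \<bar>poly p t - f t\<bar> < 1 / real (Suc n)"
    by (intro allI poly_approx compact_real_spec f) simp
  then obtain p where p: "\<And>n t. t \<in> real_spec x \<Longrightarrow> \<bar>poly (p n) t - f t\<bar> < 1 / real (Suc n)" by metis
  have "Cauchy (\<lambda>n. poly_at (p n) x)"
    unfolding Cauchy_altdef
  proof (intro allI impI)
    fix e :: real assume e: "e > 0"
    obtain N where N: "2 / real (Suc N) < e"
      using reals_Archimedean[of "e/2"] e by (auto simp: field_simps)
    show "\<exists>M. \<forall>m\<ge>M. \<forall>n>m. dist (poly_at (p m) x) (poly_at (p n) x) < e"
    proof (intro exI allI impI)
      fix m n assume mn: "m \<ge> N" "n > m"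
      have "norm (poly_at (p m - p n) x) \<le> 2 / real (Suc N)"
      proof (rule poly_at_norm_le[OF x])
        fix t assume t: "t \<in> real_spec x"
        have "1 / real (Suc m) \<le> 1 / real (Suc N)" "1 / real (Suc n) \<le> 1 / real (Suc N)"
          using mn by (auto simp: field_simps)
        with p[OF t, of m] p[OF t, of n]
        show "\<bar>poly (p m - p n) t\<bar> \<le> 2 / real (Suc N)" by simp
      qed
      then show "dist (poly_at (p m) x) (poly_at (p n) x) < e" using N by (simp add: dist_norm)
    qed
  qed
  then obtain y where y: "(\<lambda>n. poly_at (p n) x) \<longlonglongrightarrow> y" using Cauchy_convergent convergent_def by blast
  show ?thesis
  proof (intro exI[of _ y], unfold cfc_rel_def, intro allI impI)
    fix e :: real assume e: "e > 0"
    have 1: "\<forall>\<^sub>F n in sequentially. norm (poly_at (p n) x - y) < e"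
      using tendstoD[OF y e] by (simp add: dist_norm)
    have 2: "\<forall>\<^sub>F n in sequentially. 1 / real (Suc n) < e"
      using order_tendstoD(2)[OF LIMSEQ_inverse_real_of_nat e] by (simp add: inverse_eq_divide)
    from eventually_happens[OF eventually_conj[OF 1 2]] obtain n where
      "norm (poly_at (p n) x - y) < e" "1 / real (Suc n) < e" by auto
    then show "\<exists>q. (\<forall>t\<in>real_spec x. \<bar>poly q t - f t\<bar> < e) \<and> norm (poly_at q x - y) < e"
      using p[of _ n] by (intro exI[of _ "p n"]) fastforce
  qed
qed

lemma cfc_eqI:
  assumes "adj x = x" "cfc_rel x f y" shows "cfc f x = y"
  unfolding cfc_eq_The
proof (rule the_equality)
  fix z assume "cfc_rel x f z"
  from cfc_rel_near[OF assms(1) this assms(2), of 0] show "z = y" by simp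
qed fact

lemma cfc_rel_cfc:
  assumes "adj x = x" "continuous_on (real_spec x) f" shows "cfc_rel x f (cfc f x)"
  using cfc_rel_ex[OF assms] cfc_eqI[OF assms(1)] by blast

lemma cfc_rel_limit:
  assumes "\<And>n. cfc_rel x (f n) (y n)" "y \<longlonglongrightarrow> z"
    "\<And>e. e > 0 \<Longrightarrow> \<forall>\<^sub>F n in sequentially. \<forall>t\<in>real_spec x. \<bar>f n t - g t\<bar> < e"
  shows "cfc_rel x g z"
  unfolding cfc_rel_def
proof (intro allI impI)
  fix e :: real assume "e > 0"
  then have e: "e / 2 > 0" by simp
  from eventually_happens[OF eventually_conj[OF assms(3)[OF e] tendstoD[OF assms(2) e]]]
  obtain n where n: "\<forall>t\<in>real_spec x. \<bar>f n t - g t\<bar> < e/2" "dist (y n) z < e/2" by auto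
  from assms(1)[of n] e obtain p where p: "\<forall>t\<in>real_spec x. \<bar>poly p t - f n t\<bar> < e/2"
      "norm (poly_at p x - y n) < e/2" unfolding cfc_rel_def by blast
  have "norm (poly_at p x - z) < e"
    using p(2) n(2) by norm
  moreover have "\<bar>poly p t - g t\<bar> < e" if "t \<in> real_spec x" for t
    using bspec[OF p(1) that] bspec[OF n(1) that] by linarith
  ultimately show "\<exists>p. (\<forall>t\<in>real_spec x. \<bar>poly p t - g t\<bar> < e) \<and> norm (poly_at p x - z) < e" by blast
qed

lemma cfc_rel_poly: "cfc_rel x (poly p) (poly_at p x)"
  unfolding cfc_rel_def by (intro allI impI exI[of _ p]) simp

lemma cfc_poly: "adj x = x \<Longrightarrow> cfc (poly p) x = poly_at p x"
  by (intro cfc_eqI cfc_rel_poly)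

lemma cfc_cong:
  assumes "\<And>t. t \<in> real_spec x \<Longrightarrow> f t = g t" shows "cfc f x = cfc g x"
  unfolding cfc_eq_The cfc_rel_def using assms by simp

lemma cfc_dist_le:
  assumes "adj x = x" "continuous_on (real_spec x) f" "continuous_on (real_spec x) g"
    "\<And>t. t \<in> real_spec x \<Longrightarrow> \<bar>f t - g t\<bar> \<le> B"
  shows "norm (cfc f x - cfc g x) \<le> B"
  using assms by (intro cfc_rel_near[of x f _ g]) (auto intro: cfc_rel_cfc)

lemma cfc_approx_seq:
  assumes x: "adj x = x" and f: "continuous_on (real_spec x) f"
  obtains p where "\<And>n t. t \<in> real_spec x \<Longrightarrow> \<bar>poly (p n) t - f t\<bar> < 1 / real (Suc n)"
    "(\<lambda>n. poly_at (p n) x) \<longlonglongrightarrow> cfc f x"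
proof -
  have "\<forall>n. \<exists>p. (\<forall>t\<in>real_spec x. \<bar>poly p t - f t\<bar> < 1 / real (Suc n)) \<and> norm (poly_at p x - cfc f x) < 1 / real (Suc n)"
    using cfc_rel_cfc[OF assms] unfolding cfc_rel_def by simp
  then obtain p where p: "\<And>n t. t \<in> real_spec x \<Longrightarrow> \<bar>poly (p n) t - f t\<bar> < 1 / real (Suc n)"
    "\<And>n. norm (poly_at (p n) x - cfc f x) < 1 / real (Suc n)" by metis
  have "(\<lambda>n. poly_at (p n) x - cfc f x) \<longlonglongrightarrow> 0"
    by (rule Lim_null_comparison[OF _ LIMSEQ_inverse_real_of_nat])
       (use p(2) in \<open>auto simp: inverse_eq_divide intro!: always_eventually less_imp_le\<close>)
  then have "(\<lambda>n. poly_at (p n) x) \<longlonglongrightarrow> cfc f x" by (rule LIM_zero_cancel)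
  then show ?thesis using that[of p] p(1) by blast
qed

lemma uniform_approx_tendsto:
  fixes F :: "nat \<Rightarrow> real \<Rightarrow> real"
  assumes "\<And>n t. t \<in> S \<Longrightarrow> \<bar>F n t - f t\<bar> < 1 / real (Suc n)"
  shows "uniform_limit S F f sequentially"
  unfolding uniform_limit_sequentially_iff
proof (intro allI impI)
  fix e :: real assume "e > 0"
  then obtain N where N: "1 / real (Suc N) < e" using reals_Archimedean[of e] by (auto simp: inverse_eq_divide)
  show "\<exists>N. \<forall>n\<ge>N. \<forall>x\<in>S. dist (F n x) (f x) < e"
  proof (intro exI[of _ N] allI impI ballI)
    fix n x assume "N \<le> n" "x \<in> S"
    then show "dist (F n x) (f x) < e"
      using assms[of x n] N frac_le[of 1 1 "real (Suc N)" "real (Suc n)"] by (simp add: dist_norm)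
  qed
qed

lemma uniform_limit_bounds:
  assumes "uniform_limit S F (f :: real \<Rightarrow> real) sequentially" "e > 0"
  shows "\<forall>\<^sub>F n in sequentially. \<forall>t\<in>S. \<bar>F n t - f t\<bar> < e"
  using uniform_limitD[OF assms] by (simp add: dist_norm)

context
  fixes x :: "'a::cstar_algebra"
  assumes x: "adj x = x"
begin

lemma cfc_mult_add:
  assumes "continuous_on (real_spec x) f" "continuous_on (real_spec x) g"
  shows cfc_mult: "cfc (\<lambda>t. f t * g t) x = cfc f x * cfc g x"
    and cfc_add: "cfc (\<lambda>t. f t + g t) x = cfc f x + cfc g x"
proof -
  obtain p where p: "\<And>n t. t \<in> real_spec x \<Longrightarrow> \<bar>poly (p n) t - f t\<bar> < 1 / real (Suc n)"
    "(\<lambda>n. poly_at (p n) x) \<longlonglongrightarrow> cfc f x" using cfc_approx_seq[OF x assms(1)] by metis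
  obtain q where q: "\<And>n t. t \<in> real_spec x \<Longrightarrow> \<bar>poly (q n) t - g t\<bar> < 1 / real (Suc n)"
    "(\<lambda>n. poly_at (q n) x) \<longlonglongrightarrow> cfc g x" using cfc_approx_seq[OF x assms(2)] by metis
  note up = uniform_approx_tendsto[OF p(1)] and uq = uniform_approx_tendsto[OF q(1)]
  have bf: "bounded (f ` real_spec x)" "bounded (g ` real_spec x)"
    using assms compact_real_spec by (auto intro!: compact_imp_bounded compact_continuous_image)
  show "cfc (\<lambda>t. f t * g t) x = cfc f x * cfc g x"
  proof (rule cfc_eqI[OF x], rule cfc_rel_limit[OF cfc_rel_poly[of x "p _ * q _"]])
    show "(\<lambda>n. poly_at (p n * q n) x) \<longlonglongrightarrow> cfc f x * cfc g x"
      using tendsto_mult[OF p(2) q(2)] by simp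
    show "\<forall>\<^sub>F n in sequentially. \<forall>t\<in>real_spec x. \<bar>poly (p n * q n) t - f t * g t\<bar> < e" if "e > 0" for e
      using uniform_limit_bounds[OF uniform_lim_mult[OF up uq bf] that] by simp
  qed
  show "cfc (\<lambda>t. f t + g t) x = cfc f x + cfc g x"
  proof (rule cfc_eqI[OF x], rule cfc_rel_limit[OF cfc_rel_poly[of x "p _ + q _"]])
    show "(\<lambda>n. poly_at (p n + q n) x) \<longlonglongrightarrow> cfc f x + cfc g x"
      using tendsto_add[OF p(2) q(2)] by simp
    show "\<forall>\<^sub>F n in sequentially. \<forall>t\<in>real_spec x. \<bar>poly (p n + q n) t - (f t + g t)\<bar> < e" if "e > 0" for e
      using uniform_limit_bounds[OF uniform_limit_add[OF up uq] that] by simp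
  qed
qed

lemma cfc_const: "cfc (\<lambda>_. c) x = c *\<^sub>R 1"
  using cfc_poly[OF x, of "[:c:]"] by (simp add: fun_eq_iff cong: cfc_cong)

lemma cfc_ident: "cfc (\<lambda>t. t) x = x"
  using cfc_poly[OF x, of "[:0,1:]"] by (simp cong: cfc_cong)

lemma cfc_scaleR: "continuous_on (real_spec x) f \<Longrightarrow> cfc (\<lambda>t. c * f t) x = c *\<^sub>R cfc f x"
  using cfc_mult[of "\<lambda>_. c" f] by (simp add: cfc_const)

lemma cfc_diff:
  assumes "continuous_on (real_spec x) f" "continuous_on (real_spec x) g"
  shows "cfc (\<lambda>t. f t - g t) x = cfc f x - cfc g x"
  using cfc_add[of f "\<lambda>t. (-1) * g t"] cfc_scaleR[of g "-1"] assms
  by (simp add: continuous_on_minus)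

lemma cfc_norm_le:
  assumes "continuous_on (real_spec x) f" "\<And>t. t \<in> real_spec x \<Longrightarrow> \<bar>f t\<bar> \<le> B"
  shows "norm (cfc f x) \<le> B"
  using cfc_dist_le[OF x assms(1), of "\<lambda>_. 0" B] assms(2) by (simp add: cfc_const)

lemma adj_cfc:
  assumes "continuous_on (real_spec x) f" shows "adj (cfc f x) = cfc f x"
proof -
  obtain p where p: "(\<lambda>n. poly_at (p n) x) \<longlonglongrightarrow> cfc f x" using cfc_approx_seq[OF x assms(1)] by metis
  from bounded_linear.tendsto[OF bounded_linear_adj this]
  have "(\<lambda>n. poly_at (p n) x) \<longlonglongrightarrow> adj (cfc f x)" by (simp add: adj_poly_at[OF x])
  then show ?thesis using p LIMSEQ_unique by blast
qed

lemma cfc_commute: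
  assumes "continuous_on (real_spec x) f" "continuous_on (real_spec x) g"
  shows "cfc f x * cfc g x = cfc g x * cfc f x"
  using cfc_mult[OF assms] cfc_mult[OF assms(2,1)] by (simp add: mult.commute cong: cfc_cong)

end

text \<open>\<open>cfc\<close> accepts real functions only, whereas the coefficient tau of the
  factorisation and the leading symbols of the factors are complex.\<close>

definition ccfc :: "(real \<Rightarrow> complex) \<Rightarrow> 'a::cstar_algebra \<Rightarrow> 'a" where
  "ccfc f x = cfc (\<lambda>t. Re (f t)) x + \<i> *\<^sub>C cfc (\<lambda>t. Im (f t)) x"

lemma ccfc_cong: "(\<And>t. t \<in> real_spec x \<Longrightarrow> f t = g t) \<Longrightarrow> ccfc f x = ccfc g x"
  unfolding ccfc_def by (metis (no_types, lifting) cfc_cong)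

lemma ccfc_of_real: "adj x = x \<Longrightarrow> ccfc (\<lambda>t. of_real (f t)) x = cfc f x"
  by (simp add: ccfc_def cfc_const scaleC.zero_right)

context
  fixes x :: "'a::cstar_algebra"
  assumes x: "adj x = x"
begin

lemma ccfc_const: "ccfc (\<lambda>_. c) x = c *\<^sub>C 1"
proof -
  have "ccfc (\<lambda>_. c) x = (of_real (Re c) + \<i> * of_real (Im c)) *\<^sub>C 1"
    unfolding ccfc_def by (simp add: cfc_const[OF x] scaleC.add_left flip: scaleC_scaleC)
  then show ?thesis by (simp flip: complex_eq)
qed

lemma ccfc_add:
  assumes "continuous_on (real_spec x) f" "continuous_on (real_spec x) g"
  shows "ccfc (\<lambda>t. f t + g t) x = ccfc f x + ccfc g x"
  using assms by (simp add: ccfc_def cfc_add[OF x] continuous_on_Re continuous_on_Im scaleC.add_right)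

lemma ccfc_mult:
  assumes "continuous_on (real_spec x) f" "continuous_on (real_spec x) g"
  shows "ccfc (\<lambda>t. f t * g t) x = ccfc f x * ccfc g x"
  using assms
  by (simp add: ccfc_def cfc_add[OF x] cfc_diff[OF x] cfc_mult[OF x] continuous_on_Re continuous_on_Im continuous_on_mult
      scaleC.add_right algebra_simps mult_scaleC_left mult_scaleC_right scaleC_scaleC scaleC.minus_left
      cfc_commute[OF x, of "\<lambda>t. Im (g t)" "\<lambda>t. Re (f t)"])

text \<open>By the C*-identity the square of the norm is the norm of the calculus of the real
  function |f|^2, to which the real estimate applies without loss of a constant.\<close>

lemma ccfc_norm_le:
  assumes f: "continuous_on (real_spec x) f" and B: "\<And>t. t \<in> real_spec x \<Longrightarrow> cmod (f t) \<le> B"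
  shows "norm (ccfc f x) \<le> B"
proof -
  obtain t0 where "t0 \<in> real_spec x" using real_spec_nonempty[OF x] by auto
  from B[OF this] have B0: "B \<ge> 0" using norm_ge_zero order_trans by blast
  note c = continuous_on_Re[OF f] continuous_on_Im[OF f]
  have "adj (ccfc f x) = ccfc (\<lambda>t. cnj (f t)) x"
    using cfc_scaleR[OF x c(2), of "-1"]
    by (simp add: ccfc_def adj_add adj_scaleC adj_cfc[OF x] c scaleC.minus_left scaleC.minus_right)
  then have "adj (ccfc f x) * ccfc f x = ccfc (\<lambda>t. cnj (f t) * f t) x"
    using f by (simp add: ccfc_mult continuous_on_cnj)
  also have "\<dots> = cfc (\<lambda>t. cmod (f t) ^ 2) x"
    unfolding ccfc_of_real[OF x, symmetric]
    by (rule ccfc_cong) (simp add: complex_norm_square mult.commute flip: of_real_power)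
  finally have "norm (ccfc f x) ^ 2 = norm (cfc (\<lambda>t. cmod (f t) ^ 2) x)" by (metis norm_adj_mult)
  also have "\<dots> \<le> B ^ 2"
    by (rule cfc_norm_le[OF x]) (use f B in \<open>auto intro!: continuous_intros power_mono\<close>)
  finally show ?thesis using B0 by (rule power2_le_imp_le)
qed

lemma ccfc_inverse:
  assumes f: "continuous_on (real_spec x) f" and nz: "\<And>t. t \<in> real_spec x \<Longrightarrow> f t \<noteq> 0"
  shows "alg_invertible (ccfc f x)" "alg_inv (ccfc f x) = ccfc (\<lambda>t. inverse (f t)) x"
proof -
  have i: "continuous_on (real_spec x) (\<lambda>t. inverse (f t))" using f nz by (intro continuous_intros) auto
  have "ccfc f x * ccfc (\<lambda>t. inverse (f t)) x = ccfc (\<lambda>_. 1) x" "ccfc (\<lambda>t. inverse (f t)) x * ccfc f x = ccfc (\<lambda>_. 1) x"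
    unfolding ccfc_mult[OF f i, symmetric] ccfc_mult[OF i f, symmetric] by (rule ccfc_cong; simp add: nz)+
  then show "alg_invertible (ccfc f x)" "alg_inv (ccfc f x) = ccfc (\<lambda>t. inverse (f t)) x"
    by (auto simp: ccfc_const intro: alg_invertibleI alg_inv_eqI)
qed

end

no_notation fps_nth (infixl "$" 75)


subsection \<open>The noncommutative two torus\<close>

lemma upow_0 [simp]: "upow u 0 = 1"
  by (simp add: upow_def)

lemma upow_Suc:
  assumes "u * adj u = 1" shows "upow u (k + 1) = u * upow u k"
proof (cases "0 \<le> k")
  case True
  then have "nat (k + 1) = Suc (nat k)" by simp
  then show ?thesis using True by (simp add: upow_def)
next
  case False
  then obtain m where m: "k = - int (Suc m)" by (metis negD not_le)
  have "u * adj u ^ Suc m = adj u ^ m" using assms by (simp flip: mult.assoc)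
  then show ?thesis using False m by (cases m) (simp_all add: upow_def nat_add_distrib)
qed

lemma upow_pred:
  assumes "u * adj u = 1" "adj u * u = 1" shows "upow u (k - 1) = adj u * upow u k"
  using upow_Suc[OF assms(1), of "k - 1"] assms(2) by (simp flip: mult.assoc)

lemma upow_add:
  assumes "u * adj u = 1" "adj u * u = 1" shows "upow u (k + l) = upow u k * upow u l"
proof (induction k rule: int_induct[where k=0])
  case (step1 i)
  have "upow u (i + 1 + l) = u * upow u (i + l)" using upow_Suc[OF assms(1), of "i + l"] by (simp add: add_ac)
  then show ?case by (simp add: step1 upow_Suc[OF assms(1)] mult.assoc)
next
  case (step2 i)
  have "upow u (i - 1 + l) = adj u * upow u (i + l)" using upow_pred[OF assms, of "i + l"] by (simp add: algebra_simps)
  then show ?case by (simp add: step2 upow_pred[OF assms] mult.assoc)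
qed simp

lemma upow_inverse:
  assumes "u * adj u = 1" "adj u * u = 1"
  shows "upow u k * upow u (- k) = 1" "upow u (- k) * upow u k = 1"
  using upow_add[OF assms, of k "-k"] upow_add[OF assms, of "-k" k] by simp_all

lemma adj_upow: "adj (upow u k) = upow u (- k)"
proof (cases "k = 0")
  case False
  then show ?thesis by (auto simp: upow_def adj_power adj_adj)
qed simp

lemma upow_1 [simp]: "upow u 1 = u"
  by (simp add: upow_def)

lemma upow_q_commute:
  assumes u: "u * adj u = 1" "adj u * u = 1" and c: "x * u = cis t *\<^sub>C (u * x)"
  shows "x * upow u k = cis (t * of_int k) *\<^sub>C (upow u k * x)"
proof -
  have "adj u * (x * u) * adj u = adj u * (cis t *\<^sub>C (u * x)) * adj u" using c by simp
  then have "adj u * x = cis t *\<^sub>C (x * adj u)"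
    using u by (simp add: mult.assoc mult_scaleC_left mult_scaleC_right) (simp add: u flip: mult.assoc)
  then have "cis (-t) *\<^sub>C (adj u * x) = x * adj u"
    by (simp add: scaleC_scaleC cis_mult)
  then have c': "x * adj u = cis (-t) *\<^sub>C (adj u * x)" by simp
  show ?thesis
  proof (induction k rule: int_induct[where k=0])
    case (step1 i)
    have "x * upow u (i + 1) = (x * u) * upow u i" by (simp add: upow_Suc[OF u(1)] mult.assoc)
    also have "\<dots> = cis t *\<^sub>C (u * (x * upow u i))" by (simp add: c mult_scaleC_left mult.assoc)
    also have "\<dots> = cis (t * of_int (i + 1)) *\<^sub>C (upow u (i + 1) * x)"
      by (simp add: step1 upow_Suc[OF u(1)] mult_scaleC_right mult.assoc scaleC_scaleC cis_mult) (simp add: algebra_simps)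
    finally show ?case .
  next
    case (step2 i)
    have "x * upow u (i - 1) = (x * adj u) * upow u i" by (simp add: upow_pred[OF u] mult.assoc)
    also have "\<dots> = cis (-t) *\<^sub>C (adj u * (x * upow u i))" by (simp add: c' mult_scaleC_left mult.assoc)
    also have "\<dots> = cis (t * of_int (i - 1)) *\<^sub>C (upow u (i - 1) * x)"
      by (simp add: step2 upow_pred[OF u] mult_scaleC_right mult.assoc scaleC_scaleC cis_mult) (simp add: algebra_simps)
    finally show ?case .
  qed simp
qed

lemma sum_roots_of_unity:
  assumes "\<bar>n\<bar> < int M" "n \<noteq> 0"
  shows "(\<Sum>j<M. cis (2 * pi * real j / real M * of_int n)) = 0"
proof -
  have M: "M > 0" using assms by linarith
  define w where "w = cis (2 * pi * of_int n / real M)"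
  have w1: "w \<noteq> 1"
  proof
    assume "w = 1"
    then have "exp (\<i> * complex_of_real (2 * pi * of_int n / real M)) = 1"
      unfolding w_def cis_conv_exp .
    then obtain k where "2 * pi * of_int n / real M = of_int (2 * k) * pi"
      unfolding exp_eq_1 by auto
    then have "real_of_int n = of_int k * real M" using M by (simp add: field_simps)
    then have nk: "n = k * int M" by (metis of_int_eq_iff of_int_mult of_int_of_nat_eq)
    with assms(2) have "\<bar>k\<bar> \<ge> 1" by auto
    then have "\<bar>n\<bar> \<ge> int M" unfolding nk abs_mult by (simp add: mult_le_cancel_right1)
    with assms(1) show False by simp
  qed
  have "real M * (2 * pi * of_int n / real M) = 2 * pi * of_int n" using M by simp
  then have "w ^ M = cis (2 * pi * of_int n)" unfolding w_def Complex.DeMoivre by (simp only:)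
  also have "\<dots> = 1" by (rule cis_multiple_2pi) simp
  finally have "(\<Sum>j<M. w ^ j) = 0" using w1 by (simp add: geometric_sum)
  moreover have "w ^ j = cis (2 * pi * real j / real M * of_int n)" for j
    by (simp add: w_def Complex.DeMoivre mult_ac)
  ultimately show ?thesis by simp
qed

definition wt :: "int^2 \<Rightarrow> real" where
  "wt n = 1 + \<bar>of_int (n$1)\<bar> + \<bar>of_int (n$2)\<bar>"

lemma wt_ge_1: "wt n \<ge> 1" and wt_pos [simp]: "wt n > 0"
  by (simp_all add: wt_def)

text \<open>Submultiplicativity of the weight is what lets rapid decay survive a twisted
  convolution.\<close>

lemma wt_add: "wt (m + n) \<le> wt m * wt n"
proof -
  have "wt (m + n) \<le> 1 + (\<bar>of_int (m$1)\<bar> + \<bar>of_int (m$2)\<bar>) + (\<bar>of_int (n$1)\<bar> + \<bar>of_int (n$2)\<bar>)" by (simp add: wt_def)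
  also have "\<dots> \<le> wt m * wt n"
    unfolding wt_def add.assoc by (simp add: distrib_left distrib_right)
  finally show ?thesis .
qed

lemma rapid_decay_wt: "rapid_decay c \<longleftrightarrow> (\<forall>k. \<exists>C. \<forall>n. wt n ^ k * cmod (c n) \<le> C)"
  unfolding rapid_decay_def bounded_iff wt_def
  by (auto simp: abs_mult)

lemma sum_inverse_squares: "(\<Sum>j\<le>M. 1 / (1 + real j)\<^sup>2) \<le> 2 - 1 / (1 + real M)"
proof (induction M)
  case (Suc M)
  have "1 / (2 + real M)\<^sup>2 \<le> 1 / ((1 + real M) * (2 + real M))"
    unfolding power2_eq_square by (intro divide_left_mono mult_right_mono) auto
  also have "\<dots> = 1 / (1 + real M) - 1 / (2 + real M)" by (simp add: field_simps)
  finally show ?case using Suc by (simp add: add.commute)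
qed simp

lemma sum_inverse_squares_le:
  "(\<Sum>j=-int M..int M. 1 / (1 + \<bar>real_of_int j\<bar>)\<^sup>2) \<le> 4"
proof -
  note a = sum_inverse_squares[of M]
  have "(\<Sum>j=-int M..int M. 1 / (1 + \<bar>real_of_int j\<bar>)\<^sup>2) \<le>
     (\<Sum>j\<in>int ` {..M} \<union> (\<lambda>j. - int j) ` {..M}. 1 / (1 + \<bar>real_of_int j\<bar>)\<^sup>2)"
  proof (rule sum_mono2)
    show "{-int M..int M} \<subseteq> int ` {..M} \<union> (\<lambda>j. - int j) ` {..M}"
    proof
      fix j assume "j \<in> {-int M..int M}"
      then show "j \<in> int ` {..M} \<union> (\<lambda>j. - int j) ` {..M}"
        by (cases j rule: int_cases2) auto
    qed
  qed auto
  also have "\<dots> \<le> (\<Sum>j\<in>int ` {..M}. 1 / (1 + \<bar>real_of_int j\<bar>)\<^sup>2) + (\<Sum>j\<in>(\<lambda>j. - int j) ` {..M}. 1 / (1 + \<bar>real_of_int j\<bar>)\<^sup>2)"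
    by (subst sum.union_inter[symmetric]) (auto intro!: sum_nonneg)
  also have "\<dots> = 2 * (\<Sum>j\<le>M. 1 / (1 + real j)\<^sup>2)"
    by (subst (1 2) sum.reindex) (auto simp: inj_on_def)
  moreover have "0 \<le> 1 / (1 + real M)" by simp
  ultimately show ?thesis using a by linarith
qed

text \<open>The exponent 4 is distributed as 2 + 2 over the coordinates, so finite sums are
  dominated by a product of two sums of inverse squares, each at most 4.\<close>

lemma summable_wt: "(\<lambda>n. 1 / wt n ^ 4) summable_on UNIV"
proof (rule nonneg_bdd_above_summable_on)
  show "bdd_above (sum (\<lambda>n. 1 / wt n ^ 4) ` {F. F \<subseteq> UNIV \<and> finite F})"
  proof (rule bdd_aboveI2)
    fix F :: "(int^2) set" assume "F \<in> {F. F \<subseteq> UNIV \<and> finite F}"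
    then have F: "finite F" by simp
    define M where "M = (\<Sum>n\<in>F. nat \<bar>n$1\<bar> + nat \<bar>n$2\<bar>)"
    have b: "n$1 \<in> {-int M..int M} \<and> n$2 \<in> {-int M..int M}" if "n \<in> F" for n
    proof -
      have "nat \<bar>n$1\<bar> + nat \<bar>n$2\<bar> \<le> M" unfolding M_def by (rule member_le_sum[OF that _ F]) simp
      then show ?thesis unfolding atLeastAtMost_iff by linarith
    qed
    let ?I = "{-int M..int M}"
    have le: "1 / wt n ^ 4 \<le> (1 / (1 + \<bar>of_int (n$1)\<bar>)\<^sup>2) * (1 / (1 + \<bar>of_int (n$2)\<bar>)\<^sup>2)" for n
    proof -
      have "(1 + \<bar>of_int (n$1)\<bar>)\<^sup>2 * (1 + \<bar>of_int (n$2)\<bar>)\<^sup>2 \<le> wt n ^ 2 * wt n ^ 2"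
        unfolding wt_def by (intro mult_mono power_mono) auto
      then show ?thesis
        by (simp add: divide_simps flip: power_add)
    qed
    have "(\<Sum>n\<in>F. 1 / wt n ^ 4) \<le> (\<Sum>n\<in>F. case (n$1, n$2) of (i, j) \<Rightarrow> (1 / (1 + \<bar>of_int i\<bar>)\<^sup>2) * (1 / (1 + \<bar>of_int j\<bar>)\<^sup>2))"
      using le by (intro sum_mono) simp
    also have "\<dots> = (\<Sum>(i,j)\<in>(\<lambda>n. (n$1, n$2)) ` F. (1 / (1 + \<bar>of_int i\<bar>)\<^sup>2) * (1 / (1 + \<bar>of_int j\<bar>)\<^sup>2))"
      by (subst sum.reindex) (auto simp: inj_on_def vec_eq_iff forall_2)
    also have "\<dots> \<le> (\<Sum>(i,j)\<in>?I \<times> ?I. (1 / (1 + \<bar>of_int i\<bar>)\<^sup>2) * (1 / (1 + \<bar>of_int j\<bar>)\<^sup>2))"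
      using b by (intro sum_mono2) auto
    also have "\<dots> = (\<Sum>i\<in>?I. 1 / (1 + \<bar>of_int i\<bar>)\<^sup>2) * (\<Sum>j\<in>?I. 1 / (1 + \<bar>of_int j\<bar>)\<^sup>2)"
      by (simp add: sum_product sum.cartesian_product)
    also have "\<dots> \<le> 4 * 4"
      by (intro mult_mono sum_inverse_squares_le sum_nonneg) auto
    finally show "(\<Sum>n\<in>F. 1 / wt n ^ 4) \<le> 4 * 4" .
  qed
qed (auto simp: less_imp_le)

locale nc_torus =
  fixes \<theta> :: "real^2^2" and U :: "2 \<Rightarrow> 'a::cstar_algebra"
  assumes skew: "transpose \<theta> = - \<theta>" and nct: "nct \<theta> U"
begin

abbreviation "mon \<equiv> nct_monom U"
abbreviation "ph \<equiv> 2 * pi * \<theta>$1$2"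
abbreviation "fs c \<equiv> finite {n::int^2. c n \<noteq> (0::complex)}"
definition pol :: "(int^2 \<Rightarrow> complex) \<Rightarrow> 'a" where "pol c = (\<Sum>n | c n \<noteq> 0. c n *\<^sub>C mon n)"

lemma nct_facts:
  shows "adj (U k) * U k = 1 \<and> U k * adj (U k) = 1"
    and "U k * U j = cis (2 * pi * \<theta>$j$k) *\<^sub>C (U j * U k)"
    and "\<lbrakk>closed S; range U \<subseteq> S; 1 \<in> S; \<And>x y. x \<in> S \<Longrightarrow> y \<in> S \<Longrightarrow> x + y \<in> S \<and> x * y \<in> S;
      \<And>x. x \<in> S \<Longrightarrow> adj x \<in> S \<and> (\<forall>w. w *\<^sub>C x \<in> S)\<rbrakk> \<Longrightarrow> S = UNIV"
    and "tw_cstar_seminorm \<theta> N \<Longrightarrow> fs c \<Longrightarrow> N c \<le> norm (pol c)"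
proof -
  note n = nct[unfolded nct_def]
  show "adj (U k) * U k = 1 \<and> U k * adj (U k) = 1" by (rule n[THEN conjunct1, rule_format])
  show "U k * U j = cis (2 * pi * \<theta>$j$k) *\<^sub>C (U j * U k)"
    by (rule n[THEN conjunct2, THEN conjunct1, rule_format])
  show "S = UNIV" if "closed S" "range U \<subseteq> S" "1 \<in> S" "\<And>x y. x \<in> S \<Longrightarrow> y \<in> S \<Longrightarrow> x + y \<in> S \<and> x * y \<in> S"
      "\<And>x. x \<in> S \<Longrightarrow> adj x \<in> S \<and> (\<forall>w. w *\<^sub>C x \<in> S)"
    by (rule n[THEN conjunct2, THEN conjunct2, THEN conjunct1, THEN spec, THEN mp]) (intro conjI ballI that)
  show "N c \<le> norm (pol c)" if "tw_cstar_seminorm \<theta> N" "fs c"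
    unfolding pol_def by (rule n[THEN conjunct2, THEN conjunct2, THEN conjunct2, rule_format]) (intro conjI that)
qed

lemma unitary [simp]: "U k * adj (U k) = 1" "adj (U k) * U k = 1"
  using nct_facts(1) by simp_all

text \<open>Carrying the power of \<open>U 2\<close> past the power of \<open>U 1\<close> produces
  exactly the cocycle in \<open>tw_mult\<close>, which makes \<open>pol\<close>
  multiplicative.\<close>

lemma mon_mult: "mon m * mon n = cis (ph * of_int (m$2) * of_int (n$1)) *\<^sub>C mon (m + n)"
proof -
  have "U 2 * U 1 = cis ph *\<^sub>C (U 1 * U 2)" by (rule nct_facts(2))
  from upow_q_commute[OF unitary this, of "n$1"]
  have "cis (-(ph * of_int (n$1))) *\<^sub>C (U 2 * upow (U 1) (n$1)) = upow (U 1) (n$1) * U 2"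
    by (simp add: scaleC_scaleC cis_mult)
  then have "upow (U 1) (n$1) * upow (U 2) (m$2)
      = cis (-(ph * of_int (n$1)) * of_int (m$2)) *\<^sub>C (upow (U 2) (m$2) * upow (U 1) (n$1))"
    by (intro upow_q_commute unitary) simp
  then have "cis (ph * of_int (n$1) * of_int (m$2)) *\<^sub>C (upow (U 1) (n$1) * upow (U 2) (m$2))
      = upow (U 2) (m$2) * upow (U 1) (n$1)"
    by (simp add: scaleC_scaleC cis_mult)
  then have "upow (U 2) (m$2) * upow (U 1) (n$1) = cis (ph * of_int (m$2) * of_int (n$1)) *\<^sub>C (upow (U 1) (n$1) * upow (U 2) (m$2))"
    by (simp add: mult_ac)
  then have "mon m * mon n = upow (U 1) (m$1) * (cis (ph * of_int (m$2) * of_int (n$1)) *\<^sub>C (upow (U 1) (n$1) * upow (U 2) (m$2))) * upow (U 2) (n$2)"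
    unfolding nct_monom_def by (metis mult.assoc)
  then show ?thesis
    by (simp add: nct_monom_def mult_scaleC_left mult_scaleC_right upow_add mult.assoc)
qed

lemma mon_0 [simp]: "mon 0 = 1"
  by (simp add: nct_monom_def)

lemma adj_mon: "adj (mon n) = cis (ph * of_int (n$1) * of_int (n$2)) *\<^sub>C mon (- n)"
proof -
  let ?x = "cis (ph * of_int (n$1) * of_int (n$2)) *\<^sub>C mon (- n)"
  have "mon n * ?x = 1"
    by (simp add: mult_scaleC_right mon_mult scaleC_scaleC cis_mult mult_ac)
  then have "adj (mon n) = adj (mon n) * (mon n * ?x)" by simp
  moreover have "adj (mon n) * mon n = 1"
    by (simp add: nct_monom_def adj_mult adj_upow mult.assoc)
       (simp add: upow_inverse flip: mult.assoc)
  ultimately show ?thesis by (simp flip: mult.assoc)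
qed

lemma adj_mon_mult: "adj (mon n) * mon n = 1" "mon n * adj (mon n) = 1"
  by (simp_all add: adj_mon mult_scaleC_left mult_scaleC_right mon_mult scaleC_scaleC cis_mult mult_ac)

lemma norm_mon [simp]: "norm (mon n) = 1"
  using norm_adj_mult[of "mon n"] norm_ge_zero[of "mon n"] by (simp add: adj_mon_mult power2_eq_1_iff)

lemma pol_superset:
  assumes "finite F" "{n. c n \<noteq> 0} \<subseteq> F" shows "pol c = (\<Sum>n\<in>F. c n *\<^sub>C mon n)"
  unfolding pol_def by (rule sum.mono_neutral_left) (use assms in \<open>auto simp: scaleC.zero_left\<close>)

lemma fs_add: "fs c \<Longrightarrow> fs d \<Longrightarrow> fs (\<lambda>n. c n + d n)"
  by (rule finite_subset[of _ "{n. c n \<noteq> 0} \<union> {n. d n \<noteq> 0}"]) auto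

lemma fs_scale: "fs c \<Longrightarrow> fs (\<lambda>n. w * c n)"
  by (rule finite_subset[of _ "{n. c n \<noteq> 0}"]) auto

lemma pol_add: assumes "fs c" "fs d" shows "pol (\<lambda>n. c n + d n) = pol c + pol d"
proof -
  let ?F = "{n. c n \<noteq> 0} \<union> {n. d n \<noteq> 0}"
  have "finite ?F" using assms by simp
  then show ?thesis by (subst (1 2 3) pol_superset[of ?F]) (auto simp: scaleC.add_left sum.distrib)
qed

lemma pol_scale: "pol (\<lambda>n. w * c n) = w *\<^sub>C pol c" if "fs c"
  using that by (subst (1 2) pol_superset[of "{n. c n \<noteq> 0}"])
    (auto simp: scaleC.sum_right scaleC_scaleC)

lemma fs_diff: "fs c \<Longrightarrow> fs d \<Longrightarrow> fs (\<lambda>n. c n - d n)"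
  using fs_add[of c "\<lambda>n. -1 * d n"] fs_scale[of d "-1"] by simp

lemma pol_diff: "fs c \<Longrightarrow> fs d \<Longrightarrow> pol (\<lambda>n. c n - d n) = pol c - pol d"
  using pol_add[of c "\<lambda>n. -1 * d n"] fs_scale[of d "-1"] pol_scale[of d "-1"] by (simp add: scaleC.minus_left)

lemma tw_mult_superset:
  assumes "finite F" "{n. c n \<noteq> 0} \<subseteq> F"
  shows "tw_mult \<theta> c d n = (\<Sum>m\<in>F. c m * d (n - m) * cis (ph * of_int (m$2) * of_int ((n - m)$1)))"
  unfolding tw_mult_def by (rule sum.mono_neutral_left) (use assms in auto)

lemma fs_tw_mult:
  assumes "fs c" "fs d" shows "fs (tw_mult \<theta> c d)"
proof (rule finite_subset)
  show "{n. tw_mult \<theta> c d n \<noteq> 0} \<subseteq> (\<lambda>(m,k). m + k) ` ({n. c n \<noteq> 0} \<times> {n. d n \<noteq> 0})"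
  proof
    fix n assume "n \<in> {n. tw_mult \<theta> c d n \<noteq> 0}"
    then obtain m where "c m \<noteq> 0" "d (n - m) \<noteq> 0" unfolding tw_mult_def
      by (smt (verit) mem_Collect_eq mult_eq_0_iff sum.neutral)
    then show "n \<in> (\<lambda>(m,k). m + k) ` ({n. c n \<noteq> 0} \<times> {n. d n \<noteq> 0})"
      by (intro image_eqI[of _ _ "(m, n - m)"]) auto
  qed
qed (use assms in auto)

lemma pol_mult:
  assumes "fs c" "fs d" shows "pol (tw_mult \<theta> c d) = pol c * pol d"
proof -
  let ?C = "{n. c n \<noteq> 0}" and ?D = "{n. d n \<noteq> 0}"
  let ?E = "{n. tw_mult \<theta> c d n \<noteq> 0} \<union> (\<lambda>(m,k). m + k) ` (?C \<times> ?D)"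
  have E: "finite ?E" using assms fs_tw_mult by auto
  let ?t = "\<lambda>m k. (c m * d k * cis (ph * of_int (m$2) * of_int (k$1))) *\<^sub>C mon (m + k)"
  have "pol (tw_mult \<theta> c d) = (\<Sum>n\<in>?E. \<Sum>m\<in>?C. ?t m (n - m))"
    using E by (subst pol_superset[of ?E]) (auto simp: tw_mult_def scaleC.sum_left)
  also have "\<dots> = (\<Sum>m\<in>?C. \<Sum>n\<in>?E. ?t m (n - m))" by (rule sum.swap)
  also have "\<dots> = (\<Sum>m\<in>?C. \<Sum>k\<in>?D. ?t m k)"
  proof (rule sum.cong[OF refl])
    fix m assume m: "m \<in> ?C"
    have "(\<Sum>n\<in>?E. ?t m (n - m)) = (\<Sum>n\<in>(\<lambda>k. m + k) ` ?D. ?t m (n - m))"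
    proof (rule sum.mono_neutral_right[OF E])
      show "(\<lambda>k. m + k) ` ?D \<subseteq> ?E" using m by auto
      show "\<forall>i\<in>?E - (\<lambda>k. m + k) ` ?D. ?t m (i - m) = 0"
      proof
        fix i assume "i \<in> ?E - (\<lambda>k. m + k) ` ?D"
        then have "d (i - m) = 0" by (metis (mono_tags, lifting) DiffD2 add_diff_cancel_left' diff_add_cancel image_eqI mem_Collect_eq add.commute)
        then show "?t m (i - m) = 0" by (simp add: scaleC.zero_left)
      qed
    qed
    also have "\<dots> = (\<Sum>k\<in>?D. ?t m k)" by (subst sum.reindex) (auto simp: inj_on_def)
    finally show "(\<Sum>n\<in>?E. ?t m (n - m)) = (\<Sum>k\<in>?D. ?t m k)" .
  qed
  also have "\<dots> = pol c * pol d"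
    by (simp add: pol_def sum_product mult_scaleC_left mult_scaleC_right mon_mult scaleC_scaleC mult_ac)
  finally show ?thesis .
qed

lemma tw_adj_0_iff: "tw_adj \<theta> c n \<noteq> 0 \<longleftrightarrow> c (- n) \<noteq> 0"
  by (simp add: tw_adj_def)

lemma fs_tw_adj: assumes "fs c" shows "fs (tw_adj \<theta> c)"
proof -
  have "{n. tw_adj \<theta> c n \<noteq> 0} = uminus ` {n. c n \<noteq> 0}"
    by (force simp: tw_adj_0_iff image_iff)
  then show ?thesis using assms by simp
qed

lemma pol_adj: assumes "fs c" shows "pol (tw_adj \<theta> c) = adj (pol c)"
proof -
  have *: "{n. tw_adj \<theta> c n \<noteq> 0} = uminus ` {n. c n \<noteq> 0}"
    by (force simp: tw_adj_0_iff image_iff)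
  have "adj (pol c) = (\<Sum>n | c n \<noteq> 0. adj (c n *\<^sub>C mon n))"
    unfolding pol_def using bounded_linear.linear[OF bounded_linear_adj] by (rule linear_sum)
  also have "\<dots> = pol (tw_adj \<theta> c)"
    unfolding pol_def * by (subst sum.reindex) (auto simp: tw_adj_def adj_scaleC adj_mon scaleC_scaleC mult_ac)
  finally show ?thesis by simp
qed

text \<open>The dual action of the torus, which multiplies \<open>U 1\<close> by
  \<open>cis s\<close> and \<open>U 2\<close> by \<open>cis t\<close>, expressed on coefficient
  families.\<close>

definition gauge :: "real \<Rightarrow> real \<Rightarrow> (int^2 \<Rightarrow> complex) \<Rightarrow> int^2 \<Rightarrow> complex" where
  "gauge s t c n = cis (s * of_int (n$1) + t * of_int (n$2)) * c n"

lemma gauge_0_iff: "gauge s t c n = 0 \<longleftrightarrow> c n = 0"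
  by (simp add: gauge_def)

lemma gauge_mult: "tw_mult \<theta> (gauge s t c) (gauge s t d) = gauge s t (tw_mult \<theta> c d)"
proof
  fix n :: "int^2"
  have "cis (s * of_int (m$1) + t * of_int (m$2)) * cis (s * of_int ((n - m)$1) + t * of_int ((n - m)$2))
      = cis (s * of_int (n$1) + t * of_int (n$2))" for m :: "int^2"
    by (simp add: cis_mult algebra_simps)
  then have "cis (s * of_int (n$1) + t * of_int (n$2)) * w =
      cis (s * of_int (m$1) + t * of_int (m$2)) * cis (s * of_int ((n - m)$1) + t * of_int ((n - m)$2)) * w" for m and w
    by simp
  then have e: "gauge s t c m * gauge s t d (n - m) * w = cis (s * of_int (n$1) + t * of_int (n$2)) * (c m * d (n - m) * w)" for m w
    unfolding gauge_def by (simp only: mult_ac)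
  show "tw_mult \<theta> (gauge s t c) (gauge s t d) n = gauge s t (tw_mult \<theta> c d) n"
    unfolding gauge_def[of s t "tw_mult \<theta> c d"] tw_mult_def gauge_0_iff e sum_distrib_left ..
qed

lemma gauge_adj: "tw_adj \<theta> (gauge s t c) = gauge s t (tw_adj \<theta> c)"
  by (rule ext) (simp add: tw_adj_def gauge_def cis_cnj add.commute)

text \<open>Universality: the gauged norm is a C*-seminorm, hence dominated by the norm.\<close>

lemma norm_gauge_le:
  assumes "fs c" shows "norm (pol (gauge s t c)) \<le> norm (pol c)"
proof -
  let ?N = "\<lambda>c. norm (pol (gauge s t c))"
  have fg: "fs (gauge s t c)" if "fs c" for c using that by (simp add: gauge_0_iff)
  have "tw_cstar_seminorm \<theta> ?N"
    unfolding tw_cstar_seminorm_def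
  proof (intro allI impI conjI)
    fix c d :: "int^2 \<Rightarrow> complex" and w assume f: "fs c" "fs d"
    have "gauge s t (\<lambda>n. c n + d n) = (\<lambda>n. gauge s t c n + gauge s t d n)"
      by (auto simp: gauge_def algebra_simps)
    then show "?N (\<lambda>n. c n + d n) \<le> ?N c + ?N d" using f by (simp add: pol_add fg norm_triangle_ineq)
    have "gauge s t (\<lambda>n. w * c n) = (\<lambda>n. w * gauge s t c n)" by (auto simp: gauge_def)
    then show "?N (\<lambda>n. w * c n) = cmod w * ?N c" using f by (simp add: pol_scale fg norm_scaleC)
    show "?N (tw_mult \<theta> c d) \<le> ?N c * ?N d" using f
      by (simp flip: gauge_mult add: pol_mult fg norm_mult_ineq)
    show "?N (tw_mult \<theta> (tw_adj \<theta> c) c) = (?N c)\<^sup>2" using f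
      by (simp flip: gauge_mult gauge_adj add: pol_mult fs_tw_adj pol_adj fg norm_adj_mult)
  qed
  from nct_facts(4)[OF this assms] show ?thesis .
qed

text \<open>Averaging the gauge action over M-th roots of unity in both directions annihilates every
  coefficient except c 0, and gauging does not increase the norm. A finite average replaces the
  integral over the torus because the support is finite.\<close>

lemma coeff_0_le:
  assumes "fs c" shows "cmod (c 0) \<le> norm (pol c)"
proof -
  \<comment> \<open>M exceeds all coordinates of the support, so no nonzero coordinate is a multiple
    of M and the roots of unity sum to zero.\<close>
  define M where "M = Suc (\<Sum>n | c n \<noteq> 0. nat \<bar>n$1\<bar> + nat \<bar>n$2\<bar>)"
  have b: "\<bar>n$1\<bar> < int M \<and> \<bar>n$2\<bar> < int M" if "c n \<noteq> 0" for n
  proof -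
    have "nat \<bar>n$1\<bar> + nat \<bar>n$2\<bar> \<le> (\<Sum>n | c n \<noteq> 0. nat \<bar>n$1\<bar> + nat \<bar>n$2\<bar>)"
      by (rule member_le_sum) (use that assms in auto)
    then show ?thesis unfolding M_def by linarith
  qed
  let ?a = "\<lambda>j. 2 * pi * real j / real M"
  have s: "(\<Sum>j<M. \<Sum>k<M. cis (?a j * of_int (n$1) + ?a k * of_int (n$2))) = (if n = 0 then of_nat (M * M) else 0)"
    if "c n \<noteq> 0" for n
  proof -
    have "(\<Sum>j<M. \<Sum>k<M. cis (?a j * of_int (n$1) + ?a k * of_int (n$2)))
        = (\<Sum>j<M. cis (?a j * of_int (n$1))) * (\<Sum>k<M. cis (?a k * of_int (n$2)))"
      by (simp add: sum_product flip: cis_mult)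
    then show ?thesis
      using sum_roots_of_unity[of "n$1" M] sum_roots_of_unity[of "n$2" M] b[OF that]
      by (cases "n$1 = 0"; cases "n$2 = 0") (auto simp: vec_eq_iff forall_2)
  qed
  let ?g = "\<lambda>j k n. (cis (?a j * of_int (n$1) + ?a k * of_int (n$2)) * c n) *\<^sub>C mon n"
  have "(\<Sum>j<M. \<Sum>k<M. pol (gauge (?a j) (?a k) c)) = (\<Sum>j<M. \<Sum>k<M. \<Sum>n | c n \<noteq> 0. ?g j k n)"
    by (simp only: pol_def gauge_0_iff, simp only: gauge_def)
  also have "\<dots> = (\<Sum>j<M. \<Sum>n | c n \<noteq> 0. \<Sum>k<M. ?g j k n)" by (intro sum.cong refl sum.swap)
  also have "\<dots> = (\<Sum>n | c n \<noteq> 0. \<Sum>j<M. \<Sum>k<M. ?g j k n)" by (rule sum.swap)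
  also have "\<dots> = (\<Sum>n | c n \<noteq> 0. (\<Sum>j<M. \<Sum>k<M. cis (?a j * of_int (n$1) + ?a k * of_int (n$2)) * c n) *\<^sub>C mon n)"
    by (simp only: scaleC.sum_left)
  also have "\<dots> = (\<Sum>n | c n \<noteq> 0. ((if n = 0 then of_nat (M * M) else 0) * c n) *\<^sub>C mon n)"
  proof (rule sum.cong[OF refl])
    fix n assume "n \<in> {n. c n \<noteq> 0}"
    then have "c n \<noteq> 0" by simp
    from s[OF this] have "(\<Sum>j<M. \<Sum>k<M. cis (?a j * of_int (n$1) + ?a k * of_int (n$2)) * c n)
        = (if n = 0 then of_nat (M * M) else 0) * c n" by (simp only: sum_distrib_right[symmetric])
    then show "(\<Sum>j<M. \<Sum>k<M. cis (?a j * of_int (n$1) + ?a k * of_int (n$2)) * c n) *\<^sub>C mon n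
        = ((if n = 0 then of_nat (M * M) else 0) * c n) *\<^sub>C mon n" by (simp only:)
  qed
  also have "\<dots> = (\<Sum>n | c n \<noteq> 0. if n = 0 then (of_nat (M * M) * c 0) *\<^sub>C 1 else 0)"
    by (intro sum.cong refl) (auto simp: scaleC.zero_left)
  also have "\<dots> = (of_nat (M * M) * c 0) *\<^sub>C 1"
    using assms by (auto simp: scaleC.zero_left)
  finally have "norm ((of_nat (M * M) * c 0) *\<^sub>C (1::'a)) = norm (\<Sum>j<M. \<Sum>k<M. pol (gauge (?a j) (?a k) c))" by (simp only:)
  also have "\<dots> \<le> (\<Sum>j<M. \<Sum>k<M. norm (pol c))"
    by (intro sum_norm_le norm_gauge_le assms)
  finally have "real M * real M * cmod (c 0) \<le> real M * real M * norm (pol c)"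
    by (simp add: norm_scaleC norm_mult)
  moreover have "M > 0" by (simp add: M_def)
  ultimately show ?thesis by (subst (asm) mult_le_cancel_left_pos) simp_all
qed

lemma pol_inj: assumes "fs c" "fs d" "pol c = pol d" shows "c 0 = d 0"
  using coeff_0_le[OF fs_diff[OF assms(1,2)]] assms by (simp add: pol_diff)

abbreviation "PP \<equiv> pol ` {c. fs c}"

lemma polI: "fs c \<Longrightarrow> pol c \<in> PP" by auto

lemma mon_pol: "mon n = pol (\<lambda>m. if m = n then 1 else 0)" "fs (\<lambda>m. if m = n then 1 else 0)"
proof -
  show "fs (\<lambda>m. if m = n then 1 else 0)" by (rule finite_subset[of _ "{n}"]) auto
  show "mon n = pol (\<lambda>m. if m = n then 1 else 0)" by (subst pol_superset[of "{n}"]) auto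
qed

text \<open>The closure is a closed unital star subalgebra that contains the generators, hence
  everything by the generation clause of \<open>nct\<close>.\<close>

lemma closure_PP: "closure PP = UNIV"
proof -
  have cl: "x \<in> closure PP \<longleftrightarrow> (\<exists>f. (\<forall>i. f i \<in> PP) \<and> f \<longlonglongrightarrow> x)" for x by (rule closure_sequential)
  have 1: "x + y \<in> PP \<and> x * y \<in> PP \<and> adj x \<in> PP \<and> w *\<^sub>C x \<in> PP" if xy: "x \<in> PP" "y \<in> PP" for x y w
  proof -
    obtain c d where c: "fs c" "x = pol c" and d: "fs d" "y = pol d" using xy by auto
    have "x + y = pol (\<lambda>n. c n + d n)" "x * y = pol (tw_mult \<theta> c d)" "adj x = pol (tw_adj \<theta> c)" "w *\<^sub>C x = pol (\<lambda>n. w * c n)"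
      using c d by (simp_all add: pol_add pol_mult pol_adj pol_scale)
    then show ?thesis using c d by (auto intro!: polI fs_add fs_tw_mult fs_tw_adj fs_scale)
  qed
  have mon: "mon n \<in> PP" for n by (subst mon_pol(1)) (rule polI, rule mon_pol(2))
  have "mon (\<chi> i. if i = 1 then 1 else 0) = U 1" "mon (\<chi> i. if i = 2 then 1 else 0) = U 2"
    by (simp_all add: nct_monom_def)
  then have U: "U 1 \<in> PP" "U 2 \<in> PP" using mon by metis+
  have "U i \<in> PP" for i using U exhaust_2[of i] by auto
  then have r: "range U \<subseteq> closure PP" using closure_subset by fastforce
  have o: "1 \<in> closure PP" using mon[of 0] closure_subset by fastforce
  show ?thesis
  proof (rule nct_facts(3); (intro conjI allI)?)
    fix x y assume xy: "x \<in> closure PP" "y \<in> closure PP"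
    then obtain f g where f: "\<And>i. f i \<in> PP" "f \<longlonglongrightarrow> x" and g: "\<And>i. g i \<in> PP" "g \<longlonglongrightarrow> y"
      unfolding cl by auto
    show "x + y \<in> closure PP" unfolding cl using f g 1 by (intro exI[of _ "\<lambda>i. f i + g i"]) (auto intro!: tendsto_add)
    show "x * y \<in> closure PP" unfolding cl using f g 1 by (intro exI[of _ "\<lambda>i. f i * g i"]) (auto intro!: tendsto_mult)
  next
    fix x w assume "x \<in> closure PP"
    then obtain f where f: "\<And>i. f i \<in> PP" "f \<longlonglongrightarrow> x" unfolding cl by auto
    have m: "adj (f i) \<in> PP" "w *\<^sub>C f i \<in> PP" for i using 1[OF f(1)[of i] f(1)[of i]] by auto
    show "adj x \<in> closure PP" unfolding cl
      using bounded_linear.tendsto[OF bounded_linear_adj f(2)] m(1) by (intro exI[of _ "\<lambda>i. adj (f i)"]) blast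
    show "w *\<^sub>C x \<in> closure PP" unfolding cl
      using scaleC.tendsto[OF tendsto_const f(2)] m(2) by (intro exI[of _ "\<lambda>i. w *\<^sub>C f i"]) blast
  qed (use r o in auto)
qed

lemma dense: obtains c where "\<And>i::nat. fs (c i)" "(\<lambda>i. pol (c i)) \<longlonglongrightarrow> a"
proof -
  have "a \<in> closure PP" by (simp add: closure_PP)
  then obtain f where f: "\<And>i. f i \<in> PP" "f \<longlonglongrightarrow> a" unfolding closure_sequential by auto
  then have "\<forall>i. \<exists>c. fs c \<and> f i = pol c" by blast
  then obtain c where c: "\<And>i. fs (c i) \<and> f i = pol (c i)" by metis
  then have "f = (\<lambda>i. pol (c i))" by auto
  then show ?thesis using that[of c] c f by auto
qed

text \<open>On trigonometric polynomials the trace reads off the coefficient at 0: this is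
  independent of the chosen coefficients by \<open>pol_inj\<close> and 1-Lipschitz by
  \<open>coeff_0_le\<close>, so it extends uniformly continuously to the closure. Linearity and the
  bound pass to the limit.\<close>

lemma trace_exists:
  "\<exists>f. bounded_linear f \<and> (\<forall>w a. f (w *\<^sub>C a) = w * f a) \<and> (\<forall>a. cmod (f a) \<le> norm a) \<and> (\<forall>c. fs c \<longrightarrow> f (pol c) = c 0)"
proof -
  define f0 where "f0 a = (SOME c. fs c \<and> pol c = a) 0" for a
  have f0: "f0 (pol c) = c 0" if "fs c" for c
  proof -
    have "fs (SOME d. fs d \<and> pol d = pol c) \<and> pol (SOME d. fs d \<and> pol d = pol c) = pol c"
      by (rule someI[of "\<lambda>d. fs d \<and> pol d = pol c" c]) (use that in blast)
    then show ?thesis unfolding f0_def using pol_inj that by blast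
  qed
  have "uniformly_continuous_on PP f0"
    unfolding uniformly_continuous_on_def
  proof (intro allI impI)
    fix e :: real assume "e > 0"
    moreover have "dist (f0 y) (f0 x) \<le> dist y x" if "x \<in> PP" "y \<in> PP" for x y
      using that coeff_0_le[OF fs_diff] by (auto simp: f0 dist_norm simp flip: pol_diff)
    ultimately show "\<exists>d>0. \<forall>x\<in>PP. \<forall>y\<in>PP. dist y x < d \<longrightarrow> dist (f0 y) (f0 x) < e"
      by (intro exI[of _ e]) force
  qed
  from uniformly_continuous_on_extension_on_closure[OF this] obtain f where
    f: "uniformly_continuous_on UNIV f" "\<And>x. x \<in> PP \<Longrightarrow> f0 x = f x" unfolding closure_PP by metis
  have c: "(\<lambda>i. f (g i)) \<longlonglongrightarrow> f a" if "g \<longlonglongrightarrow> a" for g :: "nat \<Rightarrow> 'a" and a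
    by (rule continuous_on_tendsto_compose[OF uniformly_continuous_imp_continuous[OF f(1)] that]) auto
  have fp: "f (pol c) = c 0" if "fs c" for c using f(2) f0 that by fastforce
  have add: "f (a + b) = f a + f b" for a b
  proof -
    obtain p where p: "\<And>i::nat. fs (p i)" "(\<lambda>i. pol (p i)) \<longlonglongrightarrow> a" using dense[of a] by metis
    obtain q where q: "\<And>i::nat. fs (q i)" "(\<lambda>i. pol (q i)) \<longlonglongrightarrow> b" using dense[of b] by metis
    have "f (pol (p i) + pol (q i)) = f (pol (p i)) + f (pol (q i))" for i
      using p q fp[OF fs_add[OF p(1)[of i] q(1)[of i]]] by (simp add: pol_add fp)
    then show ?thesis
      using LIMSEQ_unique[OF c[OF tendsto_add[OF p(2) q(2)]]] tendsto_add[OF c[OF p(2)] c[OF q(2)]] by simp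
  qed
  have sc: "f (w *\<^sub>C a) = w * f a" for w a
  proof -
    obtain p where p: "\<And>i::nat. fs (p i)" "(\<lambda>i. pol (p i)) \<longlonglongrightarrow> a" using dense[of a] by metis
    have "f (w *\<^sub>C pol (p i)) = w * f (pol (p i))" for i
      using p fp[OF fs_scale[OF p(1)[of i], of w]] by (simp add: pol_scale fp)
    then show ?thesis
      using LIMSEQ_unique[OF c[OF scaleC.tendsto[OF tendsto_const p(2)]]] tendsto_mult_left[OF c[OF p(2)]] by simp
  qed
  have le: "cmod (f a) \<le> norm a" for a
  proof -
    obtain p where p: "\<And>i::nat. fs (p i)" "(\<lambda>i. pol (p i)) \<longlonglongrightarrow> a" using dense[of a] by metis
    show ?thesis
      by (rule LIMSEQ_le[OF tendsto_norm[OF c[OF p(2)]] tendsto_norm[OF p(2)]])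
        (use p fp coeff_0_le in auto)
  qed
  have "bounded_linear f"
    by (rule bounded_linear_intro[where K=1]) (use add sc[of "of_real _"] le in \<open>auto simp: scaleR_conv_of_real\<close>)
  then show ?thesis using sc le fp by blast
qed

definition "tr = (SOME f. bounded_linear f \<and> (\<forall>w a. f (w *\<^sub>C a) = w * f a) \<and> (\<forall>a. cmod (f a) \<le> norm a) \<and> (\<forall>c. fs c \<longrightarrow> f (pol c) = c 0))"

lemma tr: "bounded_linear tr" "tr (w *\<^sub>C a) = w * tr a" "cmod (tr a) \<le> norm a" "fs c \<Longrightarrow> tr (pol c) = c 0"
  using someI_ex[OF trace_exists] unfolding tr_def by blast+

lemma tr_mon: "tr (mon n) = (if n = 0 then 1 else 0)"
  unfolding mon_pol(1) tr(4)[OF mon_pol(2)] by auto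

lemma tr_mult_commute: "tr (a * b) = tr (b * a)"
proof -
  obtain p where p: "\<And>i::nat. fs (p i)" "(\<lambda>i. pol (p i)) \<longlonglongrightarrow> a" using dense[of a] by metis
  obtain q where q: "\<And>i::nat. fs (q i)" "(\<lambda>i. pol (q i)) \<longlonglongrightarrow> b" using dense[of b] by metis
  \<comment> \<open>Monomials of opposite index have the same cocycle in both orders; in all other
    cases both traces are zero.\<close>
  have mm: "tr (mon m * mon n) = tr (mon n * mon m)" for m n
  proof (cases "m + n = 0")
    case True
    then have "n = - m" by (metis add.inverse_unique)
    then show ?thesis by (simp add: mon_mult tr mult_ac)
  next
    case False
    then show ?thesis by (simp add: mon_mult tr tr_mon add.commute)
  qed
  have e: "tr (pol (p i) * pol (q i)) = tr (pol (q i) * pol (p i))" for i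
  proof -
    have l: "tr (sum f S) = (\<Sum>x\<in>S. tr (f x))" for f and S :: "'b set"
      by (rule linear_sum[OF bounded_linear.linear[OF tr(1)]])
    show ?thesis unfolding pol_def sum_product
      by (subst (2) sum.swap) (simp add: l mult_scaleC_left mult_scaleC_right tr mm mult_ac)
  qed
  show ?thesis
    using LIMSEQ_unique[OF bounded_linear.tendsto[OF tr(1) tendsto_mult[OF p(2) q(2)]]]
      bounded_linear.tendsto[OF tr(1) tendsto_mult[OF q(2) p(2)]] e by simp
qed

end

subsection \<open>The smooth subalgebra\<close>

context nc_torus
begin

abbreviation "Sm \<equiv> nct_smooth U"
abbreviation "dl \<equiv> nct_deriv U"

text \<open>The Fourier coefficient at n as an inner product with the unitary monomial; it is
  defined and continuous on the whole algebra, not only on the smooth part.\<close>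

definition cf :: "int^2 \<Rightarrow> 'a \<Rightarrow> complex" where "cf n a = tr (adj (mon n) * a)"

lemma bounded_linear_cf: "bounded_linear (cf n)"
  unfolding cf_def using bounded_linear_compose[OF tr(1) bounded_linear_mult_right] by simp

lemmas cf_add = linear_add[OF bounded_linear.linear[OF bounded_linear_cf]]
lemmas cf_diff = linear_diff[OF bounded_linear.linear[OF bounded_linear_cf]]
lemmas cf_sum = linear_sum[OF bounded_linear.linear[OF bounded_linear_cf]]
lemmas cf_tendsto = bounded_linear.tendsto[OF bounded_linear_cf]

lemma cf_zero [simp]: "cf n 0 = 0"
  by (rule linear_0[OF bounded_linear.linear[OF bounded_linear_cf]])

lemma cf_scaleC [simp]: "cf n (w *\<^sub>C a) = w * cf n a"
  by (simp add: cf_def mult_scaleC_right tr)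

lemma cf_scaleR [simp]: "cf n (w *\<^sub>R a) = of_real w * cf n a"
  using cf_scaleC[of n "of_real w" a] by (simp del: cf_scaleC)

lemma cf_le: "cmod (cf n a) \<le> norm a"
  unfolding cf_def using tr(3)[of "adj (mon n) * a"] norm_mult_ineq[of "adj (mon n)" a] by simp

lemma cf_mon: "cf n (mon m) = (if n = m then 1 else 0)"
proof (cases "n = m")
  case True
  then show ?thesis using tr_mon[of 0] by (simp add: cf_def adj_mon_mult)
next
  case False
  then have "- n + m \<noteq> 0" by (metis add.commute add.right_neutral diff_add_cancel uminus_add_conv_diff)
  then show ?thesis using False by (simp add: cf_def adj_mon mult_scaleC_left mon_mult tr tr_mon)
qed

lemma cf_pol: "fs c \<Longrightarrow> cf n (pol c) = c n"
  unfolding pol_def by (simp add: cf_sum cf_mon if_distrib cong: if_cong)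

lemma cf_0: "cf 0 a = tr a"
  by (simp add: cf_def)

lemma series_cf:
  assumes "nct_series U c a" shows "cf n a = c n"
proof -
  have "((\<lambda>m. c m *\<^sub>C mon m) has_sum a) UNIV" using assms by (simp add: nct_series_def)
  from has_sum_bounded_linear[OF bounded_linear_cf this]
  have "((\<lambda>m. c m * (if n = m then 1 else 0)) has_sum cf n a) UNIV" by (simp add: o_def cf_mon)
  moreover have "((\<lambda>m. c m * (if n = m then 1 else 0)) has_sum c n) UNIV"
    by (rule has_sum_finite_neutralI[of "{n}"]) auto
  ultimately show ?thesis using has_sum_unique by blast
qed

lemma Sm_iff: "a \<in> Sm \<longleftrightarrow> nct_series U (\<lambda>n. cf n a) a"
proof
  assume "a \<in> Sm"
  then obtain c where c: "nct_series U c a" by (auto simp: nct_smooth_def)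
  then have "c = (\<lambda>n. cf n a)" using series_cf by auto
  then show "nct_series U (\<lambda>n. cf n a) a" using c by simp
qed (auto simp: nct_smooth_def)

lemma series_unique: "nct_series U c a \<Longrightarrow> nct_series U c b \<Longrightarrow> a = b"
  unfolding nct_series_def using has_sum_unique by blast

text \<open>A smooth element is the sum of its Fourier series. Identities for the derivations are
  thereby checked one coefficient at a time.\<close>

lemma Sm_eqI:
  assumes "a \<in> Sm" "b \<in> Sm" "\<And>n. cf n a = cf n b" shows "a = b"
  using assms series_unique[of "\<lambda>n. cf n a" a b] by (simp add: Sm_iff)

lemma Sm_decay: "a \<in> Sm \<Longrightarrow> \<exists>C\<ge>0. \<forall>n. wt n ^ k * cmod (cf n a) \<le> C"
proof -
  assume "a \<in> Sm"
  then obtain C where C: "\<forall>n. wt n ^ k * cmod (cf n a) \<le> C" unfolding Sm_iff nct_series_def rapid_decay_wt by blast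
  then have "0 \<le> C" using order_trans[OF _ C[rule_format, of 0]] by (simp add: less_imp_le)
  then show ?thesis using C by blast
qed

lemma wt4_le: "wt n ^ 4 * x \<le> C \<Longrightarrow> x \<le> C * (1 / wt n ^ 4)"
  using zero_less_power[OF wt_pos[of n], of 4] by (simp add: pos_le_divide_eq mult.commute)

lemma rapid_summable:
  assumes "\<And>n. wt n ^ 4 * cmod (c n) \<le> C" shows "(\<lambda>n. c n *\<^sub>C mon n) abs_summable_on A"
proof -
  have "(\<lambda>n. norm (c n *\<^sub>C mon n)) summable_on UNIV"
    by (rule summable_on_comparison_test[OF summable_on_cmult_right[OF summable_wt, of C]])
       (use assms wt4_le in \<open>auto simp: norm_scaleC\<close>)
  then show ?thesis by (rule summable_on_subset_banach) simp
qed

lemma rapid_series: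
  assumes "rapid_decay c" shows "\<exists>a. nct_series U c a"
proof -
  obtain C where "\<And>n. wt n ^ 4 * cmod (c n) \<le> C" using assms unfolding rapid_decay_wt by meson
  from abs_summable_summable[OF rapid_summable[OF this, of UNIV]]
  show ?thesis using assms unfolding nct_series_def summable_on_def by blast
qed

definition tl :: "(int^2) set \<Rightarrow> real" where "tl F = (\<Sum>\<^sub>\<infinity>n\<in>UNIV-F. 1 / wt n ^ 4)"

lemma tl_tendsto: "(tl \<longlongrightarrow> 0) (finite_subsets_at_top UNIV)"
proof -
  let ?f = "\<lambda>n. 1 / wt n ^ 4" let ?s = "infsum ?f UNIV"
  have h: "(?f has_sum ?s) UNIV" using summable_wt by simp
  then have "((\<lambda>F. ?s - sum ?f F) \<longlongrightarrow> ?s - ?s) (finite_subsets_at_top UNIV)"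
    unfolding has_sum_def by (intro tendsto_intros)
  moreover have "\<forall>\<^sub>F F in finite_subsets_at_top UNIV. ?s - sum ?f F = tl F"
  proof (rule eventually_mono[OF eventually_finite_subsets_at_top_weakI[of UNIV finite]])
    fix F :: "(int^2) set" assume "finite F"
    then have "(?f has_sum (?s - sum ?f F)) (UNIV - F)" using h by (intro has_sum_Diff has_sum_finite) auto
    then show "?s - sum ?f F = tl F" unfolding tl_def by (simp add: infsumI)
  qed auto
  ultimately show ?thesis using Lim_transform_eventually by fastforce
qed

abbreviation "tc F a \<equiv> (\<Sum>n\<in>F. cf n a *\<^sub>C mon n)"

text \<open>One fixed null net \<open>tl\<close> controls the partial sums of all smooth elements
  with a common constant C; this uniformity is what \<open>Sm_limI\<close> needs.\<close>

lemma tail_bound: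
  assumes a: "a \<in> Sm" and C: "\<And>n. wt n ^ 4 * cmod (cf n a) \<le> C" and F: "finite F"
  shows "norm (a - tc F a) \<le> C * tl F"
proof -
  let ?f = "\<lambda>n. cf n a *\<^sub>C mon n"
  have "(?f has_sum a) UNIV" using a by (simp add: Sm_iff nct_series_def)
  then have "(?f has_sum (a - tc F a)) (UNIV - F)" using F by (intro has_sum_Diff has_sum_finite) auto
  then have e: "a - tc F a = infsum ?f (UNIV - F)" by (simp add: infsumI)
  note s = rapid_summable[OF C, of "UNIV - F"]
  have s4: "(\<lambda>n. 1 / wt n ^ 4) summable_on (UNIV - F)" by (rule summable_on_subset_banach[OF summable_wt]) simp
  have "norm (infsum ?f (UNIV - F)) \<le> infsum (\<lambda>n. norm (?f n)) (UNIV - F)"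
    by (rule norm_infsum_bound[OF s])
  also have "\<dots> \<le> (\<Sum>\<^sub>\<infinity>n\<in>UNIV-F. C * (1 / wt n ^ 4))"
    by (rule infsum_mono[OF s summable_on_cmult_right[OF s4]]) (use C wt4_le in \<open>auto simp: norm_scaleC\<close>)
  also have "\<dots> = C * tl F" unfolding tl_def by (rule infsum_cmult_right) (rule s4)
  finally show ?thesis by (simp add: e)
qed

lemma tc_tendsto: "y \<longlonglongrightarrow> x \<Longrightarrow> (\<lambda>i. tc F (y i)) \<longlonglongrightarrow> tc F x"
  by (intro tendsto_sum scaleC.tendsto cf_tendsto tendsto_const)

text \<open>A limit of smooth elements is smooth once, for every order, some approximating sequence has
  uniformly decaying coefficients.\<close>

lemma Sm_limI:
  assumes "\<And>k. \<exists>y C. y \<longlonglongrightarrow> x \<and> (\<forall>i. y i \<in> Sm \<and> (\<forall>n. wt n ^ k * cmod (cf n (y i)) \<le> C))"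
  shows "x \<in> Sm"
proof -
  have dec: "\<exists>C. \<forall>n. wt n ^ k * cmod (cf n x) \<le> C" for k
  proof -
    obtain y C where y: "y \<longlonglongrightarrow> x" "\<And>i n. wt n ^ k * cmod (cf n (y i)) \<le> C" using assms[of k] by auto
    have "wt n ^ k * cmod (cf n x) \<le> C" for n
      using Lim_bounded[OF tendsto_mult_left[OF tendsto_norm[OF cf_tendsto[OF y(1)]]], of 0 "wt n ^ k" n C] y(2) by auto
    then show ?thesis by blast
  qed
  then have rd: "rapid_decay (\<lambda>n. cf n x)" unfolding rapid_decay_wt by simp
  obtain y C where y: "y \<longlonglongrightarrow> x" "\<And>i. y i \<in> Sm" "\<And>i n. wt n ^ 4 * cmod (cf n (y i)) \<le> C"
    using assms[of 4] by auto
  have b: "norm (x - tc F x) \<le> C * tl F" if "finite F" for F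
    by (rule Lim_bounded[OF tendsto_norm[OF tendsto_diff[OF y(1) tc_tendsto[OF y(1), of F]]], of 0])
       (use tail_bound[OF y(2,3) that] in auto)
  have "((\<lambda>F. tc F x) \<longlongrightarrow> x) (finite_subsets_at_top UNIV)"
  proof -
    have "((\<lambda>F. x - tc F x) \<longlongrightarrow> 0) (finite_subsets_at_top UNIV)"
      by (rule Lim_null_comparison[OF eventually_finite_subsets_at_top_weakI tendsto_mult_right_zero[OF tl_tendsto, of C]])
         (use b in auto)
    then have "((\<lambda>F. x - (x - tc F x)) \<longlongrightarrow> x - 0) (finite_subsets_at_top UNIV)" by (intro tendsto_intros)
    then show ?thesis by simp
  qed
  then have "((\<lambda>n. cf n x *\<^sub>C mon n) has_sum x) UNIV" unfolding has_sum_def by simp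
  then show ?thesis using rd unfolding Sm_iff nct_series_def by simp
qed

lemma Sm_pol: assumes "fs c" shows "pol c \<in> Sm"
proof -
  have "rapid_decay c" unfolding rapid_decay_wt
  proof
    fix k
    have "wt n ^ k * cmod (c n) \<le> (\<Sum>m | c m \<noteq> 0. wt m ^ k * cmod (c m))" for n
    proof (cases "c n = 0")
      case False
      then show ?thesis using assms by (intro member_le_sum) (auto simp: less_imp_le)
    qed (auto intro!: sum_nonneg simp: less_imp_le)
    then show "\<exists>C. \<forall>n. wt n ^ k * cmod (c n) \<le> C" by blast
  qed
  moreover have "((\<lambda>n. c n *\<^sub>C mon n) has_sum pol c) UNIV"
    unfolding pol_def by (rule has_sum_finite_neutralI[OF assms]) (auto simp: scaleC.zero_left)
  ultimately show ?thesis unfolding nct_smooth_def nct_series_def by blast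
qed

text \<open>Square partial sums: finitely supported, with coefficients dominated by those of a,
  hence suitable approximants for \<open>Sm_limI\<close>.\<close>

definition trunc :: "'a \<Rightarrow> nat \<Rightarrow> int^2 \<Rightarrow> complex" where
  "trunc a N n = (if \<bar>n$1\<bar> \<le> int N \<and> \<bar>n$2\<bar> \<le> int N then cf n a else 0)"

definition box :: "nat \<Rightarrow> (int^2) set" where "box N = {n. \<bar>n$1\<bar> \<le> int N \<and> \<bar>n$2\<bar> \<le> int N}"

lemma finite_box: "finite (box N)"
proof -
  have "finite ((\<lambda>n. (n$1, n$2)) ` box N)"
    by (rule finite_subset[of _ "{-int N..int N} \<times> {-int N..int N}"]) (auto simp: box_def abs_le_iff)
  then show ?thesis by (rule finite_imageD) (auto simp: inj_on_def vec_eq_iff forall_2)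
qed

lemma box_at_top: "filterlim box (finite_subsets_at_top UNIV) sequentially"
  unfolding filterlim_iff
proof (intro allI impI)
  fix P assume "eventually P (finite_subsets_at_top (UNIV::(int^2) set))"
  then obtain F where F: "finite F" "\<And>G. finite G \<Longrightarrow> F \<subseteq> G \<Longrightarrow> P G"
    unfolding eventually_finite_subsets_at_top by auto
  define M where "M = (\<Sum>n\<in>F. nat \<bar>n$1\<bar> + nat \<bar>n$2\<bar>)"
  have "F \<subseteq> box N" if "N \<ge> M" for N
  proof
    fix n assume "n \<in> F"
    then have "nat \<bar>n$1\<bar> + nat \<bar>n$2\<bar> \<le> M" unfolding M_def by (intro member_le_sum F) auto
    then show "n \<in> box N" using that unfolding box_def by auto
  qed
  then show "\<forall>\<^sub>F N in sequentially. P (box N)"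
    unfolding eventually_sequentially using F finite_box by blast
qed

lemma trunc_box: "pol (trunc a N) = tc (box N) a" "fs (trunc a N)"
proof -
  have "{n. trunc a N n \<noteq> 0} \<subseteq> box N" by (auto simp: trunc_def box_def)
  then show "pol (trunc a N) = tc (box N) a" "fs (trunc a N)"
    using finite_box[of N] finite_subset by (auto simp: pol_superset trunc_def box_def intro!: sum.cong)
qed

lemma trunc_tendsto: assumes "a \<in> Sm" shows "(\<lambda>N. pol (trunc a N)) \<longlonglongrightarrow> a"
proof -
  have "((\<lambda>F. tc F a) \<longlongrightarrow> a) (finite_subsets_at_top UNIV)"
    using assms unfolding Sm_iff nct_series_def has_sum_def by simp
  from filterlim_compose[OF this box_at_top] show ?thesis by (simp add: trunc_box)
qed

lemma trunc_le: "cmod (trunc a N n) \<le> cmod (cf n a)"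
  by (simp add: trunc_def)

lemma Sm_add: "a \<in> Sm \<Longrightarrow> b \<in> Sm \<Longrightarrow> a + b \<in> Sm"
proof (rule Sm_limI)
  fix k assume ab: "a \<in> Sm" "b \<in> Sm"
  obtain C where C: "\<And>n. wt n ^ k * cmod (cf n a) \<le> C" using Sm_decay[OF ab(1)] by meson
  obtain D where D: "\<And>n. wt n ^ k * cmod (cf n b) \<le> D" using Sm_decay[OF ab(2)] by meson
  let ?y = "\<lambda>i. pol (\<lambda>n. trunc a i n + trunc b i n)"
  have "wt n ^ k * cmod (cf n (?y i)) \<le> C + D" for i n
  proof -
    have "wt n ^ k * cmod (trunc a i n + trunc b i n) \<le> wt n ^ k * (cmod (cf n a) + cmod (cf n b))"
      by (intro mult_left_mono norm_triangle_le add_mono trunc_le) (simp add: less_imp_le)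
    then show ?thesis using C[of n] D[of n] by (simp add: cf_pol fs_add trunc_box distrib_left)
  qed
  moreover have "?y \<longlonglongrightarrow> a + b" using tendsto_add[OF trunc_tendsto trunc_tendsto] ab by (simp add: pol_add trunc_box)
  ultimately show "\<exists>y C. y \<longlonglongrightarrow> a + b \<and> (\<forall>i. y i \<in> Sm \<and> (\<forall>n. wt n ^ k * cmod (cf n (y i)) \<le> C))"
    by (intro exI[of _ ?y] exI[of _ "C + D"]) (auto intro!: Sm_pol fs_add trunc_box)
qed

lemma Sm_scaleC: assumes "a \<in> Sm" shows "w *\<^sub>C a \<in> Sm"
proof -
  have "((\<lambda>n. w *\<^sub>C (cf n a *\<^sub>C mon n)) has_sum w *\<^sub>C a) UNIV"
    using has_sum_bounded_linear[OF scaleC.bounded_linear_right[of w] conjunct2[OF assms[unfolded Sm_iff nct_series_def]]]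
    by (simp add: o_def)
  moreover have "rapid_decay (\<lambda>n. w * cf n a)"
    unfolding rapid_decay_wt
  proof
    fix k
    obtain C where "\<And>n. wt n ^ k * cmod (cf n a) \<le> C" using Sm_decay[OF assms] by meson
    from mult_left_mono[OF this, of "cmod w"]
    show "\<exists>C. \<forall>n. wt n ^ k * cmod (w * cf n a) \<le> C"
      by (intro exI[of _ "cmod w * C"]) (simp add: norm_mult mult_ac)
  qed
  ultimately show ?thesis unfolding nct_smooth_def nct_series_def by (auto simp: scaleC_scaleC)
qed

lemma Sm_scaleR: "a \<in> Sm \<Longrightarrow> w *\<^sub>R a \<in> Sm"
  using Sm_scaleC[of a "of_real w"] by simp

lemma Sm_mon [simp]: "mon n \<in> Sm"
  by (subst mon_pol) (rule Sm_pol[OF mon_pol(2)])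

lemma Sm_1 [simp]: "1 \<in> Sm"
  using Sm_mon[of 0] by (simp del: Sm_mon)

lemma Sm_0 [simp]: "0 \<in> Sm"
  using Sm_scaleC[of 1 0] by (simp add: scaleC.zero_left)

lemma Sm_minus: "a \<in> Sm \<Longrightarrow> - a \<in> Sm"
  using Sm_scaleC[of a "-1"] by (simp add: scaleC.minus_left)

lemma Sm_diff: "a \<in> Sm \<Longrightarrow> b \<in> Sm \<Longrightarrow> a - b \<in> Sm"
  using Sm_add[of a "-b"] Sm_minus by simp

text \<open>By \<open>wt_add\<close> the weight of order k at n splits over m and n - m. Four
  further powers, taken from the decay of a, make the convolution sum converge uniformly in the
  truncation.\<close>

lemma Sm_mult: assumes ab: "a \<in> Sm" "b \<in> Sm" shows "a * b \<in> Sm"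
proof (rule Sm_limI)
  fix k
  obtain C where C: "C \<ge> 0" "\<And>n. wt n ^ (k + 4) * cmod (cf n a) \<le> C" using Sm_decay[OF ab(1)] by meson
  obtain D where D: "D \<ge> 0" "\<And>n. wt n ^ k * cmod (cf n b) \<le> D" using Sm_decay[OF ab(2)] by meson
  let ?p = "\<lambda>i. tw_mult \<theta> (trunc a i) (trunc b i)"
  let ?W = "\<Sum>\<^sub>\<infinity>n. 1 / wt n ^ 4"
  have "wt n ^ k * cmod (?p i n) \<le> C * D * ?W" for i n
  proof -
    have "wt n ^ k * cmod (?p i n) \<le> (\<Sum>m | trunc a i m \<noteq> 0. wt n ^ k * cmod (trunc a i m * trunc b i (n - m) * cis (ph * of_int (m$2) * of_int ((n - m)$1))))"
      unfolding tw_mult_def sum_distrib_left[symmetric] by (intro mult_left_mono norm_sum) (simp add: less_imp_le)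
    also have "\<dots> \<le> (\<Sum>m | trunc a i m \<noteq> 0. C * D * (1 / wt m ^ 4))"
    proof (rule sum_mono)
      fix m
      have w: "wt n ^ k \<le> wt m ^ k * wt (n - m) ^ k"
        using wt_add[of m "n - m"] power_mono[of "wt n" "wt m * wt (n - m)" k]
        by (simp add: power_mult_distrib less_imp_le)
      have "wt n ^ k * cmod (trunc a i m * trunc b i (n - m) * cis (ph * of_int (m$2) * of_int ((n - m)$1)))
          \<le> (wt m ^ k * wt (n - m) ^ k) * (cmod (cf m a) * cmod (cf (n - m) b))"
        using w by (simp only: norm_mult norm_cis mult_1_right) (intro mult_mono trunc_le; simp add: less_imp_le)
      also have "\<dots> = (wt m ^ k * cmod (cf m a)) * (wt (n - m) ^ k * cmod (cf (n - m) b))" by simp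
      also have "\<dots> \<le> (C * (1 / wt m ^ 4)) * D"
        by (intro mult_mono wt4_le D) (use C in \<open>auto simp: power_add mult_ac less_imp_le\<close>)
      finally show "wt n ^ k * cmod (trunc a i m * trunc b i (n - m) * cis (ph * of_int (m$2) * of_int ((n - m)$1)))
          \<le> C * D * (1 / wt m ^ 4)" by (simp add: mult_ac)
    qed
    also have "\<dots> = C * D * (\<Sum>m | trunc a i m \<noteq> 0. 1 / wt m ^ 4)" by (simp add: sum_distrib_left)
    also have "\<dots> \<le> C * D * ?W"
      using C D by (intro mult_left_mono finite_sum_le_infsum[OF summable_wt] trunc_box) (auto simp: less_imp_le)
    finally show ?thesis .
  qed
  then have "wt n ^ k * cmod (cf n (pol (?p i))) \<le> C * D * ?W" for i n
    by (simp add: cf_pol fs_tw_mult trunc_box)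
  moreover have "(\<lambda>i. pol (?p i)) \<longlonglongrightarrow> a * b"
    using tendsto_mult[OF trunc_tendsto trunc_tendsto] ab by (simp add: pol_mult trunc_box)
  ultimately show "\<exists>y C. y \<longlonglongrightarrow> a * b \<and> (\<forall>i. y i \<in> Sm \<and> (\<forall>n. wt n ^ k * cmod (cf n (y i)) \<le> C))"
    by (intro exI[of _ "\<lambda>i. pol (?p i)"] exI[of _ "C * D * ?W"]) (auto intro!: Sm_pol fs_tw_mult trunc_box)
qed

lemma Sm_power: "a \<in> Sm \<Longrightarrow> a ^ n \<in> Sm"
  by (induction n) (auto intro: Sm_mult)

lemma Sm_sum: "(\<And>i. i \<in> I \<Longrightarrow> f i \<in> Sm) \<Longrightarrow> sum f I \<in> Sm"
  by (induction I rule: infinite_finite_induct) (auto intro: Sm_add)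

subsection \<open>The derivations and the trace\<close>

text \<open>The factor n_j costs one power of the weight, so decay of order k + 1 gives decay of
  order k. Since coefficients and sum of a series determine each other, the definite description in
  \<open>nct_deriv\<close> is resolved.\<close>

lemma dl_facts:
  assumes "a \<in> Sm" shows Sm_dl: "dl j a \<in> Sm" and cf_dl: "cf n (dl j a) = of_int (n$j) * cf n a"
proof -
  have j: "\<bar>of_int (n$j)\<bar> \<le> wt n" for n using exhaust_2[of j] by (auto simp: wt_def)
  have "rapid_decay (\<lambda>n. of_int (n$j) * cf n a)"
    unfolding rapid_decay_wt
  proof
    fix k
    obtain C where C: "\<And>n. wt n ^ Suc k * cmod (cf n a) \<le> C" using Sm_decay[OF assms] by meson
    have "wt n ^ k * cmod (of_int (n$j) * cf n a) \<le> wt n ^ k * (wt n * cmod (cf n a))" for n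
      using j[of n] by (intro mult_left_mono) (auto simp: norm_mult less_imp_le intro!: mult_right_mono)
    moreover have "wt n ^ k * (wt n * cmod (cf n a)) \<le> C" for n using C[of n] by (simp add: mult_ac)
    ultimately have "wt n ^ k * cmod (of_int (n$j) * cf n a) \<le> C" for n by (rule order_trans)
    then show "\<exists>C. \<forall>n. wt n ^ k * cmod (of_int (n$j) * cf n a) \<le> C" by blast
  qed
  then obtain b where b: "nct_series U (\<lambda>n. of_int (n$j) * cf n a) b" using rapid_series by blast
  have "dl j a = b" unfolding nct_deriv_def
  proof (rule the_equality)
    show "\<exists>c. nct_series U c a \<and> nct_series U (\<lambda>n. of_int (n$j) * c n) b" using b assms Sm_iff by blast
    fix b' assume "\<exists>c. nct_series U c a \<and> nct_series U (\<lambda>n. of_int (n$j) * c n) b'"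
    then obtain c where c: "nct_series U c a" "nct_series U (\<lambda>n. of_int (n$j) * c n) b'" by blast
    then have "c = (\<lambda>n. cf n a)" using series_cf by auto
    with c(2) b show "b' = b" using series_unique by auto
  qed
  then show "dl j a \<in> Sm" "cf n (dl j a) = of_int (n$j) * cf n a"
    using b series_cf[OF b] by (auto simp: nct_smooth_def)
qed

lemma dl_scaleC: "a \<in> Sm \<Longrightarrow> dl j (w *\<^sub>C a) = w *\<^sub>C dl j a"
  by (rule Sm_eqI) (auto simp: Sm_dl Sm_scaleC cf_dl)

lemma dl_scaleR: "a \<in> Sm \<Longrightarrow> dl j (w *\<^sub>R a) = w *\<^sub>R dl j a"
  using dl_scaleC[of a j "of_real w"] by simp

lemma dl_add: "a \<in> Sm \<Longrightarrow> b \<in> Sm \<Longrightarrow> dl j (a + b) = dl j a + dl j b"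
  by (rule Sm_eqI) (auto simp: Sm_dl Sm_add cf_dl cf_add distrib_left)

lemma dl_diff: "a \<in> Sm \<Longrightarrow> b \<in> Sm \<Longrightarrow> dl j (a - b) = dl j a - dl j b"
  by (rule Sm_eqI) (auto simp: Sm_dl Sm_diff cf_dl cf_diff right_diff_distrib)

lemma dl_minus: "a \<in> Sm \<Longrightarrow> dl j (- a) = - dl j a"
  using dl_scaleC[of a j "-1"] by (simp add: scaleC.minus_left)

lemma dl_commute: "a \<in> Sm \<Longrightarrow> dl i (dl j a) = dl j (dl i a)"
  by (rule Sm_eqI) (auto simp: Sm_dl cf_dl)

lemma dl_1 [simp]: "dl j 1 = 0"
proof (rule Sm_eqI)
  show "cf n (dl j 1) = cf n 0" for n using cf_mon[of n 0] by (auto simp: cf_dl)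
qed (auto intro: Sm_dl)

lemma dl_0 [simp]: "dl j 0 = 0"
  using dl_scaleC[of 1 j 0] by (simp add: scaleC.zero_left)

lemma trunc_dl: "a \<in> Sm \<Longrightarrow> trunc (dl j a) N n = of_int (n$j) * trunc a N n"
  by (simp add: trunc_def cf_dl)

text \<open>On indices the Leibniz rule is n_j = m_j + (n - m)_j. It is verified for truncations and
  carried to the limit one Fourier coefficient at a time, because \<open>dl\<close> is not
  continuous for the norm.\<close>

lemma dl_mult:
  assumes "a \<in> Sm" "b \<in> Sm" shows "dl j (a * b) = dl j a * b + a * dl j b"
proof (rule Sm_eqI)
  fix n
  have p: "(\<lambda>N. cf n (pol (trunc x N) * pol (trunc y N))) \<longlonglongrightarrow> cf n (x * y)" if "x \<in> Sm" "y \<in> Sm" for x y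
    by (intro cf_tendsto tendsto_mult trunc_tendsto that)
  have e: "cf n (pol (trunc x N) * pol (trunc y N)) = tw_mult \<theta> (trunc x N) (trunc y N) n" for x y N
    by (simp add: cf_pol fs_tw_mult trunc_box(2) flip: pol_mult)
  have "of_int (n$j) * tw_mult \<theta> (trunc a N) (trunc b N) n =
      tw_mult \<theta> (trunc (dl j a) N) (trunc b N) n + tw_mult \<theta> (trunc a N) (trunc (dl j b) N) n" for N
  proof -
    let ?F = "{n. trunc a N n \<noteq> 0}"
    have F: "finite ?F" "{n. trunc (dl j a) N n \<noteq> 0} \<subseteq> ?F" using trunc_box by (auto simp: trunc_dl assms)
    show ?thesis
      unfolding tw_mult_superset[OF F(1) order_refl] tw_mult_superset[OF F] sum_distrib_left sum.distrib[symmetric]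
      by (intro sum.cong refl) (simp add: trunc_dl assms algebra_simps)
  qed
  then have "(\<lambda>N. of_int (n$j) * cf n (pol (trunc a N) * pol (trunc b N))) \<longlonglongrightarrow> cf n (dl j a * b) + cf n (a * dl j b)"
    using tendsto_add[OF p[of "dl j a" b] p[of a "dl j b"]] assms by (simp add: e Sm_dl)
  moreover have "(\<lambda>N. of_int (n$j) * cf n (pol (trunc a N) * pol (trunc b N))) \<longlonglongrightarrow> of_int (n$j) * cf n (a * b)"
    by (intro tendsto_mult_left p assms)
  ultimately show "cf n (dl j (a * b)) = cf n (dl j a * b + a * dl j b)"
    using LIMSEQ_unique by (fastforce simp: cf_dl cf_add Sm_mult assms)
qed (auto intro: Sm_dl Sm_mult Sm_add assms)

lemma tr_dl: "a \<in> Sm \<Longrightarrow> tr (dl j a) = 0"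
  using cf_dl[of a 0 j] by (simp add: cf_0)

lemma nct_trace_eq: "nct_trace U = tr"
  unfolding nct_trace_def
proof (rule the_equality)
  show "bounded_linear tr \<and> (\<forall>w a. tr (w *\<^sub>C a) = w * tr a) \<and> (\<forall>c a. nct_series U c a \<longrightarrow> tr a = c 0)"
    using tr series_cf cf_0 by metis
  fix f assume f: "bounded_linear f \<and> (\<forall>w a. f (w *\<^sub>C a) = w * f a) \<and> (\<forall>c a. nct_series U c a \<longrightarrow> f a = c 0)"
  show "f = tr"
  proof
    fix a
    obtain p where p: "\<And>i::nat. fs (p i)" "(\<lambda>i. pol (p i)) \<longlonglongrightarrow> a" using dense[of a] by metis
    have "f (pol (p i)) = tr (pol (p i))" for i
      using f Sm_pol[OF p(1)[of i]] unfolding Sm_iff by (metis cf_0)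
    then show "f a = tr a"
      using LIMSEQ_unique[OF bounded_linear.tendsto[OF conjunct1[OF f] p(2)]] bounded_linear.tendsto[OF tr(1) p(2)] by simp
  qed
qed

subsection \<open>Graph norms and inverses\<close>

text \<open>Unfolded, this is the sum over k of (r choose k) times the norm of the k-th
  \<open>dl j\<close> derivative; the binomial weights make it submultiplicative.\<close>

fun gn :: "2 \<Rightarrow> nat \<Rightarrow> 'a \<Rightarrow> real" where
  "gn j 0 a = norm a"
| "gn j (Suc r) a = gn j r a + gn j r (dl j a)"

lemma gn_nonneg [simp]: "gn j r a \<ge> 0"
  by (induction r arbitrary: a) auto

lemma gn_add: "a \<in> Sm \<Longrightarrow> b \<in> Sm \<Longrightarrow> gn j r (a + b) \<le> gn j r a + gn j r b"
proof (induction r arbitrary: a b)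
  case (Suc r)
  show ?case using Suc.IH[OF Suc.prems] Suc.IH[OF Sm_dl[OF Suc.prems(1), of j] Sm_dl[OF Suc.prems(2), of j]]
    by (simp add: dl_add Suc.prems)
qed (simp add: norm_triangle_ineq)

lemma gn_0 [simp]: "gn j r 0 = 0"
  by (induction r) auto

lemma gn_sum: "(\<And>i. i \<in> I \<Longrightarrow> f i \<in> Sm) \<Longrightarrow> gn j r (sum f I) \<le> (\<Sum>i\<in>I. gn j r (f i))"
proof (induction I rule: infinite_finite_induct)
  case (insert x I)
  then show ?case using gn_add[of "f x" "sum f I" j r] by (fastforce simp: Sm_sum)
qed auto

lemma gn_scaleR: "a \<in> Sm \<Longrightarrow> gn j r (w *\<^sub>R a) = \<bar>w\<bar> * gn j r a"
  by (induction r arbitrary: a) (auto simp: dl_scaleR Sm_dl distrib_left)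

lemma gn_mult: "a \<in> Sm \<Longrightarrow> b \<in> Sm \<Longrightarrow> gn j r (a * b) \<le> gn j r a * gn j r b"
proof (induction r arbitrary: a b)
  case (Suc r)
  have "gn j (Suc r) (a * b) \<le> gn j r (a * b) + (gn j r (dl j a * b) + gn j r (a * dl j b))"
    using gn_add[of "dl j a * b" "a * dl j b" j r] Suc.prems by (simp add: dl_mult Sm_dl Sm_mult)
  also have "\<dots> \<le> gn j r a * gn j r b + (gn j r (dl j a) * gn j r b + gn j r a * gn j r (dl j b))"
    using Suc by (intro add_mono Suc.IH) (auto intro: Sm_dl)
  also have "\<dots> \<le> gn j (Suc r) a * gn j (Suc r) b"
    by (simp add: distrib_left distrib_right)
  finally show ?case .
qed (simp add: norm_mult_ineq)

lemma gn_cf: "a \<in> Sm \<Longrightarrow> \<bar>of_int (n$j)\<bar> ^ r * cmod (cf n a) \<le> gn j r a"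
proof (induction r arbitrary: a)
  case (Suc r)
  have "\<bar>of_int (n$j)\<bar> ^ r * cmod (cf n (dl j a)) \<le> gn j r (dl j a)" by (rule Suc.IH[OF Sm_dl[OF Suc.prems]])
  then show ?case using gn_nonneg[of j r a] by (simp add: cf_dl[OF Suc.prems] norm_mult mult_ac del: gn_nonneg)
qed (simp add: cf_le)

lemma wt_power_le: "wt n ^ r \<le> 3 ^ r * (1 + \<bar>of_int (n$1)\<bar> ^ r + \<bar>of_int (n$2)\<bar> ^ r)"
proof -
  let ?a = "\<bar>of_int (n$1)\<bar> :: real" and ?b = "\<bar>of_int (n$2)\<bar> :: real"
  have "wt n \<le> 3 * max 1 (max ?a ?b)" unfolding wt_def by linarith
  then have "wt n ^ r \<le> (3 * max 1 (max ?a ?b)) ^ r" by (intro power_mono) (auto simp: less_imp_le)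
  also have "\<dots> = 3 ^ r * (max 1 (max ?a ?b)) ^ r" by (rule power_mult_distrib)
  also have "(max 1 (max ?a ?b)) ^ r \<le> 1 + ?a ^ r + ?b ^ r"
    by (auto simp: max_def)
  finally show ?thesis by simp
qed

text \<open>Pure derivatives in the two directions already control the full weight, as wt n is at
  most three times the largest of 1, |n_1|, |n_2|.\<close>

lemma wt_gn:
  assumes "a \<in> Sm" shows "wt n ^ r * cmod (cf n a) \<le> 3 ^ r * (norm a + gn 1 r a + gn 2 r a)"
proof -
  have "wt n ^ r * cmod (cf n a) \<le> (3 ^ r * (1 + \<bar>of_int (n$1)\<bar> ^ r + \<bar>of_int (n$2)\<bar> ^ r)) * cmod (cf n a)"
    by (intro mult_right_mono wt_power_le) auto
  also have "\<dots> = 3 ^ r * (cmod (cf n a) + \<bar>of_int (n$1)\<bar> ^ r * cmod (cf n a) + \<bar>of_int (n$2)\<bar> ^ r * cmod (cf n a))"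
    by (simp add: algebra_simps)
  also have "\<dots> \<le> 3 ^ r * (norm a + gn 1 r a + gn 2 r a)"
    using cf_le[of n a] gn_cf[OF assms] by (intro mult_left_mono add_mono) auto
  finally show ?thesis .
qed

lemma Sm_limI_gn:
  assumes "\<And>r. \<exists>y C. y \<longlonglongrightarrow> x \<and> (\<forall>i. y i \<in> Sm \<and> gn 1 r (y i) \<le> C \<and> gn 2 r (y i) \<le> C)"
  shows "x \<in> Sm"
proof (rule Sm_limI)
  fix r
  obtain y C where y: "y \<longlonglongrightarrow> x" "\<And>i. y i \<in> Sm" "\<And>i. gn 1 r (y i) \<le> C" "\<And>i. gn 2 r (y i) \<le> C" using assms[of r] by blast
  obtain B where B: "\<And>i. norm (y i) \<le> B" using convergent_imp_Bseq[OF convergentI[OF y(1)]] unfolding Bseq_def by blast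
  have "wt n ^ r * cmod (cf n (y i)) \<le> 3 ^ r * (B + C + C)" for i n
    by (rule order_trans[OF wt_gn[OF y(2)] mult_left_mono[OF add_mono[OF add_mono[OF B y(3)] y(4)]]]) simp
  then show "\<exists>y C. y \<longlonglongrightarrow> x \<and> (\<forall>i. y i \<in> Sm \<and> (\<forall>n. wt n ^ r * cmod (cf n (y i)) \<le> C))" using y by blast
qed

text \<open>Both the powers of an element and its Chebyshev polynomials satisfy such a derivation rule.\<close>

lemma gn_growth:
  fixes v :: "nat \<Rightarrow> 'a"
  assumes v: "\<And>m. v m \<in> Sm" and d: "d \<in> Sm" and \<rho>: "\<rho> > 0"
    and dv: "\<And>m. dl j (v m) = (\<Sum>i<m. v (m - 1 - i) * d * v i)"
    and nv: "\<And>m. norm (v m) \<le> (real m + 1) * \<rho> ^ m"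
  shows "\<exists>C e. C \<ge> 0 \<and> (\<forall>m. gn j r (v m) \<le> C * (real m + 1) ^ e * \<rho> ^ m)"
proof (induction r)
  case 0
  show ?case using nv by (intro exI[of _ 1] exI[of _ "1::nat"]) simp
next
  case (Suc r)
  then obtain C e where C: "C \<ge> 0" "\<And>m. gn j r (v m) \<le> C * (real m + 1) ^ e * \<rho> ^ m" by blast
  let ?D = "gn j r d"
  \<comment> \<open>The derivation rule has m summands, each with two factors of total degree m - 1.
    This accounts for C twice, for the division by \<rho>, and for the new exponent 2 e + 1.\<close>
  define C' where "C' = C + C * C * ?D / \<rho>"
  have C': "C' \<ge> 0" unfolding C'_def using C \<rho> by simp
  have "gn j (Suc r) (v m) \<le> C' * (real m + 1) ^ (2 * e + 1) * \<rho> ^ m" for m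
  proof -
    have t: "gn j r (v (m - 1 - i) * d * v i) \<le> C * C * ?D / \<rho> * (real m + 1) ^ (2 * e) * \<rho> ^ m" if "i < m" for i
    proof -
      have "gn j r (v (m - 1 - i) * d * v i) \<le> gn j r (v (m - 1 - i)) * ?D * gn j r (v i)"
        using gn_mult[OF Sm_mult[OF v d] v, of j r "m - 1 - i" i] gn_mult[OF v d, of j r "m - 1 - i"]
        by (meson gn_nonneg mult_right_mono order_trans)
      also have "\<dots> \<le> (C * (real m + 1) ^ e * \<rho> ^ (m - 1 - i)) * ?D * (C * (real m + 1) ^ e * \<rho> ^ i)"
      proof (intro mult_mono mult_nonneg_nonneg gn_nonneg order_refl)
        have "C * (real (m - 1 - i) + 1) ^ e * \<rho> ^ (m - 1 - i) \<le> C * (real m + 1) ^ e * \<rho> ^ (m - 1 - i)"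
          using C \<rho> by (intro mult_right_mono mult_left_mono power_mono) auto
        with C(2)[of "m - 1 - i"] show "gn j r (v (m - 1 - i)) \<le> C * (real m + 1) ^ e * \<rho> ^ (m - 1 - i)" by linarith
        have "C * (real i + 1) ^ e * \<rho> ^ i \<le> C * (real m + 1) ^ e * \<rho> ^ i"
          using C \<rho> that by (intro mult_right_mono mult_left_mono power_mono) auto
        with C(2)[of i] show "gn j r (v i) \<le> C * (real m + 1) ^ e * \<rho> ^ i" by linarith
      qed (use C \<rho> in auto)
      also have "\<dots> = C * C * ?D * ((real m + 1) ^ e * (real m + 1) ^ e) * (\<rho> ^ (m - 1 - i) * \<rho> ^ i)"
        by (simp only: mult_ac)
      also have "(real m + 1) ^ e * (real m + 1) ^ e = (real m + 1) ^ (2 * e)" by (simp only: mult_2 power_add)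
      also have "\<rho> ^ (m - 1 - i) * \<rho> ^ i = \<rho> ^ m / \<rho>"
      proof -
        have "\<rho> ^ (m - 1 - i) * \<rho> ^ i * \<rho> = \<rho> ^ m" using that by (simp flip: power_add power_Suc2)
        then show ?thesis using \<rho> by (simp add: field_simps)
      qed
      finally show ?thesis by simp
    qed
    have "gn j r (dl j (v m)) \<le> (\<Sum>i<m. gn j r (v (m - 1 - i) * d * v i))"
      unfolding dv by (rule gn_sum) (intro Sm_mult v d)
    also have "\<dots> \<le> (\<Sum>i<m. C * C * ?D / \<rho> * (real m + 1) ^ (2 * e) * \<rho> ^ m)" by (intro sum_mono t) auto
    also have "\<dots> = real m * (C * C * ?D / \<rho> * (real m + 1) ^ (2 * e) * \<rho> ^ m)" by simp
    also have "\<dots> \<le> (real m + 1) * (C * C * ?D / \<rho> * (real m + 1) ^ (2 * e) * \<rho> ^ m)"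
      using C \<rho> by (intro mult_right_mono) auto
    also have "\<dots> = C * C * ?D / \<rho> * (real m + 1) ^ (2 * e + 1) * \<rho> ^ m" by simp
    finally have 1: "gn j r (dl j (v m)) \<le> C * C * ?D / \<rho> * (real m + 1) ^ (2 * e + 1) * \<rho> ^ m" .
    have "C * (real m + 1) ^ e * \<rho> ^ m \<le> C * (real m + 1) ^ (2 * e + 1) * \<rho> ^ m"
      using C \<rho> by (intro mult_right_mono mult_left_mono power_increasing) auto
    with 1 C(2)[of m] show ?thesis by (simp add: C'_def distrib_right)
  qed
  then show ?case using C' by blast
qed

lemma dl_power:
  assumes "a \<in> Sm" shows "dl j (a ^ m) = (\<Sum>i<m. a ^ (m - 1 - i) * dl j a * a ^ i)"
proof (induction m)
  case (Suc m)
  have "dl j (a ^ Suc m) = dl j a * a ^ m + (\<Sum>i<m. a * (a ^ (m - 1 - i) * dl j a * a ^ i))"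
    using assms by (simp add: dl_mult Sm_power Suc sum_distrib_left)
  also have "(\<Sum>i<m. a * (a ^ (m - 1 - i) * dl j a * a ^ i)) = (\<Sum>i<m. a ^ (m - i) * dl j a * a ^ i)"
    by (intro sum.cong refl) (auto simp: Suc_diff_Suc simp flip: mult.assoc power_Suc)
  finally show ?case by (simp add: add.commute)
qed simp

text \<open>In graph norms the powers of a grow only polynomially faster than \<rho>^m, so
  coefficients that are summable against every such factor give partial sums bounded in all graph
  norms.\<close>

lemma Sm_power_series:
  assumes a: "a \<in> Sm" "norm a \<le> \<rho>" "\<rho> > 0"
    and b: "\<And>e. summable (\<lambda>m. \<bar>b m\<bar> * (real m + 1) ^ e * \<rho> ^ m)"
    and x: "(\<lambda>m. b m *\<^sub>R a ^ m) sums x"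
  shows "x \<in> Sm"
proof (rule Sm_limI_gn)
  fix r
  let ?y = "\<lambda>N. \<Sum>m<N. b m *\<^sub>R a ^ m"
  have "\<exists>C. \<forall>N. gn j r (?y N) \<le> C" for j
  proof -
    have "norm (a ^ m) \<le> (real m + 1) * \<rho> ^ m" for m
    proof -
      have "norm (a ^ m) \<le> norm a ^ m" by (rule norm_power_ineq)
      also have "\<dots> \<le> \<rho> ^ m" using a by (intro power_mono) auto
      also have "\<dots> \<le> (real m + 1) * \<rho> ^ m" using a by (simp add: distrib_right)
      finally show ?thesis .
    qed
    from gn_growth[OF Sm_power[OF a(1)] Sm_dl[OF a(1)] a(3) dl_power[OF a(1)] this, where r=r]
    obtain C e where C: "C \<ge> 0" "\<And>m. gn j r (a ^ m) \<le> C * (real m + 1) ^ e * \<rho> ^ m" by blast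
    let ?s = "\<lambda>m. \<bar>b m\<bar> * (real m + 1) ^ e * \<rho> ^ m"
    have "gn j r (?y N) \<le> C * suminf ?s" for N
    proof -
      have "gn j r (?y N) \<le> (\<Sum>m<N. gn j r (b m *\<^sub>R a ^ m))" by (intro gn_sum Sm_scaleR Sm_power a)
      also have "\<dots> \<le> (\<Sum>m<N. C * ?s m)"
      proof (rule sum_mono)
        fix m show "gn j r (b m *\<^sub>R a ^ m) \<le> C * ?s m"
          using mult_left_mono[OF C(2)[of m], of "\<bar>b m\<bar>"] by (simp add: gn_scaleR Sm_power a mult_ac)
      qed
      also have "\<dots> = C * (\<Sum>m<N. ?s m)" by (simp add: sum_distrib_left)
      also have "\<dots> \<le> C * suminf ?s" using C a by (intro mult_left_mono sum_le_suminf b) auto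
      finally show ?thesis .
    qed
    then show ?thesis by blast
  qed
  then obtain C1 C2 where "\<And>N. gn 1 r (?y N) \<le> C1" "\<And>N. gn 2 r (?y N) \<le> C2" by meson
  then have "\<forall>N. ?y N \<in> Sm \<and> gn 1 r (?y N) \<le> max C1 C2 \<and> gn 2 r (?y N) \<le> max C1 C2"
    by (auto simp: le_max_iff_disj intro!: Sm_sum Sm_scaleR Sm_power a)
  moreover have "?y \<longlonglongrightarrow> x" using x by (simp add: sums_def)
  ultimately show "\<exists>y C. y \<longlonglongrightarrow> x \<and> (\<forall>i. y i \<in> Sm \<and> gn 1 r (y i) \<le> C \<and> gn 2 r (y i) \<le> C)" by blast
qed

lemma summable_poly_geometric:
  fixes \<rho> :: real assumes "0 < \<rho>" "\<rho> < 1" shows "summable (\<lambda>m. (real m + 1) ^ e * \<rho> ^ m)"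
proof -
  \<comment> \<open>With this s the product exp s times \<rho> is the square root of \<rho>, still
    below 1, while exp (s m) absorbs the polynomial factor.\<close>
  define s where "s = - ln \<rho> / 2"
  have s: "s > 0" using assms by (simp add: s_def)
  have es: "exp s * \<rho> < 1"
  proof -
    have "exp s * \<rho> = exp (s + ln \<rho>)" using assms by (simp add: exp_add)
    also have "\<dots> < 1" using assms s by (simp add: s_def)
    finally show ?thesis .
  qed
  have b: "(real m + 1) ^ e * \<rho> ^ m \<le> (fact e / s ^ e * exp s) * (exp s * \<rho>) ^ m" for m
  proof -
    have "(s * (real m + 1)) ^ e / fact e \<le> exp (s * (real m + 1))"
    proof -
      have "(\<Sum>i\<in>{e}. (s * (real m + 1)) ^ i /\<^sub>R fact i) \<le> exp (s * (real m + 1))"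
        unfolding exp_def by (rule sum_le_suminf[OF summable_exp_generic]) (use s in auto)
      then show ?thesis by (simp add: field_simps)
    qed
    then have "s ^ e * (real m + 1) ^ e / fact e \<le> exp (s * (real m + 1))" by (simp only: power_mult_distrib)
    then have "(real m + 1) ^ e \<le> fact e / s ^ e * exp (s * (real m + 1))"
      using s by (simp add: divide_le_eq pos_le_divide_eq mult.commute)
    also have "exp (s * (real m + 1)) = exp s * exp s ^ m" by (simp add: distrib_left exp_add mult.commute flip: exp_of_nat_mult)
    finally have "(real m + 1) ^ e * \<rho> ^ m \<le> (fact e / s ^ e * (exp s * exp s ^ m)) * \<rho> ^ m"
      using assms by (intro mult_right_mono) auto
    then show ?thesis by (simp add: power_mult_distrib mult_ac)
  qed
  show ?thesis
  proof (rule summable_comparison_test[OF exI[of _ 0]])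
    show "summable (\<lambda>m. (fact e / s ^ e * exp s) * (exp s * \<rho>) ^ m)"
      using es assms by (intro summable_mult summable_geometric) auto
  qed (use b assms in auto)
qed

text \<open>Spectral invariance. If a polynomial element s is close to the inverse of a, then s a is
  close to 1, its Neumann series stays smooth, and (s a)^(-1) s is the inverse of a.\<close>

lemma Sm_alg_inv:
  assumes a: "a \<in> Sm" and i: "alg_invertible a" shows "alg_inv a \<in> Sm"
proof -
  let ?y = "alg_inv a"
  obtain c where c: "\<And>i::nat. fs (c i)" "(\<lambda>i. pol (c i)) \<longlonglongrightarrow> ?y" using dense[of ?y] by metis
  have "(\<lambda>i. norm (1 - pol (c i) * a)) \<longlonglongrightarrow> norm (1 - ?y * a)" by (intro tendsto_intros c)
  then have "(\<lambda>i. norm (1 - pol (c i) * a)) \<longlonglongrightarrow> 0" using i by simp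
  then have "\<forall>\<^sub>F i in sequentially. norm (1 - pol (c i) * a) < 1/2" by (rule order_tendstoD) simp
  then obtain k where k: "norm (1 - pol (c k) * a) < 1/2" by (auto simp: eventually_sequentially)
  define s where "s = pol (c k)"
  define x where "x = 1 - s * a"
  have sS: "s \<in> Sm" and xS: "x \<in> Sm" using c by (auto simp: s_def x_def intro!: Sm_pol Sm_diff Sm_mult a)
  have nx: "norm x \<le> 1/2" "norm x < 1" using k by (auto simp: x_def s_def)
  have "alg_inv (1 - x) \<in> Sm"
    by (rule Sm_power_series[OF xS nx(1), of "\<lambda>_. 1"])
       (use neumann_invertible(2)[OF nx(2)] summable_poly_geometric[of "1/2"] in auto)
  moreover have "alg_inv (1 - x) * s = ?y"
  proof -
    have "alg_inv (1 - x) * (s * a) = 1" using neumann_invertible(1)[OF nx(2)] by (simp add: x_def)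
    then have "alg_inv (1 - x) * s * a * ?y = ?y" by (simp add: mult.assoc[symmetric])
    then show ?thesis using i by (simp add: mult.assoc)
  qed
  ultimately show ?thesis using Sm_mult[OF _ sS] by force
qed

lemma dl_alg_inv:
  assumes a: "a \<in> Sm" "alg_invertible a"
  shows "dl j (alg_inv a) = - (alg_inv a * dl j a * alg_inv a)"
proof -
  note i = Sm_alg_inv[OF a]
  have "dl j (alg_inv a * a) = 0" using a by simp
  then have "dl j (alg_inv a) * a = - (alg_inv a * dl j a)"
    using dl_mult[OF i a(1), of j] by (simp add: eq_neg_iff_add_eq_0)
  then have "dl j (alg_inv a) * a * alg_inv a = - (alg_inv a * dl j a) * alg_inv a" by simp
  then show ?thesis using a by (simp add: mult.assoc)
qed

end

subsection \<open>Chebyshev expansions and the smooth functional calculus\<close>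

text \<open>Chebyshev rather than power expansions, because on a self-adjoint element scaled into
  [-1,1] the norms of these polynomials stay bounded; their graph norms then grow polynomially, and
  a smooth function has coefficients decaying faster than that.\<close>

definition chT :: "nat \<Rightarrow> real \<Rightarrow> real" where "chT n x = cos (real n * arccos x)"

text \<open>Chebyshev polynomials of the second kind on [-1,1]. This form of the recursion makes the
  bound n + 1 immediate; the three-term recursion is recovered in \<open>chU_rec\<close>.\<close>

fun chU :: "nat \<Rightarrow> real \<Rightarrow> real" where
  "chU 0 x = 1" | "chU (Suc n) x = x * chU n x + chT (Suc n) x"

lemma chT_simps:
  assumes "x \<in> {-1..1}"
  shows "chT 0 x = 1" "chT (Suc 0) x = x" "chT (Suc (Suc n)) x = 2 * x * chT (Suc n) x - chT n x"
proof -
  show "chT 0 x = 1" "chT (Suc 0) x = x" using assms by (auto simp: chT_def)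
  have "cos (real (Suc (Suc n)) * arccos x) + cos (real n * arccos x) = 2 * x * cos (real (Suc n) * arccos x)"
    using cos_add[of "real (Suc n) * arccos x" "arccos x"] cos_diff[of "real (Suc n) * arccos x" "arccos x"] assms
    by (simp add: algebra_simps)
  then show "chT (Suc (Suc n)) x = 2 * x * chT (Suc n) x - chT n x" by (simp add: chT_def)
qed

lemma chT_le_1: "\<bar>chT n x\<bar> \<le> 1"
  by (simp add: chT_def)

lemma chU_le: assumes "x \<in> {-1..1}" shows "\<bar>chU n x\<bar> \<le> real n + 1"
proof (induction n)
  case (Suc n)
  have "\<bar>x * chU n x\<bar> \<le> 1 * (real n + 1)" unfolding abs_mult using assms Suc by (intro mult_mono) auto
  then show ?case using chT_le_1[of "Suc n" x] abs_triangle_ineq[of "x * chU n x" "chT (Suc n) x"] by simp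
qed simp

lemma chT_chU: "x \<in> {-1..1} \<Longrightarrow> chT (Suc (Suc n)) x = x * chU (Suc n) x - chU n x"
proof (induction n)
  case (Suc n)
  show ?case unfolding chT_simps(3)[OF Suc.prems, of "Suc n"] using Suc.prems arg_cong[OF Suc.IH[OF Suc.prems], of "(*) x"]
    by (simp add: algebra_simps)
qed (simp add: chT_simps algebra_simps)

lemma chU_rec: "x \<in> {-1..1} \<Longrightarrow> chU (Suc (Suc n)) x = 2 * x * chU (Suc n) x - chU n x"
  using chT_chU[of x n] by simp

lemma chT_half_diff: "x \<in> {-1..1} \<Longrightarrow> chT (Suc (Suc n)) x = (chU (Suc (Suc n)) x - chU n x) / 2"
  using chT_chU[of x n] chU_rec[of x n] by (simp del: chU.simps)

lemma continuous_on_chT [continuous_intros]: "continuous_on {-1..1} (chT n)"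
  unfolding chT_def by (intro continuous_intros) auto

lemma continuous_on_chU [continuous_intros]: "continuous_on {-1..1} (chU n)"
  by (induction n) (auto intro!: continuous_intros)

text \<open>The cosine coefficients of a polynomial decay as its derivatives allow, because
  \<open>2 m I\<^sub>m(p) = I\<^bsub>m-1\<^esub>(p') - I\<^bsub>m+1\<^esub>(p')\<close>.\<close>

definition chI :: "nat \<Rightarrow> real poly \<Rightarrow> real" where
  "chI m p = integral {0..pi} (\<lambda>x. poly p (cos x) * cos (real m * x))"

lemma chI_integrable: "(\<lambda>x. poly p (cos x) * cos (real m * x)) integrable_on {0..pi}"
  by (intro integrable_continuous_interval continuous_intros)

lemma chI_bound:
  assumes "\<And>x. x \<in> {-1..1} \<Longrightarrow> \<bar>poly p x\<bar> \<le> B" shows "\<bar>chI m p\<bar> \<le> pi * B"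
proof -
  have "B \<ge> 0" using assms[of 0] by simp
  have "norm (chI m p) \<le> B * (pi - 0)"
    unfolding chI_def
  proof (rule integral_bound)
    fix x assume "x \<in> {0..pi}"
    show "norm (poly p (cos x) * cos (real m * x)) \<le> B"
      using mult_mono[OF assms[of "cos x"] abs_cos_le_one[of "real m * x"]] \<open>B \<ge> 0\<close> by (simp add: abs_mult)
  qed (auto intro!: continuous_intros)
  then show ?thesis by (simp add: mult.commute)
qed

text \<open>Integration by parts; the boundary terms vanish because sin (m x) is zero at 0 and pi,
  and the product of two sines splits into cosines of neighbouring frequencies.\<close>

lemma chI_rec:
  assumes "m \<ge> 1" shows "2 * real m * chI m p = chI (m - 1) (pderiv p) - chI (m + 1) (pderiv p)"
proof -
  let ?G = "\<lambda>x. poly p (cos x) * sin (real m * x)"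
  let ?g = "\<lambda>x. real m * (poly p (cos x) * cos (real m * x)) - poly (pderiv p) (cos x) * sin x * sin (real m * x)"
  have "(?g has_integral (?G pi - ?G 0)) {0..pi}"
  proof (rule fundamental_theorem_of_calculus)
    fix x assume "x \<in> {0..pi}"
    have "(?G has_real_derivative ?g x) (at x within {0..pi})"
      by (auto intro!: derivative_eq_intros DERIV_chain'[where f=cos and g="poly p", OF _ poly_DERIV, THEN DERIV_cong])
    then show "(?G has_vector_derivative ?g x) (at x within {0..pi})"
      by (simp add: has_real_derivative_iff_has_vector_derivative)
  qed simp
  moreover have "sin (real m * pi) = 0" by (simp add: mult.commute)
  ultimately have "(?g has_integral 0) {0..pi}" by simp
  moreover have "?g x = real m * (poly p (cos x) * cos (real m * x))
     - 1/2 * (poly (pderiv p) (cos x) * cos (real (m - 1) * x) - poly (pderiv p) (cos x) * cos (real (m + 1) * x))" for x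
  proof -
    have "sin x * sin (real m * x) = 1/2 * (cos (real (m - 1) * x) - cos (real (m + 1) * x))"
      using assms cos_diff[of "real m * x" x] cos_add[of "real m * x" x] by (simp add: of_nat_diff algebra_simps)
    then show ?thesis unfolding mult.assoc by (simp only: right_diff_distrib mult.left_commute[of _ "1/2"])
  qed
  moreover have "((\<lambda>x. real m * (poly p (cos x) * cos (real m * x))
     - 1/2 * (poly (pderiv p) (cos x) * cos (real (m - 1) * x) - poly (pderiv p) (cos x) * cos (real (m + 1) * x)))
     has_integral (real m * chI m p - 1/2 * (chI (m - 1) (pderiv p) - chI (m + 1) (pderiv p)))) {0..pi}"
    unfolding chI_def
    by (intro has_integral_diff has_integral_mult_right integrable_integral chI_integrable)
  ultimately have "0 = real m * chI m p - 1/2 * (chI (m - 1) (pderiv p) - chI (m + 1) (pderiv p))"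
    by (metis (no_types, lifting) has_integral_cong has_integral_unique)
  then show ?thesis by simp
qed

text \<open>Each use of \<open>chI_rec\<close> trades one derivative of p for one power of m. The
  constant is independent of p, so the estimate will be uniform along a sequence of approximating
  polynomials.\<close>

lemma chI_decay:
  "\<exists>C\<ge>0. \<forall>p B m. (\<forall>i\<le>R. \<forall>x\<in>{-1..1}. \<bar>poly ((pderiv ^^ i) p) x\<bar> \<le> B) \<longrightarrow> \<bar>chI m p\<bar> * (real m + 1) ^ R \<le> C * B"
proof (induction R)
  case 0
  show ?case by (intro exI[of _ pi]) (auto intro: chI_bound)
next
  case (Suc R)
  then obtain C where C: "C \<ge> 0" and H: "\<And>p B m. (\<forall>i\<le>R. \<forall>x\<in>{-1..1}. \<bar>poly ((pderiv ^^ i) p) x\<bar> \<le> B) \<Longrightarrow> \<bar>chI m p\<bar> * (real m + 1) ^ R \<le> C * B"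
    by blast
  show ?case
  proof (intro exI[of _ "pi + 2 ^ Suc R * C"] conjI allI impI)
    fix p B m assume as: "\<forall>i\<le>Suc R. \<forall>x\<in>{-1..1}. \<bar>poly ((pderiv ^^ i) p) x\<bar> \<le> (B::real)"
    have B: "B \<ge> 0" using as[rule_format, of 0 0] by simp
    show "\<bar>chI m p\<bar> * (real m + 1) ^ Suc R \<le> (pi + 2 ^ Suc R * C) * B"
    proof (cases "m = 0")
      case True
      have "\<bar>chI m p\<bar> \<le> pi * B" by (rule chI_bound) (use as[rule_format, of 0] in auto)
      moreover have "0 \<le> 2 ^ Suc R * C * B" using B C by simp
      ultimately have "\<bar>chI m p\<bar> \<le> pi * B + 2 ^ Suc R * C * B" by linarith
      then show ?thesis using True by (simp add: distrib_right)
    next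
      case False
      have "\<forall>i\<le>R. \<forall>x\<in>{-1..1}. \<bar>poly ((pderiv ^^ i) (pderiv p)) x\<bar> \<le> B"
        using as by (metis Suc_le_mono funpow_Suc_right o_apply)
      note h = H[OF this]
      let ?a = "\<bar>chI (m - 1) (pderiv p)\<bar>" and ?b = "\<bar>chI (m + 1) (pderiv p)\<bar>"
      have m: "real m > 0" "real m + 1 \<le> 2 * real m" using False by auto
      have 1: "?a * real m ^ R \<le> C * B" using h[of "m - 1"] False by (simp add: of_nat_diff)
      have 2: "?b * real m ^ R \<le> C * B"
      proof -
        have "?b * real m ^ R \<le> ?b * (real (m + 1) + 1) ^ R" by (intro mult_left_mono power_mono) auto
        then show ?thesis using h[of "m + 1"] by linarith
      qed
      have "2 * real m * \<bar>chI m p\<bar> \<le> ?a + ?b"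
        using chI_rec[of m p] False by (simp add: abs_mult flip: abs_mult[of 2] abs_mult[of "2 * real m"])
      then have "2 * real m * \<bar>chI m p\<bar> * real m ^ R \<le> (?a + ?b) * real m ^ R" by (intro mult_right_mono) auto
      also have "\<dots> \<le> 2 * (C * B)" using 1 2 by (simp add: distrib_right)
      finally have 3: "\<bar>chI m p\<bar> * real m ^ Suc R \<le> C * B" by (simp add: mult_ac)
      have "\<bar>chI m p\<bar> * (real m + 1) ^ Suc R \<le> \<bar>chI m p\<bar> * (2 * real m) ^ Suc R"
        using m by (intro mult_left_mono power_mono) auto
      also have "\<dots> = 2 ^ Suc R * (\<bar>chI m p\<bar> * real m ^ Suc R)" unfolding power_mult_distrib by (simp only: mult_ac)
      also have "\<dots> \<le> 2 ^ Suc R * (C * B)" using 3 by (intro mult_left_mono) auto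
      also have "\<dots> \<le> (pi + 2 ^ Suc R * C) * B" using B by (simp add: distrib_right)
      finally show ?thesis .
    qed
  qed (use C in auto)
qed

lemma cos_integral:
  "((\<lambda>x. cos (of_int n * x)) has_integral (if n = 0 then pi else 0)) {0..pi}"
proof (cases "n = 0")
  case True
  then show ?thesis using has_integral_const_real[of "1::real" 0 pi] by simp
next
  case False
  have "((\<lambda>x. cos (of_int n * x)) has_integral (sin (of_int n * pi) / of_int n - sin (of_int n * 0) / of_int n)) {0..pi}"
    by (rule fundamental_theorem_of_calculus)
       (use False in \<open>auto intro!: derivative_eq_intros simp flip: has_real_derivative_iff_has_vector_derivative\<close>)
  moreover have "sin (of_int n * pi) = 0" by (simp add: sin_zero_iff_int2)
  ultimately show ?thesis using False by simp
qed

lemma cos_cos_integral: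
  "((\<lambda>x. cos (real k * x) * cos (real m * x)) has_integral (if k = m then (if m = 0 then pi else pi / 2) else 0)) {0..pi}"
proof -
  have e: "cos (real k * x) * cos (real m * x) = 1/2 * (cos (of_int (int k - int m) * x) + cos (of_int (int k + int m) * x))" for x
    using cos_add[of "real k * x" "real m * x"] cos_diff[of "real k * x" "real m * x"] by (simp add: algebra_simps)
  have "((\<lambda>x. 1/2 * (cos (of_int (int k - int m) * x) + cos (of_int (int k + int m) * x)))
     has_integral 1/2 * ((if int k - int m = 0 then pi else 0) + (if int k + int m = 0 then pi else 0))) {0..pi}"
    by (intro has_integral_mult_right has_integral_add cos_integral)
  then show ?thesis unfolding e using has_integral_const_real[of "1::real" 0 pi]
    by (cases "k = 0 \<and> m = 0") (auto split: if_splits)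
qed

text \<open>The expansion is demanded for every sufficiently long partial sum, so that two
  expansions can be added without matching their lengths.\<close>

definition ch_span :: "(real \<Rightarrow> real) set" where
  "ch_span = {f. \<exists>c N. (\<forall>m\<ge>N. c m = 0) \<and> (\<forall>n\<ge>N. \<forall>x\<in>{-1..1}. f x = (\<Sum>m<n. c m * chT m x))}"

lemma ch_span_add: "f \<in> ch_span \<Longrightarrow> g \<in> ch_span \<Longrightarrow> (\<lambda>x. f x + g x) \<in> ch_span"
  unfolding ch_span_def
proof clarify
  fix c c' N N'
  assume "\<forall>m\<ge>N. c m = 0" "\<forall>n\<ge>N. \<forall>x\<in>{-1..1}. f x = (\<Sum>m<n. c m * chT m x)"
     "\<forall>m\<ge>N'. c' m = 0" "\<forall>n\<ge>N'. \<forall>x\<in>{-1..1}. g x = (\<Sum>m<n. c' m * chT m x)"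
  then show "\<exists>c N. (\<forall>m\<ge>N. c m = 0) \<and> (\<forall>n\<ge>N. \<forall>x\<in>{-1..1}. f x + g x = (\<Sum>m<n. c m * chT m x))"
    by (intro exI[of _ "\<lambda>m. c m + c' m"] exI[of _ "max N N'"]) (auto simp add: distrib_right sum.distrib)
qed

lemma ch_span_scale: "f \<in> ch_span \<Longrightarrow> (\<lambda>x. a * f x) \<in> ch_span"
  unfolding ch_span_def
proof clarify
  fix c N
  assume "\<forall>m\<ge>N. c m = 0" "\<forall>n\<ge>N. \<forall>x\<in>{-1..1}. f x = (\<Sum>m<n. c m * chT m x)"
  then show "\<exists>c N. (\<forall>m\<ge>N. c m = 0) \<and> (\<forall>n\<ge>N. \<forall>x\<in>{-1..1}. a * f x = (\<Sum>m<n. c m * chT m x))"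
    by (intro exI[of _ "\<lambda>m. a * c m"] exI[of _ N]) (simp add: sum_distrib_left mult.assoc)
qed

lemma ch_span_cong: "(\<And>x. x \<in> {-1..1} \<Longrightarrow> f x = g x) \<Longrightarrow> f \<in> ch_span \<longleftrightarrow> g \<in> ch_span"
  unfolding ch_span_def by auto

lemma ch_span_chT: "chT k \<in> ch_span"
proof -
  have "(\<Sum>m<n. (if m = k then 1 else 0) * chT m x) = chT k x" if "n \<ge> Suc k" for n x
    using that by (simp add: if_distrib[of "\<lambda>c. c * _"] cong: if_cong)
  then show ?thesis unfolding ch_span_def
    by (auto intro!: exI[of _ "\<lambda>m. if m = k then 1 else 0"] exI[of _ "Suc k"])
qed

lemma ch_span_sum: "finite I \<Longrightarrow> (\<And>i. i \<in> I \<Longrightarrow> f i \<in> ch_span) \<Longrightarrow> (\<lambda>x. \<Sum>i\<in>I. f i x) \<in> ch_span"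
proof (induction I rule: finite_induct)
  case empty
  then show ?case using ch_span_scale[OF ch_span_chT[of 0], of 0] by simp
qed (auto intro: ch_span_add)

lemma ch_span_shift: assumes "f \<in> ch_span" shows "(\<lambda>x. x * f x) \<in> ch_span"
proof -
  obtain c N where c: "\<And>x. x \<in> {-1..1} \<Longrightarrow> f x = (\<Sum>m<N. c m * chT m x)" using assms unfolding ch_span_def by blast
  have t: "(\<lambda>x. x * chT m x) \<in> ch_span" for m
  proof (cases m)
    case 0
    then show ?thesis using ch_span_chT[of "Suc 0"] by (subst ch_span_cong[of _ "chT (Suc 0)"]) (auto simp: chT_simps)
  next
    case (Suc k)
    have "(\<lambda>x. x * chT m x) \<in> ch_span \<longleftrightarrow> (\<lambda>x. 1/2 * (chT (Suc (Suc k)) x + chT k x)) \<in> ch_span"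
      by (rule ch_span_cong) (simp add: Suc chT_simps(3))
    moreover have "(\<lambda>x. 1/2 * (chT (Suc (Suc k)) x + chT k x)) \<in> ch_span"
      by (intro ch_span_scale ch_span_add ch_span_chT)
    ultimately show ?thesis by blast
  qed
  have "(\<lambda>x. x * f x) \<in> ch_span \<longleftrightarrow> (\<lambda>x. \<Sum>m<N. c m * (x * chT m x)) \<in> ch_span"
    by (rule ch_span_cong) (auto simp: c sum_distrib_left mult_ac)
  then show ?thesis by (auto intro!: ch_span_sum ch_span_scale t)
qed

lemma ch_span_poly: "poly p \<in> ch_span"
proof (induction p)
  case 0
  then show ?case using ch_span_scale[OF ch_span_chT[of 0], of 0] by (simp add: poly_0)
next
  case (pCons a p)
  have "poly (pCons a p) \<in> ch_span \<longleftrightarrow> (\<lambda>x. a * chT 0 x + x * poly p x) \<in> ch_span"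
    by (rule ch_span_cong) (auto simp: chT_simps)
  moreover have "(\<lambda>x. a * chT 0 x + x * poly p x) \<in> ch_span"
    by (intro ch_span_add ch_span_scale ch_span_chT ch_span_shift pCons.IH)
  ultimately show ?case by blast
qed

text \<open>Orthogonality of the cosines on [0,pi] identifies \<open>chI m p\<close> with c m times
  pi or pi / 2; both factors are at least 1, hence the inequality without a constant.\<close>

lemma ch_expansion:
  obtains c n where "\<And>x. x \<in> {-1..1} \<Longrightarrow> poly p x = (\<Sum>m<n. c m * chT m x)" "\<And>m. \<bar>c m\<bar> \<le> \<bar>chI m p\<bar>"
proof -
  obtain c N where c: "\<And>m. m \<ge> N \<Longrightarrow> c m = 0" "\<And>x. x \<in> {-1..1} \<Longrightarrow> poly p x = (\<Sum>m<N. c m * chT m x)"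
    using ch_span_poly[of p] unfolding ch_span_def by blast
  have "\<bar>c m\<bar> \<le> \<bar>chI m p\<bar>" for m
  proof (cases "m < N")
    case True
    let ?v = "\<lambda>k. if k = m then (if m = 0 then pi else pi / 2) else 0"
    have "((\<lambda>x. \<Sum>k<N. c k * (cos (real k * x) * cos (real m * x))) has_integral (\<Sum>k<N. c k * ?v k)) {0..pi}"
      by (intro has_integral_sum has_integral_mult_right cos_cos_integral) auto
    moreover have "(\<Sum>k<N. c k * (cos (real k * x) * cos (real m * x))) = poly p (cos x) * cos (real m * x)" if "x \<in> {0..pi}" for x
      using that by (simp add: c(2) chT_def arccos_cos sum_distrib_right mult.assoc)
    ultimately have "((\<lambda>x. poly p (cos x) * cos (real m * x)) has_integral (\<Sum>k<N. c k * ?v k)) {0..pi}"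
      by (metis (no_types, lifting) has_integral_cong)
    moreover have "(\<Sum>k<N. c k * ?v k) = c m * ?v m"
      using True by (simp add: if_distrib[of "\<lambda>c. _ * c"] cong: if_cong)
    ultimately have "chI m p = c m * ?v m" unfolding chI_def by (simp add: integral_unique)
    moreover have "1 \<le> ?v m" using pi_ge_two by auto
    ultimately show ?thesis using mult_left_mono[of 1 "?v m" "\<bar>c m\<bar>"] by (simp add: abs_mult del: mult_le_cancel_left1)
  qed (simp add: c)
  then show ?thesis using that c(2) by blast
qed

lemma poly_antiderivative: "\<exists>P::real poly. pderiv P = q"
proof -
  let ?P = "\<Sum>i\<le>degree q. monom (coeff q i / real (Suc i)) (Suc i)"
  have "pderiv ?P = (\<Sum>i\<le>degree q. monom (coeff q i) i)"
    by (rule poly_eqI) (auto simp: coeff_pderiv coeff_sum coeff_monom if_distrib[of "\<lambda>c. _ * c"] cong: if_cong)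
  also have "\<dots> = q" by (rule poly_as_sum_of_monoms)
  finally show ?thesis by blast
qed

text \<open>Weierstrass approximation of the highest derivative, integrated R times. With the
  constant of integration fixed at 0, integration over [-1,1] does not increase the error.\<close>

lemma poly_approx_derivs:
  assumes "\<And>i x. i < R \<Longrightarrow> (F i has_real_derivative F (Suc i) x) (at x)" "continuous_on {-1..1} (F R)" "e > 0"
  shows "\<exists>p. \<forall>i\<le>R. \<forall>x\<in>{-1..1}. \<bar>poly ((pderiv ^^ i) p) x - F i x\<bar> \<le> e"
  using assms
proof (induction R arbitrary: F)
  case 0
  then show ?case using poly_approx[of "{-1..1}" "F 0" e] by (auto intro: less_imp_le)
next
  case (Suc R)
  have "\<exists>p. \<forall>i\<le>R. \<forall>x\<in>{-1..1}. \<bar>poly ((pderiv ^^ i) p) x - F (Suc i) x\<bar> \<le> e"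
    by (rule Suc.IH[of "\<lambda>i. F (Suc i)"]) (use Suc.prems in auto)
  then obtain q where q: "\<And>i x. i \<le> R \<Longrightarrow> x \<in> {-1..1} \<Longrightarrow> \<bar>poly ((pderiv ^^ i) q) x - F (Suc i) x\<bar> \<le> e" by blast
  obtain P where P: "pderiv P = q" using poly_antiderivative by blast
  define p where "p = P + [:F 0 0 - poly P 0:]"
  have p: "pderiv p = q" "poly p 0 = F 0 0" by (auto simp: p_def pderiv_add pderiv_pCons P)
  have "\<bar>poly p x - F 0 x\<bar> \<le> e" if x: "x \<in> {-1..1}" for x
  proof -
    have "norm ((poly p x - F 0 x) - (poly p 0 - F 0 0)) \<le> e * norm (x - 0)"
    proof (rule field_differentiable_bound[of "{-1..1}" "\<lambda>x. poly p x - F 0 x" "\<lambda>x. poly q x - F (Suc 0) x"])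
      fix y :: real assume y: "y \<in> {-1..1}"
      show "((\<lambda>x. poly p x - F 0 x) has_field_derivative poly q y - F (Suc 0) y) (at y within {-1..1})"
        by (intro DERIV_diff) (use poly_DERIV[of p y] p Suc.prems(1)[of 0 y] in \<open>auto intro: has_field_derivative_at_within\<close>)
      show "norm (poly q y - F (Suc 0) y) \<le> e" using q[of 0 y] y by simp
    qed (use x in auto)
    also have "\<dots> \<le> e * 1" using x \<open>e > 0\<close> by (intro mult_left_mono) auto
    finally show ?thesis using p by simp
  qed
  moreover have "\<bar>poly ((pderiv ^^ Suc i) p) x - F (Suc i) x\<bar> \<le> e" if "i \<le> R" "x \<in> {-1..1}" for i x
    using q[OF that] p(1) by (simp del: funpow.simps add: funpow_Suc_right)
  ultimately have "\<forall>i\<le>Suc R. \<forall>x\<in>{-1..1}. \<bar>poly ((pderiv ^^ i) p) x - F i x\<bar> \<le> e"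
    by (metis Suc_le_mono funpow_0 not0_implies_Suc)
  then show ?case by blast
qed

lemma smooth_real_scaled:
  assumes "smooth_real f"
  shows "((\<lambda>x. M ^ i * (deriv ^^ i) f (M * x)) has_real_derivative M ^ Suc i * (deriv ^^ Suc i) f (M * x)) (at x)"
    and "continuous_on A ((deriv ^^ i) f)"
proof -
  have d: "((deriv ^^ i) f has_real_derivative (deriv ^^ Suc i) f y) (at y)" for y
    using assms unfolding smooth_real_def differentiable_on_def real_differentiable_def[symmetric]
    by (simp add: DERIV_deriv_iff_real_differentiable)
  show "((\<lambda>x. M ^ i * (deriv ^^ i) f (M * x)) has_real_derivative M ^ Suc i * (deriv ^^ Suc i) f (M * x)) (at x)"
  proof -
    have "((\<lambda>x. (deriv ^^ i) f (M * x)) has_real_derivative (deriv ^^ Suc i) f (M * x) * M) (at x)"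
      by (rule DERIV_chain2[OF d]) (auto intro!: derivative_eq_intros)
    from DERIV_cmult[OF this, of "M ^ i"] show ?thesis by (simp add: mult_ac)
  qed
  show "continuous_on A ((deriv ^^ i) f)"
    by (rule continuous_at_imp_continuous_on) (use d DERIV_isCont in blast)
qed

lemma smooth_real_continuous: "smooth_real f \<Longrightarrow> continuous_on A f"
  using smooth_real_scaled(2)[of f A 0] by simp


context nc_torus
begin

text \<open>\<open>v m\<close> plays the role of the Chebyshev polynomial \<open>U\<^sub>m\<close> evaluated at \<open>x / 2\<close>.\<close>

lemma dl_chebyshev_recursion:
  fixes v :: "nat \<Rightarrow> 'a"
  assumes v0: "v 0 = 1" and v1: "v (Suc 0) = x" and vr: "\<And>m. v (Suc (Suc m)) = x * v (Suc m) - v m"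
    and x: "x \<in> Sm" and v: "\<And>m. v m \<in> Sm"
  shows "dl j (v m) = (\<Sum>i<m. v (m - 1 - i) * dl j x * v i)"
proof (induction m rule: less_induct)
  case (less m)
  let ?d = "dl j x"
  define Sg where "Sg m = (\<Sum>i<m. v (m - 1 - i) * ?d * v i)" for m
  consider "m = 0" | "m = Suc 0" | n where "m = Suc (Suc n)" by (metis not0_implies_Suc)
  then show ?case
  proof cases
    case 3
    have "x * Sg (Suc n) = (\<Sum>i<Suc n. x * v (n - i) * ?d * v i)"
      by (simp add: Sg_def sum_distrib_left mult.assoc distrib_left del: sum.lessThan_Suc)
    also have "\<dots> = (\<Sum>i<n. x * v (n - i) * ?d * v i) + x * v 0 * ?d * v n" by simp
    also have "(\<Sum>i<n. x * v (n - i) * ?d * v i) = (\<Sum>i<n. v (Suc n - i) * ?d * v i + v (n - 1 - i) * ?d * v i)"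
    proof (rule sum.cong[OF refl])
      fix i assume "i \<in> {..<n}"
      then obtain k where k: "n - i = Suc k" "Suc n - i = Suc (Suc k)" "n - 1 - i = k"
        using that[of "n - Suc i"] by force
      have "x * v (Suc k) = v (Suc (Suc k)) + v k" using vr[of k] by simp
      then show "x * v (n - i) * ?d * v i = v (Suc n - i) * ?d * v i + v (n - 1 - i) * ?d * v i"
        unfolding k by (simp add: distrib_right)
    qed
    also have "\<dots> = (\<Sum>i<n. v (Suc n - i) * ?d * v i) + Sg n" by (simp add: Sg_def sum.distrib)
    finally have e: "x * Sg (Suc n) = (\<Sum>i<n. v (Suc n - i) * ?d * v i) + Sg n + x * ?d * v n" by (simp add: v0)
    have "dl j (v m) = ?d * v (Suc n) + x * dl j (v (Suc n)) - dl j (v n)"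
      using 3 by (simp add: vr dl_diff dl_mult Sm_mult x v)
    also have "\<dots> = ?d * v (Suc n) + x * Sg (Suc n) - Sg n"
      using less.IH[of "Suc n"] less.IH[of n] 3 by (simp add: Sg_def)
    also have "\<dots> = Sg m" using 3 by (simp add: e) (simp add: Sg_def v0 v1)
    finally show ?thesis by (simp add: Sg_def)
  qed (simp_all add: v0 v1)
qed

context
  fixes h :: 'a
  assumes h: "h \<in> Sm" "adj h = h"
begin

text \<open>The polynomials of the second kind satisfy the hypotheses of \<open>gn_growth\<close>
  with \<rho> = 1; those of the first kind inherit the bound as half the difference of two of
  them.\<close>

lemma chebyshev_growth:
  assumes M: "M \<ge> norm h" "M > 0"
  shows "(\<forall>m. cfc (\<lambda>t. chT m (t / M)) h \<in> Sm) \<and>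
    (\<exists>C e. C \<ge> 0 \<and> (\<forall>m. gn j r (cfc (\<lambda>t. chT m (t / M)) h) \<le> C * (real m + 1) ^ e))"
proof -
  define V where "V m = cfc (\<lambda>t. chU m (t / M)) h" for m
  let ?x = "(2 / M) *\<^sub>R h"
  have r: "t / M \<in> {-1..1}" if "t \<in> real_spec h" for t
    using real_spec_bound[OF that] M by (auto simp: abs_le_iff field_simps)
  have cont: "continuous_on (real_spec h) (\<lambda>t. chU m (t / M))" "continuous_on (real_spec h) (\<lambda>t. chT m (t / M))" for m
    using r M by (auto intro!: continuous_on_compose2[OF continuous_on_chU] continuous_on_compose2[OF continuous_on_chT] continuous_intros)
  have x: "cfc (\<lambda>t. 2 * (t / M)) h = ?x" "?x \<in> Sm"
    using cfc_scaleR[OF h(2), of "\<lambda>t. t" "2 / M"] cfc_ident[OF h(2)] h(1) by (auto intro: Sm_scaleR)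
  have V0: "V 0 = 1" using cfc_const[OF h(2), of 1] by (simp add: V_def)
  have V1: "V (Suc 0) = ?x" unfolding V_def x(1)[symmetric]
    by (rule cfc_cong) (use chT_simps(2)[OF r] in simp)
  have VR: "V (Suc (Suc m)) = ?x * V (Suc m) - V m" for m
  proof -
    have "V (Suc (Suc m)) = cfc (\<lambda>t. (2 * (t / M)) * chU (Suc m) (t / M) - chU m (t / M)) h"
      unfolding V_def by (rule cfc_cong) (use chU_rec[OF r] in simp)
    also have "\<dots> = cfc (\<lambda>t. (2 * (t / M)) * chU (Suc m) (t / M)) h - V m"
      unfolding V_def using M by (intro cfc_diff h continuous_on_mult cont) (auto intro!: continuous_intros)
    also have "cfc (\<lambda>t. (2 * (t / M)) * chU (Suc m) (t / M)) h = ?x * V (Suc m)"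
      unfolding V_def x(1)[symmetric] using M by (intro cfc_mult h cont) (auto intro!: continuous_intros)
    finally show ?thesis .
  qed
  have VS: "V m \<in> Sm" for m
  proof (induction m rule: less_induct)
    case (less m)
    consider "m = 0" | "m = Suc 0" | n where "m = Suc (Suc n)" by (metis not0_implies_Suc)
    then show ?case
    proof cases
      case 3
      then show ?thesis using Sm_diff[OF Sm_mult[OF x(2) less.IH[of "Suc n"]] less.IH[of n]] by (simp only: VR)
    qed (use V0 V1 x in simp_all)
  qed
  have nV: "norm (V m) \<le> (real m + 1) * 1 ^ m" for m
    unfolding V_def using cfc_norm_le[OF h(2) cont(1), of m "real m + 1"] chU_le[OF r] by simp
  from gn_growth[OF VS Sm_dl[OF x(2)] zero_less_one dl_chebyshev_recursion[OF V0 V1 VR x(2) VS, of j] nV, where r=r]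
  obtain C e where C: "C \<ge> 0" "\<And>m. gn j r (V m) \<le> C * (real m + 1) ^ e" by auto
  have W: "cfc (\<lambda>t. chT m (t / M)) h \<in> Sm \<and> gn j r (cfc (\<lambda>t. chT m (t / M)) h) \<le> C * (real m + 1) ^ e" for m
  proof -
    consider "m = 0" | "m = Suc 0" | n where "m = Suc (Suc n)" by (metis not0_implies_Suc)
    then show ?thesis
    proof cases
      case 1
      have "cfc (\<lambda>t. chT m (t / M)) h = V 0" unfolding V_def 1 by (rule cfc_cong) (use chT_simps(1)[OF r] in simp)
      then show ?thesis using C(2)[of 0] VS 1 by simp
    next
      case 2
      have "cfc (\<lambda>t. chT m (t / M)) h = cfc (\<lambda>t. 1/2 * chU (Suc 0) (t / M)) h" unfolding 2
        by (rule cfc_cong) (use chT_simps(2)[OF r] in simp)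
      also have "\<dots> = (1/2) *\<^sub>R V (Suc 0)" unfolding V_def by (intro cfc_scaleR h cont)
      finally have e: "cfc (\<lambda>t. chT m (t / M)) h = (1/2) *\<^sub>R V (Suc 0)" .
      have "gn j r ((1/2) *\<^sub>R V (Suc 0)) = 1/2 * gn j r (V (Suc 0))" by (subst gn_scaleR[OF VS]) simp
      also have "\<dots> \<le> C * (real m + 1) ^ e" using C(2)[of "Suc 0"] gn_nonneg[of j r "V (Suc 0)"] unfolding 2 by linarith
      finally show ?thesis using e VS Sm_scaleR by simp
    next
      case (3 n)
      have "cfc (\<lambda>t. chT m (t / M)) h = cfc (\<lambda>t. 1/2 * (chU m (t / M) - chU n (t / M))) h" unfolding 3
        by (rule cfc_cong) (use chT_half_diff[OF r] in simp)
      also have "\<dots> = (1/2) *\<^sub>R cfc (\<lambda>t. chU m (t / M) - chU n (t / M)) h"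
        by (intro cfc_scaleR h continuous_on_diff cont)
      also have "cfc (\<lambda>t. chU m (t / M) - chU n (t / M)) h = V m - V n"
        unfolding V_def by (intro cfc_diff h cont)
      finally have e: "cfc (\<lambda>t. chT m (t / M)) h = (1/2) *\<^sub>R (V m + (-1) *\<^sub>R V n)" by simp
      have "gn j r ((1/2) *\<^sub>R (V m + (-1) *\<^sub>R V n)) = 1/2 * gn j r (V m + (-1) *\<^sub>R V n)"
        by (subst gn_scaleR) (auto intro: Sm_add Sm_diff Sm_minus VS)
      also have "\<dots> \<le> 1/2 * (gn j r (V m) + gn j r (V n))"
        using gn_add[OF VS Sm_scaleR[OF VS], of j r m "-1" n] gn_scaleR[OF VS, of j r "-1" n] by simp
      also have "\<dots> \<le> C * (real m + 1) ^ e"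
      proof -
        have "C * (real n + 1) ^ e \<le> C * (real m + 1) ^ e" using 3 C by (intro mult_left_mono power_mono) auto
        from add_mono[OF C(2)[of m] order_trans[OF C(2)[of n] this]] show ?thesis by simp
      qed
      finally show ?thesis using e VS Sm_scaleR Sm_diff by simp
    qed
  qed
  then show ?thesis using C(1) by blast
qed

text \<open>After scaling the spectrum into [-1,1], polynomials that approximate f with R
  derivatives have Chebyshev coefficients of size (m + 1)^(-R), uniformly along the sequence. This
  beats the growth (m + 1)^e of the graph norms, so \<open>Sm_limI_gn\<close> applies.\<close>

lemma Sm_cfc_smooth:
  assumes f: "smooth_real f" shows "cfc f h \<in> Sm"
proof (rule Sm_limI_gn)
  fix r
  define M where "M = norm h + 1"
  have M: "M \<ge> norm h" "M > 0" by (auto simp: M_def add_nonneg_pos)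
  have rs: "t / M \<in> {-1..1}" if "t \<in> real_spec h" for t
    using real_spec_bound[OF that] M by (auto simp: abs_le_iff field_simps)
  have WS: "cfc (\<lambda>t. chT m (t / M)) h \<in> Sm" for m using chebyshev_growth[OF M] by blast
  obtain C1 e1 where 1: "C1 \<ge> 0" "\<And>m. gn 1 r (cfc (\<lambda>t. chT m (t / M)) h) \<le> C1 * (real m + 1) ^ e1"
    using chebyshev_growth[OF M, of 1 r] by blast
  obtain C2 e2 where 2: "C2 \<ge> 0" "\<And>m. gn 2 r (cfc (\<lambda>t. chT m (t / M)) h) \<le> C2 * (real m + 1) ^ e2"
    using chebyshev_growth[OF M, of 2 r] by blast
  define C where "C = max C1 C2" define e where "e = max e1 e2"
  have C0: "C \<ge> 0" using 1 by (simp add: C_def)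
  have gC: "gn j r (cfc (\<lambda>t. chT m (t / M)) h) \<le> C * (real m + 1) ^ e" for j m
  proof -
    have "C1 * (real m + 1) ^ e1 \<le> C * (real m + 1) ^ e" "C2 * (real m + 1) ^ e2 \<le> C * (real m + 1) ^ e"
      unfolding C_def e_def using 1(1) 2(1) by (intro mult_mono power_increasing; simp)+
    then show ?thesis using 1(2)[of m] 2(2)[of m] exhaust_2[of j] by (metis order_trans)
  qed
  \<comment> \<open>Beyond the growth exponent e, two more derivatives leave the summable factor (m
    + 1)^(-2).\<close>
  define R where "R = e + 2"
  let ?F = "\<lambda>i x. M ^ i * (deriv ^^ i) f (M * x)"
  have cF: "continuous_on {-1..1} (?F i)" for i
    by (intro continuous_intros continuous_on_compose2[OF smooth_real_scaled(2)[OF f, of UNIV]]) auto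
  have "\<forall>n. \<exists>p. \<forall>i\<le>R. \<forall>x\<in>{-1..1}. \<bar>poly ((pderiv ^^ i) p) x - ?F i x\<bar> \<le> 1 / real (Suc (Suc n))"
    by (intro allI poly_approx_derivs smooth_real_scaled(1)[OF f] cF) simp
  then obtain p where p: "\<And>n i x. i \<le> R \<Longrightarrow> x \<in> {-1..1} \<Longrightarrow> \<bar>poly ((pderiv ^^ i) (p n)) x - ?F i x\<bar> \<le> 1 / real (Suc (Suc n))"
    by metis
  have "\<exists>B. \<forall>i\<le>R. \<forall>x\<in>{-1..1}. \<bar>?F i x\<bar> \<le> B"
  proof -
    have "\<forall>i. \<exists>B. \<forall>x\<in>{-1..1}. \<bar>?F i x\<bar> \<le> B"
      using compact_imp_bounded[OF compact_continuous_image[OF cF]] by (auto simp: bounded_iff)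
    then obtain B where B: "\<And>i x. x \<in> {-1..1} \<Longrightarrow> \<bar>?F i x\<bar> \<le> B i" by metis
    have "\<bar>?F i x\<bar> \<le> (\<Sum>i\<le>R. \<bar>B i\<bar>)" if "i \<le> R" "x \<in> {-1..1}" for i x
      using B[OF that(2), of i] member_le_sum[of i "{..R}" "\<lambda>i. \<bar>B i\<bar>"] that(1) by simp
    then show ?thesis by blast
  qed
  then obtain B where B: "\<And>i x. i \<le> R \<Longrightarrow> x \<in> {-1..1} \<Longrightarrow> \<bar>?F i x\<bar> \<le> B" by blast
  have pB: "\<bar>poly ((pderiv ^^ i) (p n)) x\<bar> \<le> B + 1" if "i \<le> R" "x \<in> {-1..1}" for i x n
  proof -
    have "1 / real (Suc (Suc n)) \<le> 1" by simp
    then show ?thesis using p[OF that, of n] B[OF that] by linarith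
  qed
  obtain D where D: "D \<ge> 0" "\<And>n m. \<bar>chI m (p n)\<bar> * (real m + 1) ^ R \<le> D * (B + 1)"
    using chI_decay[of R] pB by blast
  have BD: "D * (B + 1) \<ge> 0" using D(2)[of 0 0] by (smt (verit) abs_ge_zero mult_nonneg_nonneg of_nat_0_le_iff zero_le_power)
  define y where "y n = cfc (\<lambda>t. poly (p n) (t / M)) h" for n
  have cp: "continuous_on (real_spec h) (\<lambda>t. poly (p n) (t / M))" for n using M by (intro continuous_intros) auto
  have yS: "y n \<in> Sm \<and> gn j r (y n) \<le> C * (D * (B + 1)) * 2" for n j
  proof -
    obtain c N where c: "\<And>x. x \<in> {-1..1} \<Longrightarrow> poly (p n) x = (\<Sum>m<N. c m * chT m x)" "\<And>m. \<bar>c m\<bar> \<le> \<bar>chI m (p n)\<bar>"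
      using ch_expansion by blast
    let ?W = "\<lambda>m. cfc (\<lambda>t. chT m (t / M)) h"
    have cW: "continuous_on (real_spec h) (\<lambda>t. chT m (t / M))" for m
      using rs M by (auto intro!: continuous_on_compose2[OF continuous_on_chT] continuous_intros)
    have "cfc (\<lambda>t. \<Sum>m<k. c m * chT m (t / M)) h = (\<Sum>m<k. c m *\<^sub>R ?W m)" for k
    proof (induction k)
      case 0
      then show ?case using cfc_const[OF h(2), of 0] by simp
    next
      case (Suc k)
      have "cfc (\<lambda>t. (\<Sum>m<k. c m * chT m (t / M)) + c k * chT k (t / M)) h
          = cfc (\<lambda>t. \<Sum>m<k. c m * chT m (t / M)) h + cfc (\<lambda>t. c k * chT k (t / M)) h"
        by (intro cfc_add h continuous_on_sum continuous_on_mult continuous_on_const cW)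
      then show ?case using Suc cfc_scaleR[OF h(2) cW, of "c k" k] by simp
    qed
    moreover have "y n = cfc (\<lambda>t. \<Sum>m<N. c m * chT m (t / M)) h" unfolding y_def by (rule cfc_cong) (use c(1)[OF rs] in simp)
    ultimately have y: "y n = (\<Sum>m<N. c m *\<^sub>R ?W m)" by simp
    have "gn j r (y n) \<le> (\<Sum>m<N. gn j r (c m *\<^sub>R ?W m))" unfolding y by (intro gn_sum Sm_scaleR WS)
    also have "\<dots> \<le> (\<Sum>m<N. C * (D * (B + 1)) * (1 / (real m + 1) ^ 2))"
    proof (rule sum_mono)
      fix m
      have pos: "(real m + 1) ^ 2 > 0" by (simp add: add_nonneg_pos)
      have "\<bar>c m\<bar> * (real m + 1) ^ e * (real m + 1) ^ 2 \<le> \<bar>chI m (p n)\<bar> * (real m + 1) ^ R"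
        using mult_right_mono[OF c(2)[of m], of "(real m + 1) ^ R"] by (simp add: R_def power_add mult.assoc power2_eq_square)
      then have "\<bar>c m\<bar> * (real m + 1) ^ e \<le> D * (B + 1) * (1 / (real m + 1) ^ 2)"
        using D(2)[of m n] pos by (simp add: pos_le_divide_eq)
      then have "C * (\<bar>c m\<bar> * (real m + 1) ^ e) \<le> C * (D * (B + 1) * (1 / (real m + 1) ^ 2))"
        by (intro mult_left_mono C0)
      moreover have "gn j r (c m *\<^sub>R ?W m) \<le> \<bar>c m\<bar> * (C * (real m + 1) ^ e)"
        unfolding gn_scaleR[OF WS] by (intro mult_left_mono gC) auto
      ultimately show "gn j r (c m *\<^sub>R ?W m) \<le> C * (D * (B + 1)) * (1 / (real m + 1) ^ 2)" by (simp add: mult_ac)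
    qed
    also have "\<dots> = C * (D * (B + 1)) * (\<Sum>m<N. 1 / (real m + 1) ^ 2)" by (simp add: sum_distrib_left)
    also have "\<dots> \<le> C * (D * (B + 1)) * 2"
    proof (rule mult_left_mono)
      have "(\<Sum>m<N. 1 / (real m + 1) ^ 2) \<le> (\<Sum>m\<le>N. 1 / (1 + real m) ^ 2)"
        by (simp add: add.commute) (intro sum_mono2; auto)
      moreover have "0 \<le> 1 / (1 + real N)" by simp
      ultimately show "(\<Sum>m<N. 1 / (real m + 1) ^ 2) \<le> 2" using sum_inverse_squares[of N] by linarith
    qed (use C0 BD in simp)
    finally show ?thesis unfolding y by (auto intro: Sm_sum Sm_scaleR WS)
  qed
  have "(\<lambda>n. y n - cfc f h) \<longlonglongrightarrow> 0"
  proof (rule Lim_null_comparison[OF always_eventually LIMSEQ_inverse_real_of_nat], intro allI)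
    fix n
    show "norm (y n - cfc f h) \<le> inverse (real (Suc n))"
      unfolding y_def
    proof (rule cfc_dist_le[OF h(2) cp smooth_real_continuous[OF f]])
      fix t assume t: "t \<in> real_spec h"
      have "\<bar>poly (p n) (t / M) - f t\<bar> \<le> 1 / real (Suc (Suc n))" using p[of 0, OF _ rs[OF t], of n] M by simp
      also have "\<dots> \<le> inverse (real (Suc n))" by (simp add: inverse_eq_divide frac_le)
      finally show "\<bar>poly (p n) (t / M) - f t\<bar> \<le> inverse (real (Suc n))" .
    qed
  qed
  then have "y \<longlonglongrightarrow> cfc f h" by (rule LIM_zero_cancel)
  then show "\<exists>y C. y \<longlonglongrightarrow> cfc f h \<and> (\<forall>i. y i \<in> Sm \<and> gn 1 r (y i) \<le> C \<and> gn 2 r (y i) \<le> C)"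
    using yS by blast
qed

text \<open>Off the spectrum f may vanish or change sign, so its power need not be smooth on the
  line and \<open>Sm_cfc_smooth\<close> is not applicable. Instead f / M = 1 + g with |g| \<le>
  \<rho> < 1 on the spectrum, and the binomial series in the smooth element g(h) is summed.\<close>

lemma Sm_cfc_powr:
  assumes f: "continuous_on (real_spec h) f" and pos: "\<And>t. t \<in> real_spec h \<Longrightarrow> f t > 0" and S: "cfc f h \<in> Sm"
  shows "cfc (\<lambda>t. f t powr a) h \<in> Sm"
proof -
  have ne: "real_spec h \<noteq> {}" using real_spec_nonempty[OF h(2)] .
  obtain t1 where t1: "t1 \<in> real_spec h" "\<And>t. t \<in> real_spec h \<Longrightarrow> f t \<le> f t1"
    using continuous_attains_sup[OF compact_real_spec ne f] by blast
  obtain t0 where t0: "t0 \<in> real_spec h" "\<And>t. t \<in> real_spec h \<Longrightarrow> f t0 \<le> f t"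
    using continuous_attains_inf[OF compact_real_spec ne f] by blast
  \<comment> \<open>M is the maximum of f on the spectrum. The lower bound 1/2 for \<rho> keeps it
    positive when f is constant there.\<close>
  define M where "M = f t1" define \<rho> where "\<rho> = max (1 - f t0 / M) (1/2)"
  have M: "M > 0" "f t0 > 0" using pos t0 t1 by (auto simp: M_def)
  have \<rho>: "0 < \<rho>" "\<rho> < 1" using M by (auto simp: \<rho>_def)
  let ?g = "\<lambda>t. f t / M - 1"
  have g: "\<bar>?g t\<bar> \<le> \<rho>" if "t \<in> real_spec h" for t
  proof -
    have "f t0 / M \<le> f t / M" "f t / M \<le> 1" using t0(2)[OF that] t1(2)[OF that] M by (auto simp: M_def divide_right_mono)
    then show ?thesis by (simp add: \<rho>_def)
  qed
  have cg: "continuous_on (real_spec h) ?g" using f M by (intro continuous_intros) auto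
  let ?x = "cfc ?g h"
  have "?x = (1/M) *\<^sub>R cfc f h - 1"
    using cfc_diff[OF h(2), of "\<lambda>t. (1/M) * f t" "\<lambda>_. 1"] cfc_scaleR[OF h(2) f, of "1/M"] cfc_const[OF h(2), of 1] f
    by (simp add: continuous_on_divide M less_imp_neq[OF M(1), symmetric])
  then have xS: "?x \<in> Sm" using S by (simp add: Sm_diff Sm_scaleR)
  have xn: "norm ?x \<le> \<rho>" by (rule cfc_norm_le[OF h(2) cg g])
  have xp: "?x ^ n = cfc (\<lambda>t. ?g t ^ n) h" for n
  proof (induction n)
    case 0
    show ?case using cfc_const[OF h(2), of 1] by simp
  next
    case (Suc n)
    have "cfc (\<lambda>t. ?g t * ?g t ^ n) h = ?x * cfc (\<lambda>t. ?g t ^ n) h"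
      by (rule cfc_mult[OF h(2) cg]) (intro continuous_intros cg)
    then show ?case by (simp add: Suc)
  qed
  let ?b = "\<lambda>n. a gchoose n"
  have sb: "summable (\<lambda>m. \<bar>?b m\<bar> * (real m + 1) ^ e * \<rho> ^ m)" for e
  proof -
    \<comment> \<open>Convergence of the binomial series at s bounds its terms by a constant K; the
      other factor s^m of \<rho>^m remains to absorb the polynomial.\<close>
    define s where "s = sqrt \<rho>"
    have s: "0 < s" "s < 1" "s * s = \<rho>" using \<rho> by (auto simp: s_def)
    have "summable (\<lambda>n. ?b n * s ^ n)" using gen_binomial_real[of s a] s sums_summable by auto
    then have "(\<lambda>n. ?b n * s ^ n) \<longlonglongrightarrow> 0" by (rule summable_LIMSEQ_zero)
    from convergent_imp_Bseq[OF convergentI[OF this]] obtain K where "\<forall>n. norm (?b n * s ^ n) \<le> K" by (rule BseqE)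
    then have K: "norm (?b n * s ^ n) \<le> K" for n by blast
    show ?thesis
    proof (rule summable_comparison_test[OF exI[of _ 0]])
      show "summable (\<lambda>m. K * ((real m + 1) ^ e * s ^ m))" using s by (intro summable_mult summable_poly_geometric)
      show "\<forall>n\<ge>0. norm (\<bar>?b n\<bar> * (real n + 1) ^ e * \<rho> ^ n) \<le> K * ((real n + 1) ^ e * s ^ n)"
      proof (intro allI impI)
        fix n
        have "norm (\<bar>?b n\<bar> * (real n + 1) ^ e * \<rho> ^ n) = norm (?b n * s ^ n) * ((real n + 1) ^ e * s ^ n)"
          using s by (simp add: abs_mult power_mult_distrib flip: s(3))
        also have "\<dots> \<le> K * ((real n + 1) ^ e * s ^ n)" using K s by (intro mult_right_mono) auto
        finally show "norm (\<bar>?b n\<bar> * (real n + 1) ^ e * \<rho> ^ n) \<le> K * ((real n + 1) ^ e * s ^ n)" .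
      qed
    qed
  qed
  have sb0: "summable (\<lambda>m. \<bar>?b m\<bar> * \<rho> ^ m)" using sb[of 0] by simp
  let ?G = "\<lambda>t. (1 + ?g t) powr a"
  have cG: "continuous_on (real_spec h) ?G"
  proof (rule continuous_on_powr)
    show "\<forall>t\<in>real_spec h. 1 + ?g t \<noteq> 0" using pos M by force
  qed (intro continuous_intros cg)+
  have part: "(\<Sum>m<N. ?b m *\<^sub>R ?x ^ m) = cfc (\<lambda>t. \<Sum>m<N. ?b m * ?g t ^ m) h" for N
  proof (induction N)
    case 0
    show ?case using cfc_const[OF h(2), of 0] by simp
  next
    case (Suc N)
    have "cfc (\<lambda>t. (\<Sum>m<N. ?b m * ?g t ^ m) + ?b N * ?g t ^ N) h = cfc (\<lambda>t. \<Sum>m<N. ?b m * ?g t ^ m) h + cfc (\<lambda>t. ?b N * ?g t ^ N) h"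
      by (intro cfc_add h continuous_intros cg)
    moreover have "cfc (\<lambda>t. ?b N * ?g t ^ N) h = ?b N *\<^sub>R ?x ^ N"
      unfolding xp by (intro cfc_scaleR h continuous_intros cg)
    ultimately show ?case by (simp add: Suc)
  qed
  have "(\<lambda>m. ?b m *\<^sub>R ?x ^ m) sums cfc ?G h"
    unfolding sums_def
  proof (rule LIM_zero_cancel, rule Lim_null_comparison[OF always_eventually], intro allI)
    have "(\<lambda>N. (\<Sum>m. \<bar>?b m\<bar> * \<rho> ^ m) - (\<Sum>m<N. \<bar>?b m\<bar> * \<rho> ^ m)) \<longlonglongrightarrow> (\<Sum>m. \<bar>?b m\<bar> * \<rho> ^ m) - (\<Sum>m. \<bar>?b m\<bar> * \<rho> ^ m)"
      by (intro tendsto_intros summable_LIMSEQ sb0)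
    then show "(\<lambda>N. (\<Sum>m. \<bar>?b m\<bar> * \<rho> ^ m) - (\<Sum>m<N. \<bar>?b m\<bar> * \<rho> ^ m)) \<longlonglongrightarrow> 0" by simp
    fix N
    show "norm ((\<Sum>m<N. ?b m *\<^sub>R ?x ^ m) - cfc ?G h) \<le> (\<Sum>m. \<bar>?b m\<bar> * \<rho> ^ m) - (\<Sum>m<N. \<bar>?b m\<bar> * \<rho> ^ m)"
      unfolding part
    proof (rule cfc_dist_le[OF h(2) _ cG])
      show "continuous_on (real_spec h) (\<lambda>t. \<Sum>m<N. ?b m * ?g t ^ m)" by (intro continuous_intros cg)
      fix t assume t: "t \<in> real_spec h"
      have "(\<lambda>n. ?b n * ?g t ^ n) sums ?G t" using gen_binomial_real[of "?g t" a] g[OF t] \<rho> by simp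
      then have s: "summable (\<lambda>n. ?b n * ?g t ^ n)" "?G t = (\<Sum>n. ?b n * ?g t ^ n)" by (auto simp: sums_iff)
      have le: "norm (?b n * ?g t ^ n) \<le> \<bar>?b n\<bar> * \<rho> ^ n" for n
        using power_mono[OF g[OF t] abs_ge_zero, of n] by (simp add: abs_mult power_abs mult_left_mono)
      have "?G t - (\<Sum>n<N. ?b n * ?g t ^ n) = (\<Sum>n. ?b (n + N) * ?g t ^ (n + N))"
        unfolding s(2) using suminf_minus_initial_segment[OF s(1), of N] by simp
      then have "\<bar>(\<Sum>n<N. ?b n * ?g t ^ n) - ?G t\<bar> = norm (\<Sum>n. ?b (n + N) * ?g t ^ (n + N))" by (simp add: abs_minus_commute)
      also have "\<dots> \<le> (\<Sum>n. \<bar>?b (n + N)\<bar> * \<rho> ^ (n + N))"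
        by (rule norm_suminf_le[OF le]) (use sb0 summable_ignore_initial_segment in blast)
      also have "\<dots> = (\<Sum>m. \<bar>?b m\<bar> * \<rho> ^ m) - (\<Sum>m<N. \<bar>?b m\<bar> * \<rho> ^ m)"
        by (rule suminf_minus_initial_segment[OF sb0])
      finally show "\<bar>(\<Sum>m<N. ?b m * ?g t ^ m) - ?G t\<bar> \<le> (\<Sum>m. \<bar>?b m\<bar> * \<rho> ^ m) - (\<Sum>m<N. \<bar>?b m\<bar> * \<rho> ^ m)" .
    qed
  qed
  from Sm_power_series[OF xS xn \<rho>(1) sb this] have GS: "cfc ?G h \<in> Sm" .
  have "cfc (\<lambda>t. f t powr a) h = cfc (\<lambda>t. M powr a * ?G t) h"
    by (rule cfc_cong) (use M pos in \<open>simp add: powr_divide less_imp_le\<close>)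
  also have "\<dots> = M powr a *\<^sub>R cfc ?G h" by (rule cfc_scaleR[OF h(2) cG])
  finally show ?thesis using GS by (simp add: Sm_scaleR)
qed

end
end

subsection \<open>Differential expressions\<close>

text \<open>Symbols are handled as syntactic expressions in the path parameter \<open>Sig\<close>, the spectral
  parameter \<open>Lam\<close> and the covectors \<open>Xi i\<close>, so that the partial derivatives \<open>Dv\<close> and the derivations
  \<open>dx\<close> are total operations satisfying the Leibniz rule by definition.\<close>

datatype var = Sig | Lam | Xi 2

datatype 'a ex = Cst 'a | Vr var | Iv "'a ex" | Pl "'a ex" "'a ex" (infixl "\<oplus>" 65) | Ti "'a ex" "'a ex" (infixl "\<otimes>" 70)

abbreviation Ng :: "'a::cstar_algebra ex \<Rightarrow> 'a ex" where "Ng e \<equiv> Cst (-1) \<otimes> e"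

primrec ev :: "'a::cstar_algebra ex \<Rightarrow> (var \<Rightarrow> complex) \<Rightarrow> 'a" where
  "ev (Cst a) z = a"
| "ev (Vr v) z = z v *\<^sub>C 1"
| "ev (Iv e) z = alg_inv (ev e z)"
| "ev (e \<oplus> f) z = ev e z + ev f z"
| "ev (e \<otimes> f) z = ev e z * ev f z"

text \<open>\<open>alg_inv\<close> is total, so the points at which all inverted subexpressions
  really are invertible have to be recorded separately.\<close>

primrec dm :: "'a::cstar_algebra ex \<Rightarrow> (var \<Rightarrow> complex) \<Rightarrow> bool" where
  "dm (Cst a) z \<longleftrightarrow> True"
| "dm (Vr v) z \<longleftrightarrow> True"
| "dm (Iv e) z \<longleftrightarrow> dm e z \<and> alg_invertible (ev e z)"
| "dm (e \<oplus> f) z \<longleftrightarrow> dm e z \<and> dm f z"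
| "dm (e \<otimes> f) z \<longleftrightarrow> dm e z \<and> dm f z"

primrec Dv :: "var \<Rightarrow> 'a::cstar_algebra ex \<Rightarrow> 'a ex" where
  "Dv v (Cst a) = Cst 0"
| "Dv v (Vr w) = Cst (if v = w then 1 else 0)"
| "Dv v (Iv e) = Ng (Iv e \<otimes> Dv v e \<otimes> Iv e)"
| "Dv v (e \<oplus> f) = Dv v e \<oplus> Dv v f"
| "Dv v (e \<otimes> f) = Dv v e \<otimes> f \<oplus> e \<otimes> Dv v f"

lemma dm_Dv [simp]: "dm e z \<Longrightarrow> dm (Dv v e) z"
  by (induction e) auto

lemma ev_Dv_commute: "ev (Dv v (Dv w e)) z = ev (Dv w (Dv v e)) z"
  by (induction e) (simp_all add: algebra_simps)

lemma ev_tendsto: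
  assumes "\<And>v. ((\<lambda>t. f t v) \<longlongrightarrow> z v) F" "dm e z"
  shows "eventually (\<lambda>t. dm e (f t)) F \<and> ((\<lambda>t. ev e (f t)) \<longlongrightarrow> ev e z) F"
  using assms(2)
proof (induction e)
  case (Iv e)
  then have e: "eventually (\<lambda>t. dm e (f t)) F" "((\<lambda>t. ev e (f t)) \<longlongrightarrow> ev e z) F" "alg_invertible (ev e z)" by auto
  show ?case using tendsto_alg_inv[OF e(2,3)] eventually_conj[OF e(1)] by simp
qed (auto intro!: tendsto_intros scaleC.tendsto assms(1) eventually_conj)

lemma ev_continuous:
  assumes "\<And>v. continuous_on T (\<lambda>t. f t v)" "\<And>t. t \<in> T \<Longrightarrow> dm e (f t)"
  shows "continuous_on T (\<lambda>t. ev e (f t))"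
  unfolding continuous_on_def
proof
  fix t assume "t \<in> T"
  then show "((\<lambda>t. ev e (f t)) \<longlongrightarrow> ev e (f t)) (at t within T)"
    using ev_tendsto[of f "f t" "at t within T" e] assms by (auto simp: continuous_on_def)
qed

lemma has_derivative_alg_inv:
  fixes x :: "'a::cstar_algebra"
  assumes "alg_invertible x"
  shows "(alg_inv has_derivative (\<lambda>h. - (alg_inv x * h * alg_inv x))) (at x)"
  unfolding has_derivative_at2
proof (intro conjI)
  let ?y = "alg_inv x"
  show "bounded_linear (\<lambda>h. - (?y * h * ?y))"
    by (intro bounded_linear_minus bounded_linear_mult_left[THEN bounded_linear_compose] bounded_linear_mult_right)
  have t: "((\<lambda>x. x) \<longlongrightarrow> x) (at x)" by (rule tendsto_ident_at)
  note ti = tendsto_alg_inv[OF t assms]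
  have "((\<lambda>x'. norm (?y - alg_inv x') * norm ?y) \<longlongrightarrow> norm (?y - ?y) * norm ?y) (at x)"
    by (intro tendsto_intros ti)
  then have l: "((\<lambda>x'. norm (?y - alg_inv x') * norm ?y) \<longlongrightarrow> 0) (at x)" by simp
  show "((\<lambda>x'. (1 / norm (x' - x)) *\<^sub>R (alg_inv x' - (alg_inv x + - (?y * (x' - x) * ?y)))) \<longlongrightarrow> 0) (at x)"
  proof (rule Lim_null_comparison[OF _ l])
    show "\<forall>\<^sub>F x' in at x. norm ((1 / norm (x' - x)) *\<^sub>R (alg_inv x' - (alg_inv x + - (?y * (x' - x) * ?y)))) \<le> norm (?y - alg_inv x') * norm ?y"
      using ti(1) eventually_neq_at_within[of x x UNIV]
    proof eventually_elim
      case (elim x')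
      have "(?y - alg_inv x') * (x' - x) * ?y = alg_inv x' - (alg_inv x + - (?y * (x' - x) * ?y))"
        using assms elim(1) by (simp add: left_diff_distrib right_diff_distrib mult.assoc alg_inv_mult_assoc)
      moreover have "norm ((?y - alg_inv x') * (x' - x) * ?y) \<le> norm (?y - alg_inv x') * norm (x' - x) * norm ?y"
        by (meson mult_right_mono norm_ge_zero norm_mult_ineq order_trans)
      ultimately show ?case using elim(2) by (simp add: divide_le_eq mult_ac)
    qed
  qed
qed

lemma ev_has_derivative:
  "dm e z \<Longrightarrow> ((\<lambda>w. ev e (z(v := w))) has_derivative (\<lambda>h. h *\<^sub>C ev (Dv v e) z)) (at (z v))"
proof (induction e)
  case (Cst a)
  then show ?case by (simp add: scaleC.zero_right)
next
  case (Vr w)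
  have "((\<lambda>t. t *\<^sub>C (1::'a)) has_derivative (\<lambda>h. h *\<^sub>C 1)) (at (z v))"
    by (rule bounded_linear_imp_has_derivative[OF scaleC.bounded_linear_left])
  then show ?case by (cases "v = w") (simp_all add: scaleC.zero_right)
next
  case (Iv e)
  then have d: "dm e z" "alg_invertible (ev e z)" by simp_all
  note e = Iv.IH[OF d(1)] d(2)
  have "(alg_inv has_derivative (\<lambda>h. - (alg_inv (ev e z) * h * alg_inv (ev e z)))) (at (ev e (z(v := z v))))"
    using has_derivative_alg_inv[OF e(2)] by simp
  from has_derivative_compose[OF e(1) this] show ?case
    by (simp add: mult_scaleC_left mult_scaleC_right scaleC.minus_right mult.assoc)
next
  case (Pl e f)
  then show ?case by (auto simp: scaleC.add_right intro!: has_derivative_add)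
next
  case (Ti e f)
  then have d: "dm e z" "dm f z" by simp_all
  have "((\<lambda>w. ev e (z(v := w)) * ev f (z(v := w))) has_derivative
     (\<lambda>h. ev e (z(v := z v)) * (h *\<^sub>C ev (Dv v f) z) + (h *\<^sub>C ev (Dv v e) z) * ev f (z(v := z v)))) (at (z v))"
    by (intro has_derivative_mult Ti.IH d)
  then show ?case by (simp add: scaleC.add_right mult_scaleC_left mult_scaleC_right add.commute fun_upd_def)
qed

text \<open>A formal derivative depends only on values near the point. The difference of the two
  values vanishes on T, so the remainder quotient has constant norm there, namely the norm of the
  difference of the derivatives, and must tend to 0. As the derivative is complex linear, approach
  along a real line suffices.\<close>

lemma ev_Dv_cong:
  assumes eq: "\<And>z. z \<in> T \<Longrightarrow> ev e z = ev f z" and d: "dm e z" "dm f z" and z: "z \<in> T"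
    and lim: "z v islimpt {w. z(v := w) \<in> T}"
  shows "ev (Dv v e) z = ev (Dv v f) z"
proof -
  let ?A = "{w. z(v := w) \<in> T}"
  let ?D = "\<lambda>w. ev e (z(v := w)) - ev f (z(v := w))" and ?c = "ev (Dv v e) z - ev (Dv v f) z"
  have "(?D has_derivative (\<lambda>h. h *\<^sub>C ?c)) (at (z v))"
    using has_derivative_diff[OF ev_has_derivative[OF d(1), of v] ev_has_derivative[OF d(2), of v]] by (simp add: scaleC.diff_right)
  then have "((\<lambda>y. (1 / norm (y - z v)) *\<^sub>R (?D y - (?D (z v) + (y - z v) *\<^sub>C ?c))) \<longlongrightarrow> 0) (at (z v))"
    unfolding has_derivative_at2 by blast
  then have "((\<lambda>y. (1 / norm (y - z v)) *\<^sub>R (?D y - (?D (z v) + (y - z v) *\<^sub>C ?c))) \<longlongrightarrow> 0) (at (z v) within ?A)"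
    by (rule tendsto_within_subset) simp
  then have "((\<lambda>y. norm ((1 / norm (y - z v)) *\<^sub>R (?D y - (?D (z v) + (y - z v) *\<^sub>C ?c)))) \<longlongrightarrow> 0) (at (z v) within ?A)"
    by (rule tendsto_norm_zero)
  moreover have "\<forall>\<^sub>F y in at (z v) within ?A. norm ((1 / norm (y - z v)) *\<^sub>R (?D y - (?D (z v) + (y - z v) *\<^sub>C ?c))) = norm ?c"
    unfolding eventually_at_filter using eq z by (auto simp: norm_scaleC intro!: always_eventually)
  ultimately have "((\<lambda>y. norm ?c) \<longlongrightarrow> 0) (at (z v) within ?A)" using Lim_transform_eventually by fastforce
  moreover have "at (z v) within ?A \<noteq> bot" using lim by (simp add: trivial_limit_within)
  ultimately have "norm ?c = 0" using tendsto_const_iff by blast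
  then show ?thesis by simp
qed

text \<open>\<open>Lam\<close> has weight two because it is subtracted from a quadratic symbol. The
  zero constant is given every degree, since differentiation produces it in all degrees.\<close>

inductive hm :: "'a::cstar_algebra ex \<Rightarrow> int \<Rightarrow> bool" where
  hm_Cst: "hm (Cst a) 0"
| hm_0: "hm (Cst 0) d"
| hm_Xi: "hm (Vr (Xi i)) 1"
| hm_Lam: "hm (Vr Lam) 2"
| hm_Sig: "hm (Vr Sig) 0"
| hm_Iv: "hm e d \<Longrightarrow> hm (Iv e) (- d)"
| hm_Pl: "hm e d \<Longrightarrow> hm f d \<Longrightarrow> hm (e \<oplus> f) d"
| hm_Ti: "hm e d \<Longrightarrow> hm f d' \<Longrightarrow> hm (e \<otimes> f) (d + d')"

definition scl :: "complex \<Rightarrow> (var \<Rightarrow> complex) \<Rightarrow> var \<Rightarrow> complex" where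
  "scl r z v = (case v of Sig \<Rightarrow> z Sig | Lam \<Rightarrow> r\<^sup>2 * z Lam | Xi i \<Rightarrow> r * z (Xi i))"

fun vdeg :: "var \<Rightarrow> int" where "vdeg Sig = 0" | "vdeg Lam = 2" | "vdeg (Xi i) = 1"

lemma hm_scale:
  assumes "hm e d" "r \<noteq> 0" "dm e z"
  shows "dm e (scl r z) \<and> ev e (scl r z) = (r powi d) *\<^sub>C ev e z"
  using assms
proof (induction rule: hm.induct)
  case (hm_Iv e d)
  then have e: "dm e (scl r z)" "ev e (scl r z) = (r powi d) *\<^sub>C ev e z" "alg_invertible (ev e z)" by auto
  have "r powi d \<noteq> 0" using hm_Iv by simp
  from alg_invertible_scaleC[OF e(3) this] e show ?case by (simp add: power_int_minus)
next
  case (hm_Ti e d f d')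
  then show ?case by (simp add: mult_scaleC_left mult_scaleC_right scaleC_scaleC power_int_add mult.commute)
qed (auto simp: scl_def scaleC.zero_right scaleC_scaleC scaleC.add_right)

lemma hm_cong: "hm e d \<Longrightarrow> d = d' \<Longrightarrow> hm e d'" by simp

lemma hm_Ng: "hm e d \<Longrightarrow> hm (Ng e) d"
  using hm_Ti[OF hm_Cst] by force

lemma hm_Dv: "hm e d \<Longrightarrow> hm (Dv v e) (d - vdeg v)"
proof (induction rule: hm.induct)
  case (hm_Xi i)
  show ?case by (cases "v = Xi i") (auto intro: hm.intros hm_cong[OF hm_Cst])
next
  case hm_Lam
  show ?case by (cases "v = Lam") (auto intro: hm.intros hm_cong[OF hm_Cst])
next
  case hm_Sig
  show ?case by (cases "v = Sig") (auto intro: hm.intros hm_cong[OF hm_Cst])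
next
  case (hm_Iv e d)
  have "hm (Iv e \<otimes> Dv v e \<otimes> Iv e) ((- d + (d - vdeg v)) + - d)" by (intro hm.intros hm_Iv)
  then show ?case by (auto intro!: hm_Ng elim!: hm_cong)
next
  case (hm_Ti e d f d')
  have "hm (Dv v e \<otimes> f) ((d - vdeg v) + d')" "hm (e \<otimes> Dv v f) (d + (d' - vdeg v))" by (intro hm.intros hm_Ti)+
  then show ?case by (auto intro!: hm_Pl elim!: hm_cong)
qed (auto intro: hm.intros)

context nc_torus
begin

primrec cs :: "'a ex \<Rightarrow> bool" where
  "cs (Cst a) \<longleftrightarrow> a \<in> Sm"
| "cs (Vr v) \<longleftrightarrow> True"
| "cs (Iv e) \<longleftrightarrow> cs e"
| "cs (e \<oplus> f) \<longleftrightarrow> cs e \<and> cs f"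
| "cs (e \<otimes> f) \<longleftrightarrow> cs e \<and> cs f"

primrec dx :: "2 \<Rightarrow> 'a ex \<Rightarrow> 'a ex" where
  "dx j (Cst a) = Cst (dl j a)"
| "dx j (Vr w) = Cst 0"
| "dx j (Iv e) = Ng (Iv e \<otimes> dx j e \<otimes> Iv e)"
| "dx j (e \<oplus> f) = dx j e \<oplus> dx j f"
| "dx j (e \<otimes> f) = dx j e \<otimes> f \<oplus> e \<otimes> dx j f"

lemma Sm_m1 [simp]: "-1 \<in> Sm" "dl j (-1) = 0"
  by (simp_all add: Sm_minus dl_minus)

lemma cs_Dv [simp]: "cs e \<Longrightarrow> cs (Dv v e)"
  by (induction e) auto

lemma cs_dx [simp]: "cs e \<Longrightarrow> cs (dx j e)"
  by (induction e) (auto intro: Sm_dl)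

lemma dm_dx [simp]: "dm e z \<Longrightarrow> dm (dx v e) z"
  by (induction e) auto

lemma hm_dx: "hm e d \<Longrightarrow> hm (dx v e) d"
proof (induction rule: hm.induct)
  case (hm_Iv e d)
  have "hm (Iv e \<otimes> dx v e \<otimes> Iv e) ((- d + d) + - d)" by (intro hm.intros hm_Iv)
  then show ?case by (auto intro!: hm_Ng elim!: hm_cong)
qed (auto intro: hm.intros)

lemma ev_Sm: "cs e \<Longrightarrow> dm e z \<Longrightarrow> ev e z \<in> Sm"
  by (induction e) (auto intro: Sm_add Sm_mult Sm_alg_inv Sm_scaleC)

lemma ev_dx: "cs e \<Longrightarrow> dm e z \<Longrightarrow> ev (dx j e) z = dl j (ev e z)"
  by (induction e) (auto simp: dl_scaleC scaleC.zero_right ev_Sm dl_alg_inv dl_add dl_mult Sm_alg_inv mult.assoc)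

lemma ev_dx_Dv: "ev (dx j (Dv v e)) z = ev (Dv v (dx j e)) z"
  by (induction e) (simp_all add: algebra_simps)

lemma ev_dx_dx: "cs e \<Longrightarrow> dm e z \<Longrightarrow> ev (dx i (dx j e)) z = ev (dx j (dx i e)) z"
  by (simp add: ev_dx dl_commute ev_Sm)

definition ok :: "(var \<Rightarrow> complex) set \<Rightarrow> 'a ex \<Rightarrow> bool" where
  "ok T e \<longleftrightarrow> cs e \<and> (\<forall>z\<in>T. dm e z)"

lemma ok_simps [simp]:
  "ok T (Cst a) \<longleftrightarrow> a \<in> Sm" "ok T (Vr v)" "ok T (e \<oplus> f) \<longleftrightarrow> ok T e \<and> ok T f" "ok T (e \<otimes> f) \<longleftrightarrow> ok T e \<and> ok T f"
  "ok T (Iv e) \<longleftrightarrow> ok T e \<and> (\<forall>z\<in>T. alg_invertible (ev e z))"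
  by (auto simp: ok_def)

lemma ok_ops [simp]: "ok T e \<Longrightarrow> ok T (Dv v e)" "ok T e \<Longrightarrow> ok T (dx j e)"
  by (auto simp: ok_def)

end

section \<open>The algebra of symbols truncated to three homogeneous terms\<close>

datatype 'a sym = Sym (s0: "'a ex") (s1: "'a ex") (s2: "'a ex")

context nc_torus
begin

text \<open>Together with \<open>brk2\<close> the terms of order one and two in the composition
  formula, the sum over alpha of (1 / alpha!) times the alpha-th \<xi> derivative of X times
  delta^alpha Y. No powers of i occur, because the monomials have real eigenvalues n_j under
  delta_j.\<close>

definition brk1 :: "'a ex \<Rightarrow> 'a ex \<Rightarrow> 'a ex" where
  "brk1 X Y = Dv (Xi 1) X \<otimes> dx 1 Y \<oplus> Dv (Xi 2) X \<otimes> dx 2 Y"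

definition brk2 :: "'a ex \<Rightarrow> 'a ex \<Rightarrow> 'a ex" where
  "brk2 X Y = Cst ((1/2) *\<^sub>R 1) \<otimes> (Dv (Xi 1) (Dv (Xi 1) X) \<otimes> dx 1 (dx 1 Y) \<oplus> Dv (Xi 1) (Dv (Xi 2) X) \<otimes> dx 1 (dx 2 Y) \<oplus>
     Dv (Xi 2) (Dv (Xi 1) X) \<otimes> dx 2 (dx 1 Y) \<oplus> Dv (Xi 2) (Dv (Xi 2) X) \<otimes> dx 2 (dx 2 Y))"

text \<open>The three leading homogeneous parts of the symbol of a product of operators.\<close>

definition star :: "'a sym \<Rightarrow> 'a sym \<Rightarrow> 'a sym" (infixr "\<star>" 70) where
  "star X Y = Sym (s0 X \<otimes> s0 Y) (s0 X \<otimes> s1 Y \<oplus> s1 X \<otimes> s0 Y \<oplus> brk1 (s0 X) (s0 Y))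
     (s0 X \<otimes> s2 Y \<oplus> s1 X \<otimes> s1 Y \<oplus> s2 X \<otimes> s0 Y \<oplus> brk1 (s0 X) (s1 Y) \<oplus> brk1 (s1 X) (s0 Y) \<oplus> brk2 (s0 X) (s0 Y))"

definition sadd :: "'a sym \<Rightarrow> 'a sym \<Rightarrow> 'a sym" where
  "sadd X Y = Sym (s0 X \<oplus> s0 Y) (s1 X \<oplus> s1 Y) (s2 X \<oplus> s2 Y)"

definition sneg :: "'a sym \<Rightarrow> 'a sym" where "sneg X = Sym (Ng (s0 X)) (Ng (s1 X)) (Ng (s2 X))"

definition one :: "'a sym" where "one = Sym (Cst 1) (Cst 0) (Cst 0)"

definition dS :: "var \<Rightarrow> 'a sym \<Rightarrow> 'a sym" where "dS v X = Sym (Dv v (s0 X)) (Dv v (s1 X)) (Dv v (s2 X))"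

text \<open>The left inverse of K solved order by order from the inverse i of its leading term; this
  is the recursion that defines b_0, b_1, b_2. \<open>rinv\<close> is its mirror image.\<close>

definition linv :: "'a sym \<Rightarrow> 'a ex \<Rightarrow> 'a sym" where
  "linv K i = (let b1 = Ng ((i \<otimes> s1 K \<oplus> brk1 i (s0 K)) \<otimes> i) in
     Sym i b1 (Ng ((i \<otimes> s2 K \<oplus> b1 \<otimes> s1 K \<oplus> brk1 i (s1 K) \<oplus> brk1 b1 (s0 K) \<oplus> brk2 i (s0 K)) \<otimes> i)))"

definition rinv :: "'a sym \<Rightarrow> 'a ex \<Rightarrow> 'a sym" where
  "rinv K i = (let r1 = Ng (i \<otimes> (s1 K \<otimes> i \<oplus> brk1 (s0 K) i)) in
     Sym i r1 (Ng (i \<otimes> (s1 K \<otimes> r1 \<oplus> s2 K \<otimes> i \<oplus> brk1 (s0 K) r1 \<oplus> brk1 (s1 K) i \<oplus> brk2 (s0 K) i))))"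

definition okS :: "(var \<Rightarrow> complex) set \<Rightarrow> 'a sym \<Rightarrow> bool" where
  "okS T X \<longleftrightarrow> ok T (s0 X) \<and> ok T (s1 X) \<and> ok T (s2 X)"

definition seq :: "(var \<Rightarrow> complex) set \<Rightarrow> 'a sym \<Rightarrow> 'a sym \<Rightarrow> bool" where
  "seq T X Y \<longleftrightarrow> (\<forall>z\<in>T. ev (s0 X) z = ev (s0 Y) z \<and> ev (s1 X) z = ev (s1 Y) z \<and> ev (s2 X) z = ev (s2 Y) z)"

definition lim_set :: "(var \<Rightarrow> complex) set \<Rightarrow> var \<Rightarrow> bool" where
  "lim_set T v \<longleftrightarrow> (\<forall>z\<in>T. z v islimpt {w. z(v := w) \<in> T})"

lemma seq_refl [simp]: "seq T X X" and seq_sym: "seq T X Y \<Longrightarrow> seq T Y X"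
  and seq_trans [trans]: "seq T X Y \<Longrightarrow> seq T Y Z \<Longrightarrow> seq T X Z"
  by (auto simp: seq_def)

lemma seq_s2:
  assumes "z \<in> T"
  shows "seq T X (sadd P Q) \<Longrightarrow> ev (s2 X) z = ev (s2 P) z + ev (s2 Q) z" "seq T X (sneg P) \<Longrightarrow> ev (s2 X) z = - ev (s2 P) z"
  using assms by (simp_all add: seq_def sadd_def sneg_def)

lemma ok_half [simp]: "(1/2) *\<^sub>R 1 \<in> Sm" "dl j ((1/2) *\<^sub>R 1) = 0"
  using dl_scaleR[of 1 j "1/2"] by (auto intro: Sm_scaleR)

lemma okS_ops [simp]:
  "okS T X \<Longrightarrow> okS T Y \<Longrightarrow> okS T (star X Y)" "okS T X \<Longrightarrow> okS T Y \<Longrightarrow> okS T (sadd X Y)"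
  "okS T X \<Longrightarrow> okS T (sneg X)" "okS T one" "okS T X \<Longrightarrow> okS T (dS v X)"
  "okS T X \<Longrightarrow> ok T i \<Longrightarrow> okS T (linv X i)" "okS T X \<Longrightarrow> ok T i \<Longrightarrow> okS T (rinv X i)"
  by (simp_all add: okS_def star_def brk1_def brk2_def sadd_def sneg_def one_def dS_def linv_def rinv_def Let_def)

lemma star_assoc:
  assumes "okS T X" "okS T Y" "okS T Z" shows "seq T (star (star X Y) Z) (star X (star Y Z))"
  unfolding seq_def
proof (intro ballI conjI)
  fix z assume z: "z \<in> T"
  have c: "ev (dx 2 (dx 1 e)) z = ev (dx 1 (dx 2 e)) z" if "ok T e" for e
    using that z ev_dx_dx[of e z 2 1] by (auto simp: ok_def)
  note c' = c[of "s0 X"] c[of "s0 Y"] c[of "s0 Z"]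
  have o: "ok T (s0 X)" "ok T (s0 Y)" "ok T (s0 Z)" using assms by (auto simp: okS_def)
  note cc = c[OF o(1)] c[OF o(2)] c[OF o(3)] ev_Dv_commute[of "Xi 2" "Xi 1"]
  show "ev (s0 (star (star X Y) Z)) z = ev (s0 (star X (star Y Z))) z" by (simp add: star_def mult.assoc)
  show "ev (s1 (star (star X Y) Z)) z = ev (s1 (star X (star Y Z))) z"
    by (simp add: star_def brk1_def algebra_simps)
  \<comment> \<open>Doubling removes the factor 1/2 of \<open>brk2\<close>, after which both sides
    agree as sums of words.\<close>
  have "2 *\<^sub>R ev (s2 (star (star X Y) Z)) z = 2 *\<^sub>R ev (s2 (star X (star Y Z))) z"
    by (simp add: star_def brk1_def brk2_def algebra_simps cc ev_dx_Dv scaleR_2)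
  then show "ev (s2 (star (star X Y) Z)) z = ev (s2 (star X (star Y Z))) z" by simp
qed

lemma star_linear:
  "seq T (star (sadd X Y) Z) (sadd (star X Z) (star Y Z))" "seq T (star X (sadd Y Z)) (sadd (star X Y) (star X Z))"
  "seq T (star (sneg X) Z) (sneg (star X Z))" "seq T (star X (sneg Z)) (sneg (star X Z))"
  "seq T (star one X) X" "seq T (star X one) X"
  by (simp_all add: seq_def star_def sadd_def sneg_def one_def brk1_def brk2_def algebra_simps)

lemma ev_Dv3: "ev (Dv u (Dv v (Dv w e))) z = ev (Dv u (Dv w (Dv v e))) z"
  by (induction e) (simp_all add: algebra_simps ev_Dv_commute)

lemma ev_dx_dx_Dv: "ev (dx i (dx j (Dv v e))) z = ev (Dv v (dx i (dx j e))) z"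
  by (induction e) (simp_all add: algebra_simps ev_dx_Dv)

lemma dS_star: "seq T (dS v (star X Y)) (sadd (star (dS v X) Y) (star X (dS v Y)))"
  unfolding seq_def
proof (intro ballI conjI)
  fix z
  have c: "ev (Dv (Xi i) (Dv v e)) z = ev (Dv v (Dv (Xi i) e)) z"
    "ev (Dv (Xi i) (Dv (Xi j) (Dv v e))) z = ev (Dv v (Dv (Xi i) (Dv (Xi j) e))) z" for i j e
    using ev_Dv_commute[of "Xi i" v] ev_Dv3[of "Xi i" "Xi j" v e] by auto
  show "ev (s0 (dS v (star X Y))) z = ev (s0 (sadd (star (dS v X) Y) (star X (dS v Y)))) z"
    by (simp add: star_def sadd_def dS_def)
  show "ev (s1 (dS v (star X Y))) z = ev (s1 (sadd (star (dS v X) Y) (star X (dS v Y)))) z"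
    by (simp add: star_def sadd_def dS_def brk1_def algebra_simps ev_dx_Dv c)
  show "ev (s2 (dS v (star X Y))) z = ev (s2 (sadd (star (dS v X) Y) (star X (dS v Y)))) z"
    by (simp add: star_def sadd_def dS_def brk1_def brk2_def algebra_simps ev_dx_Dv ev_dx_dx_Dv c)
qed

lemma Dv_cong:
  assumes "lim_set T v" "ok T e" "ok T f" "\<And>z. z \<in> T \<Longrightarrow> ev e z = ev f z" "z \<in> T"
  shows "ev (Dv v e) z = ev (Dv v f) z"
  using assms by (intro ev_Dv_cong[of T]) (auto simp: ok_def lim_set_def)

lemma dx_cong:
  assumes "ok T e" "ok T f" "\<And>z. z \<in> T \<Longrightarrow> ev e z = ev f z" "z \<in> T"
  shows "ev (dx j e) z = ev (dx j f) z"
  using assms by (auto simp: ok_def ev_dx)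

lemma dS_cong:
  assumes "lim_set T v" "okS T X" "okS T Y" "seq T X Y" shows "seq T (dS v X) (dS v Y)"
  using assms Dv_cong[of T v] unfolding okS_def seq_def dS_def by simp

definition good :: "(var \<Rightarrow> complex) set \<Rightarrow> bool" where "good T \<longleftrightarrow> (\<forall>i. lim_set T (Xi i))"

lemma star_cong:
  assumes T: "good T" and ok: "okS T X" "okS T X'" "okS T Y" "okS T Y'" and e: "seq T X X'" "seq T Y Y'"
  shows "seq T (star X Y) (star X' Y')"
proof -
  have l: "lim_set T (Xi i)" for i using T by (simp add: good_def)
  have 1: "ev (Dv (Xi i) e) z = ev (Dv (Xi i) f) z" "ev (Dv (Xi i) (Dv (Xi j) e)) z = ev (Dv (Xi i) (Dv (Xi j) f)) z"
    if "ok T e" "ok T f" "\<forall>z\<in>T. ev e z = ev f z" "z \<in> T" for e f z i j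
  proof -
    have D: "ev (Dv (Xi i) e) z = ev (Dv (Xi i) f) z" if "z \<in> T" for z i
      by (rule Dv_cong[OF l]) (use \<open>ok T e\<close> \<open>ok T f\<close> \<open>\<forall>z\<in>T. ev e z = ev f z\<close> that in auto)
    then show "ev (Dv (Xi i) e) z = ev (Dv (Xi i) f) z" using that by simp
    show "ev (Dv (Xi i) (Dv (Xi j) e)) z = ev (Dv (Xi i) (Dv (Xi j) f)) z"
      by (rule Dv_cong[OF l]) (use that D in auto)
  qed
  have 2: "ev (dx i e) z = ev (dx i f) z" "ev (dx i (dx j e)) z = ev (dx i (dx j f)) z"
    if "ok T e" "ok T f" "\<forall>z\<in>T. ev e z = ev f z" "z \<in> T" for e f z i j
  proof -
    have D: "ev (dx i e) z = ev (dx i f) z" if "z \<in> T" for z i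
      by (rule dx_cong) (use \<open>ok T e\<close> \<open>ok T f\<close> \<open>\<forall>z\<in>T. ev e z = ev f z\<close> that in auto)
    then show "ev (dx i e) z = ev (dx i f) z" using that by simp
    show "ev (dx i (dx j e)) z = ev (dx i (dx j f)) z"
      by (rule dx_cong) (use that D in auto)
  qed
  have o: "ok T (s0 X)" "ok T (s0 X')" "\<forall>z\<in>T. ev (s0 X) z = ev (s0 X') z"
     "ok T (s1 X)" "ok T (s1 X')" "\<forall>z\<in>T. ev (s1 X) z = ev (s1 X') z"
     "ok T (s0 Y)" "ok T (s0 Y')" "\<forall>z\<in>T. ev (s0 Y) z = ev (s0 Y') z"
     "ok T (s1 Y)" "ok T (s1 Y')" "\<forall>z\<in>T. ev (s1 Y) z = ev (s1 Y') z"
    using ok e by (auto simp: okS_def seq_def)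
  note r = 1[OF o(1-3)] 1[OF o(4-6)] 2[OF o(7-9)] 2[OF o(10-12)]
  show ?thesis unfolding seq_def
  proof
    fix z assume z: "z \<in> T"
    then show "ev (s0 (star X Y)) z = ev (s0 (star X' Y')) z \<and> ev (s1 (star X Y)) z = ev (s1 (star X' Y')) z
       \<and> ev (s2 (star X Y)) z = ev (s2 (star X' Y')) z"
      using e by (simp add: seq_def star_def brk1_def brk2_def r[OF z])
  qed
qed

lemma sadd_cong: "seq T X X' \<Longrightarrow> seq T Y Y' \<Longrightarrow> seq T (sadd X Y) (sadd X' Y')"
  and sneg_cong: "seq T X X' \<Longrightarrow> seq T (sneg X) (sneg X')"
  by (simp_all add: seq_def sadd_def sneg_def)

lemma linv_left:
  assumes "\<And>z. z \<in> T \<Longrightarrow> ev i z * ev (s0 K) z = 1" shows "seq T (star (linv K i) K) one"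
  using assms unfolding seq_def linv_def Let_def star_def one_def by (simp add: mult.assoc)

lemma rinv_right:
  assumes "\<And>z. z \<in> T \<Longrightarrow> ev (s0 K) z * ev i z = 1" shows "seq T (star K (rinv K i)) one"
  using assms unfolding seq_def rinv_def Let_def star_def one_def by (simp flip: mult.assoc)

lemma inverse_unique:
  assumes T: "good T" and ok: "okS T L" "okS T K" "okS T R" and l: "seq T (star L K) one" and r: "seq T (star K R) one"
  shows "seq T L R"
proof -
  have "seq T L (star L one)" by (rule seq_sym) (rule star_linear)
  also have "seq T \<dots> (star L (star K R))" by (rule star_cong[OF T]) (use ok r seq_sym in auto)
  also have "seq T \<dots> (star (star L K) R)" by (rule seq_sym, rule star_assoc) (use ok in auto)
  also have "seq T \<dots> (star one R)" by (rule star_cong[OF T]) (use ok l in auto)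
  also have "seq T \<dots> R" by (rule star_linear)
  finally show ?thesis .
qed

lemma tr_add: "tr (a + b) = tr a + tr b" and tr_scaleR: "tr (r *\<^sub>R a) = of_real r * tr a" and tr_minus: "tr (- a) = - tr a"
  using tr(1) tr(2)[of "of_real r" a] by (simp_all add: linear_simps)

text \<open>Integration by parts twice: the trace annihilates delta_i of a product, which moves
  delta_i to the left factor, and the product rule for \<open>Dv v\<close> then moves the other
  derivative at the price of a divergence.\<close>

lemma tr_brk:
  assumes X: "cs X" "dm X z" and Y: "cs Y" "dm Y z"
  shows "tr (ev (Dv v X) z * ev (dx i Y) z) = tr (ev (Dv v Y) z * ev (dx i X) z) - tr (ev (Dv v (dx i X \<otimes> Y)) z)"
proof -
  have "tr (dl i (ev (Dv v X) z * ev Y z)) = 0" by (intro tr_dl Sm_mult ev_Sm) (use assms in auto)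
  then have "tr (ev (dx i (Dv v X)) z * ev Y z) + tr (ev (Dv v X) z * ev (dx i Y) z) = 0"
    using assms by (simp add: dl_mult ev_Sm ev_dx tr_add)
  then show ?thesis using tr_mult_commute[of "ev (dx i X) z" "ev (Dv v Y) z"]
    by (simp add: tr_add ev_dx_Dv algebra_simps add_eq_0_iff2)
qed

text \<open>The flux of a commutator: the traced third component of X \<star> Y - Y \<star> X is
  minus the \<xi> divergence of its trace.\<close>

definition divw :: "'a sym \<Rightarrow> 'a sym \<Rightarrow> 2 \<Rightarrow> 'a ex" where
  "divw X Y i = dx i (s0 X) \<otimes> s1 Y \<oplus> dx i (s1 X) \<otimes> s0 Y \<oplus> Cst ((1/2) *\<^sub>R 1) \<otimes>
     (dx i (Dv (Xi 1) (s0 X)) \<otimes> dx 1 (s0 Y) \<oplus> dx i (Dv (Xi 2) (s0 X)) \<otimes> dx 2 (s0 Y) \<oplus>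
      dx i (dx 1 (s0 X)) \<otimes> Dv (Xi 1) (s0 Y) \<oplus> dx i (dx 2 (s0 X)) \<otimes> Dv (Xi 2) (s0 Y))"

lemma tr_star_commute:
  assumes ok: "okS T X" "okS T Y" and z: "z \<in> T"
  shows "tr (ev (s2 (star X Y)) z) = tr (ev (s2 (star Y X)) z)
    - (tr (ev (Dv (Xi 1) (divw X Y 1)) z) + tr (ev (Dv (Xi 2) (divw X Y 2)) z))"
proof -
  have o: "cs (s0 X)" "dm (s0 X) z" "cs (s1 X)" "dm (s1 X) z" "cs (s0 Y)" "dm (s0 Y) z" "cs (s1 Y)" "dm (s1 Y) z"
    using ok z by (auto simp: okS_def ok_def)
  have b1: "tr (ev (brk1 e f) z) = tr (ev (brk1 f e) z) - (tr (ev (Dv (Xi 1) (dx 1 e \<otimes> f)) z) + tr (ev (Dv (Xi 2) (dx 2 e \<otimes> f)) z))"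
    if "cs e" "dm e z" "cs f" "dm f z" for e f
    using tr_brk[OF that, of "Xi 1" 1] tr_brk[OF that, of "Xi 2" 2] by (simp add: brk1_def tr_add)
  let ?x = "s0 X" and ?y = "s0 Y"
  define p where "p i j = tr (ev (Dv (Xi i) (dx i (Dv (Xi j) ?x) \<otimes> dx j ?y)) z)" for i j
  define q where "q i j = tr (ev (Dv (Xi i) (dx i (dx j ?x) \<otimes> Dv (Xi j) ?y)) z)" for i j
  \<comment> \<open>The two derivatives are moved one at a time. The second move leaves a flux with
    the indices exchanged, which summation over i and j makes symmetric again.\<close>
  have b2: "tr (ev (Dv (Xi i) (Dv (Xi j) ?x)) z * ev (dx i (dx j ?y)) z)
     = tr (ev (Dv (Xi i) (Dv (Xi j) ?y)) z * ev (dx i (dx j ?x)) z)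
       - p i j - q j i" for i j
  proof -
    have "tr (ev (Dv (Xi i) (Dv (Xi j) ?x)) z * ev (dx i (dx j ?y)) z)
      = tr (ev (Dv (Xi i) (dx j ?y)) z * ev (dx i (Dv (Xi j) ?x)) z) - tr (ev (Dv (Xi i) (dx i (Dv (Xi j) ?x) \<otimes> dx j ?y)) z)"
      by (rule tr_brk) (use o in auto)
    also have "tr (ev (Dv (Xi i) (dx j ?y)) z * ev (dx i (Dv (Xi j) ?x)) z)
       = tr (ev (Dv (Xi j) (dx i ?x)) z * ev (dx j (Dv (Xi i) ?y)) z)"
      by (simp only: ev_dx_Dv tr_mult_commute)
    also have "\<dots> = tr (ev (Dv (Xi j) (Dv (Xi i) ?y)) z * ev (dx j (dx i ?x)) z) - tr (ev (Dv (Xi j) (dx j (dx i ?x) \<otimes> Dv (Xi i) ?y)) z)"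
      by (rule tr_brk) (use o in auto)
    also have "ev (Dv (Xi j) (Dv (Xi i) ?y)) z = ev (Dv (Xi i) (Dv (Xi j) ?y)) z" by (rule ev_Dv_commute)
    also have "ev (dx j (dx i ?x)) z = ev (dx i (dx j ?x)) z" by (rule ev_dx_dx) (use o in auto)
    finally show ?thesis by (simp add: p_def q_def)
  qed
  have b2': "tr (ev (brk2 ?x ?y) z) = tr (ev (brk2 ?y ?x) z) - 1/2 * (p 1 1 + p 1 2 + p 2 1 + p 2 2 + q 1 1 + q 1 2 + q 2 1 + q 2 2)"
    by (simp add: brk2_def tr_add tr_scaleR b2 scaleR_right_distrib) (simp add: field_simps)
  have e1: "tr (ev (s2 (star X Y)) z) = tr (ev (s0 X) z * ev (s2 Y) z) + tr (ev (s1 X) z * ev (s1 Y) z) + tr (ev (s2 X) z * ev (s0 Y) z)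
     + tr (ev (brk1 (s0 X) (s1 Y)) z) + tr (ev (brk1 (s1 X) (s0 Y)) z) + tr (ev (brk2 (s0 X) (s0 Y)) z)" for X Y
    by (simp add: star_def tr_add)
  note b11 = b1[of "s0 X" "s1 Y"] b1[of "s1 X" "s0 Y"]
  have d: "tr (ev (Dv (Xi i) (divw X Y i)) z) = tr (ev (Dv (Xi i) (dx i (s0 X) \<otimes> s1 Y)) z) + tr (ev (Dv (Xi i) (dx i (s1 X) \<otimes> s0 Y)) z)
     + 1/2 * (p i 1 + p i 2 + q i 1 + q i 2)" for i
    by (simp add: divw_def p_def q_def tr_add tr_scaleR scaleR_right_distrib distrib_left)
  have "tr (ev (s2 (star X Y)) z) - tr (ev (s2 (star Y X)) z) =
     (tr (ev (brk1 (s0 X) (s1 Y)) z) - tr (ev (brk1 (s1 Y) (s0 X)) z)) + (tr (ev (brk1 (s1 X) (s0 Y)) z) - tr (ev (brk1 (s0 Y) (s1 X)) z))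
     + (tr (ev (brk2 ?x ?y) z) - tr (ev (brk2 ?y ?x) z))"
    unfolding e1 using tr_mult_commute[of "ev (s0 X) z" "ev (s2 Y) z"] tr_mult_commute[of "ev (s1 X) z" "ev (s1 Y) z"]
       tr_mult_commute[of "ev (s2 X) z" "ev (s0 Y) z"] by simp
  also have "\<dots> = - (tr (ev (Dv (Xi 1) (divw X Y 1)) z) + tr (ev (Dv (Xi 2) (divw X Y 2)) z))"
    unfolding b2' b11(1)[OF o(1,2,7,8)] b11(2)[OF o(3,4,5,6)] d by (simp add: algebra_simps)
  finally show ?thesis by (simp add: algebra_simps)
qed


section \<open>The variation of the resolvent under the trace\<close>

definition zeroS :: "'a sym" where "zeroS = Sym (Cst 0) (Cst 0) (Cst 0)"

lemma zeroS_facts [simp]: "okS T zeroS" "seq T (star zeroS X) zeroS" "seq T (star X zeroS) zeroS" "seq T (dS v one) zeroS"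
  by (simp_all add: okS_def zeroS_def seq_def star_def brk1_def brk2_def dS_def one_def)

lemma sadd_zero: "seq T (sadd zeroS X) X" "seq T (sadd X zeroS) X"
  by (simp_all add: zeroS_def seq_def sadd_def)

text \<open>The symbol of A B - lambda. Since lambda has the weight of the leading part, it is
  subtracted there and only there.\<close>

definition Kof :: "'a sym \<Rightarrow> 'a sym \<Rightarrow> 'a sym" where
  "Kof A B = Sym (s0 (A \<star> B) \<oplus> Ng (Vr Lam)) (s1 (A \<star> B)) (s2 (A \<star> B))"

definition Fvar :: "'a sym \<Rightarrow> 'a sym \<Rightarrow> 'a sym \<Rightarrow> 'a sym" where
  "Fvar A B b = sadd (dS Sig A \<star> (B \<star> b)) (dS Sig B \<star> (b \<star> A))"

lemma okS_Kof [simp]: "okS T A \<Longrightarrow> okS T B \<Longrightarrow> okS T (Kof A B)"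
  using okS_ops(1)[of T A B] unfolding okS_def Kof_def by simp

lemma resolvent_two_sided:
  assumes T: "good T" and ok: "okS T K" "ok T i"
    and inv: "\<And>z. z \<in> T \<Longrightarrow> ev i z * ev (s0 K) z = 1" "\<And>z. z \<in> T \<Longrightarrow> ev (s0 K) z * ev i z = 1"
  shows "seq T (linv K i \<star> K) one" "seq T (K \<star> linv K i) one" "seq T (linv K i) (rinv K i)"
proof -
  show 1: "seq T (linv K i \<star> K) one" by (rule linv_left) (rule inv)
  have 2: "seq T (K \<star> rinv K i) one" by (rule rinv_right) (rule inv)
  show 3: "seq T (linv K i) (rinv K i)" by (rule inverse_unique[OF T _ _ _ 1 2]) (use ok in auto)
  have "seq T (K \<star> linv K i) (K \<star> rinv K i)" by (rule star_cong[OF T]) (use ok 3 in auto)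
  then show "seq T (K \<star> linv K i) one" using 2 seq_trans by blast
qed

text \<open>In the symbol algebra the derivative of b is - b (A' B + A B') b. Moving the first
  factors to the end under the trace costs the divergences and leaves b b, which is the lambda
  derivative of b.\<close>

lemma variation:
  assumes T: "good T" "lim_set T Sig" "lim_set T Lam" and ok: "okS T A" "okS T B" "ok T i"
    and inv: "\<And>z. z \<in> T \<Longrightarrow> ev i z * ev (s0 (Kof A B)) z = 1" "\<And>z. z \<in> T \<Longrightarrow> ev (s0 (Kof A B)) z * ev i z = 1"
    and L: "seq T (dS Lam A) zeroS" "seq T (dS Lam B) zeroS"
    and z: "z \<in> T"
  defines "b \<equiv> linv (Kof A B) i"
  shows "tr (ev (s2 (dS Sig b)) z) = - tr (ev (s2 (dS Lam (Fvar A B b))) z)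
    + (tr (ev (Dv (Xi 1) (divw b (dS Sig A \<star> (B \<star> b)) 1)) z) + tr (ev (Dv (Xi 2) (divw b (dS Sig A \<star> (B \<star> b)) 2)) z))
    + (tr (ev (Dv (Xi 1) (divw (b \<star> A) (dS Sig B \<star> b) 1)) z) + tr (ev (Dv (Xi 2) (divw (b \<star> A) (dS Sig B \<star> b) 2)) z))"
proof -
  let ?K = "Kof A B"
  let ?A' = "dS Sig A" and ?B' = "dS Sig B"
  have okK: "okS T ?K" using ok by simp
  have okb: "okS T b" unfolding b_def using ok by simp
  note res = resolvent_two_sided[OF T(1) okK ok(3) inv, folded b_def]
  note sc = star_cong[OF T(1)]
  have oks [simp]: "okS T A" "okS T B" "okS T b" "okS T ?K" using ok okb okK by auto
  have cancel: "seq T D (sneg (X \<star> b))" if "seq T (D \<star> ?K) (sneg X)" "okS T D" "okS T X" for D X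
  proof -
    have "seq T D (D \<star> one)" by (rule seq_sym) (rule star_linear)
    also have "seq T \<dots> (D \<star> (?K \<star> b))" by (rule sc) (use that res seq_sym in auto)
    also have "seq T \<dots> ((D \<star> ?K) \<star> b)" by (rule seq_sym, rule star_assoc) (use that in auto)
    also have "seq T \<dots> (sneg X \<star> b)" by (rule sc) (use that in auto)
    also have "seq T \<dots> (sneg (X \<star> b))" by (rule star_linear)
    finally show ?thesis .
  qed
  have leib: "seq T (dS v b \<star> ?K) (sneg (b \<star> dS v ?K))" if v: "lim_set T v" for v
  proof -
    have "seq T (sadd (dS v b \<star> ?K) (b \<star> dS v ?K)) (dS v (b \<star> ?K))" by (rule seq_sym) (rule dS_star)
    also have "seq T \<dots> (dS v one)" by (rule dS_cong[OF v]) (use res in auto)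
    also have "seq T \<dots> zeroS" by simp
    finally show ?thesis unfolding seq_def by (simp add: sadd_def sneg_def zeroS_def eq_neg_iff_add_eq_0)
  qed
  have dK: "seq T (dS Sig ?K) (sadd (?A' \<star> B) (A \<star> ?B'))"
  proof -
    have "seq T (dS Sig ?K) (dS Sig (A \<star> B))" by (simp add: seq_def dS_def Kof_def)
    then show ?thesis using dS_star seq_trans by blast
  qed
  have dSb: "seq T (dS Sig b) (sneg ((b \<star> sadd (?A' \<star> B) (A \<star> ?B')) \<star> b))"
  proof -
    have "seq T (dS Sig b) (sneg ((b \<star> dS Sig ?K) \<star> b))" by (rule cancel[OF leib[OF T(2)]]) auto
    also have "seq T \<dots> (sneg ((b \<star> sadd (?A' \<star> B) (A \<star> ?B')) \<star> b))"
      by (intro sneg_cong sc dK) auto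
    finally show ?thesis .
  qed
  have split: "seq T ((b \<star> sadd (?A' \<star> B) (A \<star> ?B')) \<star> b) (sadd (b \<star> (?A' \<star> (B \<star> b))) ((b \<star> A) \<star> (?B' \<star> b)))"
  proof -
    have "seq T ((b \<star> sadd (?A' \<star> B) (A \<star> ?B')) \<star> b) (sadd (b \<star> (?A' \<star> B)) (b \<star> (A \<star> ?B')) \<star> b)"
      by (intro sc star_linear) auto
    also have "seq T \<dots> (sadd ((b \<star> (?A' \<star> B)) \<star> b) ((b \<star> (A \<star> ?B')) \<star> b))" by (rule star_linear)
    also have "seq T \<dots> (sadd (b \<star> (?A' \<star> (B \<star> b))) ((b \<star> A) \<star> (?B' \<star> b)))"
    proof (rule sadd_cong)
      have "seq T ((b \<star> (?A' \<star> B)) \<star> b) (b \<star> ((?A' \<star> B) \<star> b))" by (rule star_assoc) auto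
      also have "seq T \<dots> (b \<star> (?A' \<star> (B \<star> b)))" by (intro sc star_assoc) auto
      finally show "seq T ((b \<star> (?A' \<star> B)) \<star> b) (b \<star> (?A' \<star> (B \<star> b)))" .
      have "seq T ((b \<star> (A \<star> ?B')) \<star> b) (((b \<star> A) \<star> ?B') \<star> b)" by (rule sc; (rule seq_sym, rule star_assoc)?) auto
      also have "seq T \<dots> ((b \<star> A) \<star> (?B' \<star> b))" by (rule star_assoc) auto
      finally show "seq T ((b \<star> (A \<star> ?B')) \<star> b) ((b \<star> A) \<star> (?B' \<star> b))" .
    qed
    finally show ?thesis .
  qed
  have dLb: "seq T (b \<star> b) (dS Lam b)"
  proof -
    have "seq T (dS Lam ?K) (sneg one)"
    proof -
      have "seq T (dS Lam (A \<star> B)) (sadd (dS Lam A \<star> B) (A \<star> dS Lam B))" by (rule dS_star)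
      also have "seq T \<dots> (sadd (zeroS \<star> B) (A \<star> zeroS))" by (intro sadd_cong sc L) auto
      also have "seq T \<dots> (sadd zeroS zeroS)" by (intro sadd_cong) auto
      finally have "seq T (dS Lam (A \<star> B)) zeroS" using sadd_zero seq_trans by blast
      then show ?thesis unfolding seq_def by (simp add: dS_def Kof_def sneg_def one_def zeroS_def)
    qed
    then have "seq T (b \<star> dS Lam ?K) (b \<star> sneg one)" by (intro sc) auto
    also have "seq T \<dots> (sneg (b \<star> one))" by (rule star_linear)
    also have "seq T \<dots> (sneg b)" by (intro sneg_cong star_linear)
    finally have "seq T (sneg (b \<star> dS Lam ?K)) (sneg (sneg b))" by (rule sneg_cong)
    then have "seq T (dS Lam b \<star> ?K) (sneg (sneg b))" using leib[OF T(3)] seq_trans by blast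
    then have "seq T (dS Lam b) (sneg (sneg b \<star> b))" by (rule cancel) auto
    also have "seq T \<dots> (sneg (sneg (b \<star> b)))" by (intro sneg_cong star_linear)
    also have "seq T \<dots> (b \<star> b)" by (simp add: seq_def sneg_def)
    finally show ?thesis by (rule seq_sym)
  qed
  have L': "seq T (dS Lam (dS Sig X)) zeroS" if "seq T (dS Lam X) zeroS" "okS T X" for X
  proof -
    have "seq T (dS Lam (dS Sig X)) (dS Sig (dS Lam X))" by (simp add: seq_def dS_def ev_Dv_commute[of Lam Sig])
    also have "seq T \<dots> (dS Sig zeroS)" by (rule dS_cong[OF T(2)]) (use that in auto)
    also have "seq T \<dots> zeroS" by (simp add: seq_def dS_def zeroS_def)
    finally show ?thesis .
  qed
  have drop: "seq T (dS Lam (X \<star> Y)) (X \<star> dS Lam Y)" if "seq T (dS Lam X) zeroS" "okS T X" "okS T Y" for X Y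
  proof -
    have "seq T (dS Lam (X \<star> Y)) (sadd (dS Lam X \<star> Y) (X \<star> dS Lam Y))" by (rule dS_star)
    also have "seq T \<dots> (sadd (zeroS \<star> Y) (X \<star> dS Lam Y))" by (intro sadd_cong sc) (use that in auto)
    also have "seq T \<dots> (sadd zeroS (X \<star> dS Lam Y))" by (intro sadd_cong) auto
    also have "seq T \<dots> (X \<star> dS Lam Y)" by (rule sadd_zero)
    finally show ?thesis .
  qed
  have dropr: "seq T (dS Lam (Y \<star> X)) (dS Lam Y \<star> X)" if "seq T (dS Lam X) zeroS" "okS T X" "okS T Y" for X Y
  proof -
    have "seq T (dS Lam (Y \<star> X)) (sadd (dS Lam Y \<star> X) (Y \<star> dS Lam X))" by (rule dS_star)
    also have "seq T \<dots> (sadd (dS Lam Y \<star> X) (Y \<star> zeroS))" by (intro sadd_cong sc) (use that in auto)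
    also have "seq T \<dots> (sadd (dS Lam Y \<star> X) zeroS)" by (intro sadd_cong) auto
    also have "seq T \<dots> (dS Lam Y \<star> X)" by (rule sadd_zero)
    finally show ?thesis .
  qed
  \<comment> \<open>As A' and B are free of \<open>Lam\<close>, the factor b b pulls the
    \<open>Lam\<close> derivative out of the whole product.\<close>
  have F1: "seq T ((?A' \<star> (B \<star> b)) \<star> b) (dS Lam (?A' \<star> (B \<star> b)))"
  proof -
    have "seq T ((?A' \<star> (B \<star> b)) \<star> b) (?A' \<star> ((B \<star> b) \<star> b))" by (rule star_assoc) auto
    also have "seq T \<dots> (?A' \<star> (B \<star> (b \<star> b)))" by (intro sc star_assoc) auto
    also have "seq T \<dots> (?A' \<star> (B \<star> dS Lam b))" by (intro sc dLb) auto
    also have "seq T \<dots> (?A' \<star> dS Lam (B \<star> b))" by (rule sc; (rule seq_sym, rule drop)?) (use L in auto)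
    also have "seq T \<dots> (dS Lam (?A' \<star> (B \<star> b)))" by (rule seq_sym, rule drop) (use L' L in auto)
    finally show ?thesis .
  qed
  have F2: "seq T ((?B' \<star> b) \<star> (b \<star> A)) (dS Lam (?B' \<star> (b \<star> A)))"
  proof -
    have "seq T ((?B' \<star> b) \<star> (b \<star> A)) (?B' \<star> (b \<star> (b \<star> A)))" by (rule star_assoc) auto
    also have "seq T \<dots> (?B' \<star> ((b \<star> b) \<star> A))" by (rule sc; (rule seq_sym, rule star_assoc)?) auto
    also have "seq T \<dots> (?B' \<star> (dS Lam b \<star> A))" by (intro sc dLb) auto
    also have "seq T \<dots> (?B' \<star> dS Lam (b \<star> A))" by (rule sc; (rule seq_sym, rule dropr)?) (use L in auto)
    also have "seq T \<dots> (dS Lam (?B' \<star> (b \<star> A)))" by (rule seq_sym, rule drop) (use L' L in auto)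
    finally show ?thesis .
  qed
  have "tr (ev (s2 (dS Sig b)) z) = - (tr (ev (s2 (b \<star> (?A' \<star> (B \<star> b)))) z) + tr (ev (s2 ((b \<star> A) \<star> (?B' \<star> b))) z))"
    by (simp only: seq_s2(2)[OF z dSb] seq_s2(1)[OF z split] tr_minus tr_add)
  also have "tr (ev (s2 (b \<star> (?A' \<star> (B \<star> b)))) z) = tr (ev (s2 (dS Lam (?A' \<star> (B \<star> b)))) z)
    - (tr (ev (Dv (Xi 1) (divw b (?A' \<star> (B \<star> b)) 1)) z) + tr (ev (Dv (Xi 2) (divw b (?A' \<star> (B \<star> b)) 2)) z))"
    by (subst tr_star_commute[of T]) (use F1 z in \<open>auto simp: seq_def\<close>)
  also have "tr (ev (s2 ((b \<star> A) \<star> (?B' \<star> b))) z) = tr (ev (s2 (dS Lam (?B' \<star> (b \<star> A)))) z)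
    - (tr (ev (Dv (Xi 1) (divw (b \<star> A) (?B' \<star> b) 1)) z) + tr (ev (Dv (Xi 2) (divw (b \<star> A) (?B' \<star> b) 2)) z))"
    by (subst tr_star_commute[of T]) (use F2 z in \<open>auto simp: seq_def\<close>)
  finally show ?thesis by (simp add: Fvar_def dS_def sadd_def tr_add)
qed

text \<open>For lambda = 0 the resolvent inverts A B. Hence B b is a right inverse of A and b A a
  left inverse of B, and uniqueness of inverses replaces them by expressions in A alone and in B
  alone.\<close>

lemma slice:
  assumes T: "good T" "\<And>z. z \<in> T \<Longrightarrow> z Lam = 0" and ok: "okS T A" "okS T B" "ok T i" "ok T ia" "ok T ib"
    and inv: "\<And>z. z \<in> T \<Longrightarrow> ev i z * ev (s0 (Kof A B)) z = 1" "\<And>z. z \<in> T \<Longrightarrow> ev (s0 (Kof A B)) z * ev i z = 1"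
    and ia: "\<And>z. z \<in> T \<Longrightarrow> ev ia z * ev (s0 A) z = 1" "\<And>z. z \<in> T \<Longrightarrow> ev (s0 A) z * ev ia z = 1"
    and ib: "\<And>z. z \<in> T \<Longrightarrow> ev ib z * ev (s0 B) z = 1" "\<And>z. z \<in> T \<Longrightarrow> ev (s0 B) z * ev ib z = 1"
  defines "b \<equiv> linv (Kof A B) i"
  shows "seq T (Fvar A B b) (sadd (dS Sig A \<star> rinv A ia) (dS Sig B \<star> rinv B ib))"
proof -
  let ?K = "Kof A B"
  have oks [simp]: "okS T A" "okS T B" "okS T b" "okS T ?K" "ok T ia" "ok T ib" using ok unfolding b_def by auto
  note res = resolvent_two_sided[OF T(1) oks(4) ok(3) inv, folded b_def]
  note sc = star_cong[OF T(1)]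
  have K: "seq T ?K (A \<star> B)" unfolding seq_def
  proof
    fix z assume "z \<in> T"
    from T(2)[OF this] show "ev (s0 ?K) z = ev (s0 (A \<star> B)) z \<and> ev (s1 ?K) z = ev (s1 (A \<star> B)) z \<and> ev (s2 ?K) z = ev (s2 (A \<star> B)) z"
      by (simp add: Kof_def scaleC.zero_left)
  qed
  have 1: "seq T (A \<star> (B \<star> b)) one"
  proof -
    have "seq T (A \<star> (B \<star> b)) ((A \<star> B) \<star> b)" by (rule seq_sym, rule star_assoc) auto
    also have "seq T \<dots> (?K \<star> b)" by (rule sc) (use K seq_sym in auto)
    also note res(2)
    finally show ?thesis .
  qed
  have 2: "seq T ((b \<star> A) \<star> B) one"
  proof -
    have "seq T ((b \<star> A) \<star> B) (b \<star> (A \<star> B))" by (rule star_assoc) auto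
    also have "seq T \<dots> (b \<star> ?K)" by (rule sc) (use K seq_sym in auto)
    also note res(1)
    finally show ?thesis .
  qed
  note rA = resolvent_two_sided[OF T(1) oks(1) ok(4) ia] and rB = resolvent_two_sided[OF T(1) oks(2) ok(5) ib]
  have "seq T (linv A ia) (B \<star> b)" by (rule inverse_unique[OF T(1) _ _ _ rA(1) 1]) auto
  then have X: "seq T (B \<star> b) (rinv A ia)" using rA(3) seq_sym seq_trans by blast
  have "seq T (b \<star> A) (rinv B ib)" by (rule inverse_unique[OF T(1) _ _ _ 2 rinv_right[OF ib(2)]]) auto
  with X show ?thesis unfolding Fvar_def by (intro sadd_cong sc) auto
qed

section \<open>Homogeneity of the truncated symbols\<close>

definition hmS :: "'a sym \<Rightarrow> int \<Rightarrow> bool" where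
  "hmS X d \<longleftrightarrow> hm (s0 X) d \<and> hm (s1 X) (d - 1) \<and> hm (s2 X) (d - 2)"

lemma hm_TiI: "hm e d \<Longrightarrow> hm f d' \<Longrightarrow> D = d + d' \<Longrightarrow> hm (e \<otimes> f) D"
  using hm_Ti by blast

lemma hm_DX: "hm e d \<Longrightarrow> hm (Dv (Xi i) e) (d - 1)"
  using hm_Dv[of e d "Xi i"] by simp

lemma hm_DXX: "hm e d \<Longrightarrow> hm (Dv (Xi i) (Dv (Xi j) e)) (d - 2)"
  using hm_DX[OF hm_DX, of e d i j] by simp

lemma hm_half: "hm e d \<Longrightarrow> hm (Cst a \<otimes> e) d"
  using hm_Ti[OF hm_Cst] by force

lemma hm_brk: assumes "hm X d" "hm Y d'"
  shows "hm (brk1 X Y) (d + d' - 1)" "hm (brk2 X Y) (d + d' - 2)"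
proof -
  have "hm (Dv (Xi i) X \<otimes> dx j Y) (d + d' - 1)" for i j
    by (rule hm_TiI[OF hm_DX[OF assms(1)] hm_dx[OF assms(2)]]) simp
  then show "hm (brk1 X Y) (d + d' - 1)" unfolding brk1_def by (intro hm_Pl)
  have "hm (Dv (Xi i) (Dv (Xi i') X) \<otimes> dx j (dx j' Y)) (d + d' - 2)" for i j i' j'
    by (rule hm_TiI[OF hm_DXX[OF assms(1)] hm_dx[OF hm_dx[OF assms(2)]]]) simp
  then show "hm (brk2 X Y) (d + d' - 2)" unfolding brk2_def by (intro hm_Pl hm_half)
qed

lemma hmS_star: assumes "hmS X d" "hmS Y d'" shows "hmS (X \<star> Y) (d + d')"
proof -
  note x = assms(1)[unfolded hmS_def] and y = assms(2)[unfolded hmS_def]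
  have b: "hm (brk1 (s0 X) (s0 Y)) (d + d' - 1)" "hm (brk1 (s0 X) (s1 Y)) (d + d' - 2)" "hm (brk1 (s1 X) (s0 Y)) (d + d' - 2)" "hm (brk2 (s0 X) (s0 Y)) (d + d' - 2)"
    using hm_brk(1)[of "s0 X" d "s0 Y" d'] hm_brk(1)[of "s0 X" d "s1 Y" "d' - 1"] hm_brk(1)[of "s1 X" "d - 1" "s0 Y" d'] hm_brk(2)[of "s0 X" d "s0 Y" d'] x y
    by (auto elim!: hm_cong)
  have t: "hm (s0 X \<otimes> s0 Y) (d + d')" "hm (s0 X \<otimes> s1 Y) (d + d' - 1)" "hm (s1 X \<otimes> s0 Y) (d + d' - 1)"
     "hm (s0 X \<otimes> s2 Y) (d + d' - 2)" "hm (s1 X \<otimes> s1 Y) (d + d' - 2)" "hm (s2 X \<otimes> s0 Y) (d + d' - 2)"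
    using hm_Ti[of "s0 X" d "s0 Y" d'] hm_Ti[of "s0 X" d "s1 Y" "d' - 1"] hm_Ti[of "s1 X" "d - 1" "s0 Y" d']
      hm_Ti[of "s0 X" d "s2 Y" "d' - 2"] hm_Ti[of "s1 X" "d - 1" "s1 Y" "d' - 1"] hm_Ti[of "s2 X" "d - 2" "s0 Y" d'] x y
    by (auto elim!: hm_cong)
  show ?thesis unfolding hmS_def star_def using b t by (auto intro!: hm_Pl)
qed

lemma hmS_sadd: "hmS X d \<Longrightarrow> hmS Y d \<Longrightarrow> hmS (sadd X Y) d"
  by (auto simp: hmS_def sadd_def intro!: hm_Pl)

lemma hmS_dS: assumes "hmS X d" shows "hmS (dS v X) (d - vdeg v)"
  using hm_Dv[of "s0 X" d v] hm_Dv[of "s1 X" "d - 1" v] hm_Dv[of "s2 X" "d - 2" v] assms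
  by (auto simp: hmS_def dS_def algebra_simps)

lemma hmS_inv: assumes K: "hmS K d" and i: "hm i (- d)" shows "hmS (linv K i) (- d)" "hmS (rinv K i) (- d)"
proof -
  note k = K[unfolded hmS_def]
  define l1 where "l1 = Ng ((i \<otimes> s1 K \<oplus> brk1 i (s0 K)) \<otimes> i)"
  have "hm (i \<otimes> s1 K \<oplus> brk1 i (s0 K)) (- 1)"
    using hm_Ti[OF i, of "s1 K" "d - 1"] hm_brk(1)[OF i, of "s0 K" d] k by (auto intro!: hm_Pl)
  then have l1: "hm l1 (- d - 1)" unfolding l1_def by (auto intro!: hm_Ng hm_TiI[OF _ i])
  have "hm (i \<otimes> s2 K) (-2)" "hm (l1 \<otimes> s1 K) (-2)" "hm (brk1 i (s1 K)) (-2)" "hm (brk1 l1 (s0 K)) (-2)" "hm (brk2 i (s0 K)) (-2)"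
    using hm_Ti[OF i, of "s2 K" "d - 2"] hm_Ti[OF l1, of "s1 K" "d - 1"] hm_brk(1)[OF i, of "s1 K" "d - 1"]
      hm_brk(1)[OF l1, of "s0 K" d] hm_brk(2)[OF i, of "s0 K" d] k by auto
  then have "hm (Ng ((i \<otimes> s2 K \<oplus> l1 \<otimes> s1 K \<oplus> brk1 i (s1 K) \<oplus> brk1 l1 (s0 K) \<oplus> brk2 i (s0 K)) \<otimes> i)) (- d - 2)"
    by (intro hm_Ng hm_TiI[OF _ i] hm_Pl) auto
  then show "hmS (linv K i) (- d)" using l1 i by (simp add: hmS_def linv_def Let_def l1_def)
  define r1 where "r1 = Ng (i \<otimes> (s1 K \<otimes> i \<oplus> brk1 (s0 K) i))"
  have "hm (s1 K \<otimes> i \<oplus> brk1 (s0 K) i) (- 1)"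
    using hm_Ti[OF _ i, of "s1 K" "d - 1"] hm_brk(1)[OF _ i, of "s0 K" d] k by (auto intro!: hm_Pl)
  then have r1: "hm r1 (- d - 1)" unfolding r1_def by (auto intro!: hm_Ng hm_TiI[OF i])
  have "hm (s2 K \<otimes> i) (-2)" "hm (s1 K \<otimes> r1) (-2)" "hm (brk1 (s1 K) i) (-2)" "hm (brk1 (s0 K) r1) (-2)" "hm (brk2 (s0 K) i) (-2)"
    using hm_Ti[OF _ i, of "s2 K" "d - 2"] hm_Ti[OF _ r1, of "s1 K" "d - 1"] hm_brk(1)[OF _ i, of "s1 K" "d - 1"]
      hm_brk(1)[OF _ r1, of "s0 K" d] hm_brk(2)[OF _ i, of "s0 K" d] k by auto
  then have "hm (Ng (i \<otimes> (s1 K \<otimes> r1 \<oplus> s2 K \<otimes> i \<oplus> brk1 (s0 K) r1 \<oplus> brk1 (s1 K) i \<oplus> brk2 (s0 K) i))) (- d - 2)"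
    by (intro hm_Ng hm_TiI[OF i] hm_Pl) auto
  then show "hmS (rinv K i) (- d)" using r1 i by (simp add: hmS_def rinv_def Let_def r1_def)
qed

lemma hm_divw: assumes "hmS X d" "hmS Y d'" shows "hm (divw X Y i) (d + d' - 1)"
proof -
  note x = assms(1)[unfolded hmS_def] and y = assms(2)[unfolded hmS_def]
  have "hm (dx i (s0 X) \<otimes> s1 Y) (d + d' - 1)" "hm (dx i (s1 X) \<otimes> s0 Y) (d + d' - 1)"
    by (rule hm_TiI[OF hm_dx[of _ d]], use x y in simp_all, rule hm_TiI[OF hm_dx[of _ "d - 1"]], use x y in simp_all)
  moreover have "hm (dx i (Dv (Xi j) (s0 X)) \<otimes> dx j (s0 Y)) (d + d' - 1)" "hm (dx i (dx j (s0 X)) \<otimes> Dv (Xi j) (s0 Y)) (d + d' - 1)" for j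
    by (rule hm_TiI[OF hm_dx[OF hm_DX] hm_dx[of _ d']], use x y in simp_all, rule hm_TiI[OF hm_dx[OF hm_dx] hm_DX[of _ d']], use x y in simp_all)
  ultimately show ?thesis unfolding divw_def by (intro hm_Pl hm_half)
qed

lemma ok_divw [simp]: "okS T X \<Longrightarrow> okS T Y \<Longrightarrow> ok T (divw X Y i)"
  by (simp add: okS_def divw_def)

end

subsection \<open>The path of metrics\<close>

definition pt :: "complex \<Rightarrow> complex \<Rightarrow> complex \<Rightarrow> complex \<Rightarrow> var \<Rightarrow> complex" where
  "pt s x y l v = (case v of Sig \<Rightarrow> s | Lam \<Rightarrow> l | Xi i \<Rightarrow> if i = 1 then x else y)"

lemma pt_simps [simp]: "pt s x y l Sig = s" "pt s x y l Lam = l" "pt s x y l (Xi 1) = x" "pt s x y l (Xi 2) = y"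
  by (simp_all add: pt_def)

lemma pt_upd: "(pt s x y l)(Sig := r) = pt r x y l" "(pt s x y l)(Lam := r) = pt s x y r"
  "(pt s x y l)(Xi 1 := r) = pt s r y l" "(pt s x y l)(Xi 2 := r) = pt s x r l"
proof -
  have i: "i = 2" if "i \<noteq> 1" for i :: 2 using exhaust_2[of i] that by simp
  show "(pt s x y l)(Sig := r) = pt r x y l" "(pt s x y l)(Lam := r) = pt s x y r"
    "(pt s x y l)(Xi 1 := r) = pt s r y l" "(pt s x y l)(Xi 2 := r) = pt s x r l"
    by (auto simp: pt_def fun_eq_iff i split: var.splits)
qed

lemma scl_pt: "scl r (pt s x y l) = pt s (r * x) (r * y) (r\<^sup>2 * l)"
  by (auto simp: scl_def pt_def fun_eq_iff split: var.splits)

lemma pt_inj: "pt s x y l = pt s' x' y' l' \<longleftrightarrow> s = s' \<and> x = x' \<and> y = y' \<and> l = l'"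
  by (metis pt_simps)

definition cut :: "complex set" where "cut = {l. Im l = 0 \<and> Re l \<ge> 0}"

lemma closed_cut: "closed cut"
  unfolding cut_def by (intro closed_Collect_conj closed_Collect_eq closed_Collect_le continuous_intros)

lemma of_real_islimpt: "a islimpt S \<Longrightarrow> complex_of_real a islimpt (of_real ` S)"
  unfolding islimpt_approachable
proof (intro allI impI)
  fix e :: real assume a: "\<forall>e>0. \<exists>x'\<in>S. x' \<noteq> a \<and> dist x' a < e" "e > 0"
  then obtain x where "x \<in> S" "x \<noteq> a" "dist x a < e" by blast
  then show "\<exists>x'\<in>complex_of_real ` S. x' \<noteq> complex_of_real a \<and> dist x' (complex_of_real a) < e"
    by (intro bexI[of _ "of_real x"]) (auto simp: dist_norm simp flip: of_real_diff)
qed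

lemma unit_islimpt: "a \<in> {0..1} \<Longrightarrow> a islimpt {0..1::real}"
  by (rule connected_imp_perfect) (auto intro: exI[of _ 0])

text \<open>The data of the factorisation, detached from the metric: the deformation, the symbol
  calculus and the contour argument see only the signs on the spectrum and the smoothness of the
  coefficients.\<close>

locale gb_data = nc_torus +
  fixes h :: 'a and w u :: "real \<Rightarrow> real" and tau :: "real \<Rightarrow> complex"
  assumes h: "h \<in> Sm" "adj h = h"
    and cont: "continuous_on (real_spec h) w" "continuous_on (real_spec h) u" "continuous_on (real_spec h) tau"
    and pos: "\<And>t. t \<in> real_spec h \<Longrightarrow> w t > 0" "\<And>t. t \<in> real_spec h \<Longrightarrow> u t > 0" "\<And>t. t \<in> real_spec h \<Longrightarrow> Im (tau t) < 0"
    and smooth: "cfc w h \<in> Sm" "cfc u h \<in> Sm" "ccfc tau h \<in> Sm" "ccfc (\<lambda>t. cnj (tau t)) h \<in> Sm"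
begin

abbreviation "K \<equiv> real_spec h"

definition "Wx = Cst 1 \<oplus> Vr Sig \<otimes> Cst (cfc w h - 1)"
definition "Ux = Cst 1 \<oplus> Vr Sig \<otimes> Cst (cfc u h - 1)"
definition "Tx = Cst ((-\<i>) *\<^sub>C 1) \<oplus> Vr Sig \<otimes> Cst (ccfc tau h + \<i> *\<^sub>C 1)"
text \<open>The conjugate path is an expression of its own: conjugation is not complex
  differentiable in \<open>Sig\<close> and therefore has no place among the operations on
  expressions.\<close>

definition "Tx' = Cst (\<i> *\<^sub>C 1) \<oplus> Vr Sig \<otimes> Cst (ccfc (\<lambda>t. cnj (tau t)) h - \<i> *\<^sub>C 1)"
text \<open>Moving delta_2 to the right in w (delta_1 + delta_2 cnj tau) leaves the zeroth order
  term w delta_2(cnj tau). In \<open>BS\<close> the corresponding terms arise from the derivatives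
  of the right factor w.\<close>

definition "AS = Sym (Wx \<otimes> (Vr (Xi 1) \<oplus> Vr (Xi 2) \<otimes> Tx')) (Wx \<otimes> dx 2 Tx') (Cst 0)"
definition "BS = Sym (Ux \<otimes> (Vr (Xi 1) \<oplus> Vr (Xi 2) \<otimes> Tx) \<otimes> Wx) (Ux \<otimes> (dx 1 Wx \<oplus> Tx \<otimes> dx 2 Wx)) (Cst 0)"
definition "KS = Kof AS BS"
definition "Q = s0 KS"
definition "bS = linv KS (Iv Q)"

text \<open>Scalar counterparts of the expressions, as functions of the spectral variable t. Since
  all undifferentiated coefficients are functions of the single element h, invertibility of leading
  terms becomes a statement about numbers.\<close>

definition "fW s t = 1 + s * (complex_of_real (w t) - 1)"
definition "fU s t = 1 + s * (complex_of_real (u t) - 1)"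
definition "fT s t = -\<i> + s * (tau t + \<i>)"
definition "fT' s t = \<i> + s * (cnj (tau t) - \<i>)"
definition "fA s x y t = fW s t * (x + y * fT' s t)"
definition "fB s x y t = fU s t * (x + y * fT s t) * fW s t"

lemma contf [continuous_intros]:
  "continuous_on K (fW s)" "continuous_on K (fU s)" "continuous_on K (fT s)" "continuous_on K (fT' s)"
  "continuous_on K (fA s x y)" "continuous_on K (fB s x y)"
  unfolding fA_def fB_def fW_def fU_def fT_def fT'_def by (intro continuous_intros cont)+

lemma ev_coeffs:
  "ev Wx (pt s x y l) = ccfc (fW s) h" "ev Ux (pt s x y l) = ccfc (fU s) h"
  "ev Tx (pt s x y l) = ccfc (fT s) h" "ev Tx' (pt s x y l) = ccfc (fT' s) h"
proof -
  have lin: "ccfc (\<lambda>t. c + s * (f t + d)) h = c *\<^sub>C 1 + s *\<^sub>C (ccfc f h + d *\<^sub>C 1)" if "continuous_on K f" for c d f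
    using that by (simp add: ccfc_add[OF h(2)] ccfc_mult[OF h(2)] ccfc_const[OF h(2)] continuous_intros mult_scaleC_left)
  note l = lin[of "\<lambda>t. of_real (w t)" 1 "-1"] lin[of "\<lambda>t. of_real (u t)" 1 "-1"] lin[of tau "-\<i>" \<i>] lin[of "\<lambda>t. cnj (tau t)" \<i> "-\<i>"]
  show "ev Wx (pt s x y l) = ccfc (fW s) h" "ev Ux (pt s x y l) = ccfc (fU s) h"
    "ev Tx (pt s x y l) = ccfc (fT s) h" "ev Tx' (pt s x y l) = ccfc (fT' s) h"
    using l by (simp_all add: Wx_def Ux_def Tx_def Tx'_def fW_def[abs_def] fU_def[abs_def] fT_def[abs_def] fT'_def[abs_def]
      cont continuous_intros ccfc_of_real[OF h(2)] scaleC.minus_left mult_scaleC_left)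
qed

lemma ev_A: "ev (s0 AS) (pt s x y l) = ccfc (fA s x y) h"
  unfolding AS_def sym.sel ev.simps ev_coeffs fA_def[abs_def] pt_simps
  by (simp add: ccfc_add[OF h(2)] ccfc_mult[OF h(2)] ccfc_const[OF h(2)] continuous_intros contf mult_scaleC_left)

lemma ev_B: "ev (s0 BS) (pt s x y l) = ccfc (fB s x y) h"
  unfolding BS_def sym.sel ev.simps ev_coeffs fB_def[abs_def] pt_simps
  by (simp add: ccfc_add[OF h(2)] ccfc_mult[OF h(2)] ccfc_const[OF h(2)] continuous_intros contf mult_scaleC_left)

lemma ev_Q: "ev Q (pt s x y l) = ccfc (\<lambda>t. fA s x y t * fB s x y t + (- l)) h"
proof -
  have "ev Q (pt s x y l) = ev (s0 AS) (pt s x y l) * ev (s0 BS) (pt s x y l) + (- l) *\<^sub>C 1"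
    by (simp add: Q_def KS_def Kof_def star_def scaleC.minus_left)
  then show ?thesis
    by (simp only: ev_A ev_B ccfc_add[OF h(2)] ccfc_mult[OF h(2)] ccfc_const[OF h(2)] continuous_on_mult contf continuous_on_const)
qed

lemma coef_bounds:
  obtains m M where "m > 0" "m \<le> 1" "\<And>t. t \<in> K \<Longrightarrow> w t \<ge> m" "\<And>t. t \<in> K \<Longrightarrow> u t \<ge> m" "\<And>t. t \<in> K \<Longrightarrow> - Im (tau t) \<ge> m"
    "\<And>t. t \<in> K \<Longrightarrow> \<bar>Re (tau t)\<bar> \<le> M"
proof -
  note ne = real_spec_nonempty[OF h(2)]
  have inf: "\<exists>m>0. \<forall>t\<in>K. f t \<ge> m" if f: "continuous_on K f" "\<And>t. t \<in> K \<Longrightarrow> f t > 0" for f :: "real \<Rightarrow> real"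
    using continuous_attains_inf[OF compact_real_spec ne f(1)] f(2) by blast
  obtain m1 where 1: "m1 > 0" "\<forall>t\<in>K. w t \<ge> m1" using inf[OF cont(1) pos(1)] by blast
  obtain m2 where 2: "m2 > 0" "\<forall>t\<in>K. u t \<ge> m2" using inf[OF cont(2) pos(2)] by blast
  have "continuous_on K (\<lambda>t. - Im (tau t))" "\<And>t. t \<in> K \<Longrightarrow> - Im (tau t) > 0" using pos(3) by (auto intro!: continuous_intros cont)
  from inf[OF this] obtain m3 where 3: "m3 > 0" "\<forall>t\<in>K. - Im (tau t) \<ge> m3" by blast
  have "compact ((\<lambda>t. Re (tau t)) ` K)" by (intro compact_continuous_image continuous_intros cont compact_real_spec)
  then obtain M where M: "\<forall>t\<in>K. \<bar>Re (tau t)\<bar> \<le> M" using compact_imp_bounded by (fastforce simp: bounded_iff)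
  show ?thesis
    by (rule that[of "min 1 (min m1 (min m2 m3))" M]) (use 1 2 3 M in \<open>auto simp: min_le_iff_disj\<close>)
qed

definition "qr s x y t = (1 + s * (w t - 1))\<^sup>2 * (1 + s * (u t - 1)) * (cmod (complex_of_real x + of_real y * fT (of_real s) t))\<^sup>2"

text \<open>For real parameters the linear factors of A and B are complex conjugate, so the leading
  symbol is real and nonnegative on the spectrum.\<close>

lemma fAB_real: "fA (of_real s) (of_real x) (of_real y) t * fB (of_real s) (of_real x) (of_real y) t = of_real (qr s x y t)"
proof -
  have "of_real x + of_real y * fT' (of_real s) t = cnj (of_real x + of_real y * fT (of_real s) t)"
    by (simp add: fT_def fT'_def)
  moreover have "fW (of_real s) t = of_real (1 + s * (w t - 1))" "fU (of_real s) t = of_real (1 + s * (u t - 1))"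
    by (simp_all add: fW_def fU_def)
  ultimately have "fA (of_real s) (of_real x) (of_real y) t * fB (of_real s) (of_real x) (of_real y) t
     = of_real (1 + s * (w t - 1)) ^ 2 * of_real (1 + s * (u t - 1)) * ((of_real x + of_real y * fT (of_real s) t) * cnj (of_real x + of_real y * fT (of_real s) t))"
    by (simp only: fA_def fB_def power2_eq_square mult_ac)
  then show ?thesis unfolding qr_def complex_norm_square[symmetric] of_real_mult of_real_power by simp
qed

text \<open>Ellipticity, uniformly along the path: the bounds w, u, - Im tau \<ge> m hold at the
  flat end because m \<le> 1, and they persist under convex combination.\<close>

lemma qr_bound: "\<exists>c. c > 0 \<and> (\<forall>s\<in>{0..1}. \<forall>x y. \<forall>t\<in>K. c * (x\<^sup>2 + y\<^sup>2) \<le> qr s x y t)"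
proof -
  obtain m M where m: "m > 0" "m \<le> 1" "\<And>t. t \<in> K \<Longrightarrow> w t \<ge> m" "\<And>t. t \<in> K \<Longrightarrow> u t \<ge> m" "\<And>t. t \<in> K \<Longrightarrow> - Im (tau t) \<ge> m"
    "\<And>t. t \<in> K \<Longrightarrow> \<bar>Re (tau t)\<bar> \<le> M" using coef_bounds by blast
  \<comment> \<open>L is the constant in x^2 + y^2 \<le> L |x + y T|^2: x^2 is at most 2 (x + y Re
    T)^2 + 2 (y Re T)^2, and y^2 is recovered from (y Im T)^2 \<ge> m^2 y^2.\<close>
  define L where "L = 2 + (2 * M\<^sup>2 + 1) / m\<^sup>2"
  have L: "L > 0" unfolding L_def by (simp add: add_pos_nonneg)
  show ?thesis
  proof (intro exI[of _ "m\<^sup>2 * m / L"] conjI ballI allI)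
    show "m\<^sup>2 * m / L > 0" using m L by simp
    fix s x y t assume s: "s \<in> {0..1::real}" and t: "t \<in> K"
    have conv: "1 + s * (a - 1) \<ge> m" if "a \<ge> m" for a
    proof -
      have "1 + s * (a - 1) = (1 - s) * 1 + s * a" by (simp add: algebra_simps)
      also have "\<dots> \<ge> (1 - s) * m + s * m" using s that m(2) by (intro add_mono mult_left_mono) auto
      finally show ?thesis by (simp add: algebra_simps)
    qed
    let ?T = "fT (of_real s) t"
    have im: "- Im ?T \<ge> m" using conv[OF m(5)[OF t]] by (simp add: fT_def algebra_simps)
    have re: "(Re ?T)\<^sup>2 \<le> M\<^sup>2"
    proof -
      have "\<bar>Re ?T\<bar> = s * \<bar>Re (tau t)\<bar>" using s by (simp add: fT_def abs_mult)
      also have "\<dots> \<le> 1 * M" using s m(6)[OF t] by (intro mult_mono) auto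
      finally have "\<bar>Re ?T\<bar> \<le> M" by simp
      from power_mono[OF this abs_ge_zero, of 2] show ?thesis by simp
    qed
    let ?n = "(cmod (complex_of_real x + of_real y * ?T))\<^sup>2"
    have n: "?n = (x + y * Re ?T)\<^sup>2 + (y * Im ?T)\<^sup>2" by (simp add: cmod_power2)
    have "x\<^sup>2 \<le> 2 * (x + y * Re ?T)\<^sup>2 + 2 * (y * Re ?T)\<^sup>2"
      using zero_le_power2[of "x + 2 * (y * Re ?T)"] by (simp add: power2_eq_square algebra_simps)
    moreover have "(y * Re ?T)\<^sup>2 \<le> y\<^sup>2 * M\<^sup>2" unfolding power_mult_distrib by (intro mult_left_mono re) auto
    ultimately have "x\<^sup>2 + y\<^sup>2 \<le> 2 * (x + y * Re ?T)\<^sup>2 + (2 * M\<^sup>2 + 1) * y\<^sup>2" by (simp add: algebra_simps)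
    also have "(2 * M\<^sup>2 + 1) * y\<^sup>2 \<le> (2 * M\<^sup>2 + 1) / m\<^sup>2 * (y * Im ?T)\<^sup>2"
    proof -
      have "m\<^sup>2 \<le> (Im ?T)\<^sup>2" using power_mono[OF im, of 2] m(1) by simp
      then have "(2 * M\<^sup>2 + 1) / m\<^sup>2 * (y\<^sup>2 * m\<^sup>2) \<le> (2 * M\<^sup>2 + 1) / m\<^sup>2 * (y\<^sup>2 * (Im ?T)\<^sup>2)"
        by (intro mult_left_mono) auto
      then show ?thesis using m(1) by (simp add: power_mult_distrib)
    qed
    also have "2 * (x + y * Re ?T)\<^sup>2 + (2 * M\<^sup>2 + 1) / m\<^sup>2 * (y * Im ?T)\<^sup>2 \<le> L * ?n"
      unfolding n L_def by (simp add: distrib_left distrib_right)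
    finally have 1: "(x\<^sup>2 + y\<^sup>2) / L \<le> ?n" using L by (simp add: divide_le_eq mult.commute)
    have "m\<^sup>2 * m / L * (x\<^sup>2 + y\<^sup>2) = m\<^sup>2 * m * ((x\<^sup>2 + y\<^sup>2) / L)" by simp
    also have "\<dots> \<le> (1 + s * (w t - 1))\<^sup>2 * (1 + s * (u t - 1)) * ?n"
    proof (rule mult_mono)
      have "m\<^sup>2 \<le> (1 + s * (w t - 1))\<^sup>2" using conv[OF m(3)[OF t]] m(1) by (intro power_mono) auto
      then show "m\<^sup>2 * m \<le> (1 + s * (w t - 1))\<^sup>2 * (1 + s * (u t - 1))"
        using conv[OF m(4)[OF t]] m(1) by (intro mult_mono) auto
      show "0 \<le> (1 + s * (w t - 1))\<^sup>2 * (1 + s * (u t - 1))"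
        using conv[OF m(4)[OF t]] m(1) by simp
    qed (use 1 L in auto)
    finally show "m\<^sup>2 * m / L * (x\<^sup>2 + y\<^sup>2) \<le> qr s x y t" by (simp add: qr_def)
  qed
qed

definition cq :: real where "cq = (SOME c. c > 0 \<and> (\<forall>s\<in>{0..1}. \<forall>x y. \<forall>t\<in>K. c * (x\<^sup>2 + y\<^sup>2) \<le> qr s x y t))"

lemma cq: "cq > 0" "s \<in> {0..1} \<Longrightarrow> t \<in> K \<Longrightarrow> cq * (x\<^sup>2 + y\<^sup>2) \<le> qr s x y t"
proof -
  from someI_ex[OF qr_bound] have q: "cq > 0 \<and> (\<forall>s\<in>{0..1}. \<forall>x y. \<forall>t\<in>K. cq * (x\<^sup>2 + y\<^sup>2) \<le> qr s x y t)"
    unfolding cq_def .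
  then show "cq > 0" by (rule conjunct1)
  show "s \<in> {0..1} \<Longrightarrow> t \<in> K \<Longrightarrow> cq * (x\<^sup>2 + y\<^sup>2) \<le> qr s x y t"
    by (rule q[THEN conjunct2, rule_format])
qed

abbreviation rpt :: "real \<Rightarrow> real \<Rightarrow> real \<Rightarrow> complex \<Rightarrow> var \<Rightarrow> complex" where
  "rpt s x y l \<equiv> pt (of_real s) (of_real x) (of_real y) l"

text \<open>On \<Omega> the resolvent exists and all estimates take place. \<Omega>1 leaves room in
  every variable, as the variation requires; \<Omega>0 is the part lambda = 0, \<xi> nonzero, where
  A and B are invertible separately.\<close>

definition "\<Omega> = {rpt s x y l | s x y l. s \<in> {0..1} \<and> (l \<notin> cut \<or> cmod l < cq * (x\<^sup>2 + y\<^sup>2))}"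
definition "\<Omega>1 = {rpt s x y l | s x y l. s \<in> {0..1} \<and> l \<notin> cut}"
definition "\<Omega>0 = {rpt s x y 0 | s x y. s \<in> {0..1} \<and> (x, y) \<noteq> (0, 0)}"

lemma Om_sub: "\<Omega>1 \<subseteq> \<Omega>" "\<Omega>0 \<subseteq> \<Omega>"
proof -
  show "\<Omega>1 \<subseteq> \<Omega>" by (auto simp: \<Omega>_def \<Omega>1_def)
  show "\<Omega>0 \<subseteq> \<Omega>"
  proof
    fix z assume "z \<in> \<Omega>0"
    then obtain s x y where z: "z = rpt s x y 0" "s \<in> {0..1}" "(x, y) \<noteq> (0, 0)" by (auto simp: \<Omega>0_def)
    have "x\<^sup>2 + y\<^sup>2 > 0" using z(3) by (simp add: sum_power2_gt_zero_iff)
    then have "cmod 0 < cq * (x\<^sup>2 + y\<^sup>2)" using cq(1) by simp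
    then show "z \<in> \<Omega>" using z unfolding \<Omega>_def by blast
  qed
qed

text \<open>On the spectrum the leading symbol takes values in the ray from cq (x^2 + y^2) to
  infinity, so the distance of l to that ray bounds the resolvent.\<close>

lemma resolvent:
  assumes "s \<in> {0..1}" and d: "\<And>r. r \<ge> cq * (x\<^sup>2 + y\<^sup>2) \<Longrightarrow> cmod (of_real r - l) \<ge> \<eta>" and \<eta>: "\<eta> > 0"
  shows "alg_invertible (ev Q (rpt s x y l))" "norm (alg_inv (ev Q (rpt s x y l))) \<le> 1 / \<eta>"
proof -
  let ?f = "\<lambda>t. fA (of_real s) (of_real x) (of_real y) t * fB (of_real s) (of_real x) (of_real y) t + (- l)"
  have c: "continuous_on K ?f" by (intro continuous_intros)
  have b: "cmod (?f t) \<ge> \<eta>" if "t \<in> K" for t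
    using d[OF cq(2)[OF assms(1) that]] by (simp add: fAB_real)
  then have nz: "?f t \<noteq> 0" if "t \<in> K" for t using \<eta> b[OF that] by auto
  note i = ccfc_inverse[OF h(2) c nz]
  show "alg_invertible (ev Q (rpt s x y l))" using i(1) by (simp add: ev_Q)
  have "norm (ccfc (\<lambda>t. inverse (?f t)) h) \<le> 1 / \<eta>"
  proof (rule ccfc_norm_le[OF h(2)])
    show "continuous_on K (\<lambda>t. inverse (?f t))" using c nz by (intro continuous_on_inverse) auto
    fix t assume "t \<in> K"
    from le_imp_inverse_le[OF b[OF this] \<eta>] show "cmod (inverse (?f t)) \<le> 1 / \<eta>"
      by (simp only: norm_inverse inverse_eq_divide norm_divide norm_one)
  qed
  then show "norm (alg_inv (ev Q (rpt s x y l))) \<le> 1 / \<eta>" using i(2) by (simp add: ev_Q)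
qed

lemma Om_invertible: assumes "z \<in> \<Omega>" shows "alg_invertible (ev Q z)"
proof -
  obtain s x y l where z: "z = rpt s x y l" "s \<in> {0..1}" "l \<notin> cut \<or> cmod l < cq * (x\<^sup>2 + y\<^sup>2)" using assms by (auto simp: \<Omega>_def)
  have "\<exists>\<eta>>0. \<forall>r. r \<ge> cq * (x\<^sup>2 + y\<^sup>2) \<longrightarrow> cmod (of_real r - l) \<ge> \<eta>"
    using z(3)
  proof
    assume "l \<notin> cut"
    then obtain e where e: "e > 0" "\<And>l'. l' \<in> cut \<Longrightarrow> e \<le> dist l l'"
      using separate_point_closed[OF closed_cut] by blast
    have "of_real r \<in> cut" if "r \<ge> cq * (x\<^sup>2 + y\<^sup>2)" for r
    proof -
      have "0 \<le> cq * (x\<^sup>2 + y\<^sup>2)" using cq(1) by simp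
      then show ?thesis using that by (auto simp: cut_def)
    qed
    then show ?thesis using e by (intro exI[of _ e]) (metis dist_norm dist_commute)
  next
    assume a: "cmod l < cq * (x\<^sup>2 + y\<^sup>2)"
    have "cq * (x\<^sup>2 + y\<^sup>2) - cmod l \<le> cmod (of_real r - l)" if "r \<ge> cq * (x\<^sup>2 + y\<^sup>2)" for r
      using norm_triangle_ineq2[of "complex_of_real r" l] that by simp
    then show ?thesis using a by (intro exI[of _ "cq * (x\<^sup>2 + y\<^sup>2) - cmod l"]) auto
  qed
  then show ?thesis using resolvent(1)[OF z(2)] z(1) by blast
qed

lemma ok_coeffs [simp]: "ok T Wx" "ok T Ux" "ok T Tx" "ok T Tx'"
  unfolding Wx_def Ux_def Tx_def Tx'_def using smooth Sm_scaleC[of 1] by (auto intro: Sm_diff Sm_add)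

lemma okS_AB [simp]: "okS T AS" "okS T BS" "okS T KS" "ok T Q"
proof -
  show 1: "okS T AS" "okS T BS" by (auto simp: AS_def BS_def okS_def)
  then show 2: "okS T KS" by (simp add: KS_def)
  then show "ok T Q" by (simp add: Q_def okS_def)
qed

lemma ok_IvQ: "T \<subseteq> \<Omega> \<Longrightarrow> ok T (Iv Q)"
  using Om_invertible by auto

lemma okS_bS: "T \<subseteq> \<Omega> \<Longrightarrow> okS T bS"
  using ok_IvQ by (simp add: bS_def)

lemma hm_AB: "hmS AS 1" "hmS BS 1" "hmS KS 2" "hm (Iv Q) (-2)" "hmS bS (-2)"
proof -
  have S: "hm (Vr Sig \<otimes> Cst a) 0" for a using hm_Ti[OF hm_Sig hm_Cst] by simp
  then have c: "hm Wx 0" "hm Ux 0" "hm Tx 0" "hm Tx' 0"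
    unfolding Wx_def Ux_def Tx_def Tx'_def by (auto intro!: hm_Pl hm_Cst)
  have l: "hm (Vr (Xi 1) \<oplus> Vr (Xi 2) \<otimes> e) 1" if "hm e 0" for e
    using hm_Ti[OF hm_Xi that, of 2] by (intro hm_Pl hm_Xi) simp
  show A: "hmS AS 1" unfolding hmS_def AS_def sym.sel
    using hm_Ti[OF c(1) l[OF c(4)]] hm_Ti[OF c(1) hm_dx[OF c(4)]] by (auto intro: hm_0)
  show B: "hmS BS 1" unfolding hmS_def BS_def sym.sel
  proof (intro conjI hm_0)
    show "hm (Ux \<otimes> (Vr (Xi 1) \<oplus> Vr (Xi 2) \<otimes> Tx) \<otimes> Wx) 1" using hm_Ti[OF hm_Ti[OF c(2) l[OF c(3)]] c(1)] by simp
    have "hm (dx 1 Wx \<oplus> Tx \<otimes> dx 2 Wx) 0"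
      by (rule hm_Pl[OF hm_dx[OF c(1)]]) (rule hm_TiI[OF c(3) hm_dx[OF c(1)]], simp)
    then show "hm (Ux \<otimes> (dx 1 Wx \<oplus> Tx \<otimes> dx 2 Wx)) (1 - 1)" by (rule hm_TiI[OF c(2)]) simp
  qed
  have "hmS (AS \<star> BS) 2" using hmS_star[OF A B] by simp
  then show K: "hmS KS 2" unfolding KS_def Kof_def hmS_def by (auto intro!: hm_Pl hm_Ng hm_Lam)
  then have "hm Q 2" by (simp add: Q_def hmS_def)
  then show i: "hm (Iv Q) (-2)" by (rule hm_Iv)
  show "hmS bS (-2)" unfolding bS_def by (rule hmS_inv(1)[OF K]) (use i in simp)
qed

lemma good_Om: "good \<Omega>1" "lim_set \<Omega>1 Sig" "lim_set \<Omega>1 Lam" "good \<Omega>0"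
proof -
  have i2: "i = 1 \<or> i = 2" for i :: 2 using exhaust_2 by auto
  have R: "complex_of_real a islimpt range of_real" for a using of_real_islimpt[of a UNIV] islimpt_UNIV by simp
  show "good \<Omega>1" unfolding good_def lim_set_def
  proof (intro allI ballI)
    fix i :: 2 and z assume "z \<in> \<Omega>1"
    then obtain s x y l where z: "z = rpt s x y l" "s \<in> {0..1}" "l \<notin> cut" by (auto simp: \<Omega>1_def)
    have "range of_real \<subseteq> {w. z(Xi i := w) \<in> \<Omega>1}" using i2[of i] z unfolding z(1) \<Omega>1_def by (auto simp: pt_upd pt_inj)
    moreover have "\<exists>a. z (Xi i) = of_real a" using i2[of i] z(1) by auto
    ultimately show "z (Xi i) islimpt {w. z(Xi i := w) \<in> \<Omega>1}" using R islimpt_subset by metis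
  qed
  show "lim_set \<Omega>1 Sig" unfolding lim_set_def
  proof
    fix z assume "z \<in> \<Omega>1"
    then obtain s x y l where z: "z = rpt s x y l" "s \<in> {0..1}" "l \<notin> cut" by (auto simp: \<Omega>1_def)
    have "of_real ` {0..1} \<subseteq> {w. z(Sig := w) \<in> \<Omega>1}" using z unfolding z(1) \<Omega>1_def by (auto simp: pt_upd pt_inj)
    then show "z Sig islimpt {w. z(Sig := w) \<in> \<Omega>1}"
      using islimpt_subset[OF of_real_islimpt[OF unit_islimpt[OF z(2)]]] z(1) by simp
  qed
  show "lim_set \<Omega>1 Lam" unfolding lim_set_def
  proof
    fix z assume "z \<in> \<Omega>1"
    then obtain s x y l where z: "z = rpt s x y l" "s \<in> {0..1}" "l \<notin> cut" by (auto simp: \<Omega>1_def)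
    have "- cut \<subseteq> {w. z(Lam := w) \<in> \<Omega>1}" using z unfolding z(1) \<Omega>1_def by (auto simp: pt_upd pt_inj)
    moreover have "l islimpt - cut" using interior_limit_point[of l "- cut"] z(3) closed_cut
      by (simp add: interior_open open_Compl)
    ultimately show "z Lam islimpt {w. z(Lam := w) \<in> \<Omega>1}" using islimpt_subset[of l] z(1) by simp
  qed
  show "good \<Omega>0" unfolding good_def lim_set_def
  proof (intro allI ballI)
    fix i :: 2 and z assume "z \<in> \<Omega>0"
    then obtain s x y where z: "z = rpt s x y 0" "s \<in> {0..1}" "(x, y) \<noteq> (0, 0)" by (auto simp: \<Omega>0_def)
    have L: "complex_of_real a islimpt of_real ` (UNIV - {b})" for a b
      by (rule of_real_islimpt) (use islimpt_insert[of a b "UNIV - {b}"] in \<open>simp add: insert_absorb\<close>)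
    have n: "of_real ` (UNIV - {0}) \<subseteq> {w. z(Xi i := w) \<in> \<Omega>0}" using i2[of i] z unfolding z(1) \<Omega>0_def by (auto simp: pt_upd pt_inj)
    moreover have "\<exists>a. z (Xi i) = of_real a" using i2[of i] z(1) by auto
    ultimately show "z (Xi i) islimpt {w. z(Xi i := w) \<in> \<Omega>0}" using L islimpt_subset by metis
  qed
qed

end

subsection \<open>Integrals over lines and planes\<close>

lemma integrable_inverse_one_plus_square: "integrable lborel (\<lambda>x::real. 1 / (1 + x\<^sup>2))"
proof -
  have nz: "1 + x\<^sup>2 \<noteq> 0" for x :: real using zero_le_power2[of x] by linarith
  have "set_integrable lborel (einterval (-\<infinity>) \<infinity>) (\<lambda>x::real. 1 / (1 + x\<^sup>2))"
  proof (rule interval_integral_FTC_nonneg(1))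
    show "DERIV arctan x :> 1 / (1 + x\<^sup>2)" for x using DERIV_arctan[of x] by (simp add: inverse_eq_divide)
    show "isCont (\<lambda>x::real. 1 / (1 + x\<^sup>2)) x" for x using nz[of x] by (intro continuous_intros)
    show "((arctan \<circ> real_of_ereal) \<longlongrightarrow> - (pi/2)) (at_right (-\<infinity>))" unfolding ereal_tendsto_simps by (rule tendsto_arctan_at_bot)
    show "((arctan \<circ> real_of_ereal) \<longlongrightarrow> pi/2) (at_left \<infinity>)" unfolding ereal_tendsto_simps by (rule tendsto_arctan_at_top)
  qed (auto simp: add_nonneg_nonneg)
  then show ?thesis by (simp add: set_integrable_def)
qed

lemma integrable_dominated:
  fixes f :: "'b::{euclidean_space} \<Rightarrow> complex"
  assumes "continuous_on UNIV f" "\<And>x. cmod (f x) \<le> g x" "integrable lborel g"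
  shows "integrable lborel f"
proof (rule Bochner_Integration.integrable_bound[OF assms(3)])
  show "f \<in> borel_measurable lborel" using borel_measurable_continuous_onI[OF assms(1)] by simp
  show "AE x in lborel. norm (f x) \<le> norm (g x)"
    using assms(2) by (intro AE_I2) (metis abs_ge_self order_trans real_norm_def)
qed

lemma FTC_line:
  fixes f F :: "real \<Rightarrow> complex"
  assumes "\<And>x. (F has_vector_derivative f x) (at x)" "continuous_on UNIV f" "integrable lborel f"
    "(F \<longlongrightarrow> A) at_bot" "(F \<longlongrightarrow> B) at_top"
  shows "integral\<^sup>L lborel f = B - A"
proof -
  have "(LBINT x=-\<infinity>..\<infinity>. f x) = B - A"
    by (rule interval_integral_FTC_integrable[where F = F])
      (use assms in \<open>auto simp: ereal_tendsto_simps continuous_on_eq_continuous_at set_integrable_def\<close>)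
  then show ?thesis by (simp add: interval_lebesgue_integral_def set_lebesgue_integral_def)
qed

lemma FTC_line_decay:
  fixes f F :: "real \<Rightarrow> complex"
  assumes "\<And>x. (F has_vector_derivative f x) (at x)" "continuous_on UNIV f"
    and F: "\<And>x. cmod (F x) \<le> C / (1 + x\<^sup>2)" and f: "\<And>x. cmod (f x) \<le> C' / (1 + x\<^sup>2)"
  shows "integral\<^sup>L lborel f = 0"
proof -
  have "integrable lborel (\<lambda>x::real. C' * (1 / (1 + x\<^sup>2)))"
    by (intro integrable_mult_right integrable_inverse_one_plus_square)
  then have "integrable lborel f" by (intro integrable_dominated[OF assms(2), of "\<lambda>x. C' * (1 / (1 + x\<^sup>2))"]) (use f in auto)
  moreover have "(F \<longlongrightarrow> 0) at_bot" "(F \<longlongrightarrow> 0) at_top"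
  proof -
    have 1: "((\<lambda>x::real. C / (1 + x\<^sup>2)) \<longlongrightarrow> 0) at_bot" "((\<lambda>x::real. C / (1 + x\<^sup>2)) \<longlongrightarrow> 0) at_top" by real_asymp+
    show "(F \<longlongrightarrow> 0) at_bot" using 1(1) by (rule Lim_null_comparison[OF always_eventually[OF allI[OF F]]])
    show "(F \<longlongrightarrow> 0) at_top" using 1(2) by (rule Lim_null_comparison[OF always_eventually[OF allI[OF F]]])
  qed
  ultimately show ?thesis using FTC_line[OF assms(1,2), of 0 0] by simp
qed

lemma FTC_half_line:
  fixes f F :: "real \<Rightarrow> complex"
  assumes "\<And>x. x > 0 \<Longrightarrow> (F has_vector_derivative f x) (at x)" "continuous_on UNIV f" "integrable lborel f"
    "(F \<longlongrightarrow> A) (at_right 0)" "(F \<longlongrightarrow> B) at_top"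
  shows "has_bochner_integral lborel (\<lambda>x. indicator {0..} x *\<^sub>R f x) (B - A)"
proof -
  have "(LBINT x=0..\<infinity>. f x) = B - A"
    by (rule interval_integral_FTC_integrable[where F = F])
      (use assms in \<open>auto simp: zero_ereal_def ereal_tendsto_simps continuous_on_eq_continuous_at set_integrable_def
         intro!: integrable_mult_indicator\<close>)
  then have "(LINT x|lborel. indicator {0<..} x *\<^sub>R f x) = B - A"
    by (simp add: interval_lebesgue_integral_def set_lebesgue_integral_def zero_ereal_def)
  moreover have "(LINT x|lborel. indicator {0<..} x *\<^sub>R f x) = (LINT x|lborel. indicator {0..} x *\<^sub>R f x)"
  proof (rule integral_cong_AE)
    have "AE x in lborel. x \<noteq> (0::real)" by (rule AE_lborel_singleton)
    then show "AE x in lborel. indicator {0<..} x *\<^sub>R f x = indicator {0..} x *\<^sub>R f x"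
      by eventually_elim (auto split: split_indicator)
  qed (use assms(3) in auto)
  moreover have "integrable lborel (\<lambda>x. indicator {0..} x *\<^sub>R f x)"
    using assms(3) by (intro integrable_mult_indicator) auto
  ultimately show ?thesis by (simp add: has_bochner_integral_iff)
qed

text \<open>An integrable majorant in the plane with the decay of a symbol of degree -4, which is
  the degree of b_2.\<close>

definition kern :: "real \<times> real \<Rightarrow> real" where "kern p = 1 / (1 + (norm p)\<^sup>2)\<^sup>2"

lemma norm2_pair: "(norm (x, y))\<^sup>2 = x\<^sup>2 + y\<^sup>2" for x y :: real
  by (simp add: norm_Pair)

lemma kern_nonneg: "kern p \<ge> 0" by (simp add: kern_def)

lemma integrable_kern: "integrable lborel kern"
proof -
  let ?g = "\<lambda>x::real. 1 / (1 + x\<^sup>2)"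
  have "integrable (lborel \<Otimes>\<^sub>M lborel) (\<lambda>p. ?g (fst p) * ?g (snd p))"
  proof (rule lborel_pair.Fubini_integrable)
    show "(\<lambda>p. ?g (fst p) * ?g (snd p)) \<in> borel_measurable (lborel \<Otimes>\<^sub>M lborel)" by measurable
    show "integrable lborel (\<lambda>x. LINT y|lborel. norm (?g (fst (x, y)) * ?g (snd (x, y))))"
      unfolding fst_conv snd_conv real_norm_def abs_mult integral_mult_right_zero
      by (intro integrable_mult_left integrable_abs integrable_inverse_one_plus_square)
    show "AE x in lborel. integrable lborel (\<lambda>y. ?g (fst (x, y)) * ?g (snd (x, y)))"
      unfolding fst_conv snd_conv by (intro AE_I2 integrable_mult_right integrable_inverse_one_plus_square)
  qed
  then have i: "integrable lborel (\<lambda>p. ?g (fst p) * ?g (snd p))" by (simp only: lborel_prod)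
  show ?thesis
  proof (rule Bochner_Integration.integrable_bound[OF i])
    show "kern \<in> borel_measurable lborel" unfolding kern_def[abs_def] by measurable
    show "AE p in lborel. norm (kern p) \<le> norm (?g (fst p) * ?g (snd p))"
    proof (rule AE_I2)
      fix p :: "real \<times> real"
      obtain x y where p: "p = (x, y)" by (cases p)
      have "(1 + x\<^sup>2) * (1 + y\<^sup>2) \<le> (1 + (x\<^sup>2 + y\<^sup>2)) * (1 + (x\<^sup>2 + y\<^sup>2))"
        by (intro mult_mono) auto
      moreover have "(1 + x\<^sup>2) * (1 + y\<^sup>2) > 0" by (simp add: add_pos_nonneg)
      ultimately show "norm (kern p) \<le> norm (?g (fst p) * ?g (snd p))"
        unfolding p kern_def norm2_pair by (simp add: abs_mult power2_eq_square[of "1 + _"] frac_le)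
    qed
  qed
qed

text \<open>The parameter t is the path parameter in \<open>total_vanish\<close> and the position on
  a piece of the contour in \<open>ray_vanish\<close>.\<close>

lemma fubini_vanish:
  fixes f :: "real \<Rightarrow> real \<times> real \<Rightarrow> complex" and B :: "real \<Rightarrow> real"
  assumes m: "(\<lambda>q. f (fst q) (snd q)) \<in> borel_measurable borel"
    and b: "\<And>t p. cmod (f t p) \<le> B t * kern p" and B: "integrable lborel B"
    and z: "\<And>t. integral\<^sup>L lborel (f t) = 0"
  shows "integrable lborel (\<lambda>p. integral\<^sup>L lborel (\<lambda>t. f t p))" "(LINT p|lborel. LINT t|lborel. f t p) = 0"
proof -
  note [measurable] = borel_measurable_integrable[OF B] borel_measurable_integrable[OF integrable_kern]
  have mm[measurable]: "(\<lambda>q. f (fst q) (snd q)) \<in> borel_measurable (lborel \<Otimes>\<^sub>M lborel)" using m by (simp add: lborel_prod)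
  have iK: "integrable (lborel \<Otimes>\<^sub>M lborel) (\<lambda>q. B (fst q) * kern (snd q))"
  proof (rule lborel_pair.Fubini_integrable)
    show "(\<lambda>q. B (fst q) * kern (snd q)) \<in> borel_measurable (lborel \<Otimes>\<^sub>M lborel)" by measurable
    show "integrable lborel (\<lambda>x. LINT y|lborel. norm (B (fst (x, y)) * kern (snd (x, y))))"
      using B by (simp add: abs_mult)
    show "AE x in lborel. integrable lborel (\<lambda>y. B (fst (x, y)) * kern (snd (x, y)))"
      using integrable_kern by simp
  qed
  have "integrable (lborel \<Otimes>\<^sub>M lborel) (\<lambda>q. f (fst q) (snd q))"
  proof (rule Bochner_Integration.integrable_bound[OF iK mm], rule AE_I2)
    fix q :: "real \<times> real \<times> real"
    show "norm (f (fst q) (snd q)) \<le> norm (B (fst q) * kern (snd q))"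
      using b[of "fst q" "snd q"] by (metis abs_ge_self order_trans real_norm_def)
  qed
  then have "integrable (lborel \<Otimes>\<^sub>M lborel) (case_prod f)" by (simp add: case_prod_beta')
  note lborel_pair.integral_snd[OF this] lborel_pair.integrable_snd[OF this] lborel_pair.Fubini_integral[OF this]
  with z show "integrable lborel (\<lambda>p. integral\<^sup>L lborel (\<lambda>t. f t p))" "(LINT p|lborel. LINT t|lborel. f t p) = 0"
    by simp_all
qed

text \<open>Cauchy's theorem on a half disc of radius n: the arc has length pi n, and f is of order
  n^(-2) on it.\<close>

lemma half_plane_vanish_upper:
  assumes hol: "f holomorphic_on {z. Im z \<ge> 0}" and b: "\<And>z. Im z \<ge> 0 \<Longrightarrow> cmod z \<ge> 1 \<Longrightarrow> cmod (f z) \<le> C / (cmod z)\<^sup>2"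
    and i: "integrable lborel (\<lambda>x. f (of_real x))"
  shows "(LINT x|lborel. f (of_real x)) = 0"
proof -
  define F where "F = (\<lambda>n::nat. integral {- real n..real n} (\<lambda>x. f (of_real x)))"
  have C: "C \<ge> 0" using order_trans[OF norm_ge_zero b[of 1]] by simp
  have S: "convex {z. Im z \<ge> 0}" by (rule convex_halfspace_Im_ge)
  have cont: "continuous_on {z. Im z \<ge> 0} f" by (rule holomorphic_on_imp_continuous_on[OF hol])
  have Fb: "cmod (F n) \<le> C * pi / real n" if n: "n \<ge> 1" for n
  proof -
    let ?l = "linepath (complex_of_real (- real n)) (complex_of_real (real n))"
    let ?c = "part_circlepath 0 (real n) 0 pi"
    have pc: "pathstart ?c = of_real (real n)" "pathfinish ?c = of_real (- real n)"
      by (simp_all add: exp_pi_i')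
    have il: "path_image ?l \<subseteq> {z. Im z \<ge> 0}" unfolding path_image_linepath
      by (rule closed_segment_subset[OF _ _ S]) auto
    have ic: "Im z \<ge> 0 \<and> cmod z = n" if "z \<in> path_image ?c" for z
    proof -
      have "\<exists>a. z = real n * cis a \<and> 0 \<le> a \<and> a \<le> pi"
        using that by (force simp: path_image_part_circlepath' closed_segment_eq_real_ivl)
      then obtain a where a: "z = real n * cis a" "0 \<le> a" "a \<le> pi" by blast
      then show ?thesis using sin_ge_zero[of a] by (simp add: norm_mult)
    qed
    then have ic': "path_image ?c \<subseteq> {z. Im z \<ge> 0}" by auto
    have ci: "f contour_integrable_on ?l" "f contour_integrable_on ?c"
      by (rule contour_integrable_continuous_linepath contour_integrable_continuous_part_circlepath, rule continuous_on_subset[OF cont], use il ic' in simp)+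
    have "(f has_contour_integral 0) (?l +++ ?c)"
      by (rule Cauchy_theorem_convex_simple[OF hol S]) (use il ic' pc in \<open>auto simp: path_image_join intro!: valid_path_join\<close>)
    moreover have "contour_integral (?l +++ ?c) f = contour_integral ?l f + contour_integral ?c f"
      by (rule contour_integral_join) (use ci pc in auto)
    ultimately have "contour_integral ?l f = - contour_integral ?c f"
      using contour_integral_unique by (fastforce simp: add_eq_0_iff)
    moreover have "contour_integral ?l f = F n" unfolding F_def
      by (subst contour_integral_linepath_Reals_eq) (use n in auto)
    ultimately have "cmod (F n) = cmod (contour_integral ?c f)" by (metis norm_minus_cancel)
    moreover have "cmod (contour_integral ?c f) \<le> C / (real n)\<^sup>2 * real n * \<bar>pi - 0\<bar>"
      by (rule contour_integral_bound_part_circlepath[OF ci(2)]) (use C b ic n in fastforce)+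
    ultimately show ?thesis using n by (simp add: power2_eq_square field_simps)
  qed
  have "(F \<longlongrightarrow> 0) sequentially"
  proof (rule Lim_null_comparison)
    show "eventually (\<lambda>n. norm (F n) \<le> C * pi / real n) sequentially"
      using Fb by (intro eventually_sequentiallyI[of 1])
    show "(\<lambda>n. C * pi / real n) \<longlonglongrightarrow> 0" by (rule lim_const_over_n)
  qed
  moreover have "F \<longlonglongrightarrow> (LINT x|lborel. f (of_real x))"
  proof -
    have "(\<lambda>n. LINT x|lborel. indicator {- real n..real n} x *\<^sub>R f (of_real x)) \<longlonglongrightarrow> (LINT x|lborel. f (of_real x))"
    proof (rule integral_dominated_convergence[where w = "\<lambda>x. norm (f (of_real x))"])
      show "AE x in lborel. (\<lambda>n. indicator {- real n..real n} x *\<^sub>R f (of_real x)) \<longlonglongrightarrow> f (of_real x)"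
      proof (rule AE_I2, rule tendsto_eventually)
        fix x :: real
        obtain N :: nat where "\<bar>x\<bar> \<le> N" using real_arch_simple by blast
        then show "\<forall>\<^sub>F n in sequentially. indicator {- real n..real n} x *\<^sub>R f (of_real x) = f (of_real x)"
          by (intro eventually_sequentiallyI[of N]) (auto split: split_indicator)
      qed
    qed (use i in \<open>auto split: split_indicator\<close>)
    moreover have "(LINT x|lborel. indicator {- real n..real n} x *\<^sub>R f (of_real x)) = F n" for n
    proof -
      have "set_integrable lborel {- real n..real n} (\<lambda>x. f (of_real x))"
        unfolding set_integrable_def using i by (intro integrable_mult_indicator) auto
      from set_borel_integral_eq_integral(2)[OF this] show ?thesis by (simp add: F_def set_lebesgue_integral_def)
    qed
    ultimately show ?thesis by simp
  qed
  ultimately show ?thesis by (rule LIMSEQ_unique[symmetric])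
qed

lemma half_plane_vanish:
  assumes sg: "\<sigma> = 1 \<or> \<sigma> = -1" and hol: "f holomorphic_on {z. \<sigma> * Im z \<ge> 0}"
    and b: "\<And>z. \<sigma> * Im z \<ge> 0 \<Longrightarrow> cmod z \<ge> 1 \<Longrightarrow> cmod (f z) \<le> C / (cmod z)\<^sup>2"
    and i: "integrable lborel (\<lambda>x. f (of_real x))"
  shows "(LINT x|lborel. f (of_real x)) = 0"
  using sg
proof
  assume "\<sigma> = 1" then show ?thesis using half_plane_vanish_upper[of f C] assms by simp
next
  assume s: "\<sigma> = -1"
  have "(LINT x|lborel. f (- of_real x)) = 0"
  proof (rule half_plane_vanish_upper[of "\<lambda>z. f (- z)", where C = C, simplified])
    have "(f \<circ> uminus) holomorphic_on {z. 0 \<le> Im z}"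
      by (rule holomorphic_on_compose_gen[OF _ hol]) (auto simp: s intro!: holomorphic_intros)
    then show "(\<lambda>z. f (- z)) holomorphic_on {z. 0 \<le> Im z}" by (simp add: comp_def)
    show "integrable lborel (\<lambda>x. f (- of_real x))"
      using lborel_integrable_real_affine[OF i, of "-1" 0] by simp
  qed (use b[of "- _"] s in simp)
  then show ?thesis using lborel_integral_real_affine[of "-1" "\<lambda>x. f (of_real x)" 0] by simp
qed

lemma powi_decay:
  assumes "R \<ge> (1::real)" "d \<le> - 2 * int k" shows "R powi d \<le> 2 ^ k / (1 + R\<^sup>2) ^ k"
proof -
  have R: "R\<^sup>2 \<ge> 1" using assms(1) by simp
  have "R powi d \<le> R powi (- int (2 * k))" using assms by (intro power_int_increasing) auto
  also have "\<dots> = 1 / (R\<^sup>2) ^ k" by (simp only: power_int_minus power_int_of_nat power_mult inverse_eq_divide)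
  also have "\<dots> \<le> 2 ^ k / (1 + R\<^sup>2) ^ k"
  proof -
    have "(1 + R\<^sup>2) ^ k \<le> (2 * R\<^sup>2) ^ k" using R by (intro power_mono) auto
    moreover have "(1 + R\<^sup>2) ^ k > 0" "(R\<^sup>2) ^ k > 0" using R assms(1) by (auto intro!: zero_less_power add_pos_nonneg)
    ultimately show ?thesis by (simp add: divide_simps power_mult_distrib mult.commute)
  qed
  finally show ?thesis .
qed

section \<open>Traces of symbols as functions on the plane\<close>

context gb_data
begin

definition "psi e s p l = tr (ev e (rpt s (fst p) (snd p) l))"

lemma in_Om: "s \<in> {0..1} \<Longrightarrow> l \<notin> cut \<Longrightarrow> rpt s x y l \<in> \<Omega>"
  "s \<in> {0..1} \<Longrightarrow> cmod l < cq * (x\<^sup>2 + y\<^sup>2) \<Longrightarrow> rpt s x y l \<in> \<Omega>"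
  unfolding \<Omega>_def by blast+

lemma psi_cont:
  assumes e: "ok \<Omega> e" and c: "continuous_on S f" "continuous_on S g" "continuous_on S k"
    and S: "\<And>q. q \<in> S \<Longrightarrow> rpt (f q) (fst (g q)) (snd (g q)) (k q) \<in> \<Omega>"
  shows "continuous_on S (\<lambda>q. psi e (f q) (g q) (k q))"
  unfolding psi_def
proof (rule bounded_linear.continuous_on[OF tr(1)], rule ev_continuous)
  fix v show "continuous_on S (\<lambda>q. rpt (f q) (fst (g q)) (snd (g q)) (k q) v)"
  proof (cases v)
    case (Xi i)
    then show ?thesis using exhaust_2[of i] c by (auto intro!: continuous_intros)
  qed (use c in \<open>auto intro!: continuous_intros\<close>)
qed (use e S in \<open>auto simp: ok_def\<close>)

lemma psi_cont_p: "ok \<Omega> e \<Longrightarrow> s \<in> {0..1} \<Longrightarrow> l \<notin> cut \<Longrightarrow> continuous_on S (\<lambda>p. psi e s p l)"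
  by (rule psi_cont) (auto intro: continuous_intros in_Om)

lemma psi_scale:
  assumes "hm e d" "r \<noteq> 0" "dm e (rpt s x y l)"
  shows "psi e s (r * x, r * y) ((of_real r)\<^sup>2 * l) = (of_real r powi d) * psi e s (x, y) l"
  using hm_scale[OF assms(1) _ assms(3), of "of_real r"] assms(2) by (simp add: psi_def scl_pt tr(2))

text \<open>The condition on l is invariant under scaling, so the region is swept out by the compact
  set where p lies on the unit sphere and |l| \<le> cq / 2. There the resolvent exists because cq /
  2 < cq, and the factor \<open>powi d\<close> carries the bound outward.\<close>

lemma psi_outer:
  assumes e: "ok \<Omega> e" "hm e d"
  shows "\<exists>C\<ge>0. \<forall>s\<in>{0..1}. \<forall>p l. p \<noteq> 0 \<longrightarrow> cmod l \<le> cq / 2 * (norm p)\<^sup>2 \<longrightarrow> cmod (psi e s p l) \<le> C * norm p powi d"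
proof -
  let ?S = "{0..1::real} \<times> sphere (0::real \<times> real) 1 \<times> cball (0::complex) (cq / 2)"
  have "continuous_on ?S (\<lambda>q. psi e (fst q) (fst (snd q)) (snd (snd q)))"
  proof (rule psi_cont[OF e(1)])
    fix q assume q: "q \<in> ?S"
    obtain s x y l where qq: "q = (s, (x, y), l)" by (metis prod.exhaust)
    have "x\<^sup>2 + y\<^sup>2 = 1" "cmod l \<le> cq / 2" using q norm2_pair[of x y] unfolding qq by auto
    then show "rpt (fst q) (fst (fst (snd q))) (snd (fst (snd q))) (snd (snd q)) \<in> \<Omega>"
      using q cq(1) unfolding qq by (auto intro!: in_Om(2))
  qed (intro continuous_intros)+
  moreover have "compact ?S" by (intro compact_Times) auto
  ultimately have "bounded ((\<lambda>q. psi e (fst q) (fst (snd q)) (snd (snd q))) ` ?S)"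
    by (intro compact_imp_bounded compact_continuous_image)
  then obtain C where C: "\<And>q. q \<in> ?S \<Longrightarrow> cmod (psi e (fst q) (fst (snd q)) (snd (snd q))) \<le> C"
    unfolding bounded_iff by blast
  show ?thesis
  proof (intro exI[of _ "max C 0"] conjI ballI allI impI)
    fix s p l assume s: "s \<in> {0..1::real}" and p: "p \<noteq> (0 :: real \<times> real)" "cmod l \<le> cq / 2 * (norm p)\<^sup>2"
    define r where "r = norm p"
    have r: "r > 0" using p(1) by (simp add: r_def)
    define x y where "x = fst p / r" and "y = snd p / r"
    have pe: "p = (r * x, r * y)" using r by (simp add: x_def y_def prod_eq_iff)
    define l' where "l' = l / (of_real r)\<^sup>2"
    have le: "l = (of_real r)\<^sup>2 * l'" using r by (simp add: l'_def)
    have xy: "x\<^sup>2 + y\<^sup>2 = 1"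
    proof -
      have "r\<^sup>2 = r\<^sup>2 * (x\<^sup>2 + y\<^sup>2)" using norm2_pair[of "r * x" "r * y"] unfolding pe[symmetric] r_def[symmetric] by (simp add: algebra_simps)
      then show ?thesis using r by simp
    qed
    have l': "cmod l' \<le> cq / 2" using p(2) r by (simp add: l'_def norm_divide norm_power divide_le_eq r_def)
    have "cmod (psi e s (x, y) l') \<le> C"
      using C[of "(s, (x, y), l')"] s l' xy norm_Pair[of x y] by simp
    moreover have "rpt s x y l' \<in> \<Omega>" using s l' xy cq(1) by (auto intro!: in_Om(2))
    then have "psi e s p l = (of_real r powi d) * psi e s (x, y) l'"
      unfolding pe le using psi_scale[OF e(2), of r s x y l'] r e(1) by (auto simp: ok_def)
    moreover have "cmod (of_real r powi d) = r powi d" using r by (simp add: norm_power_int)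
    ultimately show "cmod (psi e s p l) \<le> max C 0 * norm p powi d"
      using r by (simp add: norm_mult mult.commute[of "r powi d"] mult_right_mono flip: r_def)
  qed simp
qed

lemma psi_bound:
  assumes e: "ok \<Omega> e" "hm e d" "d \<le> - 2 * int k" and l: "l \<notin> cut"
  shows "\<exists>C\<ge>0. \<forall>s\<in>{0..1}. \<forall>p. cmod (psi e s p l) \<le> C / (1 + (norm p)\<^sup>2) ^ k"
proof -
  obtain C1 where C1: "C1 \<ge> 0" "\<And>s (p :: real \<times> real) l. s \<in> {0..1} \<Longrightarrow> p \<noteq> 0 \<Longrightarrow> cmod l \<le> cq / 2 * (norm p)\<^sup>2 \<Longrightarrow> cmod (psi e s p l) \<le> C1 * norm p powi d"
    using psi_outer[OF e(1,2)] by blast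
  \<comment> \<open>Outside radius R the norm of p is at least 1, so its square exceeds R and the
    hypothesis on l in \<open>psi_outer\<close> is met.\<close>
  define R where "R = max 1 (2 * cmod l / cq)"
  have R: "R \<ge> 1" "cmod l \<le> cq / 2 * R" using cq(1) by (auto simp: R_def field_simps max_def)
  let ?S = "{0..1::real} \<times> cball (0::real \<times> real) R"
  have "continuous_on ?S (\<lambda>q. psi e (fst q) (snd q) l)"
    by (rule psi_cont[OF e(1)]) (use l in_Om(1) in \<open>auto intro!: continuous_intros\<close>)
  then have "bounded ((\<lambda>q. psi e (fst q) (snd q) l) ` ?S)"
    by (intro compact_imp_bounded compact_continuous_image compact_Times) auto
  then obtain C2 where C2: "\<And>q. q \<in> ?S \<Longrightarrow> cmod (psi e (fst q) (snd q) l) \<le> C2"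
    unfolding bounded_iff by blast
  have C2p: "C2 \<ge> 0" using order_trans[OF norm_ge_zero C2[of "(0, 0)"]] R by simp
  show ?thesis
  proof (intro exI[of _ "C1 * 2 ^ k + C2 * (1 + R\<^sup>2) ^ k"] conjI ballI allI)
    show "0 \<le> C1 * 2 ^ k + C2 * (1 + R\<^sup>2) ^ k" using C1(1) C2p by simp
    fix s and p :: "real \<times> real" assume s: "s \<in> {0..1::real}"
    have pos: "(1 + (norm p)\<^sup>2) ^ k > 0" by (simp add: add_pos_nonneg)
    show "cmod (psi e s p l) \<le> (C1 * 2 ^ k + C2 * (1 + R\<^sup>2) ^ k) / (1 + (norm p)\<^sup>2) ^ k"
    proof (cases "norm p \<le> R")
      case True
      have "cmod (psi e s p l) \<le> C2" using C2[of "(s, p)"] s True by simp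
      also have "\<dots> \<le> C2 * (1 + R\<^sup>2) ^ k / (1 + (norm p)\<^sup>2) ^ k"
      proof -
        have "(1 + (norm p)\<^sup>2) ^ k \<le> (1 + R\<^sup>2) ^ k" using True by (intro power_mono add_left_mono) auto
        then have "C2 * (1 + (norm p)\<^sup>2) ^ k \<le> C2 * (1 + R\<^sup>2) ^ k" using C2p by (rule mult_left_mono)
        then show ?thesis using pos by (simp add: le_divide_eq)
      qed
      also have "\<dots> \<le> (C1 * 2 ^ k + C2 * (1 + R\<^sup>2) ^ k) / (1 + (norm p)\<^sup>2) ^ k"
        using C1(1) pos by (intro divide_right_mono) auto
      finally show ?thesis .
    next
      case False
      then have n: "norm p \<ge> 1" "R \<le> (norm p)\<^sup>2" using R(1) self_le_power[of "norm p" 2] by auto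
      have "cmod l \<le> cq / 2 * (norm p)\<^sup>2" using R(2) n(2) cq(1) mult_left_mono[of R "(norm p)\<^sup>2" "cq / 2"] by linarith
      moreover have "p \<noteq> 0" using n(1) by auto
      ultimately have "cmod (psi e s p l) \<le> C1 * norm p powi d" using C1(2)[OF s] by blast
      also have "\<dots> \<le> C1 * (2 ^ k / (1 + (norm p)\<^sup>2) ^ k)" by (intro mult_left_mono powi_decay n(1) e(3) C1(1))
      also have "\<dots> \<le> (C1 * 2 ^ k + C2 * (1 + R\<^sup>2) ^ k) / (1 + (norm p)\<^sup>2) ^ k"
        using C2p pos by (auto simp: divide_right_mono)
      finally show ?thesis .
    qed
  qed
qed

lemma tr_field_deriv: "dm e z \<Longrightarrow> ((\<lambda>w. tr (ev e (z(v := w)))) has_field_derivative tr (ev (Dv v e) z)) (at (z v))"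
  using bounded_linear.has_derivative[OF tr(1) ev_has_derivative[of e z v]]
  by (simp add: has_field_derivative_def tr(2) mult_commute_abs)

lemma tr_vector_deriv:
  assumes "dm e z" "z v = of_real a"
  shows "((\<lambda>r. tr (ev e (z(v := of_real r)))) has_vector_derivative tr (ev (Dv v e) z)) (at a within S)"
  using has_vector_derivative_real_field[of "\<lambda>w. tr (ev e (z(v := w)))" _ a S] tr_field_deriv[OF assms(1), of v] assms(2)
  by (simp add: has_field_derivative_at_within)

lemma psi_integrable:
  assumes e: "ok \<Omega> e" "hm e (-4)" and s: "s \<in> {0..1}" and l: "l \<notin> cut"
  shows "integrable lborel (\<lambda>p. psi e s p l)"
proof -
  have "\<exists>C\<ge>0. \<forall>s\<in>{0..1}. \<forall>p. cmod (psi e s p l) \<le> C / (1 + (norm p)\<^sup>2)\<^sup>2"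
    by (rule psi_bound[OF e _ l]) simp
  then obtain C where "\<forall>p. cmod (psi e s p l) \<le> C / (1 + (norm p)\<^sup>2)\<^sup>2" using s by blast
  then have C: "cmod (psi e s p l) \<le> C * kern p" for p
    by (cases p) (simp add: kern_def)
  show ?thesis by (rule integrable_dominated[OF psi_cont_p[OF e(1) s l] C]) (simp add: integrable_kern)
qed

text \<open>Degree -3 forces decay at infinity, so the fundamental theorem in the variable \<xi>_i
  gives 0 on each line; the derivative has degree -4, which justifies Fubini.\<close>

lemma div_vanish:
  assumes e: "ok \<Omega> e" "hm e (-3)" and s: "s \<in> {0..1}" and l: "l \<notin> cut" and i: "i = 1 \<or> i = 2"
  shows "(LINT p|lborel. psi (Dv (Xi i) e) s p l) = 0"
proof -
  let ?f = "\<lambda>p. psi (Dv (Xi i) e) s p l"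
  have h4: "hm (Dv (Xi i) e) (-4)" using hm_DX[OF e(2), of i] by simp
  have ok4: "ok \<Omega> (Dv (Xi i) e)" using e(1) by simp
  have I: "integrable (lborel \<Otimes>\<^sub>M lborel) (\<lambda>(x, y). ?f (x, y))"
    using psi_integrable[OF ok4 h4 s l] by (simp add: lborel_prod case_prod_beta')
  obtain C1 where C1: "C1 \<ge> 0" "\<And>p. cmod (psi e s p l) \<le> C1 / (1 + (norm p)\<^sup>2)"
    using psi_bound[OF e, of 1 l] l s by (auto simp del: split_paired_All)
  obtain C2 where C2: "C2 \<ge> 0" "\<And>p. cmod (?f p) \<le> C2 / (1 + (norm p)\<^sup>2)"
    using psi_bound[OF ok4 h4, of 1 l] l s by (auto simp del: split_paired_All)
  have m: "C / (1 + (x\<^sup>2 + y\<^sup>2)) \<le> C / (1 + x\<^sup>2)" "C / (1 + (x\<^sup>2 + y\<^sup>2)) \<le> C / (1 + y\<^sup>2)" if "C \<ge> 0" for C x y :: real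
    using that by (auto intro!: divide_left_mono mult_pos_pos add_pos_nonneg)
  have dm: "dm e (rpt s x y l)" for x y using e(1) in_Om(1)[OF s l] by (auto simp: ok_def)
  from i show ?thesis
  proof
    assume i: "i = 1"
    have "(LINT x|lborel. ?f (x, y)) = 0" for y
    proof (rule FTC_line_decay)
      show "((\<lambda>x. psi e s (x, y) l) has_vector_derivative ?f (x, y)) (at x)" for x
        using tr_vector_deriv[OF dm[of x y], of "Xi 1" x] by (simp add: psi_def pt_upd i)
      show "continuous_on UNIV (\<lambda>x. ?f (x, y))"
        by (rule psi_cont[OF ok4]) (use in_Om(1)[OF s l] in \<open>auto intro!: continuous_intros\<close>)
      show "cmod (psi e s (x, y) l) \<le> C1 / (1 + x\<^sup>2)" for x
        using C1(2)[of "(x, y)"] m(1)[OF C1(1)] unfolding norm2_pair by (rule order_trans)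
      show "cmod (?f (x, y)) \<le> C2 / (1 + x\<^sup>2)" for x
        using C2(2)[of "(x, y)"] m(1)[OF C2(1)] unfolding norm2_pair by (rule order_trans)
    qed
    then show ?thesis using lborel_pair.integral_snd[OF I] by (simp add: lborel_prod case_prod_beta')
  next
    assume i: "i = 2"
    have "(LINT y|lborel. ?f (x, y)) = 0" for x
    proof (rule FTC_line_decay)
      show "((\<lambda>y. psi e s (x, y) l) has_vector_derivative ?f (x, y)) (at y)" for y
        using tr_vector_deriv[OF dm[of x y], of "Xi 2" y] by (simp add: psi_def pt_upd i)
      show "continuous_on UNIV (\<lambda>y. ?f (x, y))"
        by (rule psi_cont[OF ok4]) (use in_Om(1)[OF s l] in \<open>auto intro!: continuous_intros\<close>)
      show "cmod (psi e s (x, y) l) \<le> C1 / (1 + y\<^sup>2)" for y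
        using C1(2)[of "(x, y)"] m(2)[OF C1(1)] unfolding norm2_pair by (rule order_trans)
      show "cmod (?f (x, y)) \<le> C2 / (1 + y\<^sup>2)" for y
        using C2(2)[of "(x, y)"] m(2)[OF C2(1)] unfolding norm2_pair by (rule order_trans)
    qed
    then show ?thesis using lborel_pair.integral_fst[OF I] by (simp add: lborel_prod case_prod_beta')
  qed
qed

end

section \<open>The slice at lambda = 0 and the integral of a lambda derivative\<close>

context gb_data
begin

lemma inverse_bounds: "cmod v \<ge> 1 \<Longrightarrow> \<sigma> * Im v \<ge> 0 \<Longrightarrow> \<sigma> * Im (1 / v) \<le> 0 \<and> cmod (1 / v) \<le> 1 \<and> 1 / v \<noteq> 0"
proof (intro impI conjI)
  assume v: "cmod v \<ge> 1" and i: "\<sigma> * Im v \<ge> 0"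
  have "\<sigma> * Im (1 / v) = - ((\<sigma> * Im v) / ((Re v)\<^sup>2 + (Im v)\<^sup>2))" by (simp add: Im_divide)
  also have "\<dots> \<le> 0" using divide_nonneg_nonneg[OF i, of "(Re v)\<^sup>2 + (Im v)\<^sup>2"] by simp
  finally show "\<sigma> * Im (1 / v) \<le> 0" .
  show "cmod (1 / v) \<le> 1" "1 / v \<noteq> 0" using v by (auto simp: norm_divide divide_le_eq)
qed

text \<open>Evaluating on the line \<open>\<xi>\<^sub>2 = 1\<close> and completing by a half circle at infinity, whose neighbourhood is
  seen through \<open>\<xi>\<^sub>1 = 1\<close>, \<open>\<xi>\<^sub>2 = 1/\<zeta>\<close>.\<close>

lemma slice_vanish:
  assumes e: "hm e (-2)" and sg: "\<sigma> = 1 \<or> \<sigma> = -1"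
    and d1: "\<And>z. \<sigma> * Im z \<ge> 0 \<Longrightarrow> dm e (pt s z 1 0)" and d2: "\<And>z. \<sigma> * Im z \<le> 0 \<Longrightarrow> dm e (pt s 1 z 0)"
  shows "integrable lborel (\<lambda>x. tr (ev e (pt s (of_real x) 1 0)))" "(LINT x|lborel. tr (ev e (pt s (of_real x) 1 0))) = 0"
proof -
  let ?f = "\<lambda>z. tr (ev e (pt s z 1 0))"
  have hol: "?f holomorphic_on {z. \<sigma> * Im z \<ge> 0}"
    unfolding holomorphic_on_def
  proof
    fix z assume "z \<in> {z. \<sigma> * Im z \<ge> 0}"
    then have "(?f has_field_derivative tr (ev (Dv (Xi 1) e) (pt s z 1 0))) (at z)"
      using tr_field_deriv[OF d1[of z], of "Xi 1"] by (simp add: pt_upd)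
    then show "?f field_differentiable at z within {z. \<sigma> * Im z \<ge> 0}"
      using field_differentiable_def field_differentiable_at_within by blast
  qed
  let ?S = "cball 0 1 \<inter> {z. \<sigma> * Im z \<le> 0}"
  have contd: "continuous_on ?S (\<lambda>z. tr (ev e (pt s 1 z 0)))"
  proof (rule bounded_linear.continuous_on[OF tr(1)], rule ev_continuous)
    fix v show "continuous_on ?S (\<lambda>z. pt s 1 z 0 v)"
    proof (cases v)
      case (Xi i) then show ?thesis using exhaust_2[of i] by auto
    qed auto
  qed (use d2 in auto)
  have "closed {z. \<sigma> * Im z \<le> 0}" by (intro closed_Collect_le continuous_intros)
  then have "compact ?S" by (intro compact_Int_closed) auto
  with contd have "bounded ((\<lambda>z. tr (ev e (pt s 1 z 0))) ` ?S)"
    by (intro compact_imp_bounded compact_continuous_image)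
  then obtain C where C: "\<And>z. z \<in> ?S \<Longrightarrow> cmod (tr (ev e (pt s 1 z 0))) \<le> C" unfolding bounded_iff by blast
  have b: "cmod (?f z) \<le> C / (cmod z)\<^sup>2" if z: "\<sigma> * Im z \<ge> 0" "cmod z \<ge> 1" for z
  proof -
    have z0: "z \<noteq> 0" using z by auto
    note ib = inverse_bounds[OF z(2,1)]
    have "?f z = (z powi (-2)) * tr (ev e (pt s 1 (1 / z) 0))"
      using hm_scale[OF e z0 d2[of "1 / z"]] ib z0 by (simp add: scl_pt tr(2))
    then have "cmod (?f z) = cmod (tr (ev e (pt s 1 (1 / z) 0))) / (cmod z)\<^sup>2"
      by (simp add: norm_mult norm_power_int power_int_minus field_simps norm_inverse norm_power norm_divide)
    also have "\<dots> \<le> C / (cmod z)\<^sup>2" using C[of "1 / z"] ib by (intro divide_right_mono) auto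
    finally show ?thesis .
  qed
  have contf: "continuous_on UNIV (\<lambda>x. ?f (of_real x))"
    by (rule continuous_on_compose2[OF holomorphic_on_imp_continuous_on[OF hol]]) (auto intro!: continuous_intros)
  have "bounded ((\<lambda>x. ?f (of_real x)) ` {-1..1})"
    by (intro compact_imp_bounded compact_continuous_image continuous_on_subset[OF contf]) auto
  then obtain M where M: "\<And>x. x \<in> {-1..1} \<Longrightarrow> cmod (?f (of_real x)) \<le> M" unfolding bounded_iff by blast
  have Mp: "M \<ge> 0" using order_trans[OF norm_ge_zero M[of 0]] by simp
  have Cp: "C \<ge> 0" using order_trans[OF norm_ge_zero C[of 0]] by simp
  show i: "integrable lborel (\<lambda>x. ?f (of_real x))"
  proof (rule integrable_dominated[OF contf])
    show "integrable lborel (\<lambda>x::real. (2 * M + 2 * C) * (1 / (1 + x\<^sup>2)))"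
      by (intro integrable_mult_right integrable_inverse_one_plus_square)
    fix x :: real
    have p: "1 + x\<^sup>2 > 0" by (simp add: add_pos_nonneg)
    show "cmod (?f (of_real x)) \<le> (2 * M + 2 * C) * (1 / (1 + x\<^sup>2))"
    proof (cases "\<bar>x\<bar> \<le> 1")
      case True
      then have "1 + x\<^sup>2 \<le> 2" by (simp add: abs_square_le_1)
      then have "M * (1 + x\<^sup>2) \<le> M * 2" using Mp by (rule mult_left_mono)
      then have "M \<le> (2 * M + 2 * C) * (1 / (1 + x\<^sup>2))" using p Cp by (simp add: le_divide_eq)
      then show ?thesis using M[of x] True by (simp add: abs_le_iff)
    next
      case False
      then have x: "x\<^sup>2 \<ge> 1" by (metis abs_square_le_1 linear)
      have "cmod (?f (of_real x)) \<le> C / x\<^sup>2" using b[of "of_real x"] False by simp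
      also have "C / x\<^sup>2 \<le> (2 * C) / (1 + x\<^sup>2)"
      proof -
        have "C * (1 + x\<^sup>2) \<le> C * (2 * x\<^sup>2)" using x Cp by (intro mult_left_mono) auto
        then show ?thesis using x p Cp by (simp add: divide_simps mult_ac)
      qed
      also have "\<dots> \<le> (2 * M + 2 * C) * (1 / (1 + x\<^sup>2))" using Mp p by (simp add: divide_right_mono)
      finally show ?thesis .
    qed
  qed
  show "(LINT x|lborel. ?f (of_real x)) = 0" by (rule half_plane_vanish[OF sg hol b i])
qed

text \<open>In the coordinates (x y, y) with area factor |y|, homogeneity makes the integrand in y
  the derivative of a multiple of e at (x, 1, l / y^2). Along each line only the limit y to infinity
  contributes, which is the value at lambda = 0; what is left is the slice integral.\<close>

lemma lam_vanish:
  assumes e: "ok \<Omega> e" "hm e (-2)" and s: "s \<in> {0..1}" and l: "l \<notin> cut"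
    and sl: "(LINT x|lborel. psi e s (x, 1) 0) = 0"
  shows "(LINT p|lborel. psi (Dv Lam e) s p l) = 0"
proof -
  let ?f = "\<lambda>p. psi (Dv Lam e) s p l"
  let ?g = "\<lambda>y x. \<bar>y\<bar> *\<^sub>R ?f (x * y, y)"
  have l0: "l \<noteq> 0" using l by (auto simp: cut_def)
  have h4: "hm (Dv Lam e) (-4)" using hm_Dv[OF e(2), of Lam] by simp
  have ok4: "ok \<Omega> (Dv Lam e)" using e(1) by simp
  have fc: "continuous_on S ?f" for S by (rule psi_cont_p[OF ok4 s l])
  have I: "integrable (lborel \<Otimes>\<^sub>M lborel) (\<lambda>(x, y). ?f (x, y))"
    using psi_integrable[OF ok4 h4 s l] by (simp add: lborel_prod case_prod_beta')
  have I': "integrable (lborel \<Otimes>\<^sub>M lborel) (\<lambda>(x, y). norm (?f (x, y)))"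
    using integrable_norm[OF psi_integrable[OF ok4 h4 s l]] by (simp add: lborel_prod case_prod_beta')
  have "\<exists>C\<ge>0. \<forall>s\<in>{0..1}. \<forall>p. cmod (psi (Dv Lam e) s p l) \<le> C / (1 + (norm p)\<^sup>2)\<^sup>2"
    by (rule psi_bound[OF ok4 h4 _ l]) simp
  then obtain C where C0: "C \<ge> 0" and C: "\<forall>p. cmod (?f p) \<le> C / (1 + (norm p)\<^sup>2)\<^sup>2" using s by blast
  have fint: "integrable lborel (\<lambda>x. ?f (x, y))" for y
  proof (rule integrable_dominated)
    show "continuous_on UNIV (\<lambda>x. ?f (x, y))"
      by (rule continuous_on_compose2[OF fc[of UNIV]]) (auto intro!: continuous_intros)
    show "integrable lborel (\<lambda>x::real. C * (1 / (1 + x\<^sup>2)))" by (intro integrable_mult_right integrable_inverse_one_plus_square)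
    fix x :: real
    have "C / (1 + (x\<^sup>2 + y\<^sup>2))\<^sup>2 \<le> C / (1 + x\<^sup>2)"
    proof (rule divide_left_mono[OF _ C0])
      have "(1 + (x\<^sup>2 + y\<^sup>2)) * 1 \<le> (1 + (x\<^sup>2 + y\<^sup>2)) * (1 + (x\<^sup>2 + y\<^sup>2))" by (intro mult_left_mono) auto
      then show "1 + x\<^sup>2 \<le> (1 + (x\<^sup>2 + y\<^sup>2))\<^sup>2" unfolding power2_eq_square[of "1 + _"]
        by (rule order_trans[rotated]) simp
      show "0 < (1 + (x\<^sup>2 + y\<^sup>2))\<^sup>2 * (1 + x\<^sup>2)" by (auto intro!: mult_pos_pos zero_less_power add_pos_nonneg)
    qed
    then show "cmod (?f (x, y)) \<le> C * (1 / (1 + x\<^sup>2))"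
      using C[THEN spec, of "(x, y)"] unfolding norm2_pair by simp
  qed
  have ne0: "AE y in lborel. y \<noteq> (0::real)" by (rule AE_lborel_singleton)
  have aff: "(LINT x|lborel. q (x, y)) = (LINT x|lborel. \<bar>y\<bar> *\<^sub>R q (x * y, y))" if "y \<noteq> 0" for y and q :: "real \<times> real \<Rightarrow> 'c::{banach, second_countable_topology}"
    using lborel_integral_real_affine[OF that, of "\<lambda>x. q (x, y)" 0] by (simp add: mult.commute)
  have gm: "(\<lambda>q. ?g (fst q) (snd q)) \<in> borel_measurable borel"
    by (intro borel_measurable_continuous_onI continuous_intros continuous_on_compose2[OF fc[of UNIV]]) auto
  have gI: "integrable (lborel \<Otimes>\<^sub>M lborel) (\<lambda>q. ?g (fst q) (snd q))"
  proof (rule lborel_pair.Fubini_integrable)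
    show "(\<lambda>q. ?g (fst q) (snd q)) \<in> borel_measurable (lborel \<Otimes>\<^sub>M lborel)" using gm by (simp add: lborel_prod)
    have "integrable lborel (\<lambda>y. LINT x|lborel. norm (?f (x, y)))" by (rule lborel_pair.integrable_snd[OF I'])
    then show "integrable lborel (\<lambda>y. LINT x|lborel. norm (?g (fst (y, x)) (snd (y, x))))"
    proof (rule integrable_cong_AE_imp)
      have "(\<lambda>(y, x). norm (?g y x)) \<in> borel_measurable (lborel \<Otimes>\<^sub>M lborel)"
        using measurable_compose[OF gm borel_measurable_norm] by (simp add: lborel_prod case_prod_beta')
      from lborel.borel_measurable_lebesgue_integral[OF this]
      show "(\<lambda>y. LINT x|lborel. norm (?g (fst (y, x)) (snd (y, x)))) \<in> borel_measurable lborel" by simp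
      show "AE y in lborel. (LINT x|lborel. norm (?f (x, y))) = (LINT x|lborel. norm (?g (fst (y, x)) (snd (y, x))))"
        using ne0 by eventually_elim (use aff[of _ "\<lambda>p. norm (?f p)"] in simp)
    qed
    show "AE y in lborel. integrable lborel (\<lambda>x. ?g (fst (y, x)) (snd (y, x)))"
      using ne0
    proof eventually_elim
      fix y :: real assume y: "y \<noteq> 0"
      have "integrable lborel (\<lambda>x. ?f (0 + y * x, y))" by (rule lborel_integrable_real_affine[OF fint y])
      then show "integrable lborel (\<lambda>x. ?g (fst (y, x)) (snd (y, x)))" by (simp add: mult.commute integrable_scaleR_right)
    qed
  qed
  have inner: "(LINT y|lborel. ?g y x) = - (1 / l) * psi e s (x, 1) 0" for x
  proof -
    \<comment> \<open>The derivative of l / y^2 is -2 l / y^3, and degree -4 turns y f(x y, y) into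
      y^(-3) f(x, 1, l / y^2); the quotient is \<open>?k\<close>.\<close>
    let ?k = "- (1 / (2 * l))" and ?h = "\<lambda>y. y *\<^sub>R ?f (x * y, y)"
    let ?F = "\<lambda>y::real. ?k * psi e s (x, 1) (l / (of_real y)\<^sup>2)"
    have hc: "continuous_on UNIV ?h"
      by (intro continuous_intros continuous_on_compose2[OF fc[of UNIV]]) auto
    have hI: "integrable lborel ?h"
    proof (rule integrable_dominated[OF hc])
      show "integrable lborel (\<lambda>y::real. C * (1 / (1 + y\<^sup>2)))" by (intro integrable_mult_right integrable_inverse_one_plus_square)
      fix y :: real
      have "cmod (?h y) \<le> \<bar>y\<bar> * (C / (1 + ((x * y)\<^sup>2 + y\<^sup>2))\<^sup>2)"
        using mult_left_mono[OF C[THEN spec, of "(x * y, y)"] abs_ge_zero[of y]] unfolding norm2_pair norm_scaleR .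
      also have "\<dots> \<le> C * (1 / (1 + y\<^sup>2))"
      proof -
        have 1: "\<bar>y\<bar> \<le> 1 + y\<^sup>2"
        proof -
          have "0 \<le> y\<^sup>2 + 1 - 2 * \<bar>y\<bar>" using zero_le_power2[of "\<bar>y\<bar> - 1"] by (simp add: power2_diff)
          then show ?thesis using abs_ge_zero[of y] by linarith
        qed
        have 2: "1 + y\<^sup>2 \<le> 1 + ((x * y)\<^sup>2 + y\<^sup>2)" by simp
        have "\<bar>y\<bar> * (1 + y\<^sup>2) \<le> (1 + ((x * y)\<^sup>2 + y\<^sup>2)) * (1 + ((x * y)\<^sup>2 + y\<^sup>2))" by (intro mult_mono order_trans[OF 1 2] 2) auto
        then have "C * (\<bar>y\<bar> * (1 + y\<^sup>2)) \<le> C * (1 + ((x * y)\<^sup>2 + y\<^sup>2))\<^sup>2"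
          unfolding power2_eq_square[of "1 + _"] using C0 by (rule mult_left_mono)
        moreover have "1 + y\<^sup>2 > 0" "(1 + ((x * y)\<^sup>2 + y\<^sup>2))\<^sup>2 > 0"
          using zero_le_power2[of y] zero_le_power2[of "x * y"] by (linarith, intro zero_less_power, linarith)
        ultimately show ?thesis by (simp add: divide_simps mult_ac)
      qed
      finally show "cmod (?h y) \<le> C * (1 / (1 + y\<^sup>2))" .
    qed
    have half: "has_bochner_integral lborel (\<lambda>y. indicator {0..} y *\<^sub>R ?h y) (?k * psi e s (x, 1) 0 - ?k * 0)"
    proof (rule FTC_half_line[OF _ hc hI, where F = ?F])
      fix y :: real assume y: "y > 0"
      let ?w = "l / (of_real y)\<^sup>2"
      have w: "?w \<notin> cut"
      proof
        assume "?w \<in> cut"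
        define c where "c = 1 / y\<^sup>2"
        have "?w = of_real c * l" by (simp add: c_def)
        with \<open>?w \<in> cut\<close> have "of_real c * l \<in> cut" by (simp only:)
        moreover have "c > 0" using y by (simp add: c_def)
        ultimately show False using l by (auto simp: cut_def zero_le_mult_iff)
      qed
      have dm: "dm e (rpt s x 1 ?w)" using in_Om(1)[OF s w, of x 1] e(1) by (auto simp: ok_def)
      have D: "((\<lambda>r. psi e s (x, 1) r) has_field_derivative psi (Dv Lam e) s (x, 1) ?w) (at ?w)"
        using tr_field_deriv[OF dm, of Lam] by (simp add: psi_def pt_upd)
      have W: "((\<lambda>y::real. l / (of_real y)\<^sup>2) has_vector_derivative (- 2 * l / (of_real y) ^ 3)) (at y)"
      proof (rule has_vector_derivative_real_field)
        show "((\<lambda>z. l / z\<^sup>2) has_field_derivative (- 2 * l / (of_real y) ^ 3)) (at (of_real y))"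
          using y by (auto intro!: derivative_eq_intros simp: field_simps power2_eq_square power3_eq_cube)
      qed
      have "((\<lambda>y. psi e s (x, 1) (l / (of_real y)\<^sup>2)) has_vector_derivative (- 2 * l / (of_real y) ^ 3 * psi (Dv Lam e) s (x, 1) ?w)) (at y)"
        using field_vector_diff_chain_at[OF W D] by (simp add: comp_def)
      then have "(?F has_vector_derivative ?k * (- 2 * l / (of_real y) ^ 3 * psi (Dv Lam e) s (x, 1) ?w)) (at y)"
        by (rule has_vector_derivative_mult_right)
      moreover have "?k * (- 2 * l / (of_real y) ^ 3 * psi (Dv Lam e) s (x, 1) ?w) = ?h y"
      proof -
        define X Y where "X = psi (Dv Lam e) s (x, 1) ?w" and "Y = complex_of_real y"
        have Y: "Y \<noteq> 0" using y by (simp add: Y_def)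
        have "?f (y * x, y * 1) = (Y powi (-4)) * X"
          unfolding X_def Y_def using psi_scale[OF h4, of y s x 1 ?w] dm y by simp
        then have "?h y = Y * (inverse (Y ^ 4) * X)" by (simp add: mult.commute[of x] scaleR_conv_of_real Y_def power_int_minus)
        also have "\<dots> = ?k * (- 2 * l / Y ^ 3 * X)" using Y l0 by (simp add: divide_simps) (simp add: eval_nat_numeral)
        finally show ?thesis by (simp only: X_def Y_def)
      qed
      ultimately show "(?F has_vector_derivative ?h y) (at y)" by simp
    next
      \<comment> \<open>Near y = 0 the argument l / y^2 escapes to infinity. Degree -2 rewrites the
        value as y^2 times the value at (x y, y, l), which tends to 0.\<close>
      have "continuous_on UNIV (\<lambda>y. (of_real y)\<^sup>2 * psi e s (x * y, y) l)"
        by (intro continuous_intros continuous_on_compose2[OF psi_cont_p[OF e(1) s l, of UNIV]]) auto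
      then have "isCont (\<lambda>y. (of_real y)\<^sup>2 * psi e s (x * y, y) l) 0" by (simp add: continuous_on_eq_continuous_at)
      then have "((\<lambda>y. (of_real y)\<^sup>2 * psi e s (x * y, y) l) \<longlongrightarrow> 0) (at 0)" by (simp add: isCont_def)
      then have "((\<lambda>y. (of_real y)\<^sup>2 * psi e s (x * y, y) l) \<longlongrightarrow> 0) (at_right 0)" by (simp add: filterlim_at_split)
      moreover have "eventually (\<lambda>y. (of_real y)\<^sup>2 * psi e s (x * y, y) l = psi e s (x, 1) (l / (of_real y)\<^sup>2)) (at_right 0)"
        unfolding eventually_at_right_field
      proof (intro exI[of _ 1] conjI allI impI)
        fix y :: real assume y: "0 < y"
        have "dm e (rpt s (x * y) y l)" using in_Om(1)[OF s l, of "x * y" y] e(1) by (auto simp: ok_def)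
        from psi_scale[OF e(2) _ this, of "1 / y"] y
        have "psi e s (x, 1) ((of_real (1 / y))\<^sup>2 * l) = (of_real (1 / y) powi (-2)) * psi e s (x * y, y) l" by simp
        then show "(of_real y)\<^sup>2 * psi e s (x * y, y) l = psi e s (x, 1) (l / (of_real y)\<^sup>2)"
          using y by (simp add: power_int_minus power_divide)
      qed simp
      ultimately have "((\<lambda>y. psi e s (x, 1) (l / (of_real y)\<^sup>2)) \<longlongrightarrow> 0) (at_right 0)" by (rule Lim_transform_eventually)
      then show "(?F \<longlongrightarrow> ?k * 0) (at_right 0)" by (intro tendsto_intros)
    next
      \<comment> \<open>At the other end l / y^2 tends to 0, which lies on the cut; the resolvent
        still exists on \<xi>_2 = 1 as long as the spectral parameter has modulus below cq.\<close>
      have "continuous_on (ball 0 cq) (\<lambda>r. psi e s (x, 1) r)"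
      proof (rule psi_cont[OF e(1)])
        fix r assume "r \<in> ball (0::complex) cq"
        moreover have "cq * 1 \<le> cq * (x\<^sup>2 + 1\<^sup>2)" using cq(1) by (intro mult_left_mono) auto
        ultimately show "rpt s (fst (x, 1)) (snd (x, 1)) r \<in> \<Omega>" unfolding fst_conv snd_conv
          by (intro in_Om(2)[OF s]) (simp add: dist_norm)
      qed (intro continuous_intros)+
      then have "isCont (psi e s (x, 1)) 0" using cq(1) by (simp add: continuous_on_eq_continuous_at)
      moreover have "((\<lambda>y::real. l / (of_real y)\<^sup>2) \<longlongrightarrow> 0) at_top"
      proof (rule Lim_null_comparison)
        show "\<forall>\<^sub>F y in at_top. norm (l / (complex_of_real y)\<^sup>2) \<le> cmod l / y\<^sup>2"
          by (simp add: norm_divide norm_power)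
        show "((\<lambda>y::real. cmod l / y\<^sup>2) \<longlongrightarrow> 0) at_top" by real_asymp
      qed
      ultimately have "((\<lambda>y. psi e s (x, 1) (l / (of_real y)\<^sup>2)) \<longlongrightarrow> psi e s (x, 1) 0) at_top" by (rule isCont_tendsto_compose)
      then show "(?F \<longlongrightarrow> ?k * psi e s (x, 1) 0) at_top" by (intro tendsto_intros)
    qed
    \<comment> \<open>The degree -4 is even, so f(- x y, - y) = f(x y, y) and the whole line gives
      twice the half line.\<close>
    have "has_bochner_integral lborel (\<lambda>y. ?g y x) (2 *\<^sub>R (?k * psi e s (x, 1) 0))"
    proof (rule has_bochner_integral_even_function)
      show "has_bochner_integral lborel (\<lambda>y. indicator {0..} y *\<^sub>R ?g y x) (?k * psi e s (x, 1) 0)"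
        using half by (rule has_bochner_integral_cong[THEN iffD1, rotated 3]) (auto split: split_indicator)
      fix y
      have dm: "dm (Dv Lam e) (rpt s (x * y) y l)" using in_Om(1)[OF s l, of "x * y" y] ok4 by (auto simp: ok_def)
      show "?g (- y) x = ?g y x" using psi_scale[OF h4 _ dm, of "-1"] by simp
    qed
    then show ?thesis using l0 by (auto simp: has_bochner_integral_iff scaleR_conv_of_real field_simps)
  qed
  have "(LINT p|lborel. ?f p) = (LINT y|lborel. LINT x|lborel. ?f (x, y))"
    using lborel_pair.integral_snd[OF I] by (simp add: lborel_prod case_prod_beta')
  also have "\<dots> = (LINT y|lborel. LINT x|lborel. ?g y x)"
  proof (rule integral_cong_AE)
    show "(\<lambda>y. LINT x|lborel. ?f (x, y)) \<in> borel_measurable lborel"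
      using lborel_pair.integrable_snd[OF I] by (rule borel_measurable_integrable)
    have "(\<lambda>(y, x). ?g y x) \<in> borel_measurable (lborel \<Otimes>\<^sub>M lborel)"
      using gm by (simp add: lborel_prod case_prod_beta')
    then show "(\<lambda>y. LINT x|lborel. ?g y x) \<in> borel_measurable lborel" by (rule lborel.borel_measurable_lebesgue_integral)
    show "AE y in lborel. (LINT x|lborel. ?f (x, y)) = (LINT x|lborel. ?g y x)"
      using ne0 by eventually_elim (rule aff)
  qed
  also have "\<dots> = (LINT x|lborel. LINT y|lborel. ?g y x)"
    using lborel_pair.Fubini_integral[of ?g] gI by (simp add: case_prod_beta')
  also have "\<dots> = 0" unfolding inner integral_mult_right_zero sl by simp
  finally show ?thesis .
qed

end

lemma one_plus_mult_ne_0: "Im z \<le> 0 \<Longrightarrow> Im T > 0 \<Longrightarrow> 1 + z * T \<noteq> 0"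
proof
  assume z: "Im z \<le> 0" "Im T > 0" and "1 + z * T = 0"
  then have e: "z * T = - 1" by (simp add: add_eq_0_iff)
  have "of_real ((cmod z)\<^sup>2) * T = cnj z * (z * T)" unfolding complex_norm_square by (simp add: mult_ac)
  then have "of_real ((cmod z)\<^sup>2) * T = - cnj z" by (simp add: e)
  then have "Im (of_real ((cmod z)\<^sup>2) * T) = Im (- cnj z)" by (rule arg_cong)
  then have "(cmod z)\<^sup>2 * Im T = Im z" by simp
  then have "(cmod z)\<^sup>2 * Im T \<le> 0" using z(1) by simp
  then have "z = 0" using z(2) by (simp add: mult_le_0_iff)
  then show False using e by simp
qed

context gb_data
begin

lemma coef_conv: "s \<in> {0..1} \<Longrightarrow> a > 0 \<Longrightarrow> 1 + s * (a - 1) > (0::real)"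
proof -
  assume s: "s \<in> {0..1}" "a > 0"
  show ?thesis
  proof (cases "s = 0")
    case False
    then have "s * a > 0" using s by simp
    then show ?thesis using s by (simp add: algebra_simps)
  qed simp
qed

text \<open>In x the zero of A is minus the conjugate of tau, in the lower half plane, and that of B
  is - tau, in the upper one. In the chart (1, z) at infinity the half planes are exchanged, because
  z corresponds to 1 / z.\<close>

lemma AB_nonzero:
  assumes s: "s \<in> {0..1}" and t: "t \<in> K"
  shows "Im z \<ge> 0 \<Longrightarrow> fA (of_real s) z 1 t \<noteq> 0" "Im z \<le> 0 \<Longrightarrow> fA (of_real s) 1 z t \<noteq> 0"
    "Im z \<le> 0 \<Longrightarrow> fB (of_real s) z 1 t \<noteq> 0" "Im z \<ge> 0 \<Longrightarrow> fB (of_real s) 1 z t \<noteq> 0"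
proof -
  have W: "fW (of_real s) t \<noteq> 0"
  proof -
    have "fW (of_real s) t = of_real (1 + s * (w t - 1))" by (simp add: fW_def)
    then show ?thesis using coef_conv[OF s pos(1)[OF t]] by (simp only: of_real_eq_0_iff)
  qed
  have U: "fU (of_real s) t \<noteq> 0"
  proof -
    have "fU (of_real s) t = of_real (1 + s * (u t - 1))" by (simp add: fU_def)
    then show ?thesis using coef_conv[OF s pos(2)[OF t]] by (simp only: of_real_eq_0_iff)
  qed
  have "- Im (tau t) > 0" using pos(3)[OF t] by simp
  from coef_conv[OF s this] have T: "Im (fT' (of_real s) t) > 0" "Im (fT (of_real s) t) < 0"
    by (simp_all add: fT_def fT'_def algebra_simps)
  show "fA (of_real s) z 1 t \<noteq> 0" if "Im z \<ge> 0"
  proof -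
    have "z + fT' (of_real s) t \<noteq> 0" using that T(1) by (auto simp: complex_eq_iff)
    then show ?thesis using W by (simp add: fA_def)
  qed
  show "fA (of_real s) 1 z t \<noteq> 0" if "Im z \<le> 0"
    using one_plus_mult_ne_0[OF that T(1)] W by (simp add: fA_def)
  show "fB (of_real s) z 1 t \<noteq> 0" if "Im z \<le> 0"
  proof -
    have "z + fT (of_real s) t \<noteq> 0" using that T(2) by (auto simp: complex_eq_iff)
    then show ?thesis using W U by (simp add: fB_def)
  qed
  show "fB (of_real s) 1 z t \<noteq> 0" if "Im z \<ge> 0"
    using one_plus_mult_ne_0[of "- z" "- fT (of_real s) t"] that T(2) W U by (simp add: fB_def)
qed

lemma inv_A: "(\<And>t. t \<in> K \<Longrightarrow> fA s x y t \<noteq> 0) \<Longrightarrow> alg_invertible (ev (s0 AS) (pt s x y l))"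
  unfolding ev_A by (rule ccfc_inverse(1)[OF h(2) contf(5)])

lemma inv_B: "(\<And>t. t \<in> K \<Longrightarrow> fB s x y t \<noteq> 0) \<Longrightarrow> alg_invertible (ev (s0 BS) (pt s x y l))"
  unfolding ev_B by (rule ccfc_inverse(1)[OF h(2) contf(6)])

lemma Om0_invertible: assumes "z \<in> \<Omega>0" shows "alg_invertible (ev (s0 AS) z)" "alg_invertible (ev (s0 BS) z)"
proof -
  obtain s x y where z: "z = rpt s x y 0" "s \<in> {0..1}" "(x, y) \<noteq> (0, 0)" using assms by (auto simp: \<Omega>0_def)
  have ne: "fA (of_real s) (of_real x) (of_real y) t * fB (of_real s) (of_real x) (of_real y) t \<noteq> 0" if "t \<in> K" for t
  proof -
    have "x\<^sup>2 + y\<^sup>2 > 0" using z(3) by (simp add: sum_power2_gt_zero_iff)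
    then have "cq * (x\<^sup>2 + y\<^sup>2) > 0" using cq(1) by simp
    then have "qr s x y t > 0" using cq(2)[OF z(2) that, of x y] by linarith
    then show ?thesis unfolding fAB_real by simp
  qed
  show "alg_invertible (ev (s0 AS) z)" unfolding z(1) by (rule inv_A) (use ne in auto)
  show "alg_invertible (ev (s0 BS) z)" unfolding z(1) by (rule inv_B) (use ne in auto)
qed

definition "FA = dS Sig AS \<star> rinv AS (Iv (s0 AS))"
definition "FB = dS Sig BS \<star> rinv BS (Iv (s0 BS))"

lemma hm_FAB: "hm (s2 FA) (-2)" "hm (s2 FB) (-2)"
proof -
  have r: "hmS (rinv X (Iv (s0 X))) (-1)" "hmS (dS Sig X) 1" if "hmS X 1" for X
  proof -
    have "hm (Iv (s0 X)) (- 1)" using that by (intro hm_Iv) (simp add: hmS_def)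
    then show "hmS (rinv X (Iv (s0 X))) (-1)" using hmS_inv(2)[OF that, of "Iv (s0 X)"] by simp
    show "hmS (dS Sig X) 1" using hmS_dS[OF that, of Sig] by simp
  qed
  show "hm (s2 FA) (-2)" "hm (s2 FB) (-2)"
    using hmS_star[OF r(2,1)[OF hm_AB(1)]] hmS_star[OF r(2,1)[OF hm_AB(2)]] by (simp_all add: hmS_def FA_def FB_def)
qed

lemma ok_FAB: "(\<And>z. z \<in> T \<Longrightarrow> alg_invertible (ev (s0 AS) z)) \<Longrightarrow> okS T FA"
  "(\<And>z. z \<in> T \<Longrightarrow> alg_invertible (ev (s0 BS) z)) \<Longrightarrow> okS T FB"
proof -
  have s: "ok T (s0 AS)" "ok T (s0 BS)" using okS_AB(1,2)[of T] by (simp_all add: okS_def)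
  show "okS T FA" if "\<And>z. z \<in> T \<Longrightarrow> alg_invertible (ev (s0 AS) z)"
    unfolding FA_def by (intro okS_ops okS_AB) (use s that in simp)
  show "okS T FB" if "\<And>z. z \<in> T \<Longrightarrow> alg_invertible (ev (s0 BS) z)"
    unfolding FB_def by (intro okS_ops okS_AB) (use s that in simp)
qed

lemma slice_A:
  assumes s: "s \<in> {0..1}"
  shows "integrable lborel (\<lambda>x. psi (s2 FA) s (x, 1) 0)" "(LINT x|lborel. psi (s2 FA) s (x, 1) 0) = 0"
proof -
  have d: "dm (s2 FA) (pt (of_real s) z y 0)" if "\<And>t. t \<in> K \<Longrightarrow> fA (of_real s) z y t \<noteq> 0" for z y
    using ok_FAB(1)[of "{pt (of_real s) z y 0}"] inv_A[OF that] by (simp add: okS_def ok_def)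
  note sv = slice_vanish[OF hm_FAB(1), of 1 "of_real s"]
  show "integrable lborel (\<lambda>x. psi (s2 FA) s (x, 1) 0)" "(LINT x|lborel. psi (s2 FA) s (x, 1) 0) = 0"
    unfolding psi_def fst_conv snd_conv of_real_1
    by (rule sv; use d AB_nonzero(1,2)[OF s] in simp)+
qed

lemma slice_B:
  assumes s: "s \<in> {0..1}"
  shows "integrable lborel (\<lambda>x. psi (s2 FB) s (x, 1) 0)" "(LINT x|lborel. psi (s2 FB) s (x, 1) 0) = 0"
proof -
  have d: "dm (s2 FB) (pt (of_real s) z y 0)" if "\<And>t. t \<in> K \<Longrightarrow> fB (of_real s) z y t \<noteq> 0" for z y
    using ok_FAB(2)[of "{pt (of_real s) z y 0}"] inv_B[OF that] by (simp add: okS_def ok_def)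
  note sv = slice_vanish[OF hm_FAB(2), of "-1" "of_real s"]
  show "integrable lborel (\<lambda>x. psi (s2 FB) s (x, 1) 0)" "(LINT x|lborel. psi (s2 FB) s (x, 1) 0) = 0"
    unfolding psi_def fst_conv snd_conv of_real_1
    by (rule sv; use d AB_nonzero(3,4)[OF s] in simp)+
qed

definition "FV = Fvar AS BS bS"

lemma FV_facts: "T \<subseteq> \<Omega> \<Longrightarrow> okS T FV" "hm (s2 FV) (-2)"
proof -
  show "okS T FV" if "T \<subseteq> \<Omega>" unfolding FV_def Fvar_def by (intro okS_ops okS_AB okS_bS that)
  have "hmS (BS \<star> bS) (-1)" "hmS (bS \<star> AS) (-1)" "hmS (dS Sig AS) 1" "hmS (dS Sig BS) 1"
    using hmS_star[OF hm_AB(2) hm_AB(5)] hmS_star[OF hm_AB(5) hm_AB(1)] hmS_dS[OF hm_AB(1), of Sig] hmS_dS[OF hm_AB(2), of Sig] by simp_all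
  then have "hmS FV 0" unfolding FV_def Fvar_def
    using hmS_star[of "dS Sig AS" 1 "BS \<star> bS" "-1"] hmS_star[of "dS Sig BS" 1 "bS \<star> AS" "-1"] by (intro hmS_sadd) simp_all
  then show "hm (s2 FV) (-2)" by (simp add: hmS_def)
qed

lemma inv_Q: assumes "z \<in> \<Omega>" shows "ev (Iv Q) z * ev (s0 (Kof AS BS)) z = 1" "ev (s0 (Kof AS BS)) z * ev (Iv Q) z = 1"
  using Om_invertible[OF assms] by (simp_all add: Q_def KS_def)

lemma slice_FV:
  assumes s: "s \<in> {0..1}" shows "(LINT x|lborel. psi (s2 FV) s (x, 1) 0) = 0"
proof -
  have ss: "seq \<Omega>0 (Fvar AS BS (linv (Kof AS BS) (Iv Q))) (sadd (dS Sig AS \<star> rinv AS (Iv (s0 AS))) (dS Sig BS \<star> rinv BS (Iv (s0 BS))))"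
  proof (rule slice[OF good_Om(4)])
    show "z Lam = 0" if "z \<in> \<Omega>0" for z using that by (auto simp: \<Omega>0_def)
    show "okS \<Omega>0 AS" "okS \<Omega>0 BS" by (rule okS_AB)+
    show "ok \<Omega>0 (Iv Q)" by (rule ok_IvQ[OF Om_sub(2)])
    show "ok \<Omega>0 (Iv (s0 AS))" "ok \<Omega>0 (Iv (s0 BS))" using Om0_invertible okS_AB(1,2)[of \<Omega>0] by (simp_all add: okS_def)
    fix z assume z: "z \<in> \<Omega>0"
    show "ev (Iv Q) z * ev (s0 (Kof AS BS)) z = 1" "ev (s0 (Kof AS BS)) z * ev (Iv Q) z = 1"
      using inv_Q Om_sub(2) z by blast+
    show "ev (Iv (s0 AS)) z * ev (s0 AS) z = 1" "ev (s0 AS) z * ev (Iv (s0 AS)) z = 1"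
      "ev (Iv (s0 BS)) z * ev (s0 BS) z = 1" "ev (s0 BS) z * ev (Iv (s0 BS)) z = 1"
      using Om0_invertible[OF z] by simp_all
  qed
  have "psi (s2 FV) s (x, 1) 0 = psi (s2 FA) s (x, 1) 0 + psi (s2 FB) s (x, 1) 0" for x
  proof -
    have "rpt s x 1 0 \<in> \<Omega>0" unfolding \<Omega>0_def using s by (intro CollectI exI[of _ s] exI[of _ x] exI[of _ 1]) simp
    from seq_s2(1)[OF this ss] show ?thesis
      by (simp add: psi_def FV_def FA_def FB_def bS_def KS_def tr_add)
  qed
  then show ?thesis using slice_A[OF s] slice_B[OF s] by (simp add: Bochner_Integration.integral_add)
qed

lemma zero_slice:
  assumes l: "l \<notin> cut" shows "psi (s2 bS) 0 p l = 0"
proof -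
  obtain x y where p: "p = (x, y)" by (cases p)
  define z where "z = rpt 0 x y l"
  have z: "z \<in> \<Omega>" unfolding z_def by (rule in_Om(1)) (use l in auto)
  have zp: "z = pt 0 (of_real x) (of_real y) l" by (simp add: z_def)
  have cst: "dl j (c *\<^sub>C 1) = 0" for j c by (simp add: dl_scaleC scaleC.zero_right)
  have evd: "ev (dx j e) z = dl j (ev e z)" if "ok {z} e" for j e using that by (simp add: ok_def ev_dx)
  have okS1: "okS {z} AS" "okS {z} BS" "okS {z} KS" by (rule okS_AB)+
  note o = okS1[unfolded okS_def]
  have "fW 0 = (\<lambda>_. 1)" "fU 0 = (\<lambda>_. 1)" "fT 0 = (\<lambda>_. -\<i>)" "fT' 0 = (\<lambda>_. \<i>)"
    by (auto simp: fun_eq_iff fW_def fU_def fT_def fT'_def)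
  note f = this
  have fA: "fA 0 (of_real x) (of_real y) = (\<lambda>_. of_real x + of_real y * \<i>)" by (simp add: fun_eq_iff fA_def f)
  have fB: "fB 0 (of_real x) (of_real y) = (\<lambda>_. of_real x + of_real y * (- \<i>))" by (simp add: fun_eq_iff fB_def f)
  have dcoef: "dl j (ev Wx z) = 0" "dl j (ev Ux z) = 0" "dl j (ev Tx z) = 0" "dl j (ev Tx' z) = 0" for j
    unfolding zp ev_coeffs f ccfc_const[OF h(2)] by (rule cst)+
  have dA: "dl j (ev (s0 AS) z) = 0" and dB: "dl j (ev (s0 BS) z) = 0" and dQ: "dl j (ev (s0 KS) z) = 0" for j
    unfolding zp Q_def[symmetric] ev_A ev_B ev_Q fA fB ccfc_const[OF h(2)] by (rule cst)+
  have xA: "ev (dx j (s0 AS)) z = 0" and xB: "ev (dx j (s0 BS)) z = 0" and xQ: "ev (dx j (s0 KS)) z = 0" for j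
    using dA dB dQ o by (simp_all add: evd)
  have xxB: "ev (dx i (dx j (s0 BS))) z = 0" and xxQ: "ev (dx i (dx j (s0 KS))) z = 0" for i j
    using xB xQ o by (simp_all add: evd)
  have A1: "ev (s1 AS) z = 0" and B1: "ev (s1 BS) z = 0"
    using dcoef by (simp_all add: AS_def BS_def evd)
  have xB1: "ev (dx j (s1 BS)) z = 0" for j using B1 o by (simp add: evd)
  have K1: "ev (s1 KS) z = 0" by (simp add: KS_def Kof_def star_def brk1_def A1 B1 xB)
  have K2: "ev (s2 KS) z = 0"
  proof -
    have "s2 AS = Cst 0" "s2 BS = Cst 0" by (simp_all add: AS_def BS_def)
    then show ?thesis by (simp add: KS_def Kof_def star_def brk1_def brk2_def A1 B1 xB xxB xB1)
  qed
  have xK1: "ev (dx j (s1 KS)) z = 0" for j using K1 o by (simp add: evd)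
  have "ev (s2 bS) z = 0"
    by (simp add: bS_def linv_def Let_def brk1_def brk2_def K1 K2 xQ xxQ xK1)
  then show ?thesis using bounded_linear.linear[OF tr(1), THEN linear_0] by (simp add: psi_def p z_def)
qed

text \<open>The plane integral of the path derivative vanishes for every parameter. Fubini over the
  path and the fundamental theorem at each point p then give the difference between the metric end
  and the flat end, and the latter vanishes pointwise.\<close>

lemma total_vanish:
  assumes l: "l \<notin> cut" shows "(LINT p|lborel. psi (s2 bS) 1 p l) = 0"
proof -
  let ?D1 = "divw bS (dS Sig AS \<star> (BS \<star> bS))" and ?D2 = "divw (bS \<star> AS) (dS Sig BS \<star> bS)"
  let ?b = "s2 bS"
  have okb: "okS \<Omega> bS" by (rule okS_bS) simp
  have ok: "ok \<Omega> ?b" "ok \<Omega> (Dv Sig ?b)" "ok \<Omega> (?D1 i)" "ok \<Omega> (?D2 i)" "ok \<Omega> (s2 FV)" for i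
    using okb FV_facts(1)[of \<Omega>] by (auto simp: okS_def[of _ bS] okS_def[of _ FV] intro!: ok_divw okS_ops(1,5))
  have hmb: "hm ?b (-4)" using hm_AB(5) by (simp add: hmS_def)
  have hms: "hm (Dv Sig ?b) (-4)" using hm_Dv[OF hmb, of Sig] by simp
  have hmd: "hm (?D1 i) (-3)" "hm (?D2 i) (-3)" for i
  proof -
    have 1: "hmS (BS \<star> bS) (-1)" "hmS (bS \<star> AS) (-1)" "hmS (dS Sig AS) 1" "hmS (dS Sig BS) 1"
      using hmS_star[OF hm_AB(2) hm_AB(5)] hmS_star[OF hm_AB(5) hm_AB(1)] hmS_dS[OF hm_AB(1), of Sig] hmS_dS[OF hm_AB(2), of Sig] by simp_all
    have 2: "hmS (dS Sig AS \<star> (BS \<star> bS)) 0" "hmS (dS Sig BS \<star> bS) (-1)"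
      using hmS_star[OF 1(3,1)] hmS_star[OF 1(4) hm_AB(5)] by simp_all
    show "hm (?D1 i) (-3)" "hm (?D2 i) (-3)"
      using hm_divw[OF hm_AB(5) 2(1), of i] hm_divw[OF 1(2) 2(2), of i] by simp_all
  qed
  have hmD: "hm (Dv (Xi i) (?D1 j)) (-4)" "hm (Dv (Xi i) (?D2 j)) (-4)" "hm (Dv Lam (s2 FV)) (-4)" for i j
    using hm_DX[OF hmd(1), of i j] hm_DX[OF hmd(2), of i j] hm_Dv[OF FV_facts(2), of Lam] by simp_all
  have var: "psi (Dv Sig ?b) s p l = - psi (Dv Lam (s2 FV)) s p l
     + (psi (Dv (Xi 1) (?D1 1)) s p l + psi (Dv (Xi 2) (?D1 2)) s p l) + (psi (Dv (Xi 1) (?D2 1)) s p l + psi (Dv (Xi 2) (?D2 2)) s p l)"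
    if s: "s \<in> {0..1}" for s p
  proof -
    have z: "rpt s (fst p) (snd p) l \<in> \<Omega>1" unfolding \<Omega>1_def using s l by blast
    have Lz: "seq \<Omega>1 (dS Lam AS) zeroS" "seq \<Omega>1 (dS Lam BS) zeroS"
    proof -
      have dLx: "ev (Dv Lam (dx i e)) z = 0" if "\<And>z. ev (Dv Lam e) z = 0" "cs e" "dm e z" for i e z
        using that by (simp flip: ev_dx_Dv add: ev_dx)
      have c: "ev (Dv Lam Wx) z = 0" "ev (Dv Lam Ux) z = 0" "ev (Dv Lam Tx) z = 0" "ev (Dv Lam Tx') z = 0" for z
        by (simp_all add: Wx_def Ux_def Tx_def Tx'_def)
      have o: "cs Wx \<and> dm Wx z" "cs Ux \<and> dm Ux z" "cs Tx \<and> dm Tx z" "cs Tx' \<and> dm Tx' z" for z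
        using ok_coeffs[of "{z}"] by (simp_all add: ok_def)
      show "seq \<Omega>1 (dS Lam AS) zeroS" "seq \<Omega>1 (dS Lam BS) zeroS"
        using o by (simp_all add: seq_def dS_def zeroS_def AS_def BS_def c dLx)
    qed
    show ?thesis
      using variation[OF good_Om(1-3) okS_AB(1,2) ok_IvQ[OF Om_sub(1)] _ _ Lz z] inv_Q Om_sub(1)
      by (auto simp: psi_def FV_def bS_def KS_def dS_def subset_iff)
  qed
  have int0: "(LINT p|lborel. psi (Dv Sig ?b) s p l) = 0" if s: "s \<in> {0..1}" for s
  proof -
    have i: "integrable lborel (\<lambda>p. psi (Dv (Xi i) (?D1 j)) s p l)" "integrable lborel (\<lambda>p. psi (Dv (Xi i) (?D2 j)) s p l)"
      "integrable lborel (\<lambda>p. psi (Dv Lam (s2 FV)) s p l)" for i j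
      using ok by (auto intro!: psi_integrable hmD s l)
    have v: "(LINT p|lborel. psi (Dv (Xi 1) (?D1 1)) s p l) = 0" "(LINT p|lborel. psi (Dv (Xi 2) (?D1 2)) s p l) = 0"
      "(LINT p|lborel. psi (Dv (Xi 1) (?D2 1)) s p l) = 0" "(LINT p|lborel. psi (Dv (Xi 2) (?D2 2)) s p l) = 0"
      by (rule div_vanish[OF ok(3) hmd(1) s l] div_vanish[OF ok(4) hmd(2) s l], simp)+
    have "(LINT p|lborel. psi (Dv Lam (s2 FV)) s p l) = 0" by (rule lam_vanish[OF ok(5) FV_facts(2) s l slice_FV[OF s]])
    then show ?thesis unfolding var[OF s] using v i by (simp add: Bochner_Integration.integral_add)
  qed
  let ?f = "\<lambda>t p. indicator {0..1} t *\<^sub>R psi (Dv Sig ?b) t p l"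
  have "\<exists>C\<ge>0. \<forall>s\<in>{0..1}. \<forall>p. cmod (psi (Dv Sig ?b) s p l) \<le> C / (1 + (norm p)\<^sup>2)\<^sup>2"
    by (rule psi_bound[OF ok(2) hms _ l]) simp
  then obtain C where C: "C \<ge> 0" "\<forall>s\<in>{0..1}. \<forall>p. cmod (psi (Dv Sig ?b) s p l) \<le> C / (1 + (norm p)\<^sup>2)\<^sup>2" by blast
  have "(LINT p|lborel. LINT t|lborel. ?f t p) = 0"
  proof (rule fubini_vanish)
    have "(\<lambda>q. indicator ({0..1} \<times> UNIV) q *\<^sub>R psi (Dv Sig ?b) (fst q) (snd q) l) \<in> borel_measurable borel"
    proof (rule borel_measurable_continuous_on_indicator)
      show "{0..1::real} \<times> (UNIV :: (real \<times> real) set) \<in> sets borel" by (intro borel_closed closed_Times) auto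
      show "continuous_on ({0..1} \<times> UNIV) (\<lambda>q. psi (Dv Sig ?b) (fst q) (snd q) l)"
        by (rule psi_cont[OF ok(2)]) (use l in \<open>auto intro!: continuous_intros in_Om(1)\<close>)
    qed
    then show "(\<lambda>q. ?f (fst q) (snd q)) \<in> borel_measurable borel" by (simp add: indicator_times)
    show "cmod (?f t p) \<le> (indicator {0..1} t * C) * kern p" for t p
      using C(2)[rule_format, of t p] by (auto simp: kern_def split: split_indicator)
    show "integrable lborel (\<lambda>t::real. indicator {0..1} t * C)"
      by (intro integrable_mult_left integrable_real_indicator) auto
    show "(LINT p|lborel. ?f t p) = 0" for t using int0[of t] by (auto split: split_indicator)
  qed
  moreover have "(LINT t|lborel. ?f t p) = psi ?b 1 p l" for p
  proof -
    have "(LINT t|lborel. ?f t p) = psi ?b 1 p l - psi ?b 0 p l"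
    proof (rule integral_FTC_atLeastAtMost)
      fix t :: real assume "0 \<le> t" "t \<le> 1"
      then have "dm ?b (rpt t (fst p) (snd p) l)" using in_Om(1)[of t l "fst p" "snd p"] l ok(1) by (auto simp: ok_def)
      from tr_vector_deriv[OF this, of Sig t "{0..1}"]
      show "((\<lambda>t. psi ?b t p l) has_vector_derivative psi (Dv Sig ?b) t p l) (at t within {0..1})"
        by (simp add: psi_def pt_upd)
    next
      show "continuous_on {0..1} (\<lambda>t. psi (Dv Sig ?b) t p l)"
        by (rule psi_cont[OF ok(2)]) (use l in \<open>auto intro!: continuous_intros in_Om(1)\<close>)
    qed simp
    then show ?thesis using zero_slice[OF l] by simp
  qed
  ultimately show ?thesis by simp
qed

end

subsection \<open>Contours\<close>

text \<open>A segment from -1 meets the real axis beyond -1 only if it lies on it, and then it ends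
  at l < 0. The point -1 serves as the base of primitives.\<close>

lemma starlike_minus_cut: "l \<notin> cut \<Longrightarrow> s \<in> {0..1} \<Longrightarrow> -1 + of_real s * (l + 1) \<notin> cut"
proof
  assume l: "l \<notin> cut" and s: "s \<in> {0..1::real}" and c: "-1 + of_real s * (l + 1) \<in> cut"
  from c have 1: "s * Im l = 0" "0 \<le> -1 + s * (Re l + 1)" by (auto simp: cut_def)
  have s0: "s \<noteq> 0" using 1(2) by auto
  then have "Im l = 0" using 1(1) by simp
  then have "Re l < 0" using l by (simp add: cut_def)
  then have "s * Re l < 0" using s s0 by (simp add: mult_less_0_iff)
  then show False using 1(2) s by (simp add: algebra_simps)
qed

text \<open>A primitive along the path is obtained by integrating over the segments from \<open>-1\<close>. Since the speed
  of the path may be unbounded near its corners, this also yields the integrability.\<close>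

lemma starlike_primitive:
  fixes \<Phi> :: "complex \<Rightarrow> 'a::cstar_algebra"
  assumes D: "\<And>m. m \<notin> cut \<Longrightarrow> (\<Phi> has_derivative (\<lambda>h. h *\<^sub>C \<Phi>' m)) (at m)" and c: "continuous_on (- cut) \<Phi>'"
    and g: "\<gamma> piecewise_C1_differentiable_on UNIV" "\<And>t. \<gamma> t \<notin> cut" and ab: "a \<le> b"
  defines "H \<equiv> \<lambda>l. integral {0..1} (\<lambda>s. (l + 1) *\<^sub>C \<Phi> (-1 + of_real s * (l + 1)))"
  shows "((\<lambda>t. vector_derivative \<gamma> (at t) *\<^sub>C \<Phi> (\<gamma> t)) has_integral (H (\<gamma> b) - H (\<gamma> a))) {a..b}"
proof -
  obtain S where S: "finite S" "\<gamma> C1_differentiable_on (UNIV - S)" and gc: "continuous_on UNIV \<gamma>"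
    using g(1) by (auto simp: piecewise_C1_differentiable_on_def)
  have cP: "continuous_on (- cut) \<Phi>"
    by (intro continuous_at_imp_continuous_on ballI has_derivative_continuous[OF D]) auto
  let ?m = "\<lambda>q. -1 + of_real (snd q) * (\<gamma> (fst q) + 1)"
  have mc: "continuous_on A ?m" for A :: "(real \<times> real) set"
    by (intro continuous_intros continuous_on_compose2[OF gc]) auto
  have mi: "?m q \<in> - cut" if "q \<in> UNIV \<times> cbox 0 1" for q
    using starlike_minus_cut[OF g(2), of "snd q" "fst q"] that by auto
  have cPm: "continuous_on A (\<lambda>q. \<Phi> (?m q))" "continuous_on A (\<lambda>q. \<Phi>' (?m q))" if "A \<subseteq> UNIV \<times> cbox 0 1" for A
    by (rule continuous_on_compose2[OF cP mc] continuous_on_compose2[OF c mc]; use mi that in blast)+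
  \<comment> \<open>This form of the fundamental theorem asks for continuity on [a,b] and for the
    derivative only off the finite set S of corners, without any bound on the speed.\<close>
  show ?thesis
  proof (rule fundamental_theorem_of_calculus_interior_strong[OF S(1) ab])
    have "continuous_on UNIV (\<lambda>x. integral (cbox 0 1) (\<lambda>s. (\<gamma> x + 1) *\<^sub>C \<Phi> (-1 + of_real s * (\<gamma> x + 1))))"
    proof (rule integral_continuous_on_param)
      have "continuous_on (UNIV \<times> cbox 0 1) (\<lambda>q. (\<gamma> (fst q) + 1) *\<^sub>C \<Phi> (?m q))"
        by (intro scaleC.continuous_on cPm continuous_intros continuous_on_compose2[OF gc]) auto
      then show "continuous_on (UNIV \<times> cbox 0 1) (\<lambda>(x, s). (\<gamma> x + 1) *\<^sub>C \<Phi> (-1 + of_real s * (\<gamma> x + 1)))"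
        by (simp add: case_prod_beta')
    qed
    then show "continuous_on {a..b} (\<lambda>t. H (\<gamma> t))"
      unfolding H_def cbox_interval by (rule continuous_on_subset) simp
  next
    fix t assume t: "t \<in> {a<..<b} - S"
    have "open (- S)" using S(1) by (intro open_Compl finite_imp_closed)
    then obtain r where r: "r > 0" "ball t r \<subseteq> - S" using t by (meson Compl_iff DiffD2 openE)
    let ?U = "ball t r"
    let ?d = "\<lambda>x. vector_derivative \<gamma> (at x)"
    have gd: "(\<gamma> has_vector_derivative ?d x) (at x)" if "x \<in> ?U" for x
      using S(2) r(2) that unfolding C1_differentiable_on_eq by (auto simp: vector_derivative_works[symmetric])
    have dc: "continuous_on ?U ?d"
      using S(2) unfolding C1_differentiable_on_eq by (rule conjE) (erule continuous_on_subset, use r(2) in blast)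
    let ?f = "\<lambda>x s. (\<gamma> x + 1) *\<^sub>C \<Phi> (-1 + of_real s * (\<gamma> x + 1))"
    let ?fx = "\<lambda>x s. ?d x *\<^sub>C (\<Phi> (-1 + of_real s * (\<gamma> x + 1)) + (of_real s * (\<gamma> x + 1)) *\<^sub>C \<Phi>' (-1 + of_real s * (\<gamma> x + 1)))"
    have "((\<lambda>x. integral (cbox 0 1) (?f x)) has_vector_derivative integral (cbox 0 1) (?fx t)) (at t within ?U)"
    proof (rule leibniz_rule_vector_derivative)
      fix x s assume x: "x \<in> ?U" and s: "s \<in> cbox (0::real) 1"
      have m: "-1 + of_real s * (\<gamma> x + 1) \<notin> cut" using starlike_minus_cut[OF g(2)] s by simp
      have g1: "((\<lambda>x. \<gamma> x + 1) has_derivative (\<lambda>h. h *\<^sub>R ?d x)) (at x)"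
        using gd[OF x] unfolding has_vector_derivative_def by (auto intro!: derivative_eq_intros)
      have g2: "((\<lambda>x. -1 + of_real s * (\<gamma> x + 1)) has_derivative (\<lambda>h. of_real s * (h *\<^sub>R ?d x))) (at x)"
        by (rule has_derivative_eq_rhs[OF has_derivative_add[OF has_derivative_const has_derivative_mult_right[OF g1]]]) simp
      have "((\<lambda>x. ?f x s) has_derivative (\<lambda>h. (\<gamma> x + 1) *\<^sub>C ((of_real s * (h *\<^sub>R ?d x)) *\<^sub>C \<Phi>' (-1 + of_real s * (\<gamma> x + 1)))
          + (h *\<^sub>R ?d x) *\<^sub>C \<Phi> (-1 + of_real s * (\<gamma> x + 1)))) (at x)"
        by (rule scaleC.FDERIV[OF g1 has_derivative_compose[OF g2 D[OF m]]])
      then have "((\<lambda>x. ?f x s) has_vector_derivative ?fx x s) (at x)"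
        unfolding has_vector_derivative_def
        by (rule has_derivative_eq_rhs) (simp add: fun_eq_iff scaleC.add_right scaleC_scaleC scaleR_conv_of_real[where 'a = complex] mult_ac
          del: scaleC_real_simps flip: scaleC_of_real)
      then show "((\<lambda>x. ?f x s) has_vector_derivative ?fx x s) (at x within ?U)" by (rule has_vector_derivative_at_within)
    next
      fix x assume "x \<in> ?U"
      have "continuous_on (cbox 0 1) (\<lambda>s. \<Phi> (-1 + of_real s * (\<gamma> x + 1)))"
        by (rule continuous_on_compose2[OF cP]) (use starlike_minus_cut[OF g(2)] in \<open>auto intro!: continuous_intros\<close>)
      then show "?f x integrable_on cbox 0 1"
        by (intro integrable_continuous scaleC.continuous_on continuous_intros)
    next
      have "continuous_on (?U \<times> cbox 0 1) (\<lambda>q. ?fx (fst q) (snd q))"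
        by (intro scaleC.continuous_on cPm continuous_intros continuous_on_compose2[OF gc] continuous_on_compose2[OF dc]) auto
      then show "continuous_on (?U \<times> cbox 0 1) (\<lambda>(x, s). ?fx x s)" by (simp add: case_prod_beta')
    qed (use r in auto)
    then have "((\<lambda>t. H (\<gamma> t)) has_vector_derivative integral {0..1} (?fx t)) (at t)"
      using r(1) unfolding H_def cbox_interval by (subst (asm) at_within_open) auto
    \<comment> \<open>The integrand is the s derivative of s \<Phi>(-1 + s (\<gamma> t + 1)), so the
      integral collapses to its value at s = 1.\<close>
    moreover have "((?fx t) has_integral (?d t *\<^sub>C \<Phi> (\<gamma> t))) {0..1}"
    proof -
      have "((\<lambda>s. \<Phi> (-1 + of_real s * (\<gamma> t + 1)) + (of_real s * (\<gamma> t + 1)) *\<^sub>C \<Phi>' (-1 + of_real s * (\<gamma> t + 1))) has_integral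
         (1 *\<^sub>R \<Phi> (-1 + of_real 1 * (\<gamma> t + 1)) - 0 *\<^sub>R \<Phi> (-1 + of_real 0 * (\<gamma> t + 1)))) {0..1}"
      proof (rule fundamental_theorem_of_calculus[of 0 1 "\<lambda>s. s *\<^sub>R \<Phi> (-1 + of_real s * (\<gamma> t + 1))"])
        fix s assume s: "s \<in> {0..1::real}"
        have g2: "((\<lambda>s. -1 + of_real s * (\<gamma> t + 1)) has_derivative (\<lambda>h. of_real h * (\<gamma> t + 1))) (at s)"
          by (auto intro!: derivative_eq_intros)
        have "((\<lambda>s. s *\<^sub>R \<Phi> (-1 + of_real s * (\<gamma> t + 1))) has_derivative
            (\<lambda>h. s *\<^sub>R ((of_real h * (\<gamma> t + 1)) *\<^sub>C \<Phi>' (-1 + of_real s * (\<gamma> t + 1))) + h *\<^sub>R \<Phi> (-1 + of_real s * (\<gamma> t + 1)))) (at s)"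
          by (rule has_derivative_scaleR[OF has_derivative_ident has_derivative_compose[OF g2 D[OF starlike_minus_cut[OF g(2) s]]]])
        then show "((\<lambda>s. s *\<^sub>R \<Phi> (-1 + of_real s * (\<gamma> t + 1))) has_vector_derivative
            (\<Phi> (-1 + of_real s * (\<gamma> t + 1)) + (of_real s * (\<gamma> t + 1)) *\<^sub>C \<Phi>' (-1 + of_real s * (\<gamma> t + 1)))) (at s within {0..1})"
          unfolding has_vector_derivative_def
          by - (rule has_derivative_at_withinI, erule has_derivative_eq_rhs,
            simp add: fun_eq_iff scaleC.add_right scaleC_scaleC scaleR_conv_of_real[where 'a = complex] mult_ac
          del: scaleC_real_simps flip: scaleC_of_real)
      qed simp
      then have "((\<lambda>s. \<Phi> (-1 + of_real s * (\<gamma> t + 1)) + (of_real s * (\<gamma> t + 1)) *\<^sub>C \<Phi>' (-1 + of_real s * (\<gamma> t + 1))) has_integral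
         \<Phi> (\<gamma> t)) {0..1}" by simp
      from has_integral_linear[OF this scaleC.bounded_linear_right[of "?d t"]] show ?thesis by (simp add: comp_def)
    qed
    ultimately show "((\<lambda>t. H (\<gamma> t)) has_vector_derivative ?d t *\<^sub>C \<Phi> (\<gamma> t)) (at t)"
      by (simp only: integral_unique)
  qed
qed

lemma exp_decay: assumes "c > 0" "t \<ge> (0::real)" shows "exp (- (c * t)) \<le> 1 / min 1 (c\<^sup>2 / 2) * (1 / (1 + t\<^sup>2))"
proof -
  let ?k = "min 1 (c\<^sup>2 / 2)"
  have k: "?k > 0" using assms by simp
  have "?k * (1 + t\<^sup>2) = ?k * 1 + ?k * t\<^sup>2" by (simp add: algebra_simps)
  also have "\<dots> \<le> 1 * 1 + c\<^sup>2 / 2 * t\<^sup>2" by (intro add_mono mult_right_mono) auto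
  also have "\<dots> \<le> 1 + c * t + (c * t)\<^sup>2 / 2" using assms by (simp add: power_mult_distrib)
  also have "\<dots> \<le> exp (c * t)" using assms by (intro exp_lower_Taylor_quadratic) simp
  finally have "?k * (1 + t\<^sup>2) \<le> exp (c * t)" .
  moreover have "?k * (1 + t\<^sup>2) > 0" using k by (intro mult_pos_pos) (auto simp: add_pos_nonneg)
  ultimately have "1 / exp (c * t) \<le> 1 / (?k * (1 + t\<^sup>2))" by (intro divide_left_mono) auto
  then show ?thesis by (simp add: exp_minus inverse_eq_divide)
qed

text \<open>The inequality a \<le> exp a at a = \<delta> v / (N + 1), raised to the power N + 1;
  taking N + 1 in place of N avoids a division by zero.\<close>

lemma power_le_const_exp: assumes "\<delta> > 0" shows "\<exists>C\<ge>0. \<forall>v\<ge>1. v ^ N \<le> C * exp (\<delta> * v :: real)"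
proof (intro exI[of _ "(real (Suc N) / \<delta>) ^ Suc N"] conjI allI impI)
  let ?n = "real (Suc N)"
  fix v :: real assume v: "v \<ge> 1"
  have "\<delta> * v / ?n \<le> exp (\<delta> * v / ?n)" using exp_ge_add_one_self[of "\<delta> * v / ?n"] by linarith
  then have "(\<delta> * v / ?n) ^ Suc N \<le> exp (\<delta> * v / ?n) ^ Suc N" using assms v by (intro power_mono) auto
  also have "\<dots> = exp (?n * (\<delta> * v / ?n))" by (rule exp_of_nat_mult[symmetric])
  also have "?n * (\<delta> * v / ?n) = \<delta> * v" by (simp del: of_nat_Suc)
  finally have e: "(\<delta> * v / ?n) ^ Suc N \<le> exp (\<delta> * v)" .
  have "v ^ N \<le> v ^ Suc N" using v by (intro power_increasing) auto
  also have "\<dots> = (?n / \<delta>) ^ Suc N * (\<delta> * v / ?n) ^ Suc N" using assms by (simp flip: power_mult_distrib del: of_nat_Suc power_Suc)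
  also have "\<dots> \<le> (?n / \<delta>) ^ Suc N * exp (\<delta> * v)" using e assms by (intro mult_left_mono) auto
  finally show "v ^ N \<le> (?n / \<delta>) ^ Suc N * exp (\<delta> * v)" .
qed (use assms in auto)

text \<open>Straight pieces of contour, bounded or not, on which Fubini can be used: they keep a
  positive distance from the cut, and the weight outweighs every power of the spectral parameter.
  The clause on intersections reduces local integrability to compact intervals.\<close>

definition ray :: "real set \<Rightarrow> complex \<Rightarrow> complex \<Rightarrow> bool" where
  "ray I a b \<longleftrightarrow> closed I \<and> (\<forall>c d. \<exists>c' d'. I \<inter> {c..d} = {c'..d'}) \<and>
     (\<exists>\<eta>>0. \<forall>t\<in>I. \<forall>r\<ge>0. \<eta> \<le> cmod (of_real r - (a + of_real t * b))) \<and>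
     (\<forall>N. \<exists>C\<ge>0. \<forall>t\<in>I. (1 + cmod (a + of_real t * b)) ^ N * cmod (exp (- (a + of_real t * b)) * b) \<le> C * (1 / (1 + t\<^sup>2)))"

lemma ray_decay:
  assumes b: "Re b > 0"
  shows "\<exists>C\<ge>0. \<forall>t\<ge>0. (1 + cmod (a + of_real t * b)) ^ N * cmod (exp (- (a + of_real t * b)) * b) \<le> C * (1 / (1 + t\<^sup>2))"
proof -
  have nb: "cmod b > 0" using b by auto
  \<comment> \<open>Then \<delta> times the modulus of b is half of Re b: absorbing the polynomial
    uses up only half of the exponential decay.\<close>
  define \<delta> where "\<delta> = Re b / (2 * cmod b)"
  have \<delta>: "\<delta> > 0" using b nb by (simp add: \<delta>_def)
  obtain C1 where C1: "C1 \<ge> 0" "\<And>v. v \<ge> 1 \<Longrightarrow> v ^ N \<le> C1 * exp (\<delta> * v)" using power_le_const_exp[OF \<delta>] by blast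
  define C2 where "C2 = C1 * exp (\<delta> * (1 + cmod a)) * exp (- Re a) * cmod b"
  define k where "k = 1 / min 1 ((Re b / 2)\<^sup>2 / 2)"
  have C2: "C2 \<ge> 0" using C1(1) by (simp add: C2_def)
  have k: "k \<ge> 0" by (simp add: k_def)
  show ?thesis
  proof (intro exI[of _ "C2 * k"] conjI allI impI)
    fix t :: real assume t: "t \<ge> 0"
    let ?l = "a + of_real t * b"
    have nl: "cmod ?l \<le> cmod a + t * cmod b" using norm_triangle_ineq[of a "of_real t * b"] t by (simp add: norm_mult)
    have "(1 + cmod ?l) ^ N \<le> C1 * exp (\<delta> * (1 + cmod ?l))" by (rule C1(2)) simp
    also have "\<dots> \<le> C1 * exp (\<delta> * (1 + cmod a) + t * Re b / 2)"
    proof (intro mult_left_mono C1(1))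
      have "\<delta> * (1 + cmod ?l) \<le> \<delta> * (1 + (cmod a + t * cmod b))" using nl \<delta> by (intro mult_left_mono) auto
      also have "\<dots> = \<delta> * (1 + cmod a) + t * Re b / 2" using nb by (simp add: \<delta>_def field_simps)
      finally show "exp (\<delta> * (1 + cmod ?l)) \<le> exp (\<delta> * (1 + cmod a) + t * Re b / 2)" by simp
    qed
    finally have "(1 + cmod ?l) ^ N * cmod (exp (- ?l) * b) \<le> C1 * exp (\<delta> * (1 + cmod a) + t * Re b / 2) * cmod (exp (- ?l) * b)"
      by (intro mult_right_mono) auto
    also have "\<dots> = C2 * exp (- (Re b / 2 * t))"
    proof -
      have "cmod (exp (- ?l) * b) = exp (- Re a - t * Re b) * cmod b" by (simp add: norm_mult)
      moreover have "exp (\<delta> * (1 + cmod a) + t * Re b / 2) * exp (- Re a - t * Re b)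
          = exp (\<delta> * (1 + cmod a)) * exp (- Re a) * exp (- (Re b / 2 * t))"
        unfolding exp_add[symmetric] by (simp add: field_simps)
      ultimately show ?thesis by (simp add: C2_def mult_ac)
    qed
    also have "\<dots> \<le> C2 * (k * (1 / (1 + t\<^sup>2)))"
      unfolding k_def using exp_decay[of "Re b / 2" t] b t by (intro mult_left_mono C2) auto
    finally show "(1 + cmod ?l) ^ N * cmod (exp (- ?l) * b) \<le> C2 * k * (1 / (1 + t\<^sup>2))" by (simp only: mult.assoc)
  qed (use C2 k in simp)
qed

text \<open>The distance to a real point is at least the modulus of the imaginary part, an affine
  function of t. If it keeps its sign on a half line, its modulus cannot decrease, so the smallest
  value is the one at T.\<close>

lemma affine_away:
  assumes T: "T \<ge> 0" and "(\<forall>t\<ge>T. Im (a + of_real t * b) < 0) \<or> (\<forall>t\<ge>T. Im (a + of_real t * b) > 0)"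
  shows "\<exists>\<eta>>0. \<forall>t\<ge>T. \<forall>r. \<eta> \<le> cmod (of_real r - (a + of_real t * b))"
proof -
  have lin: "\<exists>\<eta>>0. \<forall>t\<ge>T. \<eta> \<le> p + t * q" if pq: "\<forall>t\<ge>T. 0 < p + t * q" for p q :: real
  proof (intro exI[of _ "p + T * q"] conjI allI impI)
    have "q \<ge> 0"
    proof (rule ccontr)
      assume "\<not> q \<ge> 0"
      then have q: "q < 0" by simp
      define t where "t = max T (- p / q)"
      have "t * q \<le> (- p / q) * q" using q unfolding t_def by (intro mult_right_mono_neg) auto
      then have "p + t * q \<le> 0" using q by simp
      moreover have "t \<ge> T" by (simp add: t_def)
      ultimately show False using pq by force
    qed
    then show "p + T * q \<le> p + t * q" if "t \<ge> T" for t using that by (simp add: mult_right_mono)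
  qed (use pq in simp)
  have im: "\<bar>Im (a + of_real t * b)\<bar> \<le> cmod (of_real r - (a + of_real t * b))" for t r
    using abs_Im_le_cmod[of "of_real r - (a + of_real t * b)"] by simp
  from assms(2) have "\<exists>\<eta>>0. \<forall>t\<ge>T. \<eta> \<le> \<bar>Im (a + of_real t * b)\<bar>"
  proof
    assume "\<forall>t\<ge>T. Im (a + of_real t * b) > 0"
    then have "\<forall>t\<ge>T. 0 < Im a + t * Im b" by simp
    from lin[OF this] show ?thesis by (auto intro: order_trans[OF _ abs_ge_self])
  next
    assume "\<forall>t\<ge>T. Im (a + of_real t * b) < 0"
    then have "0 < - Im a + t * (- Im b)" if "t \<ge> T" for t using that by force
    then have "\<forall>t\<ge>T. 0 < - Im a + t * (- Im b)" by blast
    from lin[OF this] obtain \<eta> where e: "\<eta> > 0" "\<And>t. t \<ge> T \<Longrightarrow> \<eta> \<le> - Im a + t * (- Im b)" by blast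
    have "\<eta> \<le> \<bar>Im (a + of_real t * b)\<bar>" if "t \<ge> T" for t
      using e(2)[OF that] abs_ge_minus_self[of "Im (a + of_real t * b)"] by simp
    then show ?thesis using e(1) by blast
  qed
  then show ?thesis using im by (meson order_trans)
qed

lemma half_line_Int: "\<exists>c' d'. {T..} \<inter> {c..d} = {c'..d'::real}" "\<exists>c' d'. {..-T} \<inter> {c..d} = {c'..d'::real}"
proof -
  show "\<exists>c' d'. {T..} \<inter> {c..d} = {c'..d'::real}" by (intro exI[of _ "max T c"] exI[of _ d]) auto
  show "\<exists>c' d'. {..-T} \<inter> {c..d} = {c'..d'::real}" by (intro exI[of _ c] exI[of _ "min d (- T)"]) auto
qed

lemma ray_right:
  assumes "T \<ge> 0" "Re b > 0" "(\<forall>t\<ge>T. Im (a + of_real t * b) < 0) \<or> (\<forall>t\<ge>T. Im (a + of_real t * b) > 0)"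
  shows "ray {T..} a b" "ray {..-T} a (- b)"
proof -
  obtain \<eta> where e: "\<eta> > 0" "\<And>t r. t \<ge> T \<Longrightarrow> \<eta> \<le> cmod (of_real r - (a + of_real t * b))"
    using affine_away[OF assms(1,3)] by blast
  have r: "a + of_real t * (- b) = a + of_real (- t) * b" for t by simp
  show "ray {T..} a b" unfolding ray_def
  proof (intro conjI allI half_line_Int)
    fix N
    obtain C where "C \<ge> 0" "\<forall>t\<ge>0. (1 + cmod (a + of_real t * b)) ^ N * cmod (exp (- (a + of_real t * b)) * b) \<le> C * (1 / (1 + t\<^sup>2))"
      using ray_decay[OF assms(2)] by blast
    then show "\<exists>C\<ge>0. \<forall>t\<in>{T..}. (1 + cmod (a + of_real t * b)) ^ N * cmod (exp (- (a + of_real t * b)) * b) \<le> C * (1 / (1 + t\<^sup>2))"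
      using assms(1) by (intro exI[of _ C]) simp
  qed (use e in auto)
  show "ray {..-T} a (- b)" unfolding ray_def r unfolding mult_minus_right norm_minus_cancel
  proof (intro conjI allI half_line_Int)
    show "\<exists>\<eta>>0. \<forall>t\<in>{..- T}. \<forall>r\<ge>0. \<eta> \<le> cmod (of_real r - (a + of_real (- t) * b))"
    proof (intro exI[of _ \<eta>] conjI ballI allI impI e(1))
      fix t r :: real assume "t \<in> {..- T}"
      then have "- t \<ge> T" by simp
      then show "\<eta> \<le> cmod (of_real r - (a + of_real (- t) * b))" by (rule e(2))
    qed
    fix N
    obtain C where C: "C \<ge> 0" "\<And>t. t\<ge>0 \<Longrightarrow> (1 + cmod (a + of_real t * b)) ^ N * cmod (exp (- (a + of_real t * b)) * b) \<le> C * (1 / (1 + t\<^sup>2))"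
      using ray_decay[OF assms(2)] by blast
    show "\<exists>C\<ge>0. \<forall>t\<in>{..- T}. (1 + cmod (a + of_real (- t) * b)) ^ N * cmod (exp (- (a + of_real (- t) * b)) * b) \<le> C * (1 / (1 + t\<^sup>2))"
    proof (intro exI[of _ C] conjI ballI C(1))
      fix t assume "t \<in> {..-T}"
      then have "- t \<ge> 0" using assms(1) by simp
      from C(2)[OF this] show "(1 + cmod (a + of_real (- t) * b)) ^ N * cmod (exp (- (a + of_real (- t) * b)) * b) \<le> C * (1 / (1 + t\<^sup>2))"
        unfolding power2_minus .
    qed
  qed auto
qed

lemma ray_segment:
  assumes l: "l \<notin> cut" shows "ray {0..1} (-1) (l + 1)"
  unfolding ray_def
proof (intro conjI allI)
  show "\<exists>c' d'. {0..1} \<inter> {c..d} = {c'..d'}" for c d :: real by (intro exI[of _ "max 0 c"] exI[of _ "min 1 d"]) auto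
  let ?g = "\<lambda>t::real. -1 + of_real t * (l + 1)"
  have gc: "continuous_on A ?g" for A by (intro continuous_intros)
  have "compact (?g ` {0..1})" by (intro compact_continuous_image gc) simp
  moreover have "?g ` {0..1} \<inter> cut = {}" using starlike_minus_cut[OF l] by blast
  ultimately obtain d where d: "d > 0" "\<forall>x\<in>?g ` {0..1}. \<forall>y\<in>cut. d \<le> dist x y"
    using separate_compact_closed[OF _ closed_cut] by blast
  show "\<exists>\<eta>>0. \<forall>t\<in>{0..1}. \<forall>r\<ge>0. \<eta> \<le> cmod (of_real r - (-1 + of_real t * (l + 1)))"
  proof (intro exI[of _ d] conjI ballI allI impI d(1))
    fix t r :: real assume "t \<in> {0..1}" "r \<ge> 0"
    then have "d \<le> dist (?g t) (of_real r)" using d(2) by (auto simp: cut_def)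
    then show "d \<le> cmod (of_real r - (-1 + of_real t * (l + 1)))" by (simp only: dist_norm norm_minus_commute)
  qed
  fix N
  let ?q = "\<lambda>t. (1 + t\<^sup>2) * ((1 + cmod (?g t)) ^ N * cmod (exp (- (?g t)) * (l + 1)))"
  have "bounded (?q ` {0..1})" by (intro compact_imp_bounded compact_continuous_image continuous_intros) simp
  then obtain C where C: "\<And>t. t \<in> {0..1} \<Longrightarrow> norm (?q t) \<le> C" unfolding bounded_iff by blast
  have "C \<ge> 0" using order_trans[OF norm_ge_zero C[of 0]] by simp
  moreover have "(1 + cmod (?g t)) ^ N * cmod (exp (- (?g t)) * (l + 1)) \<le> C * (1 / (1 + t\<^sup>2))" if "t \<in> {0..1}" for t
  proof -
    have p: "1 + t\<^sup>2 > 0" by (simp add: add_pos_nonneg)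
    have "?q t \<le> C" using C[OF that] by (metis abs_ge_self order_trans real_norm_def)
    then show ?thesis using p by (simp add: le_divide_eq mult.commute)
  qed
  ultimately show "\<exists>C\<ge>0. \<forall>t\<in>{0..1}. (1 + cmod (-1 + of_real t * (l + 1))) ^ N * cmod (exp (- (-1 + of_real t * (l + 1))) * (l + 1)) \<le> C * (1 / (1 + t\<^sup>2))"
    by blast
qed simp

section \<open>Traces of integrals along straight pieces of the contour\<close>

context gb_data
begin

text \<open>Expressions that invert nothing but Q. A lower bound for the distance of lambda to the
  cut bounds that inverse for all \<xi> at once, so such expressions grow at most
  polynomially.\<close>

primrec onlyQ :: "'a ex \<Rightarrow> bool" where
  "onlyQ (Cst a) \<longleftrightarrow> True"
| "onlyQ (Vr v) \<longleftrightarrow> True"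
| "onlyQ (Iv e) \<longleftrightarrow> e = Q"
| "onlyQ (e \<oplus> f) \<longleftrightarrow> onlyQ e \<and> onlyQ f"
| "onlyQ (e \<otimes> f) \<longleftrightarrow> onlyQ e \<and> onlyQ f"

lemma onlyQ_D: "onlyQ Q \<Longrightarrow> onlyQ e \<Longrightarrow> onlyQ (Dv v e)" "onlyQ Q \<Longrightarrow> onlyQ e \<Longrightarrow> onlyQ (dx j e)"
  by (induction e) auto

lemma onlyQ_b: "onlyQ (s2 bS)"
proof -
  have c: "onlyQ Wx" "onlyQ Ux" "onlyQ Tx" "onlyQ Tx'" by (simp_all add: Wx_def Ux_def Tx_def Tx'_def)
  have A0: "onlyQ (s0 AS)" "onlyQ (s0 BS)" by (simp_all add: AS_def BS_def c)
  have Q: "onlyQ (s0 KS)" by (simp add: KS_def Kof_def star_def A0)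
  then have QQ: "onlyQ Q" by (simp add: Q_def)
  note D = onlyQ_D[OF QQ]
  have A1: "onlyQ (s1 AS)" "onlyQ (s1 BS)" "onlyQ (s2 AS)" "onlyQ (s2 BS)" by (simp_all add: AS_def BS_def c D)
  have K: "onlyQ (s1 KS)" "onlyQ (s2 KS)" by (simp_all add: KS_def Kof_def star_def brk1_def brk2_def A0 A1 D)
  show ?thesis by (simp add: bS_def linv_def Let_def brk1_def brk2_def K Q QQ D)
qed

definition "away \<eta> l \<longleftrightarrow> (\<forall>r\<ge>0. \<eta> \<le> cmod (of_real r - l))"

lemma away_cut: "\<eta> > 0 \<Longrightarrow> away \<eta> l \<Longrightarrow> l \<notin> cut"
proof
  assume e: "\<eta> > 0" "away \<eta> l" "l \<in> cut"
  then have "l = of_real (Re l)" "Re l \<ge> 0" by (auto simp: cut_def complex_eq_iff)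
  then show False using e(1,2) unfolding away_def by (metis diff_self norm_zero not_less)
qed

lemma poly_bound:
  assumes \<eta>: "\<eta> > 0"
  shows "onlyQ e \<Longrightarrow> \<exists>C\<ge>0. \<exists>N. \<forall>x y l. away \<eta> l \<longrightarrow> norm (ev e (rpt 1 x y l)) \<le> C * (1 + cmod l + \<bar>x\<bar> + \<bar>y\<bar>) ^ N"
proof (induction e)
  case (Cst a)
  show ?case by (intro exI[of _ "norm a"] exI[of _ 0] conjI) auto
next
  case (Vr v)
  show ?case
  proof (intro exI[of _ 1] conjI allI impI)
    fix x y l
    show "norm (ev (Vr v) (rpt 1 x y l)) \<le> 1 * (1 + cmod l + \<bar>x\<bar> + \<bar>y\<bar>) ^ 1"
    proof (cases v)
      case (Xi i) then show ?thesis using exhaust_2[of i] by (auto simp: norm_scaleC)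
    qed (auto simp: norm_scaleC)
  qed simp
next
  case (Iv e)
  then have e: "e = Q" by simp
  show ?case
  proof (intro exI[of _ "1 / \<eta>"] exI[of _ 0] conjI allI impI)
    fix x y l assume a: "away \<eta> l"
    have "cmod (of_real r - l) \<ge> \<eta>" if "r \<ge> cq * (x\<^sup>2 + y\<^sup>2)" for r
    proof -
      have "0 \<le> cq * (x\<^sup>2 + y\<^sup>2)" using cq(1) by simp
      then show ?thesis using a that unfolding away_def by (meson order_trans)
    qed
    from resolvent(2)[OF _ this \<eta>, of 1 x y] show "norm (ev (Iv e) (rpt 1 x y l)) \<le> 1 / \<eta> * (1 + cmod l + \<bar>x\<bar> + \<bar>y\<bar>) ^ 0"
      by (simp add: e)
  qed (use \<eta> in simp)
next
  case (Pl e f)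
  from Pl.IH(1) Pl.prems obtain C1 N1 where 1: "C1 \<ge> 0" "\<And>x y l. away \<eta> l \<Longrightarrow> norm (ev e (rpt 1 x y l)) \<le> C1 * (1 + cmod l + \<bar>x\<bar> + \<bar>y\<bar>) ^ N1" by auto
  from Pl.IH(2) Pl.prems obtain C2 N2 where 2: "C2 \<ge> 0" "\<And>x y l. away \<eta> l \<Longrightarrow> norm (ev f (rpt 1 x y l)) \<le> C2 * (1 + cmod l + \<bar>x\<bar> + \<bar>y\<bar>) ^ N2" by auto
  show ?case
  proof (intro exI[of _ "C1 + C2"] exI[of _ "N1 + N2"] conjI allI impI)
    fix x y l assume a: "away \<eta> l"
    let ?M = "1 + cmod l + \<bar>x\<bar> + \<bar>y\<bar>"
    have M: "?M ^ N1 \<le> ?M ^ (N1 + N2)" "?M ^ N2 \<le> ?M ^ (N1 + N2)" by (intro power_increasing; simp)+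
    have "norm (ev (e \<oplus> f) (rpt 1 x y l)) \<le> C1 * ?M ^ N1 + C2 * ?M ^ N2"
      using norm_triangle_mono[OF 1(2)[OF a] 2(2)[OF a]] by simp
    also have "\<dots> \<le> C1 * ?M ^ (N1 + N2) + C2 * ?M ^ (N1 + N2)" by (intro add_mono mult_left_mono M 1(1) 2(1))
    finally show "norm (ev (e \<oplus> f) (rpt 1 x y l)) \<le> (C1 + C2) * ?M ^ (N1 + N2)" by (simp add: distrib_right)
  qed (use 1 2 in simp)
next
  case (Ti e f)
  from Ti.IH(1) Ti.prems obtain C1 N1 where 1: "C1 \<ge> 0" "\<And>x y l. away \<eta> l \<Longrightarrow> norm (ev e (rpt 1 x y l)) \<le> C1 * (1 + cmod l + \<bar>x\<bar> + \<bar>y\<bar>) ^ N1" by auto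
  from Ti.IH(2) Ti.prems obtain C2 N2 where 2: "C2 \<ge> 0" "\<And>x y l. away \<eta> l \<Longrightarrow> norm (ev f (rpt 1 x y l)) \<le> C2 * (1 + cmod l + \<bar>x\<bar> + \<bar>y\<bar>) ^ N2" by auto
  show ?case
  proof (intro exI[of _ "C1 * C2"] exI[of _ "N1 + N2"] conjI allI impI)
    fix x y l assume a: "away \<eta> l"
    let ?M = "1 + cmod l + \<bar>x\<bar> + \<bar>y\<bar>"
    have "norm (ev (e \<otimes> f) (rpt 1 x y l)) \<le> norm (ev e (rpt 1 x y l)) * norm (ev f (rpt 1 x y l))" by (simp add: norm_mult_ineq)
    also have "\<dots> \<le> (C1 * ?M ^ N1) * (C2 * ?M ^ N2)" using 1 2 a by (intro mult_mono) auto
    finally show "norm (ev (e \<otimes> f) (rpt 1 x y l)) \<le> C1 * C2 * ?M ^ (N1 + N2)" by (simp add: power_add mult_ac)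
  qed (use 1 2 in simp)
qed

text \<open>Where the square of norm p exceeds 1 + 2 |l| / cq, homogeneity gives the decay with a
  constant independent of l. Inside, the polynomial bound is used, and introducing
  \<open>kern\<close> costs only two more powers of 1 + |l|.\<close>

lemma psi_poly_bound:
  assumes \<eta>: "\<eta> > 0"
  shows "\<exists>C\<ge>0. \<exists>N. \<forall>p l. away \<eta> l \<longrightarrow> cmod (psi (s2 bS) 1 p l) \<le> C * (1 + cmod l) ^ N * kern p"
proof -
  have okb: "ok \<Omega> (s2 bS)" using okS_bS[of \<Omega>] by (simp add: okS_def)
  have hmb: "hm (s2 bS) (-4)" using hm_AB(5) by (simp add: hmS_def)
  obtain C1 where C1: "C1 \<ge> 0" "\<And>s (p :: real \<times> real) l. s \<in> {0..1} \<Longrightarrow> p \<noteq> 0 \<Longrightarrow> cmod l \<le> cq / 2 * (norm p)\<^sup>2 \<Longrightarrow> cmod (psi (s2 bS) s p l) \<le> C1 * norm p powi (-4)"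
    using psi_outer[OF okb hmb] by blast
  obtain C2 N where C2: "C2 \<ge> 0" "\<And>x y l. away \<eta> l \<Longrightarrow> norm (ev (s2 bS) (rpt 1 x y l)) \<le> C2 * (1 + cmod l + \<bar>x\<bar> + \<bar>y\<bar>) ^ N"
    using poly_bound[OF \<eta> onlyQ_b] by blast
  \<comment> \<open>In the inner region c (1 + |l|) dominates both 1 + |l| + |x| + |y| and 1 plus
    the square of norm p.\<close>
  define c where "c = 5 + 4 / cq"
  have c: "c \<ge> 5" using cq(1) by (simp add: c_def)
  show ?thesis
  proof (intro exI[of _ "C1 * 4 + C2 * c ^ (N + 2)"] exI[of _ "N + 2"] conjI allI impI)
    show "0 \<le> C1 * 4 + C2 * c ^ (N + 2)" using C1(1) C2(1) c by simp
    fix p :: "real \<times> real" and l assume a: "away \<eta> l"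
    let ?L = "1 + cmod l"
    show "cmod (psi (s2 bS) 1 p l) \<le> (C1 * 4 + C2 * c ^ (N + 2)) * ?L ^ (N + 2) * kern p"
    proof (cases "(norm p)\<^sup>2 > 1 + 2 * cmod l / cq")
      case True
      have p1: "(norm p)\<^sup>2 \<ge> 1" using True cq(1) zero_le_divide_iff[of "2 * cmod l" cq] by (smt (verit) norm_ge_zero)
      then have n1: "norm p \<ge> 1" using power2_le_imp_le[of 1 "norm p"] by simp
      have "2 * cmod l / cq \<le> (norm p)\<^sup>2" using True by simp
      then have "cmod l \<le> cq / 2 * (norm p)\<^sup>2" using cq(1) by (simp add: field_simps)
      moreover have "p \<noteq> 0" using n1 by auto
      ultimately have "cmod (psi (s2 bS) 1 p l) \<le> C1 * norm p powi (-4)" using C1(2)[of 1 p l] by simp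
      also have "\<dots> \<le> C1 * (2 ^ 2 / (1 + (norm p)\<^sup>2) ^ 2)" using n1 by (intro mult_left_mono powi_decay C1(1)) auto
      also have "\<dots> = C1 * 4 * 1 * kern p" by (simp add: kern_def)
      also have "\<dots> \<le> (C1 * 4 + C2 * c ^ (N + 2)) * ?L ^ (N + 2) * kern p"
        using C1(1) C2(1) c by (intro mult_right_mono mult_mono one_le_power kern_nonneg) auto
      finally show ?thesis .
    next
      case False
      obtain x y where p: "p = (x, y)" by (cases p)
      have np: "(norm p)\<^sup>2 \<le> 1 + 2 * cmod l / cq" using False by simp
      define k where "k = cmod l / cq"
      define j where "j = 4 / cq"
      have cL: "c * ?L = 5 + j + 5 * cmod l + 4 * k" by (simp add: c_def j_def k_def algebra_simps add_divide_distrib)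
      have q: "j \<ge> 0" "k \<ge> 0" "cmod l \<ge> 0" using cq(1) by (auto simp: j_def k_def)
      have np': "(norm p)\<^sup>2 \<le> 1 + 2 * k" using np by (simp add: k_def)
      have ab: "\<bar>v\<bar> \<le> (1 + v\<^sup>2) / 2" for v :: real
      proof -
        have "0 \<le> v\<^sup>2 + 1 - 2 * \<bar>v\<bar>" using zero_le_power2[of "\<bar>v\<bar> - 1"] by (simp add: power2_diff)
        then show ?thesis by simp
      qed
      have xy: "x\<^sup>2 + y\<^sup>2 \<le> 1 + 2 * k" using np' norm2_pair[of x y] by (simp add: p)
      have M: "1 + cmod l + \<bar>x\<bar> + \<bar>y\<bar> \<le> c * ?L"
      proof -
        have "\<bar>x\<bar> + \<bar>y\<bar> \<le> (1 + x\<^sup>2) / 2 + (1 + y\<^sup>2) / 2" by (intro add_mono ab)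
        also have "\<dots> = 1 + (x\<^sup>2 + y\<^sup>2) / 2" by (simp add: field_simps)
        also have "\<dots> \<le> 1 + (1 + 2 * k) / 2" using xy by simp
        finally have "(1 + cmod l) + (\<bar>x\<bar> + \<bar>y\<bar>) \<le> (1 + cmod l) + (1 + (1 + 2 * k) / 2)" by (rule add_left_mono)
        also have "\<dots> \<le> (1 + cmod l) + (1 + (1 + 2 * k) / 2) + (5 / 2 + j + 4 * cmod l + 3 * k)"
          using q(1,2) by (intro add_increasing2 add_nonneg_nonneg order_refl) auto
        also have "\<dots> = c * ?L" unfolding cL by (simp add: field_simps)
        finally show ?thesis by (simp only: add.assoc)
      qed
      have M2: "1 + (norm p)\<^sup>2 \<le> c * ?L" unfolding cL using np' q(1,2) norm_ge_zero[of l] by linarith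
      have pos: "(1 + (norm p)\<^sup>2)\<^sup>2 > 0" by (intro zero_less_power) (simp add: add_pos_nonneg)
      have "cmod (psi (s2 bS) 1 p l) \<le> norm (ev (s2 bS) (rpt 1 x y l))" by (simp add: psi_def p tr(3))
      also have "\<dots> \<le> C2 * (1 + cmod l + \<bar>x\<bar> + \<bar>y\<bar>) ^ N" by (rule C2(2)[OF a])
      also have "\<dots> \<le> C2 * (c * ?L) ^ N" by (intro mult_left_mono power_mono M C2(1)) simp
      also have "\<dots> = C2 * (c * ?L) ^ N * (1 + (norm p)\<^sup>2)\<^sup>2 * kern p" using pos by (simp add: kern_def)
      also have "\<dots> \<le> C2 * (c * ?L) ^ N * (c * ?L)\<^sup>2 * kern p"
        using C2(1) c by (intro mult_right_mono mult_left_mono power_mono M2 kern_nonneg) auto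
      also have "\<dots> = C2 * c ^ (N + 2) * ?L ^ (N + 2) * kern p" by (simp only: power_mult_distrib power_add mult_ac)
      also have "\<dots> \<le> (C1 * 4 + C2 * c ^ (N + 2)) * ?L ^ (N + 2) * kern p"
        using C1(1) by (intro mult_right_mono kern_nonneg) auto
      finally show ?thesis .
    qed
  qed
qed

definition "Psi p l = ev (s2 bS) (rpt 1 (fst p) (snd p) l)"

definition "Ray a b p t = (exp (- (a + of_real t * b)) * b) *\<^sub>C Psi p (a + of_real t * b)"

text \<open>The polynomial bound in norm makes the algebra-valued integral over t exist. Under the
  trace the stronger bound with \<open>kern\<close> allows the exchange with the plane integral,
  which is 0 at each point of the piece by \<open>total_vanish\<close>.\<close>

lemma ray_vanish:
  assumes I: "ray I a b"
  shows "Ray a b p integrable_on I" "integrable lborel (\<lambda>p. tr (integral I (Ray a b p)))"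
    "(LINT p|lborel. tr (integral I (Ray a b p))) = 0"
proof -
  let ?l = "\<lambda>t. a + of_real t * b"
  let ?c = "\<lambda>t. exp (- ?l t) * b"
  have okb: "ok \<Omega> (s2 bS)" using okS_bS[of \<Omega>] by (simp add: okS_def)
  obtain \<eta> where \<eta>: "\<eta> > 0" "\<And>t. t \<in> I \<Longrightarrow> away \<eta> (?l t)" using I unfolding ray_def away_def by blast
  have lc: "?l t \<notin> cut" if "t \<in> I" for t by (rule away_cut[OF \<eta>(1) \<eta>(2)[OF that]])
  have cl: "closed I" using I by (simp add: ray_def)
  then have bI: "I \<in> sets borel" by simp
  obtain C1 N1 where C1: "C1 \<ge> 0" "\<And>p l. away \<eta> l \<Longrightarrow> cmod (psi (s2 bS) 1 p l) \<le> C1 * (1 + cmod l) ^ N1 * kern p"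
    using psi_poly_bound[OF \<eta>(1)] by blast
  obtain C2 where C2: "C2 \<ge> 0" "\<And>t. t \<in> I \<Longrightarrow> (1 + cmod (?l t)) ^ N1 * cmod (?c t) \<le> C2 * (1 / (1 + t\<^sup>2))"
    using I unfolding ray_def by blast
  obtain C3 N3 where C3: "C3 \<ge> 0" "\<And>x y l. away \<eta> l \<Longrightarrow> norm (ev (s2 bS) (rpt 1 x y l)) \<le> C3 * (1 + cmod l + \<bar>x\<bar> + \<bar>y\<bar>) ^ N3"
    using poly_bound[OF \<eta>(1) onlyQ_b] by blast
  obtain C4 where C4: "C4 \<ge> 0" "\<And>t. t \<in> I \<Longrightarrow> (1 + cmod (?l t)) ^ N3 * cmod (?c t) \<le> C4 * (1 / (1 + t\<^sup>2))"
    using I unfolding ray_def by blast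
  have lor: "set_integrable lborel I (\<lambda>t::real. C * (1 / (1 + t\<^sup>2)))" for C
    unfolding set_integrable_def using bI by (intro integrable_mult_indicator integrable_mult_right integrable_inverse_one_plus_square) simp
  have cR: "continuous_on I (Ray a b p)" for p
    unfolding Ray_def[abs_def] Psi_def
  proof (intro scaleC.continuous_on continuous_intros ev_continuous)
    fix v show "continuous_on I (\<lambda>t. rpt 1 (fst p) (snd p) (?l t) v)"
    proof (cases v)
      case (Xi i) then show ?thesis using exhaust_2[of i] by auto
    qed (auto intro!: continuous_intros)
  next
    fix t assume "t \<in> I"
    then show "dm (s2 bS) (rpt 1 (fst p) (snd p) (?l t))" using in_Om(1)[OF _ lc, of 1 t "fst p" "snd p"] okb by (auto simp: ok_def)
  qed
  show iR: "Ray a b p integrable_on I" for p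
  proof (rule integrable_on_all_intervals_integrable_bound)
    fix c d :: real
    obtain c' d' where e: "I \<inter> {c..d} = {c'..d'}" using I unfolding ray_def by meson
    have "Ray a b p integrable_on {c'..d'}"
      by (rule integrable_continuous_real, rule continuous_on_subset[OF cR]) (use e in blast)
    then show "(\<lambda>x. if x \<in> I then Ray a b p x else 0) integrable_on cbox c d"
      by (simp add: integrable_restrict_Int e)
  next
    let ?k = "1 + \<bar>fst p\<bar> + \<bar>snd p\<bar>"
    show "(\<lambda>t. C3 * ?k ^ N3 * C4 * (1 / (1 + t\<^sup>2))) integrable_on I"
      by (rule set_borel_integral_eq_integral(1)[OF lor])
    fix t assume t: "t \<in> I"
    have "norm (Ray a b p t) = cmod (?c t) * norm (Psi p (?l t))" by (simp add: Ray_def norm_scaleC)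
    also have "\<dots> \<le> cmod (?c t) * (C3 * (1 + cmod (?l t) + \<bar>fst p\<bar> + \<bar>snd p\<bar>) ^ N3)"
      unfolding Psi_def by (intro mult_left_mono C3(2) \<eta>(2) t) simp
    also have "\<dots> \<le> cmod (?c t) * (C3 * (?k * (1 + cmod (?l t))) ^ N3)"
    proof (intro mult_left_mono power_mono C3(1))
      have "0 \<le> (\<bar>fst p\<bar> + \<bar>snd p\<bar>) * cmod (?l t)" by simp
      then show "1 + cmod (?l t) + \<bar>fst p\<bar> + \<bar>snd p\<bar> \<le> ?k * (1 + cmod (?l t))" by (simp add: algebra_simps)
    qed auto
    also have "\<dots> = C3 * ?k ^ N3 * ((1 + cmod (?l t)) ^ N3 * cmod (?c t))" by (simp only: power_mult_distrib mult_ac)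
    also have "\<dots> \<le> C3 * ?k ^ N3 * (C4 * (1 / (1 + t\<^sup>2)))" using C3(1) by (intro mult_left_mono C4(2) t) auto
    finally show "norm (Ray a b p t) \<le> C3 * ?k ^ N3 * C4 * (1 / (1 + t\<^sup>2))" by (simp only: mult.assoc)
  qed
  let ?f = "\<lambda>t p. indicator I t *\<^sub>R (?c t * psi (s2 bS) 1 p (?l t))"
  have cp: "continuous_on (I \<times> UNIV) (\<lambda>q. ?c (fst q) * psi (s2 bS) 1 (snd q) (?l (fst q)))"
    by (intro continuous_intros psi_cont[OF okb]) (use lc in \<open>auto intro!: in_Om(1)[of 1, simplified]\<close>)
  have m: "(\<lambda>q. ?f (fst q) (snd q)) \<in> borel_measurable borel"
  proof -
    have "I \<times> (UNIV :: (real \<times> real) set) \<in> sets borel" using cl by (intro borel_closed closed_Times) auto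
    from borel_measurable_continuous_on_indicator[OF this cp] show ?thesis by (simp add: indicator_times)
  qed
  have bd: "cmod (?f t p) \<le> (C1 * C2 * (1 / (1 + t\<^sup>2))) * kern p" for t p
  proof (cases "t \<in> I")
    case True
    have "cmod (?f t p) = cmod (?c t) * cmod (psi (s2 bS) 1 p (?l t))" using True by (simp add: norm_mult)
    also have "\<dots> \<le> cmod (?c t) * (C1 * (1 + cmod (?l t)) ^ N1 * kern p)" by (intro mult_left_mono C1(2) \<eta>(2) True) simp
    also have "\<dots> = C1 * ((1 + cmod (?l t)) ^ N1 * cmod (?c t)) * kern p" by (simp only: mult_ac)
    also have "\<dots> \<le> C1 * (C2 * (1 / (1 + t\<^sup>2))) * kern p" by (intro mult_right_mono mult_left_mono C2(2) True C1(1) kern_nonneg)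
    finally show ?thesis by (simp only: mult.assoc)
  next
    case False
    then show ?thesis using C1(1) C2(1) kern_nonneg[of p] by (simp add: add_nonneg_nonneg)
  qed
  have trR: "tr (integral I (Ray a b p)) = (LINT t|lborel. ?f t p)" for p
  proof -
    have "tr (integral I (Ray a b p)) = integral I (\<lambda>t. ?c t * psi (s2 bS) 1 p (?l t))"
      using integral_linear[OF iR tr(1)] by (simp add: comp_def Ray_def Psi_def psi_def tr(2))
    also have "\<dots> = (LINT t|lborel. ?f t p)"
    proof -
      have "integrable lborel (\<lambda>t. ?f t p)"
      proof (rule Bochner_Integration.integrable_bound)
        show "integrable lborel (\<lambda>t::real. (C1 * C2 * kern p) * (1 / (1 + t\<^sup>2)))"
          by (intro integrable_mult_right integrable_inverse_one_plus_square)
        have "(\<lambda>t. Pair t p) \<in> borel_measurable borel"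
          by (intro borel_measurable_continuous_onI continuous_intros)
        from measurable_compose[OF this m] show "(\<lambda>t. ?f t p) \<in> borel_measurable lborel" by simp
        show "AE t in lborel. norm (?f t p) \<le> norm ((C1 * C2 * kern p) * (1 / (1 + t\<^sup>2)))"
        proof (rule AE_I2)
          fix t :: real
          have "norm (?f t p) \<le> C1 * C2 * (1 / (1 + t\<^sup>2)) * kern p" by (rule bd)
          also have "\<dots> = (C1 * C2 * kern p) * (1 / (1 + t\<^sup>2))" by (simp only: mult_ac)
          also have "\<dots> \<le> norm ((C1 * C2 * kern p) * (1 / (1 + t\<^sup>2)))" unfolding real_norm_def by (rule abs_ge_self)
          finally show "norm (?f t p) \<le> norm ((C1 * C2 * kern p) * (1 / (1 + t\<^sup>2)))" .
        qed
      qed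
      then have "set_integrable lborel I (\<lambda>t. ?c t * psi (s2 bS) 1 p (?l t))" by (simp add: set_integrable_def)
      from set_borel_integral_eq_integral(2)[OF this] show ?thesis by (simp add: set_lebesgue_integral_def)
    qed
    finally show ?thesis .
  qed
  have B: "integrable lborel (\<lambda>t::real. C1 * C2 * (1 / (1 + t\<^sup>2)))"
    by (intro integrable_mult_right integrable_inverse_one_plus_square)
  have z: "(LINT p|lborel. ?f t p) = 0" for t
  proof (cases "t \<in> I")
    case True then show ?thesis using total_vanish[OF lc[OF True]] by simp
  qed simp
  show "integrable lborel (\<lambda>p. tr (integral I (Ray a b p)))" "(LINT p|lborel. tr (integral I (Ray a b p))) = 0"
    unfolding trR by (rule fubini_vanish[of ?f, OF m bd B z])+
qed

end

subsection \<open>Coefficients of differential operators\<close>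

definition v2 :: "nat \<Rightarrow> nat \<Rightarrow> nat^2" where "v2 a b = (\<chi> i. if i = 1 then a else b)"

lemma v2_simps [simp]: "v2 a b $ 1 = a" "v2 a b $ 2 = b" "v2 a b = v2 c d \<longleftrightarrow> a = c \<and> b = d"
  by (auto simp: v2_def vec_eq_iff forall_2)

lemma v2_iff: "\<alpha> = v2 a b \<longleftrightarrow> \<alpha>$1 = a \<and> \<alpha>$2 = b"
  by (simp add: vec_eq_iff forall_2)

lemma multi_index_sets:
  "{\<alpha>::nat^2. \<alpha>$1 + \<alpha>$2 \<le> 2} = {v2 0 0, v2 1 0, v2 0 1, v2 2 0, v2 1 1, v2 0 2}"
  "{\<alpha>::nat^2. \<alpha>$1 + \<alpha>$2 = 2} = {v2 2 0, v2 1 1, v2 0 2}"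
  "{\<alpha>::nat^2. \<alpha>$1 + \<alpha>$2 = 1} = {v2 1 0, v2 0 1}" "{\<alpha>::nat^2. \<alpha>$1 + \<alpha>$2 = 0} = {v2 0 0}"
proof -
  have 2: "a + b \<le> 2 \<longleftrightarrow> (a = 0 \<and> b = 0) \<or> (a = 1 \<and> b = 0) \<or> (a = 0 \<and> b = 1) \<or> (a = 2 \<and> b = 0) \<or> (a = 1 \<and> b = 1) \<or> (a = 0 \<and> b = 2)"
    for a b :: nat by presburger
  have 3: "a + b = 2 \<longleftrightarrow> (a = 2 \<and> b = 0) \<or> (a = 1 \<and> b = 1) \<or> (a = 0 \<and> b = 2)" for a b :: nat by presburger
  have 4: "a + b = 1 \<longleftrightarrow> (a = 1 \<and> b = 0) \<or> (a = 0 \<and> b = 1)" for a b :: nat by presburger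
  show "{\<alpha>::nat^2. \<alpha>$1 + \<alpha>$2 \<le> 2} = {v2 0 0, v2 1 0, v2 0 1, v2 2 0, v2 1 1, v2 0 2}"
    by (rule set_eqI) (simp only: mem_Collect_eq insert_iff empty_iff v2_iff 2 simp_thms)
  show "{\<alpha>::nat^2. \<alpha>$1 + \<alpha>$2 = 2} = {v2 2 0, v2 1 1, v2 0 2}"
    by (rule set_eqI) (simp only: mem_Collect_eq insert_iff empty_iff v2_iff 3 simp_thms)
  show "{\<alpha>::nat^2. \<alpha>$1 + \<alpha>$2 = 1} = {v2 1 0, v2 0 1}"
    by (rule set_eqI) (simp only: mem_Collect_eq insert_iff empty_iff v2_iff 4 simp_thms)
  show "{\<alpha>::nat^2. \<alpha>$1 + \<alpha>$2 = 0} = {v2 0 0}"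
    by (rule set_eqI) (simp only: mem_Collect_eq insert_iff empty_iff v2_iff add_is_0 simp_thms)
qed

context nc_torus
begin

lemma mderiv_v2: "nct_mderiv U (v2 a b) f = (dl 1 ^^ a) ((dl 2 ^^ b) f)"
  by (simp add: nct_mderiv_def)

lemma has_coeffs_iff_sum:
  "(\<Sum>\<alpha> | \<alpha>$1 + \<alpha>$2 \<le> 2. p \<alpha> * nct_mderiv U \<alpha> f) = p (v2 0 0) * f + p (v2 1 0) * dl 1 f + p (v2 0 1) * dl 2 f
    + p (v2 2 0) * dl 1 (dl 1 f) + p (v2 1 1) * dl 1 (dl 2 f) + p (v2 0 2) * dl 2 (dl 2 f)"
  unfolding multi_index_sets by (simp add: mderiv_v2 numeral_2_eq_2 add.assoc)

lemma dl_mon: "dl j (mon n) = of_int (n$j) *\<^sub>C mon n"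
  by (rule Sm_eqI) (auto simp: cf_dl cf_scaleC cf_mon intro: Sm_dl Sm_scaleC)

text \<open>Testing an operator on monomials, which are unitary, recovers its coefficients.\<close>

lemma has_coeffs_unique:
  assumes p: "has_coeffs U P p" and q: "has_coeffs U P q" shows "p = q"
proof -
  define d where "d \<alpha> = p \<alpha> - q \<alpha>" for \<alpha>
  have key: "d (v2 0 0) + of_int (n$1) *\<^sub>C d (v2 1 0) + of_int (n$2) *\<^sub>C d (v2 0 1) + (of_int (n$1) * of_int (n$1)) *\<^sub>C d (v2 2 0)
     + (of_int (n$1) * of_int (n$2)) *\<^sub>C d (v2 1 1) + (of_int (n$2) * of_int (n$2)) *\<^sub>C d (v2 0 2) = 0" (is "?s = 0") for n :: "int^2"
  proof -
    have m: "mon n \<in> Sm" by (rule Sm_mon)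
    have "(\<Sum>\<alpha> | \<alpha>$1 + \<alpha>$2 \<le> 2. p \<alpha> * nct_mderiv U \<alpha> (mon n)) = (\<Sum>\<alpha> | \<alpha>$1 + \<alpha>$2 \<le> 2. q \<alpha> * nct_mderiv U \<alpha> (mon n))"
      using p[unfolded has_coeffs_def, THEN conjunct2, THEN conjunct2, rule_format, OF m]
        q[unfolded has_coeffs_def, THEN conjunct2, THEN conjunct2, rule_format, OF m] by simp
    then have "?s * mon n = 0"
      unfolding has_coeffs_iff_sum dl_mon d_def
      by (simp add: dl_scaleC Sm_mon dl_mon scaleC_scaleC mult_scaleC_left mult_scaleC_right scaleC.diff_right algebra_simps)
    then have "?s * (mon n * mon (- n)) = 0" by (simp flip: mult.assoc)
    moreover have "mon 0 = 1" by (simp add: nct_monom_def upow_def)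
    ultimately have "cis (ph * of_int (n$2) * of_int ((- n)$1)) *\<^sub>C ?s = 0" by (simp only: mon_mult mult_scaleC_right) simp
    then have "norm (cis (ph * of_int (n$2) * of_int ((- n)$1)) *\<^sub>C ?s) = 0" by (simp only: norm_zero)
    then show ?thesis unfolding norm_scaleC by simp
  qed
  \<comment> \<open>The symbol at n is a quadratic polynomial in n; it is determined by its values
    at (0,0), (1,0), (-1,0), (0,1), (0,-1) and (1,1).\<close>
  define N where "N a b = (\<chi> i. if i = (1::2) then a else b)" for a b :: int
  have N: "N a b $ 1 = a" "N a b $ 2 = b" for a b by (simp_all add: N_def)
  have k0: "d (v2 0 0) = 0" using key[of "N 0 0"] by (simp add: N scaleC.zero_left)
  have k1: "d (v2 1 0) + d (v2 2 0) = 0" "- d (v2 1 0) + d (v2 2 0) = 0"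
    using key[of "N 1 0"] key[of "N (-1) 0"] by (simp_all add: N k0 scaleC.minus_left scaleC.zero_left)
  have k2: "d (v2 0 1) + d (v2 0 2) = 0" "- d (v2 0 1) + d (v2 0 2) = 0"
    using key[of "N 0 1"] key[of "N 0 (-1)"] by (simp_all add: N k0 scaleC.minus_left scaleC.zero_left)
  have half: "x = 0 \<and> y = 0" if "x + y = 0" "- x + y = 0" for x y :: 'a
  proof -
    have "2 *\<^sub>R y = (x + y) + (- x + y)" by (simp add: scaleR_2)
    then have "y = 0" using that by simp
    then show ?thesis using that by simp
  qed
  note h1 = half[OF k1] half[OF k2]
  have k3: "d (v2 1 1) = 0" using key[of "N 1 1"] h1 by (simp add: N k0 scaleC.zero_right)
  show "p = q"
  proof
    fix \<alpha>
    show "p \<alpha> = q \<alpha>"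
    proof (cases "\<alpha>$1 + \<alpha>$2 \<le> 2")
      case True
      then have "\<alpha> \<in> {v2 0 0, v2 1 0, v2 0 1, v2 2 0, v2 1 1, v2 0 2}" using multi_index_sets(1) by blast
      then have "d \<alpha> = 0" using k0 h1 k3 by auto
      then show ?thesis by (simp add: d_def)
    next
      case False
      then show ?thesis using p q by (simp add: has_coeffs_def)
    qed
  qed
qed

lemma op_coeffs_eq: "has_coeffs U P p \<Longrightarrow> op_coeffs U P = p"
  unfolding op_coeffs_def by (rule the_equality) (auto intro: has_coeffs_unique)

end

context gb_data
begin

abbreviation "eW \<equiv> cfc w h"
abbreviation "eU \<equiv> cfc u h"
abbreviation "eT \<equiv> ccfc tau h"
abbreviation "eT' \<equiv> ccfc (\<lambda>t. cnj (tau t)) h"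

definition "a1 = eW"
definition "a2 = eW * eT'"
definition "a0 = eW * dl 2 eT'"
definition "b1 = eU * eW"
definition "b2 = eU * eT * eW"
definition "b0 = eU * (dl 1 eW + eT * dl 2 eW)"

lemma ab_Sm [simp]: "a0 \<in> Sm" "a1 \<in> Sm" "a2 \<in> Sm" "b0 \<in> Sm" "b1 \<in> Sm" "b2 \<in> Sm"
  unfolding a0_def a1_def a2_def b0_def b1_def b2_def using smooth by (auto intro!: Sm_mult Sm_add Sm_dl)

definition "Aop f = a1 * dl 1 f + a2 * dl 2 f + a0 * f"
definition "Bop f = b1 * dl 1 f + b2 * dl 2 f + b0 * f"

text \<open>Coefficients of the composition of \<open>Aop\<close> with \<open>Bop\<close>, expanded
  by the Leibniz rule.\<close>

definition "pc \<alpha> = (if \<alpha> = v2 2 0 then a1 * b1 else if \<alpha> = v2 1 1 then a1 * b2 + a2 * b1 else if \<alpha> = v2 0 2 then a2 * b2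
  else if \<alpha> = v2 1 0 then a1 * b0 + a0 * b1 + a1 * dl 1 b1 + a2 * dl 2 b1
  else if \<alpha> = v2 0 1 then a2 * b0 + a0 * b2 + a1 * dl 1 b2 + a2 * dl 2 b2
  else if \<alpha> = v2 0 0 then a0 * b0 + a1 * dl 1 b0 + a2 * dl 2 b0 else 0)"

lemma pc_simps: "pc (v2 2 0) = a1 * b1" "pc (v2 1 1) = a1 * b2 + a2 * b1" "pc (v2 0 2) = a2 * b2"
  "pc (v2 1 0) = a1 * b0 + a0 * b1 + a1 * dl 1 b1 + a2 * dl 2 b1"
  "pc (v2 0 1) = a2 * b0 + a0 * b2 + a1 * dl 1 b2 + a2 * dl 2 b2"
  "pc (v2 0 0) = a0 * b0 + a1 * dl 1 b0 + a2 * dl 2 b0"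
  by (simp_all add: pc_def)

lemma has_coeffs_AB:
  assumes P: "\<And>f. f \<in> Sm \<Longrightarrow> P f = Aop (Bop f)" shows "has_coeffs U P pc"
  unfolding has_coeffs_def
proof (intro conjI allI impI ballI)
  show "pc \<alpha> \<in> Sm" for \<alpha> unfolding pc_def by (auto intro!: Sm_mult Sm_add Sm_dl)
  show "pc \<alpha> = 0" if "2 < \<alpha>$1 + \<alpha>$2" for \<alpha> using that by (auto simp: pc_def)
  fix f assume f: "f \<in> Sm"
  have s: "b1 * dl 1 f \<in> Sm" "b2 * dl 2 f \<in> Sm" "b0 * f \<in> Sm" using f by (auto intro!: Sm_mult Sm_dl)
  have "dl j (Bop f) = dl j (b1 * dl 1 f) + dl j (b2 * dl 2 f) + dl j (b0 * f)" for j
    unfolding Bop_def using s by (simp add: dl_add Sm_add)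
  then have B: "dl j (Bop f) = (dl j b1 * dl 1 f + b1 * dl j (dl 1 f)) + (dl j b2 * dl 2 f + b2 * dl j (dl 2 f)) + (dl j b0 * f + b0 * dl j f)" for j
    using f by (simp add: dl_mult Sm_dl)
  show "P f = (\<Sum>\<alpha> | \<alpha>$1 + \<alpha>$2 \<le> 2. pc \<alpha> * nct_mderiv U \<alpha> f)"
    unfolding P[OF f] Aop_def B has_coeffs_iff_sum pc_simps
    unfolding Bop_def by (simp add: algebra_simps dl_commute[OF f, of 2 1])
qed

lemma ev_one: "ev Wx (rpt 1 x y l) = eW" "ev Ux (rpt 1 x y l) = eU" "ev Tx (rpt 1 x y l) = eT" "ev Tx' (rpt 1 x y l) = eT'"
proof -
  have "fW 1 = (\<lambda>t. of_real (w t))" "fU 1 = (\<lambda>t. of_real (u t))" "fT 1 = tau" "fT' 1 = (\<lambda>t. cnj (tau t))"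
    by (auto simp: fun_eq_iff fW_def fU_def fT_def fT'_def)
  then show "ev Wx (rpt 1 x y l) = eW" "ev Ux (rpt 1 x y l) = eU" "ev Tx (rpt 1 x y l) = eT" "ev Tx' (rpt 1 x y l) = eT'"
    using ev_coeffs[of 1 "of_real x" "of_real y" l] by (simp_all add: ccfc_of_real[OF h(2)])
qed

lemma ev_dx_ok: "ok {z} e \<Longrightarrow> ev (dx j e) z = dl j (ev e z)"
  by (simp add: ok_def ev_dx)

lemma ev_sym:
  "ev (s0 AS) (rpt 1 x y l) = x *\<^sub>R a1 + y *\<^sub>R a2" "ev (s1 AS) (rpt 1 x y l) = a0"
  "ev (s0 BS) (rpt 1 x y l) = x *\<^sub>R b1 + y *\<^sub>R b2" "ev (s1 BS) (rpt 1 x y l) = b0"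
  "ev (Dv (Xi 1) (s0 AS)) (rpt 1 x y l) = a1" "ev (Dv (Xi 2) (s0 AS)) (rpt 1 x y l) = a2"
  "ev (Dv (Xi i) (s1 AS)) z = 0" "ev (Dv (Xi i) (Dv (Xi j) (s0 AS))) z = 0"
proof -
  have D: "ev (Dv (Xi i) Wx) z = 0" "ev (Dv (Xi i) Tx') z = 0" "ev (Dv (Xi i) (dx j Tx')) z = 0"
    "ev (Dv (Xi i) (Dv (Xi j) Wx)) z = 0" "ev (Dv (Xi i) (Dv (Xi j) Tx')) z = 0" for i j z
    by (simp_all add: Wx_def Tx'_def)
  have o: "ok {z} Wx" "ok {z} Ux" "ok {z} Tx" "ok {z} Tx'" for z by (rule ok_coeffs)+
  show "ev (s0 AS) (rpt 1 x y l) = x *\<^sub>R a1 + y *\<^sub>R a2" "ev (s1 AS) (rpt 1 x y l) = a0"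
    "ev (s0 BS) (rpt 1 x y l) = x *\<^sub>R b1 + y *\<^sub>R b2" "ev (s1 BS) (rpt 1 x y l) = b0"
    by (simp_all add: AS_def BS_def ev_one ev_dx_ok[OF o(1)] ev_dx_ok[OF o(4)] ev_one[of x y l, simplified] a0_def a1_def a2_def b0_def b1_def b2_def
       mult_scaleC_left mult_scaleC_right algebra_simps)
  show "ev (Dv (Xi 1) (s0 AS)) (rpt 1 x y l) = a1" "ev (Dv (Xi 2) (s0 AS)) (rpt 1 x y l) = a2"
    using ev_one[of x y l] by (simp_all add: AS_def D a1_def a2_def)
  show "ev (Dv (Xi i) (s1 AS)) z = 0" "ev (Dv (Xi i) (Dv (Xi j) (s0 AS))) z = 0"
    by (simp_all add: AS_def D)
qed

text \<open>At \<open>Sig\<close> = 1 the formal product of symbols agrees with the symbol read off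
  from the operator coefficients. This ties the calculus of expressions to the given
  definitions.\<close>

lemma ev_KS:
  fixes \<xi> :: "real^2"
  shows "ev (s0 KS) (rpt 1 (\<xi>$1) (\<xi>$2) l) = symb pc 2 \<xi> - l *\<^sub>C 1"
    "ev (s1 KS) (rpt 1 (\<xi>$1) (\<xi>$2) l) = symb pc 1 \<xi>" "ev (s2 KS) (rpt 1 (\<xi>$1) (\<xi>$2) l) = symb pc 0 \<xi>"
proof -
  define z where "z = rpt 1 (\<xi>$1) (\<xi>$2) l"
  have o: "ok {z} (s0 BS)" "ok {z} (s1 BS)" using okS_AB(2)[of "{z}"] by (simp_all add: okS_def)
  have s2: "s2 AS = Cst 0" "s2 BS = Cst 0" by (simp_all add: AS_def BS_def)
  have zl: "z Lam = l" by (simp add: z_def)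
  have db: "dl j (x *\<^sub>R b1 + y *\<^sub>R b2) = x *\<^sub>R dl j b1 + y *\<^sub>R dl j b2" for j x y
    by (simp add: dl_add dl_scaleR Sm_scaleR)
  have e: "ev (s0 AS) z = \<xi>$1 *\<^sub>R a1 + \<xi>$2 *\<^sub>R a2" "ev (s1 AS) z = a0" "ev (s0 BS) z = \<xi>$1 *\<^sub>R b1 + \<xi>$2 *\<^sub>R b2" "ev (s1 BS) z = b0"
    "ev (Dv (Xi 1) (s0 AS)) z = a1" "ev (Dv (Xi 2) (s0 AS)) z = a2"
    unfolding z_def by (rule ev_sym)+
  note dxs = ev_dx_ok[OF o(1)] ev_dx_ok[OF o(2)]
  show "ev (s0 KS) (rpt 1 (\<xi>$1) (\<xi>$2) l) = symb pc 2 \<xi> - l *\<^sub>C 1"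
    unfolding symb_def multi_index_sets z_def[symmetric]
    by (simp add: KS_def Kof_def star_def e zl pc_simps algebra_simps power2_eq_square flip: One_nat_def)
  show "ev (s1 KS) (rpt 1 (\<xi>$1) (\<xi>$2) l) = symb pc 1 \<xi>"
    unfolding symb_def multi_index_sets z_def[symmetric]
    by (simp add: KS_def Kof_def star_def brk1_def e dxs db pc_simps algebra_simps flip: One_nat_def)
  show "ev (s2 KS) (rpt 1 (\<xi>$1) (\<xi>$2) l) = symb pc 0 \<xi>"
    unfolding symb_def multi_index_sets z_def[symmetric]
    by (simp add: KS_def Kof_def star_def brk1_def brk2_def e ev_sym(7,8) dxs s2 pc_simps algebra_simps)
qed

lemma partial_ev:
  assumes F: "\<And>\<xi>. F \<xi> = ev e (rpt 1 (\<xi>$1) (\<xi>$2) l)" and d: "dm e (rpt 1 (\<xi>$1) (\<xi>$2) l)"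
  shows "partial i F \<xi> = ev (Dv (Xi i) e) (rpt 1 (\<xi>$1) (\<xi>$2) l)"
proof -
  let ?z = "rpt 1 (\<xi>$1) (\<xi>$2) l" and ?D = "ev (Dv (Xi i) e) (rpt 1 (\<xi>$1) (\<xi>$2) l)"
  have i: "i = 1 \<or> i = 2" by (rule exhaust_2)
  have z: "?z (Xi i) = of_real (\<xi>$i)" using i by auto
  have g: "((\<lambda>t. complex_of_real (\<xi>$i + t)) has_derivative of_real) (at 0)"
    by (rule has_derivative_eq_rhs, (rule derivative_intros)+) simp
  have "((\<lambda>w. ev e (?z(Xi i := w))) has_derivative (\<lambda>h. h *\<^sub>C ?D)) (at (complex_of_real (\<xi>$i + 0)))"
    using ev_has_derivative[OF d, of "Xi i"] unfolding z by simp
  from has_derivative_compose[OF g this]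
  have "((\<lambda>t. ev e (?z(Xi i := of_real (\<xi>$i + t)))) has_vector_derivative ?D) (at 0)"
    by (simp add: has_vector_derivative_def)
  moreover have "F (\<xi> + t *\<^sub>R axis i 1) = ev e (?z(Xi i := of_real (\<xi>$i + t)))" for t
    using i by (auto simp: F pt_upd axis_def)
  ultimately show ?thesis unfolding partial_def by (simp add: vector_derivative_at)
qed

text \<open>The recursions for \<open>res0\<close>, \<open>res1\<close>, \<open>res2\<close> and for
  \<open>linv\<close> agree term by term, once the real partial derivatives are identified with
  formal ones and the derivations with \<open>dx\<close>.\<close>

lemma res_eq:
  fixes \<xi> :: "real^2"
  assumes l: "l \<notin> cut"
  shows "res2 U pc l \<xi> = ev (s2 bS) (rpt 1 (\<xi>$1) (\<xi>$2) l)"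
proof -
  let ?z = "\<lambda>\<xi>::real^2. rpt 1 (\<xi>$1) (\<xi>$2) l"
  have zO: "?z \<xi> \<in> \<Omega>" for \<xi> by (rule in_Om(1)[OF _ l]) simp
  have okb: "ok \<Omega> (s0 bS)" "ok \<Omega> (s1 bS)" using okS_bS[of \<Omega>] by (simp_all add: okS_def)
  have dm: "dm (s0 bS) (?z \<xi>)" "dm (s1 bS) (?z \<xi>)" "dm (Dv (Xi j) (s0 bS)) (?z \<xi>)" for \<xi> j
    using okb zO[of \<xi>] by (auto simp: ok_def)
  have b0: "s0 bS = Iv Q" by (simp add: bS_def linv_def Let_def)
  have r0: "res0 pc l \<xi> = ev (s0 bS) (?z \<xi>)" for \<xi>
    unfolding res0_def b0 ev.simps Q_def ev_KS ..
  have okK: "ok {?z \<xi>} (s0 KS)" "ok {?z \<xi>} (s1 KS)" for \<xi> using okS_AB(3)[of "{?z \<xi>}"] by (simp_all add: okS_def)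
  have csS: "symb pc m \<xi> \<in> Sm" for m \<xi>
    unfolding symb_def by (intro Sm_sum Sm_scaleR) (auto simp: pc_def intro!: Sm_mult Sm_add Sm_dl)
  have dk: "dl j (symb pc 2 \<xi> - l *\<^sub>C 1) = dl j (symb pc 2 \<xi>)" for j \<xi>
    using csS by (simp add: dl_diff dl_scaleC Sm_scaleC scaleC.zero_right)
  have dx0: "ev (dx j (s0 KS)) (?z \<xi>) = dl j (symb pc 2 \<xi>)" "ev (dx j (s1 KS)) (?z \<xi>) = dl j (symb pc 1 \<xi>)" for j \<xi>
    unfolding ev_dx_ok[OF okK(1)] ev_dx_ok[OF okK(2)] ev_KS dk by simp_all
  have dx00: "ev (dx i (dx j (s0 KS))) (?z \<xi>) = dl i (dl j (symb pc 2 \<xi>))" for i j \<xi>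
  proof -
    have "ok {?z \<xi>} (dx j (s0 KS))" using okK(1) by (rule ok_ops)
    then show ?thesis by (simp only: ev_dx_ok[of "?z \<xi>" "dx j (s0 KS)"] dx0)
  qed
  have p0: "partial i (res0 pc l) \<xi> = ev (Dv (Xi i) (s0 bS)) (?z \<xi>)" for i \<xi> by (rule partial_ev[OF r0 dm(1)])
  have p00: "partial i (partial j (res0 pc l)) \<xi> = ev (Dv (Xi i) (Dv (Xi j) (s0 bS))) (?z \<xi>)" for i j \<xi>
    by (rule partial_ev[OF p0 dm(3)])
  have s1: "s1 bS = Ng ((s0 bS \<otimes> s1 KS \<oplus> brk1 (s0 bS) (s0 KS)) \<otimes> s0 bS)" by (simp add: bS_def linv_def Let_def)
  have s2: "s2 bS = Ng ((s0 bS \<otimes> s2 KS \<oplus> s1 bS \<otimes> s1 KS \<oplus> brk1 (s0 bS) (s1 KS) \<oplus> brk1 (s1 bS) (s0 KS) \<oplus> brk2 (s0 bS) (s0 KS)) \<otimes> s0 bS)"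
    by (simp add: bS_def linv_def Let_def)
  have r1: "res1 U pc l \<xi> = ev (s1 bS) (?z \<xi>)" for \<xi>
    unfolding res1_def s1 r0 p0 by (simp only: ev.simps brk1_def dx0 ev_KS sum_2) (simp add: algebra_simps)
  have p1: "partial i (res1 U pc l) \<xi> = ev (Dv (Xi i) (s1 bS)) (?z \<xi>)" for i \<xi> by (rule partial_ev[OF r1 dm(2)])
  show ?thesis
    unfolding res2_def s2 r0 r1 p0 p1 p00
    by (simp only: ev.simps brk1_def brk2_def dx0 dx00 ev_KS sum_2) (simp add: algebra_simps scaleR_right_distrib)
qed

end

subsection \<open>Functional metrics\<close>

lemma matrix_inv_eqI:
  fixes A B :: "real^2^2"
  assumes "A ** B = mat 1" "B ** A = mat 1" shows "matrix_inv A = B"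
  unfolding matrix_inv_def
proof (rule some_equality)
  fix C assume "A ** C = mat 1 \<and> C ** A = mat 1"
  then have "C = C ** (A ** B)" using assms(1) by (simp add: matrix_mul_rid)
  also have "\<dots> = B" using \<open>A ** C = mat 1 \<and> C ** A = mat 1\<close> by (simp add: matrix_mul_assoc matrix_mul_lid)
  finally show "C = B" .
qed (use assms in simp)

lemma matrix_inv_2:
  fixes A :: "real^2^2"
  assumes d: "det A \<noteq> 0"
  shows "matrix_inv A $ 1 $ 1 = A$2$2 / det A" "matrix_inv A $ 1 $ 2 = - A$1$2 / det A"
    "matrix_inv A $ 2 $ 1 = - A$2$1 / det A" "matrix_inv A $ 2 $ 2 = A$1$1 / det A"
proof -
  define B :: "real^2^2" where "B = (\<chi> i j. (if i = 1 then if j = 1 then A$2$2 else - A$1$2 else if j = 1 then - A$2$1 else A$1$1) / det A)"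
  have B: "B$1$1 = A$2$2 / det A" "B$1$2 = - A$1$2 / det A" "B$2$1 = - A$2$1 / det A" "B$2$2 = A$1$1 / det A"
    by (simp_all add: B_def)
  have m: "(X ** Y)$i$j = X$i$1 * Y$1$j + X$i$2 * Y$2$j" for X Y :: "real^2^2" and i j
    by (simp add: matrix_matrix_mult_def sum_2)
  have e: "A$1$1 * A$2$2 - A$1$2 * A$2$1 = det A" by (simp add: det_2)
  have "A ** B = mat 1" "B ** A = mat 1"
    using d by (simp_all add: vec_eq_iff forall_2 m B mat_def field_simps) (use e in \<open>simp_all add: algebra_simps\<close>)
  then have "matrix_inv A = B" by (rule matrix_inv_eqI)
  then show "matrix_inv A $ 1 $ 1 = A$2$2 / det A" "matrix_inv A $ 1 $ 2 = - A$1$2 / det A"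
    "matrix_inv A $ 2 $ 1 = - A$2$1 / det A" "matrix_inv A $ 2 $ 2 = A$1$1 / det A" using B by simp_all
qed

lemma functional_metric_pos:
  assumes g: "functional_metric h g" and t: "t \<in> real_spec h"
  shows "g t $ 2 $ 1 = g t $ 1 $ 2" "g t $ 1 $ 1 > 0" "g t $ 2 $ 2 > 0" "det (g t) > 0"
proof -
  have s: "transpose (g t) = g t" and p: "\<And>v. v \<noteq> 0 \<Longrightarrow> v \<bullet> (g t *v v) > 0"
    using g t unfolding functional_metric_def real_spec_def by auto
  from s have "transpose (g t) $ 2 $ 1 = g t $ 2 $ 1" by simp
  then show s': "g t $ 2 $ 1 = g t $ 1 $ 2" by (simp add: transpose_def)
  define v where "v a b = (\<chi> i. if i = (1::2) then a else b)" for a b :: real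
  have v: "v a b $ 1 = a" "v a b $ 2 = b" for a b by (simp_all add: v_def)
  have q: "v a b \<bullet> (g t *v v a b) = a * (g t$1$1 * a + g t$1$2 * b) + b * (g t$2$1 * a + g t$2$2 * b)" for a b
    by (simp add: inner_vec_def sum_2 matrix_vector_mult_def v)
  have nz: "v a b \<noteq> 0" if "a \<noteq> 0 \<or> b \<noteq> 0" for a b using that v[of a b] by (metis zero_index)
  show g1: "g t $ 1 $ 1 > 0" using p[OF nz, of 1 0] by (simp add: q)
  show "g t $ 2 $ 2 > 0" using p[OF nz, of 0 1] by (simp add: q)
  \<comment> \<open>Testing positivity on the vector (- g_12, g_11) produces g_11 times the
    determinant.\<close>
  have "0 < v (- g t$1$2) (g t$1$1) \<bullet> (g t *v v (- g t$1$2) (g t$1$1))" using g1 by (intro p nz) simp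
  also have "\<dots> = g t$1$1 * det (g t)" by (simp add: q det_2 s' algebra_simps)
  finally show "det (g t) > 0" using g1 by (simp add: zero_less_mult_iff)
qed

lemma continuous_on_real2: "continuous_on UNIV (\<lambda>p::real \<times> real. \<chi> i::2. if i = 1 then fst p else snd p)"
proof (rule continuous_on_vec_lambda)
  show "continuous_on UNIV (\<lambda>p::real \<times> real. if i = 1 then fst p else snd p)" for i :: 2
    by (cases "i = 1") (auto intro!: continuous_intros)
qed

text \<open>The plane integrals are computed on pairs, where Fubini applies, whereas the density
  integrates over \<open>real^2\<close>.\<close>

lemma lborel_real2: "lborel = distr lborel borel (\<lambda>p::real \<times> real. \<chi> i::2. if i = 1 then fst p else snd p)"
proof (rule lborel_eqI)
  let ?v = "\<lambda>p::real \<times> real. \<chi> i::2. if i = 1 then fst p else snd p"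
  have B: "Basis = {axis 1 1, axis 2 1 :: real^2}" by (auto simp: Basis_vec_def UNIV_2)
  have ne: "axis 1 1 \<noteq> (axis 2 1 :: real^2)" by (simp add: axis_eq_axis)
  have m: "?v \<in> borel_measurable borel"
    by (rule borel_measurable_continuous_onI[OF continuous_on_real2])
  fix l k :: "real^2" assume lk: "\<And>b. b \<in> Basis \<Longrightarrow> l \<bullet> b \<le> k \<bullet> b"
  have le: "l$1 \<le> k$1" "l$2 \<le> k$2" using lk[of "axis 1 1"] lk[of "axis 2 1"] by (simp_all add: B inner_axis)
  have pre: "?v -` box l k \<inter> space lborel = {l$1<..<k$1} \<times> {l$2<..<k$2}"
    by (auto simp: mem_box_cart forall_2)
  have "emeasure (distr lborel borel ?v) (box l k) = emeasure lborel ({l$1<..<k$1} \<times> {l$2<..<k$2})"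
    using m by (subst emeasure_distr) (simp_all add: pre[simplified])
  also have "\<dots> = emeasure lborel {l$1<..<k$1} * emeasure lborel {l$2<..<k$2}"
    unfolding lborel_prod[symmetric] by (rule lborel.emeasure_pair_measure_Times) auto
  also have "\<dots> = ennreal ((k$1 - l$1) * (k$2 - l$2))" using le by (simp add: ennreal_mult)
  also have "(k$1 - l$1) * (k$2 - l$2) = (\<Prod>b\<in>Basis. (k - l) \<bullet> b)"
    unfolding B using ne by (simp add: inner_axis)
  finally show "emeasure (distr lborel borel ?v) (box l k) = ennreal (\<Prod>b\<in>Basis. (k - l) \<bullet> b)" .
qed simp

lemma integral_real2_vanish:
  fixes G :: "real \<times> real \<Rightarrow> complex"
  assumes G: "integrable lborel G" "integral\<^sup>L lborel G = 0"
  shows "integral UNIV (\<lambda>\<xi>::real^2. G (\<xi>$1, \<xi>$2)) = 0"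
proof -
  let ?v = "\<lambda>p::real \<times> real. \<chi> i::2. if i = 1 then fst p else snd p"
  have m: "?v \<in> borel_measurable borel"
    by (rule borel_measurable_continuous_onI[OF continuous_on_real2])
  have m': "(\<lambda>\<xi>::real^2. (\<xi>$1, \<xi>$2)) \<in> borel_measurable borel"
    by (intro borel_measurable_continuous_onI continuous_intros)
  have Gm: "G \<in> borel_measurable borel" using borel_measurable_integrable[OF G(1)] by simp
  have mG: "(\<lambda>\<xi>::real^2. G (\<xi>$1, \<xi>$2)) \<in> borel_measurable borel" by (rule measurable_compose[OF m' Gm])
  have "integrable (distr lborel borel ?v) (\<lambda>\<xi>. G (\<xi>$1, \<xi>$2))"
    using m mG G(1) by (subst integrable_distr_eq) simp_all
  moreover have "(LINT \<xi>|distr lborel borel ?v. G (\<xi>$1, \<xi>$2)) = 0"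
    using m mG G(2) by (subst integral_distr) simp_all
  ultimately have "integrable lborel (\<lambda>\<xi>::real^2. G (\<xi>$1, \<xi>$2))" "(LINT \<xi>|lborel. G ((\<xi>::real^2)$1, \<xi>$2)) = 0"
    by (simp_all flip: lborel_real2)
  then show ?thesis using has_integral_integral_lborel[of "\<lambda>\<xi>::real^2. G (\<xi>$1, \<xi>$2)"] by (simp add: integral_unique)
qed

section \<open>Assembling the contour from straight pieces\<close>

context gb_data
begin

text \<open>The two ends of the contour are rays. The middle part, by
  \<open>starlike_primitive\<close>, depends only on its end points and equals the difference of the
  integrals along the segments from -1 to them; thus only straight pieces remain.\<close>

lemma contour_integral_pieces:
  assumes \<gamma>: "heat_contour \<gamma>"
  shows "\<exists>L R H. (\<forall>p. ((\<lambda>t. (exp (- \<gamma> t) * vector_derivative \<gamma> (at t)) *\<^sub>C Psi p (\<gamma> t)) has_integral (L p + H p + R p)) UNIV)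
    \<and> (\<forall>F\<in>{L, H, R}. integrable lborel (\<lambda>p. tr (F p)) \<and> (LINT p|lborel. tr (F p)) = 0)"
proof -
  have g: "\<gamma> piecewise_C1_differentiable_on UNIV" and gc': "\<And>t. \<gamma> t \<notin> complex_of_real ` {0..}" using \<gamma> by (auto simp: heat_contour_def)
  have gc: "\<gamma> t \<notin> cut" for t
  proof
    assume "\<gamma> t \<in> cut"
    then have "\<gamma> t = of_real (Re (\<gamma> t))" "Re (\<gamma> t) \<in> {0..}" by (auto simp: cut_def complex_eq_iff)
    then show False using gc'[of t] by blast
  qed
  obtain T z w0 z' w' where w: "Re w0 > 0" "Re w' > 0"
    and up: "\<And>t. t \<le> - T \<Longrightarrow> \<gamma> t = z + of_real (- t) * w0 \<and> Im (\<gamma> t) > 0"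
    and lo: "\<And>t. t \<ge> T \<Longrightarrow> \<gamma> t = z' + of_real t * w' \<and> Im (\<gamma> t) < 0"
    using \<gamma> unfolding heat_contour_def by blast
  \<comment> \<open>Strictly beyond T, so that at each point of the cut-off ends the contour is
    affine in a whole neighbourhood and its derivative is known.\<close>
  define T1 where "T1 = max T 0 + 1"
  have T1: "T1 > T" "T1 > 0" by (auto simp: T1_def)
  have r1: "ray {T1..} z' w'"
  proof (rule ray_right(1)[OF _ w(2)])
    show "(\<forall>t\<ge>T1. Im (z' + of_real t * w') < 0) \<or> (\<forall>t\<ge>T1. Im (z' + of_real t * w') > 0)"
    proof (intro disjI1 allI impI)
      fix t assume "t \<ge> T1"
      then have "t \<ge> T" using T1 by linarith
      from lo[OF this] show "Im (z' + of_real t * w') < 0" by metis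
    qed
  qed (use T1 in simp)
  have r2: "ray {..-T1} z (- w0)"
  proof (rule ray_right(2)[OF _ w(1)])
    show "(\<forall>t\<ge>T1. Im (z + of_real t * w0) < 0) \<or> (\<forall>t\<ge>T1. Im (z + of_real t * w0) > 0)"
    proof (intro disjI2 allI impI)
      fix t assume "t \<ge> T1"
      then have "- t \<le> - T" using T1 by linarith
      from up[OF this] show "Im (z + of_real t * w0) > 0" by (metis minus_minus)
    qed
  qed (use T1 in simp)
  let ?f = "\<lambda>p t. (exp (- \<gamma> t) * vector_derivative \<gamma> (at t)) *\<^sub>C Psi p (\<gamma> t)"
  have e1: "?f p t = Ray z' w' p t" if "t \<in> {T1..}" for p t
  proof -
    have "((\<lambda>t. z' + of_real t * w') has_vector_derivative w') (at t)"
      by (auto intro!: derivative_eq_intros simp: has_vector_derivative_def scaleR_conv_of_real)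
    then have "(\<gamma> has_vector_derivative w') (at t)"
      by (rule has_vector_derivative_transform_within_open[of _ _ _ "{T<..}"]) (use that T1 lo in auto)
    then have "vector_derivative \<gamma> (at t) = w'" by (rule vector_derivative_at)
    moreover have "\<gamma> t = z' + of_real t * w'" using lo[of t] that T1 by auto
    ultimately show ?thesis by (simp only: Ray_def)
  qed
  have e2: "?f p t = Ray z (- w0) p t" if "t \<in> {..-T1}" for p t
  proof -
    have "((\<lambda>t. z + of_real (- t) * w0) has_vector_derivative - w0) (at t)"
      by (auto intro!: derivative_eq_intros simp: has_vector_derivative_def scaleR_conv_of_real)
    then have "(\<gamma> has_vector_derivative - w0) (at t)"
      by (rule has_vector_derivative_transform_within_open[of _ _ _ "{..<-T}"]) (use that T1 up in auto)
    then have "vector_derivative \<gamma> (at t) = - w0" by (rule vector_derivative_at)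
    moreover have "\<gamma> t = z + of_real t * (- w0)" using up[of t] that T1 by auto
    ultimately show ?thesis by (simp only: Ray_def)
  qed
  define H where "H l p = integral {0..1} (Ray (-1) (l + 1) p)" for l p
  have okb: "ok \<Omega> (s2 bS)" using okS_bS[of \<Omega>] by (simp add: okS_def)
  have mid: "(?f p has_integral (H (\<gamma> T1) p - H (\<gamma> (- T1)) p)) {-T1..T1}" for p
  proof -
    let ?P' = "\<lambda>m. ev (Dv Lam (s2 bS)) (rpt 1 (fst p) (snd p) m)"
    let ?\<Phi> = "\<lambda>m. exp (- m) *\<^sub>C Psi p m" and ?\<Phi>' = "\<lambda>m. exp (- m) *\<^sub>C ?P' m - exp (- m) *\<^sub>C Psi p m"
    have dm: "dm (s2 bS) (rpt 1 (fst p) (snd p) m)" if "m \<notin> cut" for m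
      using in_Om(1)[OF _ that, of 1 "fst p" "snd p"] okb by (auto simp: ok_def)
    have D: "(?\<Phi> has_derivative (\<lambda>h. h *\<^sub>C ?\<Phi>' m)) (at m)" if m: "m \<notin> cut" for m
    proof -
      have 1: "((\<lambda>m. exp (- m)) has_derivative (\<lambda>h. h * - exp (- m))) (at m)"
      proof -
        have "((\<lambda>m. exp (- m)) has_field_derivative - exp (- m)) (at m)" by (auto intro!: derivative_eq_intros)
        then show ?thesis unfolding has_field_derivative_def by (rule has_derivative_eq_rhs) (simp add: fun_eq_iff)
      qed
      have 2: "(Psi p has_derivative (\<lambda>h. h *\<^sub>C ?P' m)) (at m)"
        using ev_has_derivative[OF dm[OF m], of Lam] by (simp add: pt_upd Psi_def[abs_def])
      show ?thesis
        by (rule has_derivative_eq_rhs[OF scaleC.FDERIV[OF 1 2]])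
          (simp add: fun_eq_iff scaleC.diff_right scaleC_scaleC scaleC.minus_left mult.commute)
    qed
    have ce: "continuous_on (- cut) (\<lambda>m. ev e (rpt 1 (fst p) (snd p) m))" if e: "ok \<Omega> e" for e
    proof (rule ev_continuous)
      fix v show "continuous_on (- cut) (\<lambda>m. rpt 1 (fst p) (snd p) m v)"
      proof (cases v)
        case (Xi i) then show ?thesis using exhaust_2[of i] by auto
      qed (auto intro!: continuous_intros)
    next
      fix m assume "m \<in> - cut"
      then show "dm e (rpt 1 (fst p) (snd p) m)" using in_Om(1)[of 1 m "fst p" "snd p"] e by (auto simp: ok_def)
    qed
    have c: "continuous_on (- cut) ?\<Phi>'"
      unfolding Psi_def using okb by (intro continuous_intros scaleC.continuous_on ce) simp_all
    have "((\<lambda>t. vector_derivative \<gamma> (at t) *\<^sub>C ?\<Phi> (\<gamma> t)) has_integral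
       (integral {0..1} (\<lambda>s. (\<gamma> T1 + 1) *\<^sub>C ?\<Phi> (-1 + of_real s * (\<gamma> T1 + 1))) -
        integral {0..1} (\<lambda>s. (\<gamma> (- T1) + 1) *\<^sub>C ?\<Phi> (-1 + of_real s * (\<gamma> (- T1) + 1))))) {- T1..T1}"
    proof (rule starlike_primitive[OF _ c g gc])
      show "- T1 \<le> T1" using T1(2) by linarith
    qed (rule D)
    then show ?thesis unfolding H_def Ray_def[abs_def] scaleC_scaleC by (simp only: mult.commute)
  qed
  let ?L = "\<lambda>p. integral {..-T1} (Ray z (- w0) p)" and ?R = "\<lambda>p. integral {T1..} (Ray z' w' p)"
  have I: "(?f p has_integral (?L p + (H (\<gamma> T1) p - H (\<gamma> (- T1)) p) + ?R p)) UNIV" for p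
  proof -
    have 1: "(?f p has_integral ?L p) {..-T1}"
      using integrable_integral[OF ray_vanish(1)[OF r2]] by (rule has_integral_eq[rotated]) (use e2 in simp)
    have 2: "(?f p has_integral ?R p) {T1..}"
      using integrable_integral[OF ray_vanish(1)[OF r1]] by (rule has_integral_eq[rotated]) (use e1 in simp)
    have n1: "negligible ({..-T1} \<inter> {-T1..T1})" by (rule negligible_subset[of "{-T1}"]) auto
    have n2: "negligible (({..-T1} \<union> {-T1..T1}) \<inter> {T1..})" by (rule negligible_subset[of "{T1}"]) (use T1 in auto)
    have u: "({..-T1} \<union> {-T1..T1}) \<union> {T1..} = UNIV" by auto
    show ?thesis using has_integral_Un[OF has_integral_Un[OF 1 mid n1] 2 n2] unfolding u .
  qed
  have trd: "tr (a - b) = tr a - tr b" for a b using tr_add[of a "- b"] by (simp add: tr_minus)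
  have Hv: "integrable lborel (\<lambda>p. tr (H l p))" "(LINT p|lborel. tr (H l p)) = 0" if "l \<notin> cut" for l
    unfolding H_def by (rule ray_vanish(2,3)[OF ray_segment[OF that]])+
  have "\<forall>F\<in>{?L, \<lambda>p. H (\<gamma> T1) p - H (\<gamma> (- T1)) p, ?R}. integrable lborel (\<lambda>p. tr (F p)) \<and> (LINT p|lborel. tr (F p)) = 0"
    using ray_vanish(2,3)[OF r1] ray_vanish(2,3)[OF r2] Hv[OF gc] by (simp add: trd)
  then show ?thesis using I
    by (intro exI[of _ ?L] exI[of _ ?R] exI[of _ "\<lambda>p. H (\<gamma> T1) p - H (\<gamma> (- T1)) p"] conjI allI)
qed

lemma density_trace_zero:
  assumes \<gamma>: "heat_contour \<gamma>" and P: "\<And>f. f \<in> Sm \<Longrightarrow> P f = Aop (Bop f)"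
  shows "tr (second_density U \<gamma> P) = 0"
proof -
  have oc: "op_coeffs U P = pc" by (rule op_coeffs_eq[OF has_coeffs_AB[OF P]])
  have gc: "\<gamma> t \<notin> cut" for t
  proof
    assume "\<gamma> t \<in> cut"
    then have "\<gamma> t = of_real (Re (\<gamma> t))" "Re (\<gamma> t) \<in> {0..}" by (auto simp: cut_def complex_eq_iff)
    then show False using \<gamma> unfolding heat_contour_def by blast
  qed
  obtain L R H where I: "\<And>p. ((\<lambda>t. (exp (- \<gamma> t) * vector_derivative \<gamma> (at t)) *\<^sub>C Psi p (\<gamma> t)) has_integral (L p + H p + R p)) UNIV"
    and F: "\<forall>F\<in>{L, H, R}. integrable lborel (\<lambda>p. tr (F p)) \<and> (LINT p|lborel. tr (F p)) = 0"
    using contour_integral_pieces[OF \<gamma>] by blast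
  define J where "J p = L p + H p + R p" for p
  have G: "integrable lborel (\<lambda>p. tr (J p))" "(LINT p|lborel. tr (J p)) = 0"
    using F by (simp_all add: J_def tr_add)
  define k where "k = -1 / (2 * of_real pi * \<i>)"
  have r: "res2 U pc (\<gamma> t) \<xi> = Psi (\<xi>$1, \<xi>$2) (\<gamma> t)" for t \<xi> by (simp add: res_eq[OF gc] Psi_def)
  have "integral UNIV (\<lambda>t. (exp (- \<gamma> t) * vector_derivative \<gamma> (at t)) *\<^sub>C Psi p (\<gamma> t)) = J p" for p
    unfolding J_def by (rule integral_unique[OF I])
  then have d: "second_density U \<gamma> P = (1 / (2 * pi)\<^sup>2) *\<^sub>R integral UNIV (\<lambda>\<xi>::real^2. k *\<^sub>C J (\<xi>$1, \<xi>$2))"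
    unfolding second_density_def oc r k_def by simp
  have "tr (integral UNIV (\<lambda>\<xi>::real^2. k *\<^sub>C J (\<xi>$1, \<xi>$2))) = 0"
  proof (cases "(\<lambda>\<xi>::real^2. k *\<^sub>C J (\<xi>$1, \<xi>$2)) integrable_on UNIV")
    case True
    have "tr (integral UNIV (\<lambda>\<xi>::real^2. k *\<^sub>C J (\<xi>$1, \<xi>$2))) = integral UNIV (\<lambda>\<xi>::real^2. k * tr (J (\<xi>$1, \<xi>$2)))"
      using integral_linear[OF True tr(1)] by (simp add: comp_def tr(2))
    also have "\<dots> = 0" using integral_real2_vanish[of "\<lambda>p. k * tr (J p)"] G by simp
    finally show ?thesis .
  next
    \<comment> \<open>Should the algebra-valued integral over the plane fail to exist,
      \<open>integral\<close> returns 0 and so does the trace.\<close>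
    case False
    then show ?thesis using bounded_linear.linear[OF tr(1), THEN linear_0] by (simp add: not_integrable_integral)
  qed
  then show ?thesis unfolding d by (simp add: tr_scaleR)
qed

end

section \<open>Factorisation of the Laplacian of a functional metric\<close>

context nc_torus
begin

text \<open>Here u = \<open>G 1 1\<close> and tau satisfies u tau = \<open>G 1 2\<close> - i. Since
  det G = 1, the product of tau, its conjugate and u is (1 + \<open>G 1 2\<close>^2) /
  \<open>G 1 1\<close> = \<open>G 2 2\<close>, so A B reproduces the Laplacian up to mixed terms
  with factors -i and i.\<close>

lemma total_scalar_curvature_zero:
  assumes h: "h \<in> Sm" "adj h = h" and g: "functional_metric h g" and \<gamma>: "heat_contour \<gamma>"
  shows "total_scalar_curvature U \<gamma> h g = 0"
proof -
  let ?K = "real_spec h"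
  let ?D = "\<lambda>t. det (g t)"
  note gp = functional_metric_pos[OF g]
  have sg: "smooth_real (\<lambda>t. g t $ i $ j)" for i j using g by (simp add: functional_metric_def)
  have cg: "continuous_on ?K (\<lambda>t. g t $ i $ j)" for i j by (rule smooth_real_continuous[OF sg])
  have Sg: "cfc (\<lambda>t. g t $ i $ j) h \<in> Sm" for i j by (rule Sm_cfc_smooth[OF h sg])
  have cD: "continuous_on ?K ?D" unfolding det_2 by (intro continuous_intros cg)
  have SD: "cfc ?D h \<in> Sm"
    unfolding det_2 by (simp add: cfc_diff[OF h(2)] cfc_mult[OF h(2)] cg continuous_intros Sm_diff Sm_mult Sg)
  have cP: "continuous_on ?K (\<lambda>t. ?D t powr a)" for a
    by (intro continuous_on_powr cD continuous_on_const) (use gp(4) in force)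
  have SP: "cfc (\<lambda>t. ?D t powr a) h \<in> Sm" for a by (rule Sm_cfc_powr[OF h cD gp(4) SD])
  define G where "G i j t = ?D t powr (1/2) * matrix_inv (g t) $ i $ j" for i j t
  have pw: "?D t powr (1/2) / ?D t = ?D t powr (-1/2)" if "t \<in> ?K" for t
  proof -
    have "?D t powr (1/2) / ?D t = ?D t powr (1/2) / ?D t powr 1" using gp(4)[OF that] by simp
    also have "\<dots> = ?D t powr (1/2 - 1)" by (simp only: powr_diff)
    finally show ?thesis by simp
  qed
  have Gv: "G 1 1 t = g t$2$2 * ?D t powr (-1/2)" "G 1 2 t = - 1 * (g t$1$2 * ?D t powr (-1/2))"
    "G 2 1 t = - 1 * (g t$1$2 * ?D t powr (-1/2))" "G 2 2 t = g t$1$1 * ?D t powr (-1/2)" if "t \<in> ?K" for t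
  proof -
    have "?D t \<noteq> 0" using gp(4)[OF that] by simp
    note m = matrix_inv_2[OF this]
    show "G 1 1 t = g t$2$2 * ?D t powr (-1/2)" "G 1 2 t = - 1 * (g t$1$2 * ?D t powr (-1/2))"
      "G 2 1 t = - 1 * (g t$1$2 * ?D t powr (-1/2))" "G 2 2 t = g t$1$1 * ?D t powr (-1/2)"
      unfolding G_def m pw[OF that, symmetric] by (simp_all add: gp(1)[OF that])
  qed
  have cfG: "continuous_on ?K (G 1 1) \<and> cfc (G 1 1) h \<in> Sm" "continuous_on ?K (G 1 2) \<and> cfc (G 1 2) h \<in> Sm"
    "continuous_on ?K (G 2 1) \<and> cfc (G 2 1) h \<in> Sm" "continuous_on ?K (G 2 2) \<and> cfc (G 2 2) h \<in> Sm"
  proof -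
    have pos: "continuous_on ?K F \<and> cfc F h \<in> Sm" if "\<And>t. t \<in> ?K \<Longrightarrow> F t = g t $ i $ j * ?D t powr (-1/2)" for F i j
    proof -
      have "continuous_on ?K (\<lambda>t. g t $ i $ j * ?D t powr (-1/2))" by (intro continuous_on_mult cg cP)
      moreover have "cfc F h = cfc (\<lambda>t. g t $ i $ j) h * cfc (\<lambda>t. ?D t powr (-1/2)) h"
        unfolding cfc_mult[OF h(2) cg cP, symmetric] by (rule cfc_cong[OF that])
      ultimately show ?thesis using that Sm_mult[OF Sg SP] by (simp cong: continuous_on_cong)
    qed
    have neg: "continuous_on ?K F \<and> cfc F h \<in> Sm" if F: "\<And>t. t \<in> ?K \<Longrightarrow> F t = - 1 * (g t $ i $ j * ?D t powr (-1/2))" for F i j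
    proof -
      have c: "continuous_on ?K (\<lambda>t. g t $ i $ j * ?D t powr (-1/2))" by (intro continuous_on_mult cg cP)
      have "cfc F h = (-1) *\<^sub>R cfc (\<lambda>t. g t $ i $ j * ?D t powr (-1/2)) h"
        unfolding cfc_scaleR[OF h(2) c, symmetric] by (rule cfc_cong[OF F])
      moreover have "continuous_on ?K (\<lambda>t. - 1 * (g t $ i $ j * ?D t powr (-1/2)))" by (intro continuous_on_mult continuous_on_const c)
      ultimately show ?thesis using F pos[of "\<lambda>t. g t $ i $ j * ?D t powr (-1/2)" i j] by (simp add: Sm_scaleR Sm_minus cong: continuous_on_cong)
    qed
    show "continuous_on ?K (G 1 1) \<and> cfc (G 1 1) h \<in> Sm" by (rule pos[OF Gv(1)])
    show "continuous_on ?K (G 1 2) \<and> cfc (G 1 2) h \<in> Sm" by (rule neg[OF Gv(2)])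
    show "continuous_on ?K (G 2 1) \<and> cfc (G 2 1) h \<in> Sm" by (rule neg[OF Gv(3)])
    show "continuous_on ?K (G 2 2) \<and> cfc (G 2 2) h \<in> Sm" by (rule pos[OF Gv(4)])
  qed
  note cG = cfG[THEN conjunct1] and SG = cfG[THEN conjunct2]
  have Gp: "G 1 1 t > 0" if "t \<in> ?K" for t using Gv(1)[OF that] gp(3,4)[OF that] by simp
  have Gd: "G 1 1 t * G 2 2 t - G 1 2 t * G 1 2 t = 1" if t: "t \<in> ?K" for t
  proof -
    have "?D t powr (-1/2) * ?D t powr (-1/2) = 1 / ?D t"
      unfolding powr_add[symmetric] using gp(4)[OF t] by (simp add: powr_minus inverse_eq_divide)
    then have "G 1 1 t * G 2 2 t - G 1 2 t * G 1 2 t = (g t$1$1 * g t$2$2 - g t$1$2 * g t$2$1) * (1 / ?D t)"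
      unfolding Gv[OF t] by (simp add: gp(1)[OF t] algebra_simps)
    then show ?thesis using gp(4)[OF t] by (simp add: det_2)
  qed
  define w where "w t = ?D t powr (-1/4)" for t
  \<comment> \<open>Written as a power, the reciprocal of \<open>G 1 1\<close> falls under
    \<open>Sm_cfc_powr\<close>.\<close>
  define q where "q t = G 1 1 t powr (-1)" for t
  have qe: "q t = 1 / G 1 1 t" if "t \<in> ?K" for t using Gp[OF that] by (simp add: q_def powr_minus_divide)
  have cq: "continuous_on ?K q" unfolding q_def[abs_def]
    by (intro continuous_on_powr cG continuous_on_const) (use Gp in force)
  have Sq: "cfc q h \<in> Sm" unfolding q_def[abs_def] by (rule Sm_cfc_powr[OF h cG(1) Gp SG(1)])
  define tau where "tau t = complex_of_real (G 1 2 t * q t) - \<i> * complex_of_real (q t)" for t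
  have ctau: "continuous_on ?K tau" unfolding tau_def[abs_def] by (intro continuous_intros cG cq)
  have Stau: "ccfc tau h \<in> Sm" "ccfc (\<lambda>t. cnj (tau t)) h \<in> Sm"
  proof -
    have n: "cfc (\<lambda>t. - q t) h \<in> Sm" using cfc_scaleR[OF h(2) cq, of "-1"] Sq by (simp add: Sm_minus)
    show "ccfc tau h \<in> Sm" "ccfc (\<lambda>t. cnj (tau t)) h \<in> Sm"
      unfolding ccfc_def using n Sq by (simp_all add: tau_def cfc_mult[OF h(2) cG(2) cq] Sm_add Sm_scaleC Sm_mult SG)
  qed
  interpret gb_data \<theta> U h w "G 1 1" tau
  proof
    show "continuous_on ?K w" "cfc w h \<in> Sm" unfolding w_def[abs_def] by (rule cP SP)+
    show "w t > 0" if "t \<in> ?K" for t using gp(4)[OF that] by (simp add: w_def)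
    show "Im (tau t) < 0" if "t \<in> ?K" for t using Gp[OF that] by (simp add: tau_def q_def)
  qed (use h cG SG ctau Stau Gp in auto)
  have cc: "continuous_on ?K (\<lambda>t. complex_of_real (F t))" if "continuous_on ?K F" for F by (intro continuous_intros that)
  have ctau': "continuous_on ?K (\<lambda>t. cnj (tau t))" by (intro continuous_intros ctau)
  have ut: "eU * eT = cfc (G 1 2) h - \<i> *\<^sub>C 1"
  proof -
    have "eU * eT = ccfc (\<lambda>t. of_real (G 1 1 t) * tau t) h"
      by (simp add: ccfc_mult[OF h(2) cc[OF cG(1)] ctau] ccfc_of_real[OF h(2)])
    also have "\<dots> = ccfc (\<lambda>t. of_real (G 1 2 t) + (- \<i>)) h"
      by (rule ccfc_cong) (use Gp in \<open>force simp: tau_def qe field_simps\<close>)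
    also have "\<dots> = cfc (G 1 2) h + (- \<i>) *\<^sub>C 1"
      by (simp only: ccfc_add[OF h(2) cc[OF cG(2)] continuous_on_const] ccfc_of_real[OF h(2)] ccfc_const[OF h(2)])
    finally show ?thesis by (simp add: scaleC.minus_left)
  qed
  have tu: "eT' * eU = cfc (G 1 2) h + \<i> *\<^sub>C 1"
  proof -
    have "eT' * eU = ccfc (\<lambda>t. cnj (tau t) * of_real (G 1 1 t)) h"
      by (simp add: ccfc_mult[OF h(2) ctau' cc[OF cG(1)]] ccfc_of_real[OF h(2)])
    also have "\<dots> = ccfc (\<lambda>t. of_real (G 1 2 t) + \<i>) h"
      by (rule ccfc_cong) (use Gp in \<open>force simp: tau_def qe field_simps\<close>)
    also have "\<dots> = cfc (G 1 2) h + \<i> *\<^sub>C 1"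
      by (simp only: ccfc_add[OF h(2) cc[OF cG(2)] continuous_on_const] ccfc_of_real[OF h(2)] ccfc_const[OF h(2)])
    finally show ?thesis .
  qed
  have tut: "eT' * (eU * eT) = cfc (G 2 2) h"
  proof -
    have c12: "continuous_on ?K (\<lambda>t. of_real (G 1 2 t) + (- \<i>))" by (intro continuous_intros cG)
    have "eU * eT = ccfc (\<lambda>t. of_real (G 1 2 t) + (- \<i>)) h"
      unfolding ut ccfc_add[OF h(2) cc[OF cG(2)] continuous_on_const] ccfc_of_real[OF h(2)] ccfc_const[OF h(2)] scaleC.minus_left
      by simp
    then have "eT' * (eU * eT) = ccfc (\<lambda>t. cnj (tau t) * (of_real (G 1 2 t) + (- \<i>))) h"
      by (simp only: ccfc_mult[OF h(2) ctau' c12])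
    also have "\<dots> = ccfc (\<lambda>t. of_real (G 2 2 t)) h"
    proof (rule ccfc_cong)
      fix t assume t: "t \<in> ?K"
      have "G 2 2 t = (1 + G 1 2 t * G 1 2 t) * q t" using Gd[OF t] Gp[OF t] by (simp add: qe[OF t] field_simps)
      moreover have "cnj (tau t) * (of_real (G 1 2 t) + (- \<i>)) = of_real ((1 + G 1 2 t * G 1 2 t) * q t)"
        by (simp add: tau_def complex_eq_iff algebra_simps)
      ultimately show "cnj (tau t) * (of_real (G 1 2 t) + (- \<i>)) = of_real (G 2 2 t)" by simp
    qed
    finally show ?thesis by (simp add: ccfc_of_real[OF h(2)])
  qed
  have P: "metric_laplacian U h g f = Aop (Bop f)" if f: "f \<in> Sm" for f
  proof -
    define c where "c = eW * f"
    define d1 d2 where "d1 = dl 1 c" and "d2 = dl 2 c"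
    have S: "c \<in> Sm" "d1 \<in> Sm" "d2 \<in> Sm" using f smooth by (auto simp: c_def d1_def d2_def intro!: Sm_mult Sm_dl)
    have m: "cfc (\<lambda>t. ?D t powr (1/2)) h * cfc (\<lambda>t. matrix_inv (g t) $ i $ j) h = cfc (G i j) h"
      if "continuous_on ?K (G i j)" for i j
    proof -
      have e: "matrix_inv (g t) $ i $ j = G i j t * ?D t powr (-1/2)" if "t \<in> ?K" for t
      proof -
        have "?D t powr (1/2) * ?D t powr (-1/2) = 1" unfolding powr_add[symmetric] using gp(4)[OF that] by simp
        then show ?thesis by (simp add: G_def mult.commute[of _ "matrix_inv (g t) $ i $ j"] mult.assoc)
      qed
      have "continuous_on ?K (\<lambda>t. G i j t * ?D t powr (-1/2))" by (intro continuous_on_mult that cP)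
      then have "continuous_on ?K (\<lambda>t. matrix_inv (g t) $ i $ j)" using e by (simp cong: continuous_on_cong)
      from cfc_mult[OF h(2) cP this, of "1/2"] show ?thesis by (simp add: G_def[abs_def])
    qed
    have G21: "cfc (G 2 1) h = cfc (G 1 2) h" by (rule cfc_cong) (simp add: Gv)
    let ?m11 = "cfc (G 1 1) h" and ?m12 = "cfc (G 1 2) h" and ?m22 = "cfc (G 2 2) h"
    have eWw: "cfc (\<lambda>t. ?D t powr (-1/4)) h = eW" by (simp add: w_def[abs_def])
    have "metric_laplacian U h g f = eW * dl 1 (?m11 * d1) + eW * dl 2 (?m12 * d1) + (eW * dl 1 (?m12 * d2) + eW * dl 2 (?m22 * d2))"
      unfolding metric_laplacian_def sum_2 eWw m[OF cG(1)] m[OF cG(2)] m[OF cG(3)] m[OF cG(4)] G21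
      by (simp only: c_def[symmetric] d1_def[symmetric] d2_def[symmetric])
    moreover have "Bop f = eU * (d1 + eT * d2)"
      unfolding Bop_def b0_def b1_def b2_def d1_def d2_def c_def using f smooth by (simp add: dl_mult algebra_simps)
    then have Be: "Bop f = ?m11 * d1 + (?m12 - \<i> *\<^sub>C 1) * d2" by (simp only: distrib_left ut flip: mult.assoc)
    have TB: "eT' * Bop f = (?m12 + \<i> *\<^sub>C 1) * d1 + ?m22 * d2"
    proof -
      have "eT' * Bop f = (eT' * eU) * d1 + (eT' * (eU * eT)) * d2"
        using \<open>Bop f = eU * (d1 + eT * d2)\<close> by (simp add: distrib_left mult.assoc)
      then show ?thesis by (simp only: tu tut)
    qed
    have BS: "Bop f \<in> Sm" unfolding Be using S SG by (auto intro!: Sm_add Sm_mult Sm_diff Sm_scaleC)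
    have "Aop (Bop f) = eW * (dl 1 (Bop f) + dl 2 (eT' * Bop f))"
      unfolding Aop_def a0_def a1_def a2_def using BS smooth by (simp add: dl_mult algebra_simps)
    moreover have "dl 1 (Bop f) = dl 1 (?m11 * d1) + dl 1 (?m12 * d2) - \<i> *\<^sub>C dl 1 d2"
    proof -
      have "Bop f = ?m11 * d1 + ?m12 * d2 - \<i> *\<^sub>C d2" unfolding Be by (simp add: left_diff_distrib mult_scaleC_left)
      then show ?thesis using S SG by (simp add: dl_add dl_diff dl_scaleC Sm_add Sm_mult Sm_scaleC)
    qed
    moreover have "dl 2 (eT' * Bop f) = dl 2 (?m12 * d1) + \<i> *\<^sub>C dl 2 d1 + dl 2 (?m22 * d2)"
    proof -
      have "eT' * Bop f = ?m12 * d1 + \<i> *\<^sub>C d1 + ?m22 * d2" unfolding TB by (simp add: distrib_right mult_scaleC_left)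
      then show ?thesis using S SG by (simp add: dl_add dl_scaleC Sm_add Sm_mult Sm_scaleC)
    qed
    \<comment> \<open>The two terms with -i and i cancel because the derivations commute.\<close>
    moreover have "dl 1 d2 = dl 2 d1" unfolding d1_def d2_def by (rule dl_commute[OF S(1)])
    ultimately show ?thesis by (simp add: algebra_simps)
  qed
  have "tr (second_density U \<gamma> (metric_laplacian U h g)) = 0" by (rule density_trace_zero[OF \<gamma> P])
  then show ?thesis by (simp add: total_scalar_curvature_def scalar_curvature_def nct_trace_eq tr_scaleR)
qed

end

theorem theorem5p3:
  fixes \<theta> :: "real^2^2" and U :: "2 \<Rightarrow> 'a::cstar_algebra"
    and h :: 'a and g :: "real \<Rightarrow> real^2^2" and \<gamma> :: "real \<Rightarrow> complex"
  assumes "transpose \<theta> = - \<theta>"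
    and "nct \<theta> U"
    and "h \<in> nct_smooth U" and "adj h = h"
    and "functional_metric h g"
    and "heat_contour \<gamma>"
  shows "total_scalar_curvature U \<gamma> h g = 0 \<and>
         (\<forall>h' g'. h' \<in> nct_smooth U \<and> adj h' = h' \<and> functional_metric h' g' \<longrightarrow>
            total_scalar_curvature U \<gamma> h' g' = total_scalar_curvature U \<gamma> h g)"
proof -
  interpret nc_torus \<theta> U using assms(1,2) by unfold_locales
  show ?thesis using total_scalar_curvature_zero assms(3-6) by simp
qed

end
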